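(* Let $b:\mathbb{R}^d\to\mathbb{R}^d$, $\bar b:\mathbb{R}^d\times\mathbb{R}^n\to\mathbb{R}^d$ and let $L,K,\mathcal{R},\sigma,\alpha,L_u,\alpha_c>0$ be such that: (a) for any $x\in\mathbb{R}^d$, any $h>0$ and any random variable $U$ with $\mathbb{E}[\bar b(x,U)]=b(x)$, $\mathbb{E}|\bar b(x,U)-b(x)|^2\le\sigma^2(1+|x|^2)h^\alpha$; (b) for all $x,y$ and all random variables $U$ with $\mathbb{E}[\bar b(x,U)]=b(x)$ and $\mathbb{E}[\bar b(y,U)]=b(y)$: $|\bar b(x,U)-\bar b(y,U)|\le L|x-y|$ a.s., and, if $|x-y|\ge\mathcal{R}$, $\langle x-y,\bar b(x,U)-\bar b(y,U)\rangle\le-K|x-y|^2$ a.s.; (c) the random variables $U^f_{kh},U^c_{kh}$ driving the fine and coarse chains below satisfy $\mathcal{L}(U^f_{kh})=\mathcal{L}(U^c_{kh})$ for all $k$ and, for all $x\in\mathbb{R}^d$ and $k\ge0$, $\mathbb{E}|\bar b(x,U^f_{kh})+\bar b(x,U^f_{(k+1)h})-2\bar b(x,U^c_{kh})|^2\le L_u(1+|x|^2)h^{\alpha_c}$. Let $h_0,c,A,f$ and $C_{IMLult}$ be as defined in the context. Let $h\in\big(0,h_0\wedge\frac K{4L^2+2\sigma^2}\wedge1\big)$ and let the fine chain $(\bar X^f_{kh})_{k\ge0}$ and the coarse chain $(\bar X^c_{kh})_{k\in2\mathbb{N}}$ be given by $$\bar X^f_{(k+1)h}=\bar X^f_{kh}+\bar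 b(\bar X^f_{kh},U^f_{kh})h+\sqrt h\,Z_{k+1}\quad(k\ge0),$$ $$\bar X^c_{(k+2)h}=\bar X^c_{kh}+\bar b(\bar X^c_{kh},U^c_{kh})\,2h+\sqrt{2h}\,\hat Z_{k+2}\quad(k\in2\mathbb{N}),\qquad \hat Z_{k+2}=\frac{Z_{k+1}+Z_{k+2}}{\sqrt2}.$$ Then there exists a process $(\bar G_k)_{k\ge0}$ such that $\mathcal{L}(\bar G_k)=\mathcal{L}(\bar X^f_{kh})$ for all $k\ge1$ if $\bar G_0=\bar X^f_0$, and (for all even $k$) $$\mathbb{E}|\bar G_k-\bar X^c_{kh}|^2\le A(1-ch)^k\,\mathbb{E}f(|\bar G_0-\bar X^c_0|)+\frac{A\,C_{IMLult}}c\,h^{\min(\alpha_c,1)/2}.$$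
   Context: $\mathcal{L}(X)$ is the law of $X$. $(Z_k)_{k\ge1}$ are i.i.d. $N(0,I)$ on $\mathbb{R}^d$. The $(U^f_{kh})_k$ are mutually independent, and so are the $(U^c_{kh})_k$; each $U^f_{kh}$ and $U^c_{kh}$ satisfies $\mathbb{E}[\bar b(x,U)]=b(x)$ for all $x$; they are independent of $(Z_k)$. The $U^c$'s may be chosen independent of the $U^f$'s or coupled with them. The dependence on $h$ of the right-hand side in (a) is related to the choice of the estimator $\bar b$; $\sigma$ and $\alpha$ do not depend on $h$. Constants: with $\varphi_{0,1}$ the density of $N(0,1)$ on $\mathbb{R}$, $$c_0=4\min\Big(\int_0^{1/2}u^2(1-e^{u-1/2})\varphi_{0,1}(u)\,du,\ (1-e^{-1})\int_0^{1/2}u^3\varphi_{0,1}(u)\,du\Big),$$ $$h_0=\min\Big(\frac K{L^2},\frac4K,\frac1{2L},\frac{2c_0\ln\frac32}{27L^2\mathcal{R}^2},\frac{\mathcal{R}^2}4,\frac{c_0^2(\ln2)^2}{144L^2\mathcal{R}^2}\Big),$$ $r_1=(1+h_0L)\mathcal{R}$, $r_2=r_1+\sqrt{h_0}$, $a=6Lr_1/c_0$, $$c=\min\Big(e^{-ar_2}\frac K4,\ \frac{\frac12e^{-ar_2}r_2}{\frac1a(1-e^{-ar_2})}\frac K4,\ \frac{9L^2r_1^2}{2c_0}e^{-6Lr_1^2/c_0},\ \frac{3Lr_1}{16\sqrt{h_0}}\Big),\qquad A=\max\Big(\frac{ar_2^2}{1-e^{-ar_2}},2r_2e^{ar_2}\Big),$$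 $f(r)=\frac1a(1-e^{-ar})$ for $0\le r\le r_2$ and $f(r)=\frac1a(1-e^{-ar_2})+\frac1{2r_2}e^{-ar_2}(r^2-r_2^2)$ for $r>r_2$. With $\rho=\max(\mathcal{R},2|b(0)|/K)$: $M_1=K/2$, $M_2=L\rho^2+|b(0)|\rho$. Further $$C_{IEul}=\mathbb{E}|\bar X^f_0|^2+\frac{2h_0|b(0)|^2+d+M_2+h_0\sigma^2}{M_1-2h_0L^2-h_0\sigma^2},\quad C^{(2h)}_{IEul}=\mathbb{E}|\bar X^c_0|^2+\frac{4h_0|b(0)|^2+d+M_2+2h_0\sigma^2}{M_1-4h_0L^2-2h_0\sigma^2},$$ $$C_{ISM}=C^{(2h)}_{IEul}(\sigma^2+2L^2)+\sigma^2+2|b(0)|^2,\quad C_{IASP}=\Big(\sqrt{C^{(2h)}_{IEul}}+h_0\sqrt{C_{ISM}}+\sqrt{h_0d}\Big)^2,$$ $$C_{IMLdif}=(4h_0L^2C_{ISM}+4L^2d)\,h_0^{(1-\alpha_c)^+}+2L_u(1+C^{(2h)}_{IEul}),$$ $$C_{IMLult}=\frac{e^{-ar_2}}{r_2}C_{IMLdif}h_0^{1+\min(\alpha_c,1)/2}+\Big(1+\frac{e^{-ar_2}}{r_2}\sqrt{h_0}\Big)\sqrt{C_{IMLdif}}+\frac{e^{-ar_2}}{r_2}(1+h_0L)\big(\sqrt{C_{IEul}}+\sqrt{C_{IASP}}\big)\sqrt{C_{IMLdif}}.$$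
   Formalization: Adds M_1-4h_0L^2-2h_0σ^2>0 (the claim can fail without it), and makes explicit that the initial values have finite second moments and are independent of the noise, and that b̄ is measurable and may depend on the step size. *)

theory Defs
  imports "HOL-Probability.Probability"
begin

definition std_gaussian_density :: "'a::euclidean_space \<Rightarrow> real" where
  "std_gaussian_density z = (\<Prod>i\<in>Basis. std_normal_density (z \<bullet> i))"

(* E|X|^2 with values in [0,\<infinity>]: a bound on it includes square integrability, which a bound
   on the Bochner integral (0 for non-integrable functions) would not. *)
definition mean_square :: "'w measure \<Rightarrow> ('w \<Rightarrow> 'a::euclidean_space) \<Rightarrow> ennreal" where
  "mean_square M X = (\<integral>\<^sup>+\<omega>. ennreal ((norm (X \<omega>))\<^sup>2) \<partial>M)"

(* E[B(x,U)] = b(x) for a random variable U with law \<mu>.  Conditions on "every random variable U"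
   are stated as conditions on every Borel probability measure \<mu>, since they only involve
   the law of U; this covers random variables on arbitrary probability spaces. *)
definition unbiased_at ::
  "('a::euclidean_space \<Rightarrow> 'u \<Rightarrow> 'a) \<Rightarrow> ('a \<Rightarrow> 'a) \<Rightarrow> 'u measure \<Rightarrow> 'a \<Rightarrow> bool" where
  "unbiased_at B b \<mu> x \<longleftrightarrow> integrable \<mu> (B x) \<and> (\<integral>u. B x u \<partial>\<mu>) = b x"

(* N is an enlargement of the probability space M, with projection p.  A random variable X on M
   is identified with X \<circ> p on N; all joint laws are preserved. *)
definition enlargement :: "'v measure \<Rightarrow> ('v \<Rightarrow> 'w) \<Rightarrow> 'w measure \<Rightarrow> bool" where
  "enlargement N p M \<longleftrightarrow> prob_space N \<and> p \<in> measurable N M \<and> distr N M p = M"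

(* Independence of two random variables X and Y with values in the measurable spaces S and T.
   The library's indep_var forces X and Y to have the same codomain type. *)
definition independent ::
  "'w measure \<Rightarrow> 'a measure \<Rightarrow> ('w \<Rightarrow> 'a) \<Rightarrow> 'b measure \<Rightarrow> ('w \<Rightarrow> 'b) \<Rightarrow> bool" where
  "independent M S X T Y \<longleftrightarrow> X \<in> measurable M S \<and> Y \<in> measurable M T \<and>
    prob_space.indep_set M {X -` A \<inter> space M | A. A \<in> sets S} {Y -` B \<inter> space M | B. B \<in> sets T}"

definition c0 :: real where
  "c0 = 4 * min (integral {0..1/2} (\<lambda>u. u\<^sup>2 * (1 - exp (u - 1/2)) * std_normal_density u))
                ((1 - exp (-1)) * integral {0..1/2} (\<lambda>u. u ^ 3 * std_normal_density u))"

definition h0 :: "real \<Rightarrow> real \<Rightarrow> real \<Rightarrow> real" where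
  "h0 L K R = Min {K / L\<^sup>2, 4 / K, 1 / (2 * L), 2 * c0 * ln (3/2) / (27 * L\<^sup>2 * R\<^sup>2), R\<^sup>2 / 4,
                   c0\<^sup>2 * (ln 2)\<^sup>2 / (144 * L\<^sup>2 * R\<^sup>2)}"

definition r1 :: "real \<Rightarrow> real \<Rightarrow> real \<Rightarrow> real" where
  "r1 L K R = (1 + h0 L K R * L) * R"

definition r2 :: "real \<Rightarrow> real \<Rightarrow> real \<Rightarrow> real" where
  "r2 L K R = r1 L K R + sqrt (h0 L K R)"

definition a_rate :: "real \<Rightarrow> real \<Rightarrow> real \<Rightarrow> real" where
  "a_rate L K R = 6 * L * r1 L K R / c0"

definition c_rate :: "real \<Rightarrow> real \<Rightarrow> real \<Rightarrow> real" where
  "c_rate L K R =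
    (let a = a_rate L K R; r1 = r1 L K R; r2 = r2 L K R; h0 = h0 L K R in
      Min {exp (- a * r2) * (K / 4),
           (1/2 * exp (- a * r2) * r2) / (1 / a * (1 - exp (- a * r2))) * (K / 4),
           9 * L\<^sup>2 * r1\<^sup>2 / (2 * c0) * exp (- 6 * L * r1\<^sup>2 / c0),
           3 * L * r1 / (16 * sqrt h0)})"

definition A_const :: "real \<Rightarrow> real \<Rightarrow> real \<Rightarrow> real" where
  "A_const L K R =
    (let a = a_rate L K R; r2 = r2 L K R in
      max (a * r2\<^sup>2 / (1 - exp (- a * r2))) (2 * r2 * exp (a * r2)))"

definition f_dist :: "real \<Rightarrow> real \<Rightarrow> real \<Rightarrow> real \<Rightarrow> real" where
  "f_dist L K R r =
    (let a = a_rate L K R; r2 = r2 L K R in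
      if r \<le> r2 then 1 / a * (1 - exp (- a * r))
      else 1 / a * (1 - exp (- a * r2)) + 1 / (2 * r2) * exp (- a * r2) * (r\<^sup>2 - r2\<^sup>2))"

definition rho :: "real \<Rightarrow> real \<Rightarrow> ('a::euclidean_space \<Rightarrow> 'a) \<Rightarrow> real" where
  "rho K R b = max R (2 * norm (b 0) / K)"

definition M1 :: "real \<Rightarrow> real" where
  "M1 K = K / 2"

definition M2 :: "real \<Rightarrow> real \<Rightarrow> real \<Rightarrow> ('a::euclidean_space \<Rightarrow> 'a) \<Rightarrow> real" where
  "M2 L K R b = L * (rho K R b)\<^sup>2 + norm (b 0) * rho K R b"

(* In the constants below, mf and mc stand for the second moments of the initial values of the
   fine and of the coarse chain, s for \<sigma>, and ac for \<alpha>_c. *)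

definition C_IEul ::
  "real \<Rightarrow> real \<Rightarrow> real \<Rightarrow> real \<Rightarrow> ('a::euclidean_space \<Rightarrow> 'a) \<Rightarrow> real \<Rightarrow> real" where
  "C_IEul L K R s b mf =
    (let h0 = h0 L K R in
      mf + (2 * h0 * (norm (b 0))\<^sup>2 + real DIM('a) + M2 L K R b + h0 * s\<^sup>2)
           / (M1 K - 2 * h0 * L\<^sup>2 - h0 * s\<^sup>2))"

definition C_IEul2h ::
  "real \<Rightarrow> real \<Rightarrow> real \<Rightarrow> real \<Rightarrow> ('a::euclidean_space \<Rightarrow> 'a) \<Rightarrow> real \<Rightarrow> real" where
  "C_IEul2h L K R s b mc =
    (let h0 = h0 L K R in
      mc + (4 * h0 * (norm (b 0))\<^sup>2 + real DIM('a) + M2 L K R b + 2 * h0 * s\<^sup>2)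
           / (M1 K - 4 * h0 * L\<^sup>2 - 2 * h0 * s\<^sup>2))"

definition C_ISM ::
  "real \<Rightarrow> real \<Rightarrow> real \<Rightarrow> real \<Rightarrow> ('a::euclidean_space \<Rightarrow> 'a) \<Rightarrow> real \<Rightarrow> real" where
  "C_ISM L K R s b mc =
    C_IEul2h L K R s b mc * (s\<^sup>2 + 2 * L\<^sup>2) + s\<^sup>2 + 2 * (norm (b 0))\<^sup>2"

definition C_IASP ::
  "real \<Rightarrow> real \<Rightarrow> real \<Rightarrow> real \<Rightarrow> ('a::euclidean_space \<Rightarrow> 'a) \<Rightarrow> real \<Rightarrow> real" where
  "C_IASP L K R s b mc =
    (sqrt (C_IEul2h L K R s b mc) + h0 L K R * sqrt (C_ISM L K R s b mc)
      + sqrt (h0 L K R * real DIM('a)))\<^sup>2"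

definition C_IMLdif ::
  "real \<Rightarrow> real \<Rightarrow> real \<Rightarrow> real \<Rightarrow> real \<Rightarrow> real \<Rightarrow> ('a::euclidean_space \<Rightarrow> 'a) \<Rightarrow> real \<Rightarrow> real"
where
  "C_IMLdif L K R s Lu ac b mc =
    (4 * h0 L K R * L\<^sup>2 * C_ISM L K R s b mc + 4 * L\<^sup>2 * real DIM('a))
        * h0 L K R powr (max (1 - ac) 0)
      + 2 * Lu * (1 + C_IEul2h L K R s b mc)"

definition C_IMLult ::
  "real \<Rightarrow> real \<Rightarrow> real \<Rightarrow> real \<Rightarrow> real \<Rightarrow> real \<Rightarrow> ('a::euclidean_space \<Rightarrow> 'a) \<Rightarrow>
    real \<Rightarrow> real \<Rightarrow> real" where
  "C_IMLult L K R s Lu ac b mf mc =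
    (let h0 = h0 L K R; r2 = r2 L K R; q = exp (- a_rate L K R * r2) / r2;
         D = C_IMLdif L K R s Lu ac b mc in
      q * D * h0 powr (1 + min ac 1 / 2)
      + (1 + q * sqrt h0) * sqrt D
      + q * (1 + h0 * L) * (sqrt (C_IEul L K R s b mf) + sqrt (C_IASP L K R s b mc)) * sqrt D)"

end

(*
  Only the laws of the single variables G_k are prescribed, so it suffices to construct for every
  even k a coupling of the laws of Xf_k and Xc_k and to sample its first component conditionally on
  Xc_k from fresh uniform variables.  The couplings are built recursively.  From (x, y) make two
  steps of the Euler scheme from each point with the same U's, where the noise of the step from x
  is obtained from that of the step from y by the maximal coupling completed by reflection (in the
  direction of the drifted difference, with acceptance restricted to bounded noise) if the drifted
  points are closer than r1, and is the same otherwise.  The distance f of the two points then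
  contracts in expectation by 1 - c h per step: by the concavity of f and the probability of
  meeting for nearby points, by dissipativity for distant ones.  Two fine steps from y differ
  from one coarse step from y with the same noise by an error of L^2-size h^(1 + min(alpha_c, 1)/2),
  which changes f by at most C_IMLult h^(1 + min(alpha_c, 1)/2), and the geometric series gives the
  bound for f.  Finally r^2 <= A f(r).
*)
theory Submission imports Defs begin

subsection \<open>The standard Gaussian measure\<close>

text \<open>Each of the sequences \<open>Uf\<close> and \<open>Uc\<close> is independent in time,
  but their pairs need not be: \<open>Uc k\<close> may depend on later \<open>Uf\<close>, and then
  so does the coarse state. A companion chain driven by the given variables would meet drift noise
  correlated with its present distance, and no one-step contraction could be applied. Working with
  laws avoids this: each double step draws a fresh copy of the joint law of one triple of
  \<open>U\<close>s, which is all the joint information that (c) contains, and both marginals still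
  evolve with the right kernels.

  Bounding the accepted noise keeps the new distance below \<open>r2\<close>, where \<open>f\<close>
  is concave and the randomness of the reflection gains. Beyond \<open>r2\<close>, \<open>f\<close>
  has to grow like r^2, because it must dominate r^2 and because dissipativity is a statement about
  r^2. So \<open>f\<close> is not Lipschitz: an error of size d at distance r costs about d + q d r
  + q d^2, and this brings second moments of the chains into \<open>C_IMLult\<close>.\<close>

lemma nn_integral_lborel_translate:
  fixes f :: "'a::euclidean_space \<Rightarrow> ennreal"
  assumes [measurable]: "f \<in> borel_measurable borel"
  shows "(\<integral>\<^sup>+x. f (x + c) \<partial>lborel) = (\<integral>\<^sup>+x. f x \<partial>lborel)"
proof -
  have "(\<integral>\<^sup>+x. f x \<partial>lborel) = (\<integral>\<^sup>+x. f x \<partial>distr lborel borel ((+) c))"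
    by (simp add: lborel_distr_plus)
  then show ?thesis
    by (simp add: nn_integral_distr add.commute)
qed

text \<open>Integrating \<open>A(y) B(Tx - y)\<close> in both orders, for \<open>B\<close> a ball, compares \<open>lborel\<close> and its
  image without any uniqueness theorem for Haar measure.\<close>
lemma nn_integral_lborel_orthogonal:
  fixes T :: "'a::euclidean_space \<Rightarrow> 'a"
  assumes T: "orthogonal_transformation T" and [measurable]: "f \<in> borel_measurable borel"
  shows "(\<integral>\<^sup>+x. f (T x) \<partial>lborel) = (\<integral>\<^sup>+x. f x \<partial>lborel)"
proof -
  have lin: "linear T" and nT: "\<And>x. norm (T x) = norm x"
    using T by (auto simp: orthogonal_transformation)
  have [measurable]: "T \<in> borel_measurable borel"
    using lin by (intro borel_measurable_continuous_onI linear_continuous_on) (simp add: linear_conv_bounded_linear)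
  have surj: "\<exists>x. T x = y" for y
    using orthogonal_transformation_surj[OF T] by (metis surjD)
  \<comment> \<open>The unit ball is invariant under \<open>T\<close> and under negation, and its
    volume is positive and finite, so it can be cancelled from the final identity.\<close>
  define B where "B z = (indicator (ball 0 1) z :: ennreal)" for z :: 'a
  have [measurable]: "B \<in> borel_measurable borel"
    unfolding B_def by (intro borel_measurable_indicator) simp
  have BT: "B (T z) = B z" and Bm: "B (- z) = B z" for z
    by (auto simp: B_def indicator_def nT)
  \<comment> \<open>Since \<open>T\<close> is linear and onto, a shift after \<open>T\<close> is the
    image of a shift before it.\<close>
  have shift: "(\<integral>\<^sup>+x. g (T x + y) \<partial>lborel) = (\<integral>\<^sup>+x. g (T x) \<partial>lborel)"
    if [measurable]: "g \<in> borel_measurable borel" for g :: "'a \<Rightarrow> ennreal" and y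
  proof -
    obtain c where "T c = y" using surj by blast
    then show ?thesis
      using nn_integral_lborel_translate[of "\<lambda>x. g (T x)" c] by (simp add: linear_add[OF lin])
  qed
  have "(\<integral>\<^sup>+y. \<integral>\<^sup>+x. f y * B (T x - y) \<partial>lborel \<partial>lborel) = (\<integral>\<^sup>+y. f y * (\<integral>\<^sup>+x. B x \<partial>lborel) \<partial>lborel)"
  proof (intro nn_integral_cong)
    fix y
    have "(\<integral>\<^sup>+x. B (T x - y) \<partial>lborel) = (\<integral>\<^sup>+x. B x \<partial>lborel)"
      using shift[of B "- y"] by (simp add: BT)
    then show "(\<integral>\<^sup>+x. f y * B (T x - y) \<partial>lborel) = f y * (\<integral>\<^sup>+x. B x \<partial>lborel)"
      by (simp add: nn_integral_cmult)
  qed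
  also have "\<dots> = (\<integral>\<^sup>+x. f x \<partial>lborel) * (\<integral>\<^sup>+x. B x \<partial>lborel)"
    by (simp add: nn_integral_multc)
  finally have 1: "(\<integral>\<^sup>+y. \<integral>\<^sup>+x. f y * B (T x - y) \<partial>lborel \<partial>lborel)
     = (\<integral>\<^sup>+x. f x \<partial>lborel) * (\<integral>\<^sup>+x. B x \<partial>lborel)" .
  have "(\<integral>\<^sup>+y. \<integral>\<^sup>+x. f y * B (T x - y) \<partial>lborel \<partial>lborel) = (\<integral>\<^sup>+x. \<integral>\<^sup>+y. f y * B (T x - y) \<partial>lborel \<partial>lborel)"
    by (rule lborel_pair.Fubini') measurable
  also have "\<dots> = (\<integral>\<^sup>+x. \<integral>\<^sup>+y. f (T x + y) * B y \<partial>lborel \<partial>lborel)"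
  proof (rule nn_integral_cong)
    fix x
    show "(\<integral>\<^sup>+y. f y * B (T x - y) \<partial>lborel) = (\<integral>\<^sup>+y. f (T x + y) * B y \<partial>lborel)"
      using nn_integral_lborel_translate[of "\<lambda>y. f y * B (T x - y)" "T x"]
      by (simp add: Bm add.commute)
  qed
  also have "\<dots> = (\<integral>\<^sup>+y. \<integral>\<^sup>+x. f (T x + y) * B y \<partial>lborel \<partial>lborel)"
    by (rule lborel_pair.Fubini') measurable
  also have "\<dots> = (\<integral>\<^sup>+x. f (T x) \<partial>lborel) * (\<integral>\<^sup>+x. B x \<partial>lborel)"
    by (simp add: nn_integral_cmult nn_integral_multc shift)
  finally have eq: "(\<integral>\<^sup>+x. f (T x) \<partial>lborel) * (\<integral>\<^sup>+x. B x \<partial>lborel) = (\<integral>\<^sup>+x. f x \<partial>lborel) * (\<integral>\<^sup>+x. B x \<partial>lborel)"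
    using 1 by simp
  have "(\<integral>\<^sup>+x. B x \<partial>lborel) = emeasure lborel (ball 0 1 :: 'a set)"
    unfolding B_def by (subst nn_integral_indicator) auto
  moreover have "0 < emeasure lborel (ball 0 1 :: 'a set)" "emeasure lborel (ball 0 1 :: 'a set) < \<infinity>"
    by (auto simp: emeasure_ball ennreal_mult_less_top unit_ball_vol_pos emeasure_lborel_ball_finite simp flip: zero_less_iff_neq_zero)
  ultimately show ?thesis
    using eq ennreal_mult_cancel_left[of "\<integral>\<^sup>+x. B x \<partial>lborel" "\<integral>\<^sup>+x. f (T x) \<partial>lborel" "\<integral>\<^sup>+x. f x \<partial>lborel"]
    by (auto simp: mult.commute)
qed

text \<open>A Householder reflection when \<open>norm e = 1\<close>. For \<open>e = 0\<close> it is
  the identity, the case that arises from \<open>sgn 0 = 0\<close>.\<close>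

definition reflect :: "'a::real_inner \<Rightarrow> 'a \<Rightarrow> 'a" where
  "reflect e z = z - (2 * (e \<bullet> z)) *\<^sub>R e"

lemma orthogonal_transformation_reflect:
  assumes "norm e = 1"
  shows "orthogonal_transformation (reflect e)"
proof -
  have ee: "e \<bullet> e = 1" using assms by (simp add: dot_square_norm)
  show ?thesis
    unfolding orthogonal_transformation_def reflect_def
    by (auto intro!: linearI simp: algebra_simps ee inner_commute)
qed

definition gaussian :: "'a::euclidean_space measure" where
  "gaussian = density lborel (\<lambda>z. ennreal (std_gaussian_density z))"

lemma std_gaussian_density_eq:
  "std_gaussian_density (z::'a::euclidean_space) = (1 / sqrt (2 * pi)) ^ DIM('a) * exp (- (norm z)\<^sup>2 / 2)"
proof -
  have "(norm z)\<^sup>2 = (\<Sum>i\<in>Basis. (z \<bullet> i)\<^sup>2)"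
    unfolding power2_norm_eq_inner by (subst euclidean_inner) (simp add: power2_eq_square)
  then show ?thesis
    unfolding std_gaussian_density_def std_normal_density_def prod.distrib
    by (simp add: exp_sum[symmetric] sum_negf sum_divide_distrib)
qed

lemma std_gaussian_density_pos: "0 < std_gaussian_density z"
  by (simp add: std_gaussian_density_eq)

lemma borel_measurable_std_gaussian_density [measurable]:
  "(std_gaussian_density :: 'a::euclidean_space \<Rightarrow> real) \<in> borel_measurable borel"
  unfolding std_gaussian_density_eq[abs_def] by measurable

lemma sets_gaussian [simp, measurable_cong]: "sets gaussian = sets borel"
  and space_gaussian [simp]: "space gaussian = UNIV"
  by (simp_all add: gaussian_def)

lemma nn_integral_gaussian:
  assumes [measurable]: "f \<in> borel_measurable borel"
  shows "(\<integral>\<^sup>+z. f z \<partial>gaussian) = (\<integral>\<^sup>+z. ennreal (std_gaussian_density z) * f z \<partial>lborel)"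
  unfolding gaussian_def by (subst nn_integral_density) auto

lemma nn_integral_gaussian_coordinate:
  fixes i :: "'a::euclidean_space"
  assumes i: "i \<in> Basis" and [measurable]: "f \<in> borel_measurable borel" and f: "\<And>t. 0 \<le> f t"
  shows "(\<integral>\<^sup>+z. ennreal (f (z \<bullet> i)) \<partial>gaussian) = (\<integral>\<^sup>+t. ennreal (std_normal_density t * f t) \<partial>lborel)"
proof -
  have one: "(\<integral>\<^sup>+t. ennreal (std_normal_density t) \<partial>lborel) = 1"
    using prob_space.emeasure_space_1[OF prob_space_normal_density[of 1 0]] by (simp add: emeasure_density)
  \<comment> \<open>The factor of coordinate \<open>i\<close> carries \<open>f\<close>; every other
    factor integrates to 1.\<close>
  define g where "g b t = std_normal_density t * (if b = i then f t else 1)" for b :: 'a and t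
  have "(\<integral>\<^sup>+z. ennreal (f (z \<bullet> i)) \<partial>gaussian) = (\<integral>\<^sup>+z. ennreal (\<Prod>b\<in>Basis. g b (z \<bullet> b)) \<partial>lborel)"
  proof (subst nn_integral_gaussian, measurable, intro nn_integral_cong)
    fix z :: 'a
    have "(\<Prod>b\<in>Basis. g b (z \<bullet> b)) = std_gaussian_density z * f (z \<bullet> i)"
      using i by (simp add: g_def std_gaussian_density_def prod.distrib prod.delta)
    then show "ennreal (std_gaussian_density z) * ennreal (f (z \<bullet> i)) = ennreal (\<Prod>b\<in>Basis. g b (z \<bullet> b))"
      using f std_gaussian_density_pos[of z] by (simp add: ennreal_mult)
  qed
  also have "\<dots> = (\<integral>\<^sup>+z. (\<Prod>b\<in>Basis. ennreal (g b (z \<bullet> b))) \<partial>lborel)"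
    by (intro nn_integral_cong prod_ennreal[symmetric]) (simp add: g_def f)
  also have "\<dots> = (\<Prod>b\<in>Basis. (\<integral>\<^sup>+t. ennreal (g b t) \<partial>lborel))"
    by (rule nn_integral_lborel_prod) (auto simp: g_def f)
  also have "\<dots> = (\<Prod>b\<in>Basis. (if b = i then (\<integral>\<^sup>+t. ennreal (std_normal_density t * f t) \<partial>lborel) else 1))"
    by (intro prod.cong) (auto simp: g_def one)
  finally show ?thesis using i by (simp add: prod.delta)
qed

lemma prob_space_gaussian: "prob_space (gaussian :: 'a::euclidean_space measure)"
proof
  obtain i :: 'a where "i \<in> Basis" using nonempty_Basis by blast
  from nn_integral_gaussian_coordinate[OF this, of "\<lambda>_. 1"]
  show "emeasure (gaussian :: 'a measure) (space gaussian) = 1"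
    using prob_space.emeasure_space_1[OF prob_space_normal_density[of 1 0]] by (simp add: emeasure_density)
qed

lemma nn_integral_gaussian_orthogonal:
  fixes T :: "'a::euclidean_space \<Rightarrow> 'a"
  assumes T: "orthogonal_transformation T" and [measurable]: "f \<in> borel_measurable borel"
  shows "(\<integral>\<^sup>+z. f (T z) \<partial>gaussian) = (\<integral>\<^sup>+z. f z \<partial>gaussian)"
proof -
  have lin: "linear T" and nT: "\<And>x. norm (T x) = norm x"
    using T by (auto simp: orthogonal_transformation)
  have [measurable]: "T \<in> borel_measurable borel"
    using lin by (intro borel_measurable_continuous_onI linear_continuous_on) (simp add: linear_conv_bounded_linear)
  have "std_gaussian_density (T z) = std_gaussian_density z" for z :: 'a
    by (simp add: std_gaussian_density_eq nT)
  then show ?thesis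
    using nn_integral_lborel_orthogonal[OF T, of "\<lambda>z. ennreal (std_gaussian_density z) * f z"]
    by (simp add: nn_integral_gaussian)
qed

text \<open>Rotation invariance moves \<open>e\<close> to a basis vector, where the product form of
  the density applies.\<close>

lemma nn_integral_gaussian_inner:
  fixes e :: "'a::euclidean_space"
  assumes e: "norm e = 1" and [measurable]: "f \<in> borel_measurable borel" and f: "\<And>t. 0 \<le> f t"
  shows "(\<integral>\<^sup>+z. ennreal (f (e \<bullet> z)) \<partial>gaussian) = (\<integral>\<^sup>+t. ennreal (std_normal_density t * f t) \<partial>lborel)"
proof -
  obtain i :: 'a where i: "i \<in> Basis" using nonempty_Basis by blast
  obtain T where T: "orthogonal_transformation T" "T i = e"
  proof (cases "i = e")
    case True
    then show thesis using that[of "\<lambda>x. x"] by simp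
  next
    case False
    \<comment> \<open>The Householder vector of the reflection that exchanges the unit vectors
      \<open>i\<close> and \<open>e\<close>.\<close>
    define u where "u = (1 / norm (i - e)) *\<^sub>R (i - e)"
    have "norm u = 1" using False by (simp add: u_def)
    moreover have "reflect u i = e"
    proof -
      have "(norm (i - e))\<^sup>2 = 2 * ((i - e) \<bullet> i)"
      proof -
        have "e \<bullet> e = 1" "i \<bullet> i = 1" using e i by (simp_all add: dot_square_norm)
        then show ?thesis
          unfolding power2_norm_eq_inner by (simp add: inner_diff_left inner_diff_right inner_commute)
      qed
      moreover have "u \<bullet> i = ((i - e) \<bullet> i) / norm (i - e)"
        by (simp add: u_def)
      ultimately have one: "2 * (u \<bullet> i) / norm (i - e) = 1"
        using False by (simp add: power2_eq_square) (metis eq_iff_diff_eq_0 mult_eq_0_iff norm_eq_zero zero_neq_numeral)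
      have "(2 * (u \<bullet> i)) *\<^sub>R u = (2 * (u \<bullet> i) / norm (i - e)) *\<^sub>R (i - e)"
        by (subst (2) u_def) simp
      also have "\<dots> = i - e" unfolding one by simp
      finally show ?thesis by (simp add: reflect_def)
    qed
    ultimately show thesis
      using that orthogonal_transformation_reflect by blast
  qed
  have "(\<integral>\<^sup>+z. ennreal (f (e \<bullet> z)) \<partial>gaussian) = (\<integral>\<^sup>+z. ennreal (f (e \<bullet> T z)) \<partial>gaussian)"
    by (rule nn_integral_gaussian_orthogonal[OF T(1), symmetric]) measurable
  also have "(\<lambda>z. e \<bullet> T z) = (\<lambda>z. z \<bullet> i)"
    using T by (auto simp: orthogonal_transformation_def inner_commute)
  finally show ?thesis
    using nn_integral_gaussian_coordinate[OF i, of f] f by simp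
qed

lemma nn_integral_gaussian_norm_square:
  "(\<integral>\<^sup>+z. ennreal ((norm (z::'a::euclidean_space))\<^sup>2) \<partial>gaussian) = ennreal (real DIM('a))"
proof -
  have "(\<integral>t. std_normal_density t * t ^ (2 * 1) \<partial>lborel) = 1"
    by (subst integral_std_normal_moment_even) simp
  then have 1: "(\<integral>\<^sup>+t. ennreal (std_normal_density t * t\<^sup>2) \<partial>lborel) = 1"
    using nn_integral_eq_integral[OF integrable_std_normal_moment[of 2]] by simp
  have "(\<integral>\<^sup>+z. ennreal ((norm (z::'a))\<^sup>2) \<partial>gaussian) = (\<integral>\<^sup>+z. (\<Sum>i\<in>(Basis::'a set). ennreal ((z \<bullet> i)\<^sup>2)) \<partial>gaussian)"
    unfolding power2_norm_eq_inner
    by (intro nn_integral_cong) (subst euclidean_inner, simp add: power2_eq_square sum_ennreal)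
  also have "\<dots> = (\<Sum>i\<in>(Basis::'a set). (\<integral>\<^sup>+z. ennreal ((z \<bullet> i)\<^sup>2) \<partial>gaussian))"
    by (rule nn_integral_sum) simp
  also have "\<dots> = (\<Sum>i\<in>(Basis::'a set). 1)"
    by (intro sum.cong refl) (subst nn_integral_gaussian_coordinate[where f="\<lambda>t. t\<^sup>2"], auto simp: 1)
  finally show ?thesis by (simp add: ennreal_of_nat_eq_real_of_nat)
qed

text \<open>The finite second moment makes the norm integrable. Each coordinate of the mean vanishes
  because the reflection in that coordinate preserves the measure and changes the sign.\<close>

lemma integrable_gaussian_id: "integrable gaussian (\<lambda>z::'a::euclidean_space. z)"
  and integral_gaussian_id: "(\<integral>z. z \<partial>gaussian) = (0::'a::euclidean_space)"
proof -
  interpret prob_space "gaussian :: 'a measure" by (rule prob_space_gaussian)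
  have "integrable gaussian (\<lambda>z::'a. (norm z)\<^sup>2)"
    by (rule integrableI_nonneg) (auto simp: nn_integral_gaussian_norm_square)
  then have "integrable gaussian (\<lambda>z::'a. norm z)"
    by (rule square_integrable_imp_integrable[rotated]) simp
  then show int: "integrable gaussian (\<lambda>z::'a. z)"
    by (simp add: integrable_norm_iff)
  show "(\<integral>z. z \<partial>gaussian) = (0::'a)"
  proof (rule euclidean_eqI)
    fix i :: 'a assume i: "i \<in> Basis"
    have "norm i = 1" using i by simp
    note T = orthogonal_transformation_reflect[OF this]
    have [measurable]: "reflect i \<in> borel_measurable borel"
      unfolding reflect_def by measurable
    have "distr gaussian borel (reflect i) = gaussian"
    proof (rule measure_eqI)
      fix A :: "'a set" assume "A \<in> sets (distr gaussian borel (reflect i))"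
      then have [measurable]: "A \<in> sets borel" by simp
      have "emeasure (distr gaussian borel (reflect i)) A = (\<integral>\<^sup>+z. indicator A (reflect i z) \<partial>gaussian)"
        by (subst nn_integral_indicator[symmetric], simp, subst nn_integral_distr) auto
      then show "emeasure (distr gaussian borel (reflect i)) A = emeasure gaussian A"
        using nn_integral_gaussian_orthogonal[OF T, of "indicator A"] by simp
    qed simp
    then have "(\<integral>z. z \<bullet> i \<partial>gaussian) = (\<integral>z. reflect i z \<bullet> i \<partial>gaussian)"
      by (subst (1) \<open>distr gaussian borel (reflect i) = gaussian\<close>[symmetric], subst integral_distr) auto
    also have "\<dots> = (\<integral>z. - (z \<bullet> i) \<partial>gaussian)"
    proof (intro Bochner_Integration.integral_cong refl)
      show "reflect i z \<bullet> i = - (z \<bullet> i)" for z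
        using i by (simp add: reflect_def inner_diff_left inner_commute[of i z])
    qed
    finally show "(\<integral>z. z \<partial>gaussian) \<bullet> i = 0 \<bullet> i"
      using int by simp
  qed
qed

subsection \<open>The reflection coupling\<close>

definition unif :: "real measure" where
  "unif = uniform_measure lborel {0..1}"

lemma sets_unif [simp, measurable_cong]: "sets unif = sets borel"
  and space_unif [simp]: "space unif = UNIV"
  by (simp_all add: unif_def)

lemma prob_space_unif: "prob_space unif"
  unfolding unif_def by (rule prob_space_uniform_measure) auto

lemma emeasure_unif_le:
  assumes "0 \<le> q"
  shows "emeasure unif {x. x \<le> q} = ennreal (min 1 q)"
proof -
  have "emeasure unif {x. x \<le> q} = emeasure lborel ({0..1} \<inter> {x. x \<le> q}) / emeasure lborel {0..1::real}"
    unfolding unif_def by (rule emeasure_uniform_measure) auto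
  also have "{0..1} \<inter> {x. x \<le> q} = {0..min 1 q}" by auto
  finally show ?thesis using assms by (simp add: divide_ennreal_def)
qed

lemma nn_integral_unif_if:
  assumes "0 \<le> q"
  shows "(\<integral>\<^sup>+x. (if x \<le> q then A else B) \<partial>unif) = ennreal (min 1 q) * A + ennreal (1 - min 1 q) * B"
proof -
  interpret prob_space unif by (rule prob_space_unif)
  have [measurable]: "{x. x \<le> q} \<in> sets borel" "{x. \<not> x \<le> q} \<in> sets borel" by measurable
  have "emeasure unif {x. \<not> x \<le> q} = emeasure unif (space unif - {x. x \<le> q})"
    by (intro arg_cong2[where f=emeasure] refl) auto
  also have "\<dots> = 1 - ennreal (min 1 q)"
    by (subst emeasure_compl) (auto simp: emeasure_unif_le[OF assms] emeasure_space_1 simp del: space_unif)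
  also have "\<dots> = ennreal (1 - min 1 q)"
    using assms by (simp add: ennreal_minus flip: ennreal_1)
  finally have c: "emeasure unif {x. \<not> x \<le> q} = ennreal (1 - min 1 q)" .
  have "(\<integral>\<^sup>+x. (if x \<le> q then A else B) \<partial>unif)
    = (\<integral>\<^sup>+x. A * indicator {x. x \<le> q} x + B * indicator {x. \<not> x \<le> q} x \<partial>unif)"
    by (intro nn_integral_cong) auto
  also have "\<dots> = A * emeasure unif {x. x \<le> q} + B * emeasure unif {x. \<not> x \<le> q}"
    by (subst nn_integral_add) (auto simp: nn_integral_cmult_indicator)
  finally show ?thesis by (simp add: c emeasure_unif_le[OF assms] mult.commute)
qed

text \<open>In the coupling the point \<open>x + v\<close> moves by \<open>z\<close> and the point \<open>x\<close> by \<open>couple m v z t\<close>, where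
  \<open>t\<close> is uniform: the two points meet whenever possible and are reflected otherwise, provided that
  the noise along \<open>v\<close> is at most \<open>m\<close>.\<close>
definition accept :: "real \<Rightarrow> real \<Rightarrow> real \<Rightarrow> real" where
  "accept m s w = (if \<bar>w + s\<bar> \<le> m then exp (- (w * s + s\<^sup>2 / 2)) else 0)"

definition couple :: "real \<Rightarrow> 'a::euclidean_space \<Rightarrow> 'a \<Rightarrow> real \<Rightarrow> 'a" where
  "couple m v z t =
    (if \<bar>sgn v \<bullet> z\<bar> > m then z
     else if t \<le> 0 \<or> t \<le> accept m (norm v) (sgn v \<bullet> z) then z + v
     else reflect (sgn v) z)"

lemma accept_nonneg: "0 \<le> accept m s w"
  by (simp add: accept_def)

lemma borel_measurable_sgn_euclidean [measurable (raw)]: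
  fixes f :: "'b \<Rightarrow> 'a::euclidean_space"
  assumes [measurable]: "f \<in> borel_measurable M"
  shows "(\<lambda>x. sgn (f x)) \<in> borel_measurable M"
  unfolding sgn_div_norm by measurable

lemma measurable_accept [measurable (raw)]:
  assumes [measurable]: "s \<in> borel_measurable M" "w \<in> borel_measurable M"
  shows "(\<lambda>x. accept m (s x) (w x)) \<in> borel_measurable M"
  unfolding accept_def by measurable

lemma measurable_reflect [measurable (raw)]:
  fixes e z :: "'b \<Rightarrow> 'a::euclidean_space"
  assumes [measurable]: "e \<in> borel_measurable M" "z \<in> borel_measurable M"
  shows "(\<lambda>x. reflect (e x) (z x)) \<in> borel_measurable M"
  unfolding reflect_def by measurable

lemma measurable_couple [measurable (raw)]:
  fixes v z :: "'b \<Rightarrow> 'a::euclidean_space"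
  assumes [measurable]: "v \<in> borel_measurable M" "z \<in> borel_measurable M" "t \<in> borel_measurable M"
  shows "(\<lambda>x. couple m (v x) (z x) (t x)) \<in> borel_measurable M"
proof -
  define e where "e x = sgn (v x)" for x
  have [measurable]: "e \<in> borel_measurable M" unfolding e_def[abs_def] by measurable
  show ?thesis unfolding couple_def e_def[symmetric] by measurable
qed

lemma couple_0: "couple m 0 z t = z"
  by (simp add: couple_def reflect_def)

lemma nn_integral_couple_unif:
  fixes v z :: "'a::euclidean_space"
  shows "(\<integral>\<^sup>+t. F (couple m v z t) \<partial>unif) =
    (if \<bar>sgn v \<bullet> z\<bar> > m then F z
     else ennreal (min 1 (accept m (norm v) (sgn v \<bullet> z))) * F (z + v)
        + ennreal (1 - min 1 (accept m (norm v) (sgn v \<bullet> z))) * F (reflect (sgn v) z))"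
proof -
  interpret prob_space unif by (rule prob_space_unif)
  let ?q = "accept m (norm v) (sgn v \<bullet> z)"
  show ?thesis
  proof (cases "\<bar>sgn v \<bullet> z\<bar> > m")
    case True
    then show ?thesis by (simp add: couple_def emeasure_space_1[simplified])
  next
    case False
    then have "F (couple m v z t) = (if t \<le> ?q then F (z + v) else F (reflect (sgn v) z))" for t
      using accept_nonneg[of m "norm v" "sgn v \<bullet> z"] by (auto simp: couple_def)
    then show ?thesis
      using False by (simp add: nn_integral_unif_if[OF accept_nonneg])
  qed
qed

lemma inner_sgn_self: "sgn v \<bullet> v = norm v"
  by (cases "v = 0") (auto simp: sgn_div_norm dot_square_norm power2_eq_square)

text \<open>The exponential is the likelihood ratio of \<open>z + v\<close> against
  \<open>z\<close>, and it depends on \<open>z\<close> only through the component along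
  \<open>v\<close>. Within the cutoff it is the value of \<open>accept\<close>.\<close>

lemma std_gaussian_density_shift:
  fixes v z :: "'a::euclidean_space"
  shows "std_gaussian_density (z + v)
    = std_gaussian_density z * exp (- ((sgn v \<bullet> z) * norm v + (norm v)\<^sup>2 / 2))"
proof -
  have "(sgn v \<bullet> z) * norm v = v \<bullet> z"
    by (cases "v = 0") (auto simp: sgn_div_norm)
  moreover have "(norm (z + v))\<^sup>2 = (norm z)\<^sup>2 + 2 * (v \<bullet> z) + (norm v)\<^sup>2"
    by (simp add: power2_norm_eq_inner inner_add_left inner_add_right inner_commute)
  ultimately have "- (norm (z + v))\<^sup>2 / 2 = - (norm z)\<^sup>2 / 2 + - ((sgn v \<bullet> z) * norm v + (norm v)\<^sup>2 / 2)"
    by (simp add: field_simps)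
  then show ?thesis
    by (simp only: std_gaussian_density_eq exp_add mult.assoc)
qed

text \<open>The Gaussian mass splits into three parts: what lies beyond the cutoff stays, the
  overlap \<open>k\<close> is shifted by \<open>v\<close>, and the rest is reflected. The shifted
  overlap is exactly the mass that the image of the reflected part lacks, so the three images add up
  to the Gaussian again.\<close>

lemma nn_integral_gaussian_couple:
  fixes v :: "'a::euclidean_space"
  assumes F[measurable]: "F \<in> borel_measurable borel"
  shows "(\<integral>\<^sup>+z. \<integral>\<^sup>+t. F (couple m v z t) \<partial>unif \<partial>gaussian) = (\<integral>\<^sup>+z. F z \<partial>gaussian)"
proof (cases "v = 0")
  case True
  interpret prob_space unif by (rule prob_space_unif)
  show ?thesis using True by (simp add: couple_0 emeasure_space_1[simplified])
next
  case False
  define e where "e = sgn v"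
  have e: "norm e = 1" using False by (simp add: e_def norm_sgn)
  then have ee: "e \<bullet> e = 1" by (simp add: dot_square_norm)
  note R = orthogonal_transformation_reflect[OF e]
  define \<gamma> where "\<gamma> z = std_gaussian_density z" for z :: 'a
  have \<gamma>[measurable]: "\<gamma> \<in> borel_measurable borel" and \<gamma>0: "0 \<le> \<gamma> z" for z
    unfolding \<gamma>_def[abs_def] using std_gaussian_density_pos[of z] by auto
  define I where "I z = (if \<bar>e \<bullet> z\<bar> \<le> m then 1 else 0 :: real)" for z
  \<comment> \<open>The overlap of the Gaussian with its translate, with both noises kept within the
    cutoff. By \<open>ke\<close> it is the density of the accepted noise.\<close>
  define k where "k z = min (\<gamma> z) (\<gamma> (z + v)) * I z * I (z + v)" for z
  have [measurable]: "I \<in> borel_measurable borel" unfolding I_def by measurable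
  have [measurable]: "k \<in> borel_measurable borel" unfolding k_def[abs_def] by measurable
  have [measurable]: "reflect e \<in> borel_measurable borel" unfolding reflect_def by measurable
  have k0: "0 \<le> k z" for z
    using \<gamma>0[of z] \<gamma>0[of "z + v"] by (auto simp: k_def I_def)
  have ev: "e \<bullet> v = norm v" by (simp add: e_def inner_sgn_self)
  have ke: "\<gamma> z * I z * min 1 (accept m (norm v) (e \<bullet> z)) = k z" for z
  proof -
    have "\<gamma> (z + v) = \<gamma> z * exp (- ((e \<bullet> z) * norm v + (norm v)\<^sup>2 / 2))"
      unfolding \<gamma>_def e_def by (rule std_gaussian_density_shift)
    moreover have "e \<bullet> (z + v) = e \<bullet> z + norm v" by (simp add: inner_add_right ev)
    ultimately show ?thesis
      using \<gamma>0[of z] by (simp add: k_def I_def accept_def min_mult_distrib_left)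
  qed
  have inner: "ennreal (\<gamma> z) * (\<integral>\<^sup>+t. F (couple m v z t) \<partial>unif)
    = ennreal (\<gamma> z * (1 - I z)) * F z + (ennreal (k z) * F (z + v) + ennreal (\<gamma> z * I z - k z) * F (reflect e z))" for z
  proof (cases "\<bar>e \<bullet> z\<bar> > m")
    case True
    then show ?thesis by (simp add: nn_integral_couple_unif e_def I_def k_def)
  next
    case False
    let ?p = "min 1 (accept m (norm v) (e \<bullet> z))"
    have "ennreal (\<gamma> z) * ennreal ?p = ennreal (k z)" "ennreal (\<gamma> z) * ennreal (1 - ?p) = ennreal (\<gamma> z * I z - k z)"
      using ke[of z] False \<gamma>0[of z] accept_nonneg[of m "norm v" "e \<bullet> z"]
      by (auto simp: I_def right_diff_distrib simp flip: ennreal_mult)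
    then show ?thesis
      using False by (simp add: nn_integral_couple_unif e_def[symmetric] I_def distrib_left mult.assoc[symmetric])
  qed
  \<comment> \<open>The reflection negates \<open>v\<close>, so it maps \<open>z - v\<close> to
    \<open>reflect e z + v\<close>; up to this the two arguments of the minimum are
    exchanged.\<close>
  have kR: "k (reflect e z) = k (z - v)" for z
  proof -
    have "(2 * norm v) *\<^sub>R e = v + v"
      using False by (simp add: e_def sgn_div_norm flip: scaleR_2)
    then have lin: "reflect e (z - v) = reflect e z + v"
      by (simp add: reflect_def inner_diff_right ev algebra_simps)
    have "\<gamma> (reflect e y) = \<gamma> y" for y
      using R by (simp add: \<gamma>_def std_gaussian_density_eq orthogonal_transformation)
    from this[of z] this[of "z - v"] show ?thesis
      unfolding k_def lin[symmetric] by (auto simp: I_def reflect_def inner_diff_right ee ev)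
  qed
  have RR: "reflect e (reflect e z) = z" for z
    by (simp add: reflect_def inner_diff_right ee algebra_simps)
  have "(\<integral>\<^sup>+z. \<integral>\<^sup>+t. F (couple m v z t) \<partial>unif \<partial>gaussian)
    = (\<integral>\<^sup>+z. ennreal (\<gamma> z) * (\<integral>\<^sup>+t. F (couple m v z t) \<partial>unif) \<partial>lborel)"
    unfolding \<gamma>_def by (rule nn_integral_gaussian) (use sigma_finite_measure.borel_measurable_nn_integral[OF prob_space_imp_sigma_finite[OF prob_space_unif]] in measurable)
  also have "\<dots> = (\<integral>\<^sup>+z. ennreal (\<gamma> z * (1 - I z)) * F z \<partial>lborel)
    + ((\<integral>\<^sup>+z. ennreal (k z) * F (z + v) \<partial>lborel) + (\<integral>\<^sup>+z. ennreal (\<gamma> z * I z - k z) * F (reflect e z) \<partial>lborel))"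
    unfolding inner by (simp add: nn_integral_add)
  also have "(\<integral>\<^sup>+z. ennreal (k z) * F (z + v) \<partial>lborel) = (\<integral>\<^sup>+z. ennreal (k (z - v)) * F z \<partial>lborel)"
    using nn_integral_lborel_translate[of "\<lambda>z. ennreal (k (z - v)) * F z" v] by simp
  also have "(\<integral>\<^sup>+z. ennreal (\<gamma> z * I z - k z) * F (reflect e z) \<partial>lborel)
     = (\<integral>\<^sup>+z. ennreal (\<gamma> z * I z - k (z - v)) * F z \<partial>lborel)"
  proof -
    have "\<gamma> (reflect e z) * I (reflect e z) = \<gamma> z * I z" for z
      using R by (simp add: \<gamma>_def std_gaussian_density_eq orthogonal_transformation I_def)
         (simp add: reflect_def inner_diff_right ee)
    then show ?thesis
      using nn_integral_lborel_orthogonal[OF R, of "\<lambda>z. ennreal (\<gamma> z * I z - k z) * F (reflect e z)"]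
      by (simp add: RR kR)
  qed
  also have "(\<integral>\<^sup>+z. ennreal (\<gamma> z * (1 - I z)) * F z \<partial>lborel)
    + ((\<integral>\<^sup>+z. ennreal (k (z - v)) * F z \<partial>lborel) + (\<integral>\<^sup>+z. ennreal (\<gamma> z * I z - k (z - v)) * F z \<partial>lborel))
    = (\<integral>\<^sup>+z. ennreal (\<gamma> z * (1 - I z)) * F z + (ennreal (k (z - v)) * F z + ennreal (\<gamma> z * I z - k (z - v)) * F z) \<partial>lborel)"
    by (simp add: nn_integral_add)
  also have "\<dots> = (\<integral>\<^sup>+z. ennreal (\<gamma> z) * F z \<partial>lborel)"
  proof (rule nn_integral_cong)
    fix z
    have "k (z - v) \<le> \<gamma> z * I z" using \<gamma>0 by (auto simp: k_def I_def)
    then have "ennreal (\<gamma> z * (1 - I z)) + (ennreal (k (z - v)) + ennreal (\<gamma> z * I z - k (z - v))) = ennreal (\<gamma> z)"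
      using k0[of "z - v"] \<gamma>0[of z] by (simp add: I_def flip: ennreal_plus)
    then show "ennreal (\<gamma> z * (1 - I z)) * F z + (ennreal (k (z - v)) * F z + ennreal (\<gamma> z * I z - k (z - v)) * F z)
        = ennreal (\<gamma> z) * F z"
      by (metis distrib_right)
  qed
  finally show ?thesis by (simp add: nn_integral_gaussian \<gamma>_def)
qed

text \<open>Only the component w of the noise along \<open>v\<close> matters: after a reflection the
  points differ by (norm v + 2 w) times the unit vector in direction \<open>v\<close>. This reduces
  the estimate to one dimension.\<close>

lemma nn_integral_gaussian_couple_dist:
  fixes v :: "'a::euclidean_space"
  assumes H[measurable]: "H \<in> borel_measurable borel" and H0: "\<And>t. 0 \<le> t \<Longrightarrow> 0 \<le> H t" and v: "v \<noteq> 0"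
  shows "(\<integral>\<^sup>+z. \<integral>\<^sup>+t. ennreal (H (norm (v + z - couple m v z t))) \<partial>unif \<partial>gaussian)
    = (\<integral>\<^sup>+w. ennreal (std_normal_density w * (if \<bar>w\<bar> > m then H (norm v)
        else min 1 (accept m (norm v) w) * H 0 + (1 - min 1 (accept m (norm v) w)) * H \<bar>norm v + 2 * w\<bar>)) \<partial>lborel)"
proof -
  define e where "e = sgn v"
  have e: "norm e = 1" using v by (simp add: e_def norm_sgn)
  have ve: "v = norm v *\<^sub>R e" using v by (simp add: e_def sgn_div_norm)
  define Q where "Q w = (if \<bar>w\<bar> > m then H (norm v)
        else min 1 (accept m (norm v) w) * H 0 + (1 - min 1 (accept m (norm v) w)) * H \<bar>norm v + 2 * w\<bar>)" for w
  have Q0: "0 \<le> Q w" for w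
    using H0[of "norm v"] H0[of 0] H0[of "\<bar>norm v + 2 * w\<bar>"] accept_nonneg[of m "norm v" w]
    by (auto simp: Q_def intro!: add_nonneg_nonneg mult_nonneg_nonneg)
  have [measurable]: "Q \<in> borel_measurable borel" unfolding Q_def[abs_def] accept_def by measurable
  have "(\<integral>\<^sup>+t. ennreal (H (norm (v + z - couple m v z t))) \<partial>unif) = ennreal (Q (e \<bullet> z))" for z
  proof -
    have "v + z - reflect e z = (norm v + 2 * (e \<bullet> z)) *\<^sub>R e"
      by (subst ve) (simp add: reflect_def scaleR_add_left)
    then have "norm (v + z - reflect e z) = \<bar>norm v + 2 * (e \<bullet> z)\<bar>"
      using e by simp
    then show ?thesis
      using nn_integral_couple_unif[of "\<lambda>y. ennreal (H (norm (v + z - y)))" m v z]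
        H0[of "norm v"] H0[of 0] H0[of "\<bar>norm v + 2 * (e \<bullet> z)\<bar>"] accept_nonneg[of m "norm v" "e \<bullet> z"]
      by (simp add: e_def[symmetric] Q_def ennreal_mult ennreal_plus add.commute[of z v])
  qed
  then show ?thesis
    using nn_integral_gaussian_inner[OF e, of Q] Q0 by (simp add: Q_def)
qed

text \<open>The purpose of the cutoff: after the step the distance has a deterministic bound,
  whatever the noise was.\<close>

lemma couple_dist_le:
  assumes "0 \<le> m"
  shows "norm (v + z - couple m v z t) \<le> norm v + 2 * m"
proof -
  have "norm (v + z - reflect (sgn v) z) \<le> norm v + norm ((2 * (sgn v \<bullet> z)) *\<^sub>R sgn v)"
    unfolding reflect_def by (rule order_trans[OF _ norm_triangle_ineq]) simp
  moreover have "norm ((2 * (sgn v \<bullet> z)) *\<^sub>R sgn v) \<le> 2 * m" if "\<bar>sgn v \<bullet> z\<bar> \<le> m"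
    using that assms by (simp add: norm_sgn abs_mult)
  ultimately show ?thesis
    using assms by (auto simp: couple_def)
qed

section \<open>One-dimensional estimates: the constant \<open>c0\<close> and the gain from
  concavity\<close>

lemma c0_pos: "c0 > 0"
  and c0_le1: "c0 \<le> 4 * integral {0..1/2} (\<lambda>u. u\<^sup>2 * (1 - exp (u - 1/2)) * std_normal_density u)"
  and c0_le2: "c0 \<le> 4 * ((1 - exp (-1)) * integral {0..1/2} (\<lambda>u. u ^ 3 * std_normal_density u))"
proof -
  have pos: "0 < integral {0..1/2::real} f"
    if f: "continuous_on {0..1/2} f" "\<And>x. x \<in> {0..1/2} \<Longrightarrow> 0 \<le> f x" "0 < f (1/4)" for f :: "real \<Rightarrow> real"
  proof -
    have "0 \<le> integral {0..1/2} f" using f by (intro integral_nonneg integrable_continuous_real) auto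
    moreover have "integral {0..1/2} f \<noteq> 0"
    proof
      assume "integral {0..1/2} f = 0"
      then have "f (1/4) = 0"
        using integral_eq_0_iff[of 0 "1/2" f] f by auto
      with f(3) show False by simp
    qed
    ultimately show ?thesis by simp
  qed
  have c: "continuous_on A std_normal_density" for A :: "real set"
    unfolding std_normal_density_def by (intro continuous_intros) auto
  have "0 < integral {0..1/2} (\<lambda>u::real. u\<^sup>2 * (1 - exp (u - 1/2)) * std_normal_density u)"
    by (rule pos) (auto intro!: continuous_intros c mult_nonneg_nonneg mult_pos_pos normal_density_pos)
  moreover have "0 < integral {0..1/2} (\<lambda>u::real. u ^ 3 * std_normal_density u)"
    by (rule pos) (auto intro!: continuous_intros c mult_nonneg_nonneg mult_pos_pos normal_density_pos)
  ultimately show "c0 > 0" by (simp add: c0_def)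
qed (simp_all add: c0_def)

text \<open>The concave branch of \<open>f_dist\<close>. The rate is a parameter because distances
  will be measured in units of sqrt h, which multiplies the rate by sqrt h.\<close>

definition expdist :: "real \<Rightarrow> real \<Rightarrow> real" where
  "expdist a t = (1 - exp (- a * t)) / a"

lemma expdist_nonneg: "0 < a \<Longrightarrow> 0 \<le> t \<Longrightarrow> 0 \<le> expdist a t"
  by (simp add: expdist_def)

lemma expdist_0 [simp]: "expdist a 0 = 0"
  by (simp add: expdist_def)

lemma borel_measurable_expdist [measurable]: "expdist a \<in> borel_measurable borel"
  unfolding expdist_def[abs_def] by measurable

text \<open>An increment starting at \<open>s\<close> is the increment starting at 0 damped by exp
  (- a s), so second-order estimates only have to be made at 0.\<close>

lemma expdist_add: "a \<noteq> 0 \<Longrightarrow> expdist a (s + t) - expdist a s = exp (- a * s) * expdist a t"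
proof -
  assume "a \<noteq> 0"
  moreover have "exp (- a * (s + t)) = exp (- a * s) * exp (- a * t)"
    by (simp add: algebra_simps flip: exp_add)
  ultimately show ?thesis unfolding expdist_def by (simp only:) (simp add: field_simps)
qed

lemma expdist_le: "0 < a \<Longrightarrow> expdist a t \<le> t"
  using exp_ge_add_one_self[of "- a * t"] by (simp add: expdist_def field_simps)

lemma expdist_le_nonpos:
  assumes "0 < a" "t \<le> 0"
  shows "expdist a t \<le> t - a / 2 * t\<^sup>2"
  using exp_lower_Taylor_quadratic[of "- a * t"] assms
  by (simp add: expdist_def mult_nonneg_nonpos field_simps power2_eq_square)

text \<open>After multiplication by exp x the difference of the two sides vanishes at 0 and has
  derivative x (exp x - 1).\<close>

lemma exp_minus_lower_quadratic:
  assumes "0 \<le> (x::real)"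
  shows "1 - x + x\<^sup>2 / 2 * exp (- x) \<le> exp (- x)"
proof -
  have "0 \<le> (1 - exp x + x * exp x - x\<^sup>2 / 2)"
  proof -
    have "(\<lambda>x. 1 - exp x + x * exp x - x\<^sup>2 / 2) 0 \<le> (\<lambda>x. 1 - exp x + x * exp x - x\<^sup>2 / 2) x"
    proof (rule DERIV_nonneg_imp_nondecreasing[OF assms])
      fix y :: real assume "0 \<le> y" "y \<le> x"
      have "((\<lambda>x. 1 - exp x + x * exp x - x\<^sup>2 / 2) has_real_derivative y * exp y - y) (at y)"
        by (auto intro!: derivative_eq_intros simp: field_simps)
      moreover have "0 \<le> y * exp y - y" using \<open>0 \<le> y\<close> by (simp add: mult_le_cancel_left1)
      ultimately show "\<exists>z. ((\<lambda>x. 1 - exp x + x * exp x - x\<^sup>2 / 2) has_real_derivative z) (at y) \<and> 0 \<le> z" by blast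
    qed
    then show ?thesis by simp
  qed
  then have "0 \<le> (1 - exp x + x * exp x - x\<^sup>2 / 2) * exp (- x)" by simp
  also have "\<dots> = exp (- x) - 1 + x - x\<^sup>2 / 2 * exp (- x)"
    by (simp add: algebra_simps exp_minus)
  finally show ?thesis by simp
qed

text \<open>For positive arguments the quadratic term of the Taylor bound survives only with a
  damping factor; on [0, 1] this factor is at least exp (- a).\<close>

lemma expdist_le_unit:
  assumes "0 < a" "0 \<le> t" "t \<le> 1"
  shows "expdist a t \<le> t - a / 2 * t\<^sup>2 * exp (- a)"
proof -
  have "1 - a * t + (a * t)\<^sup>2 / 2 * exp (- a) \<le> 1 - a * t + (a * t)\<^sup>2 / 2 * exp (- (a * t))"
    using assms by (intro add_left_mono mult_left_mono) (auto simp: mult_le_cancel_left1)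
  also have "\<dots> \<le> exp (- (a * t))"
    using assms by (intro exp_minus_lower_quadratic) simp
  finally have "1 - exp (- a * t) \<le> a * (t - a / 2 * t\<^sup>2 * exp (- a))"
    by (simp add: field_simps power2_eq_square)
  then show ?thesis using assms by (simp add: expdist_def field_simps)
qed

lemma one_minus_exp_ge:
  assumes "0 \<le> x" "x \<le> (1::real)"
  shows "(1 - exp (- 1)) * x \<le> 1 - exp (- x)"
proof -
  have "convex_on UNIV (\<lambda>x::real. exp x)" by (rule exp_convex)
  from convex_onD[OF this, of x 0 "- 1"] assms
  have "exp (- x) \<le> (1 - x) * 1 + x * exp (- 1)" by (simp add: algebra_simps)
  then show ?thesis by (simp add: algebra_simps)
qed

text \<open>\<open>s\<close> is the distance in units of sqrt h. The regimes match the two integrals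
  in \<open>c0\<close>: points at least one unit apart gain from reflections that bring them closer,
  nearer points from reflections that drive them apart, and there the probability of reflecting
  instead of meeting is only of order s.\<close>

definition gain :: "real \<Rightarrow> real \<Rightarrow> real" where
  "gain a s = (if s \<ge> 1 then c0 else exp (- a) * s * c0)"

lemma gain_nonneg: "0 \<le> s \<Longrightarrow> 0 \<le> gain a s"
  using c0_pos by (simp add: gain_def)

lemma lborel_integral_cbox:
  fixes f :: "real \<Rightarrow> real"
  assumes "continuous_on {c..d} f"
  shows "integrable lborel (\<lambda>t. indicator {c..d} t * f t)"
    and "(\<integral>t. indicator {c..d} t * f t \<partial>lborel) = integral {c..d} f"
proof -
  have i: "set_integrable lborel {c..d} f"
    by (rule borel_integrable_atLeastAtMost') fact
  show "integrable lborel (\<lambda>t. indicator {c..d} t * f t)"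
    using i by (simp add: set_integrable_def)
  show "(\<integral>t. indicator {c..d} t * f t \<partial>lborel) = integral {c..d} f"
    using set_borel_integral_eq_integral(2)[OF i] by (simp add: set_lebesgue_integral_def)
qed

text \<open>\<open>\<psi>\<close> is a lower bound for (2 t)^2 times the reflection probability
  times the Gaussian density, up to the damping for positive t. It is the quadratic term in the
  expansion of \<open>expdist a\<close> at 0, and its integral dominates the gain. In this form both
  regimes can be treated at once in \<open>reflection_coupling_real\<close>.\<close>

lemma gain_density:
  assumes s: "0 < s" and a: "0 < a"
  shows "\<exists>\<psi>. integrable lborel \<psi> \<and> gain a s \<le> (\<integral>t. \<psi> t \<partial>lborel) \<and>
     (\<forall>t. (\<bar>t\<bar> > 1/2 \<longrightarrow> \<psi> t = 0) \<and>
       (\<bar>t\<bar> \<le> 1/2 \<longrightarrow> (1 - min 1 (exp (- (t * s + s\<^sup>2 / 2)))) * expdist a (2 * t) * std_normal_density t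
          \<le> (1 - min 1 (exp (- (t * s + s\<^sup>2 / 2)))) * (2 * t) * std_normal_density t - a / 2 * \<psi> t))"
proof (cases "s \<ge> 1")
  case True
  let ?f = "\<lambda>u. u\<^sup>2 * (1 - exp (u - 1/2)) * std_normal_density u :: real"
  have c: "continuous_on A std_normal_density" for A :: "real set"
    unfolding std_normal_density_def by (intro continuous_intros) auto
  have cf: "continuous_on {0..1/2} ?f" by (intro continuous_intros c)
  \<comment> \<open>Only negative \<open>t\<close> are used, where a reflection shortens the
    distance; the factor 4 comes from (2 t)^2.\<close>
  define \<psi> where "\<psi> t = 4 * (indicator {0..1/2} (- t) * ?f (- t))" for t
  have int: "integrable lborel \<psi>"
    using lborel_integrable_real_affine[OF lborel_integral_cbox(1)[OF cf], of "- 1" 0] by (simp add: \<psi>_def[abs_def])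
  have "(\<integral>t. \<psi> t \<partial>lborel) = 4 * integral {0..1/2} ?f"
    using lborel_integral_real_affine[of "- 1" "\<lambda>t. indicator {0..1/2} t * ?f t" 0]
      lborel_integral_cbox(2)[OF cf] by (simp add: \<psi>_def)
  then have g: "gain a s \<le> (\<integral>t. \<psi> t \<partial>lborel)" using True c0_le1 by (simp add: gain_def)
  have pw: "(1 - min 1 (exp (- (t * s + s\<^sup>2 / 2)))) * expdist a (2 * t) * std_normal_density t
          \<le> (1 - min 1 (exp (- (t * s + s\<^sup>2 / 2)))) * (2 * t) * std_normal_density t - a / 2 * \<psi> t"
    if t: "\<bar>t\<bar> \<le> 1/2" for t
  proof -
    let ?q = "1 - min 1 (exp (- (t * s + s\<^sup>2 / 2)))"
    let ?n = "std_normal_density t"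
    have n: "0 \<le> ?n" by simp
    show ?thesis
    proof (cases "t \<le> 0")
      case True
      \<comment> \<open>The exponents at \<open>s\<close> and at 1 differ by (s - 1) (t + (s + 1) /
        2), so the reflection probability is bounded below by its value for distance 1.\<close>
      have "- (t * s + s\<^sup>2 / 2) \<le> - t - 1 / 2"
      proof -
        have "- t \<le> 1 / 2" using t by (simp add: abs_le_iff)
        then have "0 \<le> t + (s + 1) / 2" using \<open>s \<ge> 1\<close> by (simp add: field_simps)
        then have "0 \<le> (s - 1) * (t + (s + 1) / 2)" using \<open>s \<ge> 1\<close> by (intro mult_nonneg_nonneg) auto
        then show ?thesis by (simp add: field_simps power2_eq_square)
      qed
      then have "exp (- (t * s + s\<^sup>2 / 2)) \<le> exp (- t - 1 / 2)" by simp
      then have q: "1 - exp (- t - 1 / 2) \<le> ?q" by linarith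
      have "?q * expdist a (2 * t) * ?n \<le> ?q * (2 * t - a / 2 * (2 * t)\<^sup>2) * ?n"
        using expdist_le_nonpos[OF a, of "2 * t"] True n by (intro mult_right_mono mult_left_mono) auto
      also have "\<dots> = ?q * (2 * t) * ?n - a / 2 * (4 * (t\<^sup>2 * ?q * ?n))"
        by (simp add: algebra_simps power2_eq_square)
      also have "\<dots> \<le> ?q * (2 * t) * ?n - a / 2 * (4 * (t\<^sup>2 * (1 - exp (- t - 1 / 2)) * ?n))"
        using q a n by (intro diff_left_mono mult_left_mono mult_right_mono) auto
      also have "\<dots> = ?q * (2 * t) * ?n - a / 2 * \<psi> t"
        using True t by (simp add: \<psi>_def std_normal_density_def)
      finally show ?thesis .
    next
      case False
      have "?q * expdist a (2 * t) * ?n \<le> ?q * (2 * t) * ?n"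
        using expdist_le[OF a, of "2 * t"] n by (intro mult_right_mono mult_left_mono) auto
      with False show ?thesis by (simp add: \<psi>_def)
    qed
  qed
  show ?thesis
    by (rule exI[of _ \<psi>]) (use int g pw in \<open>auto simp: \<psi>_def indicator_def\<close>)
next
  case False
  then have s1: "s < 1" by simp
  let ?f = "\<lambda>u. u ^ 3 * std_normal_density u :: real"
  have c: "continuous_on A std_normal_density" for A :: "real set"
    unfolding std_normal_density_def by (intro continuous_intros) auto
  have cf: "continuous_on {0..1/2} ?f" by (intro continuous_intros c)
  \<comment> \<open>Now only positive \<open>t\<close> are used. The reflection probability is at
    least (1 - exp (-1)) t s by concavity of 1 - exp (- x) on [0, 1], and exp (- a) is the damping
    in the Taylor bound.\<close>
  define C where "C = 4 * (exp (- a) * s * (1 - exp (- 1)))"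
  define \<psi> where "\<psi> t = C * (indicator {0..1/2} t * ?f t)" for t
  have int: "integrable lborel \<psi>"
    using lborel_integral_cbox(1)[OF cf] by (simp add: \<psi>_def[abs_def])
  have "(\<integral>t. \<psi> t \<partial>lborel) = C * integral {0..1/2} ?f"
    using lborel_integral_cbox(2)[OF cf] by (simp add: \<psi>_def)
  also have "\<dots> = exp (- a) * s * (4 * ((1 - exp (-1)) * integral {0..1/2} ?f))" by (simp add: C_def)
  finally have g: "gain a s \<le> (\<integral>t. \<psi> t \<partial>lborel)"
    using False s c0_le2 by (simp add: gain_def)
  have pw: "(1 - min 1 (exp (- (t * s + s\<^sup>2 / 2)))) * expdist a (2 * t) * std_normal_density t
          \<le> (1 - min 1 (exp (- (t * s + s\<^sup>2 / 2)))) * (2 * t) * std_normal_density t - a / 2 * \<psi> t"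
    if t: "\<bar>t\<bar> \<le> 1/2" for t
  proof -
    let ?q = "1 - min 1 (exp (- (t * s + s\<^sup>2 / 2)))"
    let ?n = "std_normal_density t"
    have n: "0 \<le> ?n" by simp
    show ?thesis
    proof (cases "t \<ge> 0")
      case True
      have "t * s \<le> 1 * 1" using True t s s1 by (intro mult_mono) auto
      then have "(1 - exp (- 1)) * (t * s) \<le> 1 - exp (- (t * s))"
        using True s by (intro one_minus_exp_ge) auto
      moreover have "exp (- (t * s + s\<^sup>2 / 2)) \<le> exp (- (t * s))" by simp
      ultimately have q: "(1 - exp (- 1)) * (t * s) \<le> ?q" by linarith
      have "?q * expdist a (2 * t) * ?n \<le> ?q * (2 * t - a / 2 * (2 * t)\<^sup>2 * exp (- a)) * ?n"
        using expdist_le_unit[OF a, of "2 * t"] True t n by (intro mult_right_mono mult_left_mono) auto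
      also have "\<dots> = ?q * (2 * t) * ?n - a / 2 * (4 * exp (- a) * (t\<^sup>2 * ?q * ?n))"
        by (simp add: algebra_simps power2_eq_square)
      also have "\<dots> \<le> ?q * (2 * t) * ?n - a / 2 * (4 * exp (- a) * (t\<^sup>2 * ((1 - exp (- 1)) * (t * s)) * ?n))"
        using q a n by (intro diff_left_mono mult_left_mono mult_right_mono) auto
      also have "\<dots> = ?q * (2 * t) * ?n - a / 2 * \<psi> t"
        using True t by (simp add: \<psi>_def C_def power3_eq_cube power2_eq_square)
      finally show ?thesis .
    next
      case False
      have "?q * expdist a (2 * t) * ?n \<le> ?q * (2 * t) * ?n"
        using expdist_le[OF a, of "2 * t"] n by (intro mult_right_mono mult_left_mono) auto
      with False show ?thesis by (simp add: \<psi>_def)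
    qed
  qed
  show ?thesis
    by (rule exI[of _ \<psi>]) (use int g pw in \<open>auto simp: \<psi>_def indicator_def\<close>)
qed

lemma integrable_normal_mult_bounded:
  fixes g :: "real \<Rightarrow> real"
  assumes [measurable]: "g \<in> borel_measurable borel" and g: "\<And>t. \<bar>g t\<bar> \<le> B"
  shows "integrable lborel (\<lambda>t. std_normal_density t * g t)"
proof (rule Bochner_Integration.integrable_bound[where f="\<lambda>t. std_normal_density t * B"])
  show "AE t in lborel. norm (std_normal_density t * g t) \<le> norm (std_normal_density t * B)"
    using g order_trans[OF abs_ge_zero g] by (auto simp: abs_mult intro!: mult_left_mono)
qed auto

text \<open>Reflection is a martingale, so that the expected distance stays \<open>s\<close>; the gain comes from
  the concavity of \<open>expdist a\<close> and the fluctuations of the distance.\<close>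
lemma reflection_coupling_real:
  assumes s: "0 < s" and a: "0 < a" and m: "1/2 \<le> m"
  defines "p \<equiv> \<lambda>t. min 1 (accept m s t)"
  shows "(\<integral>\<^sup>+t. ennreal (std_normal_density t * (if \<bar>t\<bar> > m then expdist a s
        else p t * expdist a 0 + (1 - p t) * expdist a \<bar>s + 2 * t\<bar>)) \<partial>lborel)
    \<le> ennreal (expdist a s - exp (- a * s) * (a / 2) * gain a s)"
proof -
  let ?n = std_normal_density
  obtain \<psi> where \<psi>: "integrable lborel \<psi>" "gain a s \<le> (\<integral>t. \<psi> t \<partial>lborel)"
     "\<And>t. \<bar>t\<bar> > 1/2 \<Longrightarrow> \<psi> t = 0"
     "\<And>t. \<bar>t\<bar> \<le> 1/2 \<Longrightarrow> (1 - min 1 (exp (- (t * s + s\<^sup>2 / 2)))) * expdist a (2 * t) * ?n t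
          \<le> (1 - min 1 (exp (- (t * s + s\<^sup>2 / 2)))) * (2 * t) * ?n t - a / 2 * \<psi> t"
    using gain_density[OF s a] by blast
  have p01: "0 \<le> p t" "p t \<le> 1" for t
    using accept_nonneg[of m s t] by (auto simp: p_def)
  define I where "I t = (if \<bar>t\<bar> \<le> m then 1 else 0 :: real)" for t
  have [measurable]: "p \<in> borel_measurable borel" "I \<in> borel_measurable borel"
    unfolding p_def I_def by measurable
  \<comment> \<open>The pointwise majorant: \<open>expdist a\<close> at \<open>s\<close>, plus its
    slope there times the change of the distance, which is 2 t on reflection and - s on meeting,
    minus the quadratic loss. Both linear terms have mean 0, by \<open>z1\<close> and
    \<open>z2\<close>.\<close>
  define B where "B t = ?n t * expdist a s
     + exp (- a * s) * (?n t * (I t * (2 * t)) - ?n t * (I t * p t * (s + 2 * t)) - a / 2 * \<psi> t)" for t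
  have i1: "integrable lborel (\<lambda>t. ?n t * (I t * (2 * t)))"
    by (rule integrable_normal_mult_bounded[where B="2 * m"]) (use m in \<open>auto simp: I_def\<close>)
  have i2: "integrable lborel (\<lambda>t. ?n t * (I t * p t * (s + 2 * t)))"
  proof (rule integrable_normal_mult_bounded[where B="s + 2 * m"])
    fix t
    have "\<bar>p t * (s + 2 * t)\<bar> \<le> 1 * \<bar>s + 2 * t\<bar>"
      using p01[of t] unfolding abs_mult by (intro mult_right_mono) auto
    then show "\<bar>I t * p t * (s + 2 * t)\<bar> \<le> s + 2 * m"
      using s m by (auto simp: I_def)
  qed measurable
  have z1: "(\<integral>t. ?n t * (I t * (2 * t)) \<partial>lborel) = 0"
  proof -
    have "(\<integral>t. ?n t * (I t * (2 * t)) \<partial>lborel) = - (\<integral>t. ?n t * (I t * (2 * t)) \<partial>lborel)"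
      by (subst lborel_integral_real_affine[of "- 1" _ 0]) (auto simp: I_def std_normal_density_def)
    then show ?thesis by simp
  qed
  have k: "?n t * (I t * p t * (s + 2 * t)) = min (?n t) (?n (t + s)) * I t * I (t + s) * (s + 2 * t)" for t
  proof -
    have "?n (t + s) = ?n t * exp (- (t * s + s\<^sup>2 / 2))"
      by (simp add: std_normal_density_def field_simps power2_eq_square flip: exp_add)
    then show ?thesis by (simp add: p_def accept_def I_def min_mult_distrib_left)
  qed
  \<comment> \<open>When t is replaced by - s - t, the overlap and the product of the cutoffs are
    unchanged while s + 2 t changes sign.\<close>
  have z2: "(\<integral>t. ?n t * (I t * p t * (s + 2 * t)) \<partial>lborel) = 0"
  proof -
    have "(\<integral>t. ?n t * (I t * p t * (s + 2 * t)) \<partial>lborel) = - (\<integral>t. ?n t * (I t * p t * (s + 2 * t)) \<partial>lborel)"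
    proof (subst lborel_integral_real_affine[of "- 1" _ "- s"], simp, subst integral_minus[symmetric], simp only: abs_minus_cancel abs_one scaleR_one, rule Bochner_Integration.integral_cong[OF refl])
      fix t
      have "?n (- x) = ?n x" "I (- x) = I x" for x by (auto simp: std_normal_density_def I_def)
      from this[of t] this[of "t + s"]
      show "?n (- s + - 1 * t) * (I (- s + - 1 * t) * p (- s + - 1 * t) * (s + 2 * (- s + - 1 * t)))
         = - (?n t * (I t * p t * (s + 2 * t)))"
        unfolding k by (simp add: min.commute algebra_simps)
    qed
    then show ?thesis by simp
  qed
  have iB: "integrable lborel B"
    unfolding B_def by (intro Bochner_Integration.integrable_add integrable_mult_right Bochner_Integration.integrable_diff i1 i2 \<psi>(1) integrable_mult_left) auto
  have "(\<integral>t. B t \<partial>lborel) = expdist a s - exp (- a * s) * (a / 2 * (\<integral>t. \<psi> t \<partial>lborel))"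
    unfolding B_def using i1 i2 \<psi>(1) by (simp add: z1 z2)
  also have "\<dots> \<le> expdist a s - exp (- a * s) * (a / 2 * gain a s)"
    using \<psi>(2) a by (intro diff_left_mono mult_left_mono) auto
  finally have intB: "(\<integral>t. B t \<partial>lborel) \<le> expdist a s - exp (- a * s) * (a / 2) * gain a s" by simp
  have pw: "?n t * (if \<bar>t\<bar> > m then expdist a s
        else p t * expdist a 0 + (1 - p t) * expdist a \<bar>s + 2 * t\<bar>) \<le> B t" (is "?l t \<le> _") for t
  proof (cases "\<bar>t\<bar> > m")
    case True
    then show ?thesis using m \<psi>(3)[of t] by (simp add: B_def I_def)
  next
    case False
    let ?q = "1 - min 1 (exp (- (t * s + s\<^sup>2 / 2)))"
    have n: "0 \<le> ?n t" by simp
    have pq: "?q \<le> 1 - p t" by (auto simp: p_def accept_def)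
    \<comment> \<open>A reflection overshoots only if t < - s / 2. There the likelihood ratio is at
      least 1, so the points meet with certainty and the absolute value never acts.\<close>
    have abs: "(1 - p t) * expdist a \<bar>s + 2 * t\<bar> = (1 - p t) * expdist a (s + 2 * t)"
    proof (cases "s + 2 * t < 0")
      case True
      then have "\<bar>t + s\<bar> \<le> m" "0 \<le> - (s * (t + s / 2))" using s False m
        by (auto simp: mult_nonneg_nonpos)
      then have "p t = 1" by (simp add: p_def accept_def algebra_simps power2_eq_square)
      then show ?thesis by simp
    qed simp
    \<comment> \<open>The cutoff can only raise the reflection probability. This excess, and all
      \<open>t\<close> outside [-1/2, 1/2], are estimated by the tangent line alone.\<close>
    have D: "(1 - p t) * expdist a (2 * t) * ?n t \<le> (1 - p t) * (2 * t) * ?n t - a / 2 * \<psi> t"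
    proof (cases "\<bar>t\<bar> \<le> 1/2")
      case True
      have "(1 - p t - ?q) * expdist a (2 * t) * ?n t \<le> (1 - p t - ?q) * (2 * t) * ?n t"
        using pq n expdist_le[OF a, of "2 * t"] by (intro mult_right_mono mult_left_mono) auto
      with \<psi>(4)[OF True] show ?thesis by (simp add: algebra_simps)
    next
      case False
      have "(1 - p t) * expdist a (2 * t) * ?n t \<le> (1 - p t) * (2 * t) * ?n t"
        using p01 n expdist_le[OF a, of "2 * t"] by (intro mult_right_mono mult_left_mono) auto
      with \<psi>(3)[of t] False show ?thesis by simp
    qed
    have e1: "expdist a (s + 2 * t) = expdist a s + exp (- a * s) * expdist a (2 * t)"
      using expdist_add[of a s "2 * t"] a by simp
    \<comment> \<open>Concavity: falling from \<open>s\<close> to 0 loses at least \<open>s\<close>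
      times the slope at \<open>s\<close>, as the tangent bound at - s shows.\<close>
    have e2: "expdist a s \<ge> exp (- a * s) * s"
    proof -
      have "expdist a (s + (- s)) - expdist a s = exp (- a * s) * expdist a (- s)"
        using a by (intro expdist_add) simp
      moreover have "exp (- a * s) * expdist a (- s) \<le> exp (- a * s) * (- s)"
        by (intro mult_left_mono expdist_le a) simp
      ultimately show ?thesis by simp
    qed
    have "?l t = ?n t * expdist a s - p t * ?n t * expdist a s + exp (- a * s) * ((1 - p t) * expdist a (2 * t) * ?n t)"
    proof -
      have "?l t = ?n t * ((1 - p t) * expdist a (s + 2 * t))" using False by (simp add: abs)
      then show ?thesis by (simp only: e1) (simp add: algebra_simps)
    qed
    also have "\<dots> \<le> ?n t * expdist a s - p t * ?n t * (exp (- a * s) * s)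
         + exp (- a * s) * ((1 - p t) * (2 * t) * ?n t - a / 2 * \<psi> t)"
      using D e2 p01[of t] n by (intro add_mono diff_left_mono mult_left_mono) auto
    also have "\<dots> = B t" using False by (simp add: B_def I_def algebra_simps)
    finally show ?thesis .
  qed
  have l0: "0 \<le> ?l t" for t
    using p01[of t] expdist_nonneg[OF a, of s] expdist_nonneg[OF a, of "\<bar>s + 2 * t\<bar>"] s by simp
  have "(\<integral>\<^sup>+t. ennreal (?l t) \<partial>lborel) \<le> (\<integral>\<^sup>+t. ennreal (B t) \<partial>lborel)"
    by (intro nn_integral_mono ennreal_leI pw)
  also have "\<dots> = ennreal (\<integral>t. B t \<partial>lborel)"
    using pw l0 by (intro nn_integral_eq_integral iB) (auto intro: order_trans)
  also have "\<dots> \<le> ennreal (expdist a s - exp (- a * s) * (a / 2) * gain a s)"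
    by (intro ennreal_leI intB)
  finally show ?thesis .
qed

subsection \<open>The concave distance function\<close>

text \<open>\<open>K \<le> L\<close> is a consequence of (b), see \<open>driver_K_le_L\<close>; it
  makes h K at most 1/2.\<close>

locale contraction_parameters =
  fixes L K R h :: real
  assumes pos: "0 < L" "0 < K" "0 < R" and KL: "K \<le> L" and h: "0 < h" "h < h0 L K R"
begin

abbreviation "H \<equiv> h0 L K R"
abbreviation "\<rho>1 \<equiv> r1 L K R"
abbreviation "\<rho>2 \<equiv> r2 L K R"
abbreviation "\<kappa> \<equiv> a_rate L K R"
abbreviation "c \<equiv> c_rate L K R"
abbreviation "f \<equiv> f_dist L K R"

text \<open>The slope of \<open>f\<close> at r above \<open>r2\<close> is q r. At \<open>r2\<close>
  it equals exp (- \<kappa> r2), so the two branches of \<open>f\<close> join with equal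
  slopes.\<close>

definition q :: real where "q = exp (- \<kappa> * \<rho>2) / \<rho>2"

lemma H_pos: "0 < H"
  using h by simp

lemma H_le: "H \<le> K / L\<^sup>2" "H \<le> 1 / (2 * L)" "H \<le> 2 * c0 * ln (3/2) / (27 * L\<^sup>2 * R\<^sup>2)"
    "H \<le> R\<^sup>2 / 4" "H \<le> c0\<^sup>2 * (ln 2)\<^sup>2 / (144 * L\<^sup>2 * R\<^sup>2)"
  unfolding h0_def by (rule Min_le; blast)+

lemma HL: "H * L \<le> 1/2" and hL: "h * L \<le> 1/2" "0 \<le> h * L" and hK: "h * K \<le> 1/2" "0 \<le> h * K"
  and hLL: "h * L\<^sup>2 \<le> K"
proof -
  show HL: "H * L \<le> 1/2" using H_le(2) pos by (simp add: field_simps)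
  have "h * L \<le> H * L" using h pos by simp
  with HL show "h * L \<le> 1/2" by linarith
  moreover have "h * K \<le> h * L" using h KL by simp
  ultimately show "h * K \<le> 1/2" by linarith
  have "H * L\<^sup>2 \<le> K" using H_le(1) pos by (simp add: field_simps)
  moreover have "h * L\<^sup>2 \<le> H * L\<^sup>2" using h by (intro mult_right_mono) auto
  ultimately show "h * L\<^sup>2 \<le> K" by linarith
qed (use h pos in auto)

lemma \<rho>1_bounds: "R \<le> \<rho>1" "\<rho>1 \<le> 3/2 * R" "0 < \<rho>1" "(1 + h * L) * R \<le> \<rho>1"
proof -
  have "(1 + 0) * R \<le> (1 + H * L) * R" "(1 + H * L) * R \<le> (1 + 1/2) * R" "(1 + h * L) * R \<le> (1 + H * L) * R"
    using HL H_pos pos h by (intro mult_right_mono add_left_mono; simp)+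
  then show "R \<le> \<rho>1" "\<rho>1 \<le> 3/2 * R" "(1 + h * L) * R \<le> \<rho>1" by (simp_all add: r1_def)
  with pos show "0 < \<rho>1" by linarith
qed

lemma \<rho>2_eq: "\<rho>2 = \<rho>1 + sqrt H" and \<rho>2_pos: "0 < \<rho>2" and \<rho>12: "\<rho>1 \<le> \<rho>2" and R\<rho>2: "R \<le> \<rho>2"
proof -
  show *: "\<rho>2 = \<rho>1 + sqrt H" by (simp add: r2_def)
  have "0 < sqrt H" using H_pos by simp
  with * \<rho>1_bounds show "0 < \<rho>2" "\<rho>1 \<le> \<rho>2" "R \<le> \<rho>2" by linarith+
qed

lemma \<kappa>_pos: "0 < \<kappa>" and \<kappa>_c0: "\<kappa> * c0 = 6 * L * \<rho>1"
  using pos \<rho>1_bounds c0_pos by (simp_all add: a_rate_def)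

lemma q_pos: "0 < q"
  using \<rho>2_pos by (simp add: q_def)

lemma sqrt_H_le: "sqrt H \<le> R / 2"
  using real_sqrt_le_mono[OF H_le(4)] pos by (simp add: real_sqrt_divide)

text \<open>What the ln (3/2) entry of \<open>h0\<close> provides: when the drift stretches a
  distance of at most R, the slope of \<open>f\<close> drops by at most a third.\<close>

lemma exp_\<kappa>_hLR: "2/3 \<le> exp (- (\<kappa> * (h * L * R)))"
proof -
  have "h * (27 * L\<^sup>2 * R\<^sup>2) \<le> H * (27 * L\<^sup>2 * R\<^sup>2)" using h pos by (intro mult_right_mono) auto
  also have "\<dots> \<le> 2 * c0 * ln (3/2)"
    using H_le(3) pos by (simp add: field_simps)
  finally have *: "9 * L\<^sup>2 * R\<^sup>2 * h \<le> 2/3 * c0 * ln (3/2)" by (simp add: mult_ac)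
  have "c0 * (\<kappa> * (h * L * R)) = 6 * L * \<rho>1 * (h * L * R)"
    using \<kappa>_c0 by (simp add: algebra_simps)
  also have "\<dots> \<le> 6 * L * (3/2 * R) * (h * L * R)"
    using pos h \<rho>1_bounds by (intro mult_right_mono mult_left_mono) auto
  also have "\<dots> = 9 * L\<^sup>2 * R\<^sup>2 * h" by (simp add: power2_eq_square)
  also have "\<dots> \<le> 2/3 * c0 * ln (3/2)" by fact
  also have "\<dots> \<le> c0 * ln (3/2)" using c0_pos by simp
  finally have "\<kappa> * (h * L * R) \<le> ln (3/2)" using c0_pos by simp
  then have "exp (- ln (3/2)) \<le> exp (- (\<kappa> * (h * L * R)))" by simp
  then show ?thesis by (simp add: exp_minus)
qed

text \<open>What the ln 2 entry of \<open>h0\<close> provides, for drifted distances below sqrt h: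
  the damping at that distance and the damping inside \<open>gain\<close> together leave at least a
  third.\<close>

lemma exp_\<kappa>_sqrt_h: "1/3 \<le> exp (- (2 * (\<kappa> * sqrt h)))"
proof -
  have "sqrt H \<le> sqrt ((c0 * ln 2 / (12 * L * R))\<^sup>2)"
    using H_le(5) by (intro real_sqrt_le_mono) (simp add: power_divide power_mult_distrib)
  then have s: "sqrt H \<le> c0 * ln 2 / (12 * L * R)"
    using c0_pos pos by simp
  have "sqrt h \<le> sqrt H" using h by simp
  then have s': "sqrt h \<le> c0 * ln 2 / (12 * L * R)" using s by linarith
  have "c0 * (\<kappa> * sqrt h) = 6 * L * \<rho>1 * sqrt h"
    using \<kappa>_c0 by (simp add: algebra_simps)
  also have "\<dots> \<le> 6 * L * (3/2 * R) * (c0 * ln 2 / (12 * L * R))"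
    using pos h \<rho>1_bounds s' by (intro mult_mono) auto
  also have "\<dots> = c0 * (3/4 * ln 2)" using pos by simp
  finally have "\<kappa> * sqrt h \<le> 3/4 * ln 2" using c0_pos by (simp only: mult_le_cancel_left_pos)
  then have 1: "exp (- (3/2 * ln 2)) \<le> exp (- (2 * (\<kappa> * sqrt h)))" by simp
  \<comment> \<open>The constant is 2^(3/2), whose square 8 is below 9.\<close>
  have "(exp (3/2 * ln 2 :: real))\<^sup>2 = exp (ln 2 + ln 2 + ln (2::real))"
    by (simp add: exp_double[symmetric])
  also have "\<dots> = 8" by (simp only: exp_add) simp
  finally have "(exp (3/2 * ln 2 :: real))\<^sup>2 \<le> 3\<^sup>2" by simp
  then have "exp (3/2 * ln 2 :: real) \<le> 3" by (rule power2_le_imp_le) simp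
  then have "1/3 \<le> inverse (exp (3/2 * ln 2 :: real))" by (simp add: field_simps)
  then have "1/3 \<le> exp (- (3/2 * ln 2 :: real))" by (simp only: exp_minus)
  with 1 show ?thesis by linarith
qed

text \<open>The entries of \<open>c_rate\<close>, cleared of denominators, are the rates available
  in the four regimes: distances from R to \<open>r2\<close>, distances beyond \<open>r2\<close>,
  and short distances whose drifted length is above or below sqrt h.\<close>

lemma c_le:
  "c \<le> exp (- \<kappa> * \<rho>2) * (K / 4)"
  "c * expdist \<kappa> \<rho>2 \<le> 1/2 * exp (- \<kappa> * \<rho>2) * \<rho>2 * (K / 4)"
  "c * exp (\<kappa> * \<rho>1) \<le> 9 * L\<^sup>2 * \<rho>1\<^sup>2 / (2 * c0)"
  "c * sqrt H \<le> 3/16 * L * \<rho>1"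
proof -
  let ?e = "exp (- \<kappa> * \<rho>2)"
  have e: "1 / \<kappa> * (1 - ?e) = expdist \<kappa> \<rho>2" by (simp add: expdist_def)
  have min: "c \<le> ?e * (K / 4)" "c \<le> (1/2 * ?e * \<rho>2) / expdist \<kappa> \<rho>2 * (K / 4)"
    "c \<le> 9 * L\<^sup>2 * \<rho>1\<^sup>2 / (2 * c0) * exp (- 6 * L * \<rho>1\<^sup>2 / c0)" "c \<le> 3 * L * \<rho>1 / (16 * sqrt H)"
    unfolding c_rate_def Let_def e by (rule Min_le; blast)+
  show "c \<le> ?e * (K / 4)" by fact
  have "0 < expdist \<kappa> \<rho>2" using \<kappa>_pos \<rho>2_pos by (simp add: expdist_def)
  with min(2) show "c * expdist \<kappa> \<rho>2 \<le> 1/2 * ?e * \<rho>2 * (K / 4)" by (simp add: field_simps)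
  have "- 6 * L * \<rho>1\<^sup>2 / c0 = - (\<kappa> * \<rho>1)" by (simp add: a_rate_def power2_eq_square)
  with min(3) have "c * exp (\<kappa> * \<rho>1) \<le> 9 * L\<^sup>2 * \<rho>1\<^sup>2 / (2 * c0) * exp (- (\<kappa> * \<rho>1)) * exp (\<kappa> * \<rho>1)"
    by (intro mult_right_mono) auto
  also have "\<dots> = 9 * L\<^sup>2 * \<rho>1\<^sup>2 / (2 * c0) * exp (- (\<kappa> * \<rho>1) + \<kappa> * \<rho>1)"
    by (simp only: exp_add mult.assoc)
  finally show "c * exp (\<kappa> * \<rho>1) \<le> 9 * L\<^sup>2 * \<rho>1\<^sup>2 / (2 * c0)" by simp
  show "c * sqrt H \<le> 3/16 * L * \<rho>1" using min(4) H_pos by (simp add: field_simps)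
qed

lemma c_pos: "0 < c"
proof -
  have e: "0 < 1 - exp (- \<kappa> * \<rho>2)" using \<kappa>_pos \<rho>2_pos by simp
  show ?thesis
    unfolding c_rate_def Let_def using pos \<rho>1_bounds \<rho>2_pos c0_pos H_pos \<kappa>_pos e
    by (subst Min_gr_iff) (auto intro!: mult_pos_pos divide_pos_pos simp del: mult_minus_left)
qed

lemma exp_\<kappa>\<rho>2_le1: "exp (- \<kappa> * \<rho>2) \<le> 1"
  using \<kappa>_pos \<rho>2_pos by simp

lemma ch_bounds: "0 < c * h" "c * h \<le> 1"
proof -
  show "0 < c * h" using c_pos h by simp
  have "c \<le> 1 * (K / 4)"
    by (rule order_trans[OF c_le(1)]) (use exp_\<kappa>\<rho>2_le1 pos in \<open>intro mult_right_mono, auto\<close>)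
  then have "c * h \<le> 1 * (K / 4) * h" using h by (intro mult_right_mono) auto
  then show "c * h \<le> 1" using hK by (simp add: mult.commute)
qed

lemma f_low: "r \<le> \<rho>2 \<Longrightarrow> f r = expdist \<kappa> r"
  by (simp add: f_dist_def expdist_def Let_def)

lemma f_high: "\<rho>2 \<le> r \<Longrightarrow> f r = expdist \<kappa> \<rho>2 + q / 2 * (r\<^sup>2 - \<rho>2\<^sup>2)"
  by (auto simp: f_dist_def expdist_def Let_def q_def)

lemma borel_measurable_f [measurable]: "f \<in> borel_measurable borel"
  unfolding f_dist_def[abs_def] Let_def by measurable

lemma f_0 [simp]: "f 0 = 0"
  using \<rho>2_pos by (simp add: f_low)

text \<open>The slope of \<open>f\<close> is at most 1 up to \<open>r2\<close> and grows like q r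
  beyond. This modulus converts the defect between fine and coarse steps into an error in
  \<open>f\<close>.\<close>

lemma f_diff_le:
  assumes "0 \<le> r" "r \<le> r'"
  shows "f r' - f r \<le> (r' - r) * (1 + q * r')"
proof -
  have low: "expdist \<kappa> y - expdist \<kappa> x \<le> y - x" if "0 \<le> x" "x \<le> y" for x y
  proof -
    have "expdist \<kappa> y - expdist \<kappa> x = exp (- \<kappa> * x) * expdist \<kappa> (y - x)"
      using expdist_add[of \<kappa> x "y - x"] \<kappa>_pos by simp
    also have "\<dots> \<le> 1 * expdist \<kappa> (y - x)"
      using that \<kappa>_pos by (intro mult_right_mono expdist_nonneg) auto
    also have "\<dots> \<le> y - x" using expdist_le[OF \<kappa>_pos] by simp
    finally show ?thesis .
  qed
  have high: "q / 2 * (y\<^sup>2 - x\<^sup>2) \<le> (y - x) * (q * y)" if "x \<le> y" for x y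
  proof -
    have "(y - x) * (q * y) - q / 2 * (y\<^sup>2 - x\<^sup>2) = q / 2 * (y - x)\<^sup>2"
      by (simp add: field_simps power2_eq_square)
    moreover have "0 \<le> q / 2 * (y - x)\<^sup>2" using q_pos by simp
    ultimately show ?thesis by linarith
  qed
  have q0: "0 \<le> q * r'" using q_pos assms by simp
  consider "r' \<le> \<rho>2" | "r \<le> \<rho>2" "\<rho>2 \<le> r'" | "\<rho>2 \<le> r" by linarith
  then show ?thesis
  proof cases
    case 1
    have "f r' - f r \<le> (r' - r) * 1" using 1 assms low[of r r'] by (simp add: f_low)
    also have "\<dots> \<le> (r' - r) * (1 + q * r')" using assms q0 by (intro mult_left_mono) auto
    finally show ?thesis .
  next
    case 2
    have "f r' - f r \<le> (\<rho>2 - r) * 1 + (r' - \<rho>2) * (q * r')"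
      using 2 assms low[of r \<rho>2] high[of \<rho>2 r'] by (simp add: f_low f_high)
    also have "\<dots> \<le> (\<rho>2 - r) * (1 + q * r') + (r' - \<rho>2) * (1 + q * r')"
      using 2 q0 by (intro add_mono mult_left_mono) auto
    finally show ?thesis by (simp add: algebra_simps)
  next
    case 3
    have "f r' - f r \<le> (r' - r) * (q * r')"
      using 3 assms high[of r r'] by (simp add: f_high algebra_simps)
    also have "\<dots> \<le> (r' - r) * (1 + q * r')" using assms by (intro mult_left_mono) auto
    finally show ?thesis .
  qed
qed

lemma expdist_diff_ge: "exp (- \<kappa> * r') * (r' - r) \<le> expdist \<kappa> r' - expdist \<kappa> r"
proof -
  have "expdist \<kappa> r - expdist \<kappa> r' = exp (- \<kappa> * r') * expdist \<kappa> (r - r')"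
    using expdist_add[of \<kappa> r' "r - r'"] \<kappa>_pos by simp
  also have "\<dots> \<le> exp (- \<kappa> * r') * (r - r')"
    by (intro mult_left_mono expdist_le \<kappa>_pos) auto
  finally show ?thesis by (simp add: algebra_simps)
qed

lemma expdist_mono: "r \<le> r' \<Longrightarrow> expdist \<kappa> r \<le> expdist \<kappa> r'"
  using expdist_diff_ge[of r' r] by (smt (verit) exp_ge_zero mult_nonneg_nonneg)

lemma expdist_diff_ge_\<rho>2:
  assumes "r \<le> r'" "r' \<le> \<rho>2"
  shows "exp (- \<kappa> * \<rho>2) * (r' - r) \<le> expdist \<kappa> r' - expdist \<kappa> r"
proof -
  have "exp (- \<kappa> * \<rho>2) * (r' - r) \<le> exp (- \<kappa> * r') * (r' - r)"
    using assms \<kappa>_pos by (intro mult_right_mono) auto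
  with expdist_diff_ge[of r' r] show ?thesis by linarith
qed

text \<open>The slope of \<open>f\<close> at r is at least q r everywhere: below \<open>r2\<close>
  it is at least exp (- \<kappa> r2), which is q r2. So \<open>f\<close> minus q r^2 / 2 is
  nondecreasing.\<close>

lemma f_diff_ge_square:
  assumes "0 \<le> r" "r \<le> r'" "\<rho>2 \<le> r'"
  shows "q / 2 * (r'\<^sup>2 - r\<^sup>2) \<le> f r' - f r"
proof (cases "r \<le> \<rho>2")
  case True
  have "q * \<rho>2 * (\<rho>2 - r) \<le> expdist \<kappa> \<rho>2 - expdist \<kappa> r"
    using expdist_diff_ge_\<rho>2[OF True] \<rho>2_pos by (simp add: q_def)
  moreover have "0 \<le> q / 2 * (\<rho>2 - r)\<^sup>2" using q_pos by simp
  moreover have "q / 2 * (r'\<^sup>2 - r\<^sup>2) = q / 2 * (r'\<^sup>2 - \<rho>2\<^sup>2) + q * \<rho>2 * (\<rho>2 - r) - q / 2 * (\<rho>2 - r)\<^sup>2"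
    by (simp add: field_simps power2_eq_square)
  ultimately show ?thesis using True assms by (simp add: f_low f_high)
next
  case False
  then show ?thesis using assms by (simp add: f_high algebra_simps)
qed

lemma f_mono: "0 \<le> r \<Longrightarrow> r \<le> r' \<Longrightarrow> f r \<le> f r'"
proof (cases "r' \<le> \<rho>2")
  case True
  then show "r \<le> r' \<Longrightarrow> f r \<le> f r'" by (simp add: f_low expdist_mono)
next
  case False
  assume "0 \<le> r" "r \<le> r'"
  then have "0 \<le> q / 2 * (r'\<^sup>2 - r\<^sup>2)" using q_pos by (simp add: power_mono)
  with False f_diff_ge_square[OF \<open>0 \<le> r\<close> \<open>r \<le> r'\<close>] show "f r \<le> f r'" by simp
qed

lemma f_nonneg: "0 \<le> r \<Longrightarrow> 0 \<le> f r"
  using f_mono[of 0 r] by simp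

text \<open>On [0, r2] concavity keeps \<open>f\<close> above its chord, so r^2 \<le> r r2 \<le>
  r2^2 f(r) / f(r2), which gives the first entry of \<open>A_const\<close>. Beyond r2 the second
  entry makes A q / 2 at least 1, so the increments of r^2 are dominated as well.\<close>

lemma square_le_A_f:
  assumes "0 \<le> r"
  shows "r\<^sup>2 \<le> A_const L K R * f r"
proof -
  let ?A = "A_const L K R"
  define E where "E = expdist \<kappa> \<rho>2"
  have E: "0 < E" using \<kappa>_pos \<rho>2_pos by (simp add: E_def expdist_def)
  have A1: "\<rho>2\<^sup>2 / E \<le> ?A" and A2: "2 * \<rho>2 * exp (\<kappa> * \<rho>2) \<le> ?A"
    by (simp_all add: A_const_def Let_def E_def expdist_def mult.commute)
  have low: "x\<^sup>2 \<le> ?A * expdist \<kappa> x" if x: "0 \<le> x" "x \<le> \<rho>2" for x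
  proof -
    have "convex_on UNIV (\<lambda>x::real. exp x)" by (rule exp_convex)
    from convex_onD[OF this, of "x / \<rho>2" 0 "- \<kappa> * \<rho>2"] x \<rho>2_pos
    have "exp (- (\<kappa> * x)) \<le> 1 - x / \<rho>2 + x / \<rho>2 * exp (- (\<kappa> * \<rho>2))" by (simp add: mult.commute)
    then have "x / \<rho>2 * (1 - exp (- (\<kappa> * \<rho>2))) \<le> 1 - exp (- (\<kappa> * x))" by (simp add: algebra_simps)
    then have "x / \<rho>2 * E \<le> expdist \<kappa> x"
      using \<kappa>_pos divide_right_mono[of _ _ \<kappa>] by (fastforce simp: expdist_def E_def)
    then have "\<rho>2\<^sup>2 / E * (x / \<rho>2 * E) \<le> ?A * expdist \<kappa> x"
      using A1 E x \<rho>2_pos by (intro mult_mono) (auto intro: order_trans[OF _ A1])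
    moreover have "x\<^sup>2 \<le> \<rho>2\<^sup>2 / E * (x / \<rho>2 * E)"
      using E x \<rho>2_pos by (simp add: power2_eq_square mult_right_mono)
    ultimately show ?thesis by linarith
  qed
  show ?thesis
  proof (cases "r \<le> \<rho>2")
    case True
    then show ?thesis using low assms by (simp add: f_low)
  next
    case False
    have "1 \<le> ?A * (q / 2)"
    proof -
      have "2 * \<rho>2 * exp (\<kappa> * \<rho>2) * (q / 2) \<le> ?A * (q / 2)"
        using A2 q_pos by (intro mult_right_mono) auto
      moreover have "2 * \<rho>2 * exp (\<kappa> * \<rho>2) * (q / 2) = 1"
        using \<rho>2_pos by (simp add: q_def exp_minus)
      ultimately show ?thesis by simp
    qed
    then have "1 * (r\<^sup>2 - \<rho>2\<^sup>2) \<le> ?A * (q / 2) * (r\<^sup>2 - \<rho>2\<^sup>2)"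
      using False \<rho>2_pos by (intro mult_right_mono) (auto intro!: power_mono)
    then show ?thesis
      using False low[of \<rho>2] \<rho>2_pos by (simp add: f_high algebra_simps)
  qed
qed

lemma A_pos: "0 < A_const L K R"
  using \<rho>2_pos by (auto simp: A_const_def Let_def less_max_iff_disj)

text \<open>Dissipativity contracts squares by 1 - h K. Up to \<open>r2\<close> this is a factor of
  at most 1 - h K / 2 for the distance, and the slope of \<open>f\<close> is at least exp (-
  \<kappa> r2) there; beyond \<open>r2\<close>, \<open>f\<close> is compared with squares
  directly.\<close>

lemma f_contract_far:
  assumes r: "R \<le> r" and r': "0 \<le> r'" "r'\<^sup>2 \<le> (1 - h * K) * r\<^sup>2"
  shows "f r' \<le> (1 - c * h) * f r"
proof -
  have r0: "0 \<le> r" using r pos by simp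
  have sq: "h * K * r\<^sup>2 \<le> r\<^sup>2 - r'\<^sup>2" using r' by (simp add: algebra_simps)
  moreover have "0 \<le> h * K * r\<^sup>2" using hK by simp
  ultimately have "r'\<^sup>2 \<le> r\<^sup>2" by linarith
  then have rr: "r' \<le> r" using r0 by (rule power2_le_imp_le)
  show ?thesis
  proof (cases "r \<le> \<rho>2")
    case True
    have "0 \<le> (h * K / 2 * r)\<^sup>2" by simp
    then have "(1 - h * K) * r\<^sup>2 \<le> ((1 - h * K / 2) * r)\<^sup>2"
      by (simp add: power2_eq_square algebra_simps)
    then have "r'\<^sup>2 \<le> ((1 - h * K / 2) * r)\<^sup>2" using r' by linarith
    then have "r' \<le> (1 - h * K / 2) * r" by (rule power2_le_imp_le) (use hK r0 in simp)
    then have d: "h * K / 2 * r \<le> r - r'" by (simp add: algebra_simps)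
    have "c * h * f r \<le> exp (- \<kappa> * \<rho>2) * (K / 4) * h * r"
      using c_le(1) h f_nonneg[OF r0] True expdist_le[OF \<kappa>_pos, of r] pos c_pos
      by (intro mult_mono) (auto simp: f_low)
    also have "\<dots> \<le> exp (- \<kappa> * \<rho>2) * (h * K / 2 * r)"
      using h pos r0 by simp
    also have "\<dots> \<le> exp (- \<kappa> * \<rho>2) * (r - r')"
      using d by (intro mult_left_mono) auto
    also have "\<dots> \<le> f r - f r'"
      using expdist_diff_ge_\<rho>2[OF rr True] True rr by (simp add: f_low)
    finally show ?thesis by (simp add: algebra_simps)
  next
    case False
    have "c \<le> 1 * (K / 4)"
      by (rule order_trans[OF c_le(1)]) (use exp_\<kappa>\<rho>2_le1 pos in \<open>intro mult_right_mono, auto\<close>)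
    then have "c * (q / 2 * (r\<^sup>2 - \<rho>2\<^sup>2)) \<le> K / 4 * (q / 2 * (r\<^sup>2 - \<rho>2\<^sup>2))"
      using False \<rho>2_pos q_pos by (intro mult_right_mono) (auto intro!: mult_nonneg_nonneg power_mono)
    moreover have "c * expdist \<kappa> \<rho>2 \<le> K / 4 * (q / 2 * \<rho>2\<^sup>2)"
      using c_le(2) \<rho>2_pos by (simp add: q_def power2_eq_square mult_ac)
    ultimately have "c * f r \<le> K / 4 * (q / 2 * r\<^sup>2)"
      using False by (simp add: f_high algebra_simps)
    then have "c * f r * h \<le> K / 4 * (q / 2 * r\<^sup>2) * h" using h by (intro mult_right_mono) auto
    also have "\<dots> \<le> q / 2 * (h * K * r\<^sup>2)" using q_pos h pos by simp
    also have "\<dots> \<le> q / 2 * (r\<^sup>2 - r'\<^sup>2)" using sq q_pos by (intro mult_left_mono) auto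
    also have "\<dots> \<le> f r - f r'" using f_diff_ge_square[OF r'(1) rr] False by simp
    finally show ?thesis by (simp add: algebra_simps)
  qed
qed

text \<open>The drift may stretch the distance by the factor 1 + h L. The gain from reflection has
  to pay for this stretching and also for the loss c h f.\<close>

lemma f_contract_near:
  assumes r: "0 \<le> r" "r \<le> R" and r': "0 \<le> r'" "r' \<le> (1 + h * L) * r"
  shows "expdist \<kappa> r' - exp (- \<kappa> * r') * (\<kappa> * h / 2) * gain (\<kappa> * sqrt h) (r' / sqrt h) \<le> (1 - c * h) * f r"
proof -
  \<comment> \<open>The distance that the drift would stretch to exactly \<open>r'\<close>. As
    \<open>x \<le> r\<close>, monotonicity of \<open>f\<close> allows the estimate to be made at
    \<open>x\<close>.\<close>
  define x where "x = r' / (1 + h * L)"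
  have hL1: "1 \<le> 1 + h * L" using hL by simp
  have "x * (1 + h * L) = r'" using hL1 by (simp add: x_def)
  then have r'x: "r' = x + h * L * x" by (simp add: algebra_simps)
  have x0: "0 \<le> x" using r' hL1 by (simp add: x_def)
  have xr: "x \<le> r" using r' hL1 by (simp add: x_def field_simps)
  have xr': "x \<le> r'" using x0 hL by (simp add: r'x)
  have x\<rho>: "x \<le> \<rho>1" using xr r \<rho>1_bounds by linarith
  have exp_x: "expdist \<kappa> r' \<le> expdist \<kappa> x + exp (- \<kappa> * x) * (h * L * x)"
  proof -
    have "expdist \<kappa> r' - expdist \<kappa> x = exp (- \<kappa> * x) * expdist \<kappa> (h * L * x)"
      unfolding r'x using \<kappa>_pos by (intro expdist_add) simp
    also have "\<dots> \<le> exp (- \<kappa> * x) * (h * L * x)" by (intro mult_left_mono expdist_le \<kappa>_pos) simp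
    finally show ?thesis by simp
  qed
  have "expdist \<kappa> r' - exp (- \<kappa> * r') * (\<kappa> * h / 2) * gain (\<kappa> * sqrt h) (r' / sqrt h) \<le> expdist \<kappa> x - c * h * expdist \<kappa> x"
  proof (cases "sqrt h \<le> r'")
    case True
    then have g: "gain (\<kappa> * sqrt h) (r' / sqrt h) = c0" using h by (simp add: gain_def)
    \<comment> \<open>The balance in units of exp (- \<kappa> x) L \<rho>1 h: the gain is at least
      2, the drift costs at most 1 and the rate \<open>c\<close> at most 3/4.\<close>
    have "2/3 \<le> exp (- (\<kappa> * (h * L * x)))"
    proof -
      have "\<kappa> * (h * L * x) \<le> \<kappa> * (h * L * R)"
        using \<kappa>_pos hL xr r by (intro mult_left_mono) auto
      then show ?thesis using exp_\<kappa>_hLR by (smt (verit) exp_le_cancel_iff)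
    qed
    then have "exp (- \<kappa> * x) * (2/3) * (3 * L * \<rho>1 * h) \<le> exp (- \<kappa> * x) * exp (- (\<kappa> * (h * L * x))) * (3 * L * \<rho>1 * h)"
      using pos h \<rho>1_bounds by (intro mult_right_mono mult_left_mono) auto
    also have "\<dots> = exp (- \<kappa> * r') * (\<kappa> * h / 2) * c0"
    proof -
      have "exp (- \<kappa> * r') = exp (- \<kappa> * x) * exp (- (\<kappa> * (h * L * x)))"
        by (simp add: r'x algebra_simps flip: exp_add)
      moreover have "3 * L * \<rho>1 * h = \<kappa> * h / 2 * c0" using \<kappa>_c0 by (simp add: algebra_simps)
      ultimately show ?thesis by (simp only: mult.assoc)
    qed
    finally have G: "exp (- \<kappa> * x) * (2 * L * \<rho>1 * h) \<le> exp (- \<kappa> * r') * (\<kappa> * h / 2) * c0" by (simp add: mult_ac)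
    have C: "c * expdist \<kappa> x \<le> exp (- \<kappa> * x) * (3/4 * L * \<rho>1)"
    proof -
      have "c * expdist \<kappa> x = exp (- \<kappa> * x) * (c * (exp (\<kappa> * x) - 1) / \<kappa>)"
        using \<kappa>_pos by (simp add: expdist_def field_simps flip: exp_add)
      also have "\<dots> \<le> exp (- \<kappa> * x) * (c * exp (\<kappa> * \<rho>1) / \<kappa>)"
        using \<kappa>_pos c_pos x\<rho> by (intro mult_left_mono divide_right_mono) (auto intro: order_trans[of _ "exp (\<kappa> * x)"])
      also have "\<dots> \<le> exp (- \<kappa> * x) * (9 * L\<^sup>2 * \<rho>1\<^sup>2 / (2 * c0) / \<kappa>)"
        using \<kappa>_pos c_le(3) by (intro mult_left_mono divide_right_mono) auto
      also have "9 * L\<^sup>2 * \<rho>1\<^sup>2 / (2 * c0) / \<kappa> = 3/4 * L * \<rho>1"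
        using \<kappa>_c0 pos \<rho>1_bounds c0_pos \<kappa>_pos by (simp add: a_rate_def power2_eq_square)
      finally show ?thesis .
    qed
    have "exp (- \<kappa> * x) * (h * L * x) \<le> exp (- \<kappa> * x) * (h * L * \<rho>1)"
      using x\<rho> hL by (intro mult_left_mono) auto
    moreover have "c * h * expdist \<kappa> x \<le> exp (- \<kappa> * x) * (3/4 * L * \<rho>1) * h"
      using mult_right_mono[OF C, of h] h by (simp add: mult_ac)
    moreover have "0 \<le> exp (- \<kappa> * x) * (L * \<rho>1 * h)" using pos h \<rho>1_bounds by simp
    ultimately show ?thesis using G exp_x unfolding g by (simp add: algebra_simps)
  next
    case False
    then have g: "gain (\<kappa> * sqrt h) (r' / sqrt h) = exp (- (\<kappa> * sqrt h)) * (r' / sqrt h) * c0"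
      using h by (simp add: gain_def)
    have "exp (- (2 * (\<kappa> * sqrt h))) \<le> exp (- \<kappa> * r' - \<kappa> * sqrt h)"
      using False \<kappa>_pos by (simp add: algebra_simps)
    then have "1/3 \<le> exp (- \<kappa> * r' - \<kappa> * sqrt h)"
      using exp_\<kappa>_sqrt_h by linarith
    then have "1/3 \<le> exp (- \<kappa> * r') * exp (- (\<kappa> * sqrt h))"
      by (simp flip: exp_add)
    then have "1/3 * (3 * L * \<rho>1 * sqrt h * r') \<le> exp (- \<kappa> * r') * exp (- (\<kappa> * sqrt h)) * (3 * L * \<rho>1 * sqrt h * r')"
      using pos h \<rho>1_bounds r' by (intro mult_right_mono) auto
    also have "\<dots> = exp (- \<kappa> * r') * (\<kappa> * h / 2) * gain (\<kappa> * sqrt h) (r' / sqrt h)"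
    proof -
      have "3 * L * \<rho>1 * sqrt h * r' = \<kappa> * c0 / 2 * sqrt h * r'" by (simp add: \<kappa>_c0)
      also have "\<dots> = (\<kappa> * h / 2) * ((r' / sqrt h) * c0)"
        using h by (simp add: field_simps)
      finally show ?thesis unfolding g by simp
    qed
    finally have G: "L * \<rho>1 * sqrt h * r' \<le> exp (- \<kappa> * r') * (\<kappa> * h / 2) * gain (\<kappa> * sqrt h) (r' / sqrt h)" by simp
    have sh: "h = sqrt h * sqrt h" "sqrt h \<le> sqrt H" using h by auto
    have "exp (- \<kappa> * x) * (h * L * x) \<le> 1 * (h * L * x)"
      using \<kappa>_pos x0 hL by (intro mult_right_mono) auto
    also have "\<dots> = L * sqrt h * x * sqrt h" using sh(1) by (metis mult.assoc mult.commute mult_1)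
    also have "\<dots> \<le> L * sqrt h * x * (\<rho>1 / 2)"
    proof (rule mult_left_mono)
      show "sqrt h \<le> \<rho>1 / 2" using sh(2) sqrt_H_le \<rho>1_bounds by linarith
    qed (use pos h x0 in simp)
    finally have 1: "exp (- \<kappa> * x) * (h * L * x) \<le> 1/2 * (L * \<rho>1 * sqrt h * x)" by (simp add: mult_ac)
    have "c * h * expdist \<kappa> x \<le> c * h * x"
      using c_pos h expdist_le[OF \<kappa>_pos] by (intro mult_left_mono) auto
    also have "\<dots> = c * sqrt h * (sqrt h * x)" using sh(1) by (metis mult.assoc)
    also have "\<dots> \<le> c * sqrt H * (sqrt h * x)"
      using sh c_pos x0 by (intro mult_right_mono mult_left_mono) auto
    also have "\<dots> \<le> 3/16 * L * \<rho>1 * (sqrt h * x)"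
      using c_le(4) h x0 by (intro mult_right_mono) auto
    finally have 2: "c * h * expdist \<kappa> x \<le> 3/16 * (L * \<rho>1 * sqrt h * x)" by (simp add: mult_ac)
    have "L * \<rho>1 * sqrt h * x \<le> L * \<rho>1 * sqrt h * r'" "0 \<le> L * \<rho>1 * sqrt h * x"
      using xr' pos \<rho>1_bounds h x0 by (auto intro!: mult_left_mono)
    with 1 2 G exp_x show ?thesis by linarith
  qed
  also have "\<dots> = (1 - c * h) * expdist \<kappa> x" by (simp add: algebra_simps)
  also have "\<dots> \<le> (1 - c * h) * f r"
    using expdist_mono[OF xr] r R\<rho>2 ch_bounds by (intro mult_left_mono) (auto simp: f_low)
  finally show ?thesis .
qed

end

context contraction_parameters
begin

subsection \<open>Contraction of one coupled step\<close>

text \<open>\<open>d\<close> is the difference of the points after the drift, divided by sqrt h to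
  be comparable with a standard Gaussian. The cutoff corresponds to noise of size sqrt H / 2 along
  \<open>d\<close>, so a reflection lengthens the distance by at most sqrt H and never leads beyond
  \<open>\<rho>2\<close>.\<close>

definition coupled_noise :: "'a::euclidean_space \<Rightarrow> 'a \<Rightarrow> real \<Rightarrow> 'a" where
  "coupled_noise d z t =
     (if norm d \<le> \<rho>1 then couple (sqrt (H / h) / 2) ((1 / sqrt h) *\<^sub>R d) z t else z)"

lemma measurable_coupled_noise [measurable (raw)]:
  fixes d z :: "'b \<Rightarrow> 'a::euclidean_space"
  assumes [measurable]: "d \<in> borel_measurable M" "z \<in> borel_measurable M" "t \<in> borel_measurable M"
  shows "(\<lambda>x. coupled_noise (d x) (z x) (t x)) \<in> borel_measurable M"
  unfolding coupled_noise_def by measurable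

lemma nn_integral_coupled_noise:
  fixes d :: "'a::euclidean_space"
  assumes [measurable]: "F \<in> borel_measurable borel"
  shows "(\<integral>\<^sup>+z. \<integral>\<^sup>+t. F (coupled_noise d z t) \<partial>unif \<partial>gaussian) = (\<integral>\<^sup>+z. F z \<partial>gaussian)"
proof -
  interpret prob_space unif by (rule prob_space_unif)
  show ?thesis
    by (cases "norm d \<le> \<rho>1")
       (simp_all add: coupled_noise_def nn_integral_gaussian_couple emeasure_space_1[simplified])
qed

lemma coupled_noise_diff:
  "d + sqrt h *\<^sub>R z - sqrt h *\<^sub>R couple m ((1 / sqrt h) *\<^sub>R d) z t
     = sqrt h *\<^sub>R ((1 / sqrt h) *\<^sub>R d + z - couple m ((1 / sqrt h) *\<^sub>R d) z t)"
  using h by (simp add: algebra_simps)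

lemma norm_coupled_noise_le:
  "norm (d + sqrt h *\<^sub>R z - sqrt h *\<^sub>R coupled_noise d z t) \<le> norm d + sqrt H"
proof (cases "norm d \<le> \<rho>1")
  case True
  let ?v = "(1 / sqrt h) *\<^sub>R d" and ?m = "sqrt (H / h) / 2"
  have "sqrt h * norm (?v + z - couple ?m ?v z t) \<le> sqrt h * (norm ?v + 2 * ?m)"
    using h by (intro mult_left_mono couple_dist_le) auto
  also have "\<dots> = norm d + sqrt H"
    using h by (simp add: distrib_left real_sqrt_divide)
  finally show ?thesis
    using True h by (simp add: coupled_noise_def coupled_noise_diff)
next
  case False
  then show ?thesis using H_pos by (simp add: coupled_noise_def)
qed

text \<open>Synchronous noise leaves the drifted distance unchanged, which is enough beyond
  \<open>\<rho>1\<close>. Below \<open>\<rho>1\<close> the new distance stays in the concave range,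
  where scaling by sqrt h turns the claim into the one-dimensional estimate.\<close>

lemma coupling_contracts:
  fixes d :: "'a::euclidean_space"
  assumes r: "0 \<le> r" and d: "norm d \<le> (1 + h * L) * r"
    and far: "R \<le> r \<Longrightarrow> (norm d)\<^sup>2 \<le> (1 - h * K) * r\<^sup>2"
  shows "(\<integral>\<^sup>+z. \<integral>\<^sup>+t. ennreal (f (norm (d + sqrt h *\<^sub>R z - sqrt h *\<^sub>R coupled_noise d z t))) \<partial>unif \<partial>gaussian)
    \<le> ennreal ((1 - c * h) * f r)"
proof (cases "norm d \<le> \<rho>1")
  case False
  interpret u: prob_space unif by (rule prob_space_unif)
  interpret g: prob_space "gaussian :: 'a measure" by (rule prob_space_gaussian)
  \<comment> \<open>The drift stretches distances below R at most to \<open>\<rho>1\<close>, so a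
    larger drifted distance means that dissipativity was available.\<close>
  have "R \<le> r"
  proof (rule ccontr)
    assume "\<not> R \<le> r"
    then have "(1 + h * L) * r \<le> (1 + h * L) * R" using hL by (intro mult_left_mono) auto
    with \<rho>1_bounds(4) d False show False by linarith
  qed
  then have "f (norm d) \<le> (1 - c * h) * f r"
    using far by (intro f_contract_far) auto
  with False show ?thesis
    by (simp add: coupled_noise_def u.emeasure_space_1[simplified] g.emeasure_space_1[simplified] ennreal_leI)
next
  case True
  let ?v = "(1 / sqrt h) *\<^sub>R d" and ?m = "sqrt (H / h) / 2"
  let ?a = "\<kappa> * sqrt h"
  have a: "0 < ?a" using \<kappa>_pos h by simp
  have m: "1/2 \<le> ?m" using h by simp
  have f_scaled: "f (norm (d + sqrt h *\<^sub>R z - sqrt h *\<^sub>R coupled_noise d z t))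
     = sqrt h * expdist ?a (norm (?v + z - couple ?m ?v z t))" for z t
  proof -
    have "norm (d + sqrt h *\<^sub>R z - sqrt h *\<^sub>R coupled_noise d z t) \<le> \<rho>2"
      using norm_coupled_noise_le[of d z t] True by (simp add: \<rho>2_eq)
    then show ?thesis
      using h True by (simp add: f_low coupled_noise_def coupled_noise_diff expdist_def mult_ac)
  qed
  have g0: "expdist \<kappa> (norm d) - exp (- \<kappa> * norm d) * (\<kappa> * h / 2) * gain ?a (norm d / sqrt h) \<le> (1 - c * h) * f r"
  proof (cases "R \<le> r")
    case True
    have "0 \<le> exp (- \<kappa> * norm d) * (\<kappa> * h / 2) * gain ?a (norm d / sqrt h)"
      using h \<kappa>_pos by (intro mult_nonneg_nonneg gain_nonneg) auto
    moreover have "f (norm d) \<le> (1 - c * h) * f r"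
      using far True by (intro f_contract_far) auto
    moreover have "f (norm d) = expdist \<kappa> (norm d)"
      using \<open>norm d \<le> \<rho>1\<close> \<rho>12 by (intro f_low) simp
    ultimately show ?thesis by linarith
  next
    case False
    then show ?thesis using d r by (intro f_contract_near) auto
  qed
  show ?thesis
  proof (cases "d = 0")
    case True
    interpret u: prob_space unif by (rule prob_space_unif)
    interpret g: prob_space "gaussian :: 'a measure" by (rule prob_space_gaussian)
    from True show ?thesis
      unfolding f_scaled by (simp add: couple_0)
  next
    case False
    let ?s = "norm ?v"
    have s: "?s = norm d / sqrt h" "0 < ?s" using False h by auto
    have "(\<integral>\<^sup>+z. \<integral>\<^sup>+t. ennreal (f (norm (d + sqrt h *\<^sub>R z - sqrt h *\<^sub>R coupled_noise d z t))) \<partial>unif \<partial>gaussian)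
      = (\<integral>\<^sup>+z. \<integral>\<^sup>+t. ennreal (sqrt h) * ennreal (expdist ?a (norm (?v + z - couple ?m ?v z t))) \<partial>unif \<partial>gaussian)"
      unfolding f_scaled using h a by (intro nn_integral_cong ennreal_mult expdist_nonneg) auto
    also have "\<dots> = ennreal (sqrt h) * (\<integral>\<^sup>+z. \<integral>\<^sup>+t. ennreal (expdist ?a (norm (?v + z - couple ?m ?v z t))) \<partial>unif \<partial>gaussian)"
    proof -
      interpret u: prob_space unif by (rule prob_space_unif)
      show ?thesis by (simp add: nn_integral_cmult)
    qed
    also have "\<dots> \<le> ennreal (sqrt h) * ennreal (expdist ?a ?s - exp (- ?a * ?s) * (?a / 2) * gain ?a ?s)"
    proof (intro mult_left_mono)
      show "(\<integral>\<^sup>+z. \<integral>\<^sup>+t. ennreal (expdist ?a (norm (?v + z - couple ?m ?v z t))) \<partial>unif \<partial>gaussian)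
        \<le> ennreal (expdist ?a ?s - exp (- ?a * ?s) * (?a / 2) * gain ?a ?s)"
        using reflection_coupling_real[OF s(2) a m] False h
        by (subst nn_integral_gaussian_couple_dist) (auto intro: expdist_nonneg[OF a])
    qed simp
    also have "\<dots> = ennreal (sqrt h * (expdist ?a ?s - exp (- ?a * ?s) * (?a / 2) * gain ?a ?s))"
      using h by (simp add: ennreal_mult')
    also have "sqrt h * (expdist ?a ?s - exp (- ?a * ?s) * (?a / 2) * gain ?a ?s)
       = expdist \<kappa> (norm d) - exp (- \<kappa> * norm d) * (\<kappa> * h / 2) * gain ?a (norm d / sqrt h)"
    proof -
      have "sqrt h * expdist ?a ?s = expdist \<kappa> (norm d)" "exp (- ?a * ?s) = exp (- \<kappa> * norm d)"
        using h by (simp_all add: expdist_def)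
      moreover have "sqrt h * (?a / 2) = \<kappa> * h / 2" using h by simp
      moreover have "gain ?a ?s = gain ?a (norm d / sqrt h)" by (simp only: s(1))
      moreover have "sqrt h * (x - y * (?a / 2) * w) = sqrt h * x - y * (sqrt h * (?a / 2)) * w" for x y w
        by (simp add: algebra_simps)
      ultimately show ?thesis by (simp only:)
    qed
    finally show ?thesis using g0 by (meson ennreal_leI order_trans)
  qed
qed

end

subsection \<open>Moments of one step\<close>

lemma nn_integral_bias_variance:
  fixes \<xi> :: "'u \<Rightarrow> 'a::euclidean_space"
  assumes "prob_space \<mu>" and \<xi>: "integrable \<mu> \<xi>" "(\<integral>u. \<xi> u \<partial>\<mu>) = 0"
    and fin: "(\<integral>\<^sup>+u. ennreal ((norm (\<xi> u))\<^sup>2) \<partial>\<mu>) \<noteq> \<infinity>"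
  shows "(\<integral>\<^sup>+u. ennreal ((norm (p + \<xi> u))\<^sup>2) \<partial>\<mu>) = ennreal ((norm p)\<^sup>2) + (\<integral>\<^sup>+u. ennreal ((norm (\<xi> u))\<^sup>2) \<partial>\<mu>)"
proof -
  interpret prob_space \<mu> by fact
  have [measurable]: "\<xi> \<in> borel_measurable \<mu>" using \<xi> by simp
  have i2: "integrable \<mu> (\<lambda>u. (norm (\<xi> u))\<^sup>2)"
    by (rule integrableI_nonneg) (use fin in \<open>auto simp: less_top\<close>)
  have i1: "integrable \<mu> (\<lambda>u. p \<bullet> \<xi> u)" using \<xi> by simp
  have eq: "(norm (p + \<xi> u))\<^sup>2 = (norm p)\<^sup>2 + 2 * (p \<bullet> \<xi> u) + (norm (\<xi> u))\<^sup>2" for u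
    by (simp add: power2_norm_eq_inner inner_add_left inner_add_right inner_commute)
  have i: "integrable \<mu> (\<lambda>u. (norm (p + \<xi> u))\<^sup>2)"
    unfolding eq using i1 i2 by auto
  have "(\<integral>u. (norm (p + \<xi> u))\<^sup>2 \<partial>\<mu>) = (norm p)\<^sup>2 + (\<integral>u. (norm (\<xi> u))\<^sup>2 \<partial>\<mu>)"
    unfolding eq using i1 i2 \<xi> by (simp add: prob_space)
  then show ?thesis
    using i i2 by (simp add: nn_integral_eq_integral flip: ennreal_plus)
qed

text \<open>What (a) and (b) say about a single law of \<open>U\<close> at one step size. The power
  of h in (a) is already bounded by 1, which is the form that the constants \<open>C_IEul\<close>
  and \<open>C_ISM\<close> refer to.\<close>

definition driver ::
  "real \<Rightarrow> real \<Rightarrow> real \<Rightarrow> real \<Rightarrow> ('a::euclidean_space \<Rightarrow> 'u::euclidean_space \<Rightarrow> 'a) \<Rightarrow> ('a \<Rightarrow> 'a) \<Rightarrow> 'u measure \<Rightarrow> bool" where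
  "driver L K R \<sigma> B b \<mu> \<longleftrightarrow> prob_space \<mu> \<and> sets \<mu> = sets borel \<and> (\<forall>x. unbiased_at B b \<mu> x) \<and>
     (\<forall>x. mean_square \<mu> (\<lambda>u. B x u - b x) \<le> ennreal (\<sigma>\<^sup>2 * (1 + (norm x)\<^sup>2))) \<and>
     (\<forall>x y. AE u in \<mu>. norm (B x u - B y u) \<le> L * norm (x - y)) \<and>
     (\<forall>x y. R \<le> norm (x - y) \<longrightarrow> (AE u in \<mu>. (x - y) \<bullet> (B x u - B y u) \<le> - K * (norm (x - y))\<^sup>2))"

lemma driverD:
  assumes "driver L K R \<sigma> B b \<mu>"
  shows "prob_space \<mu>" "sets \<mu> = sets borel" "integrable \<mu> (B x)" "(\<integral>u. B x u \<partial>\<mu>) = b x"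
    "(\<integral>\<^sup>+u. ennreal ((norm (B x u - b x))\<^sup>2) \<partial>\<mu>) \<le> ennreal (\<sigma>\<^sup>2 * (1 + (norm x)\<^sup>2))"
    "AE u in \<mu>. norm (B x u - B y u) \<le> L * norm (x - y)"
    "R \<le> norm (x - y) \<Longrightarrow> AE u in \<mu>. (x - y) \<bullet> (B x u - B y u) \<le> - K * (norm (x - y))\<^sup>2"
  using assms by (auto simp: driver_def unbiased_at_def mean_square_def)

lemma driver_drift:
  assumes D: "driver L K R \<sigma> B b \<mu>"
  shows driver_drift_Lipschitz: "norm (b x - b y) \<le> L * norm (x - y)"
    and driver_drift_contractive: "R \<le> norm (x - y) \<Longrightarrow> (x - y) \<bullet> (b x - b y) \<le> - K * (norm (x - y))\<^sup>2"
proof -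
  interpret prob_space \<mu> by (rule driverD(1)[OF D])
  note i = driverD(3)[OF D] and e = driverD(4)[OF D, symmetric]
  have "norm (b x - b y) = norm (\<integral>u. B x u - B y u \<partial>\<mu>)" using i by (simp add: e)
  also have "\<dots> \<le> (\<integral>u. norm (B x u - B y u) \<partial>\<mu>)" by (rule integral_norm_bound)
  also have "\<dots> \<le> L * norm (x - y)"
    using driverD(6)[OF D] i by (intro integral_le_const) auto
  finally show "norm (b x - b y) \<le> L * norm (x - y)" .
  assume R: "R \<le> norm (x - y)"
  have "(x - y) \<bullet> (b x - b y) = (\<integral>u. (x - y) \<bullet> (B x u - B y u) \<partial>\<mu>)" using i by (simp add: e)
  also have "\<dots> \<le> - K * (norm (x - y))\<^sup>2"
    using driverD(7)[OF D R] i by (intro integral_le_const) auto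
  finally show "(x - y) \<bullet> (b x - b y) \<le> - K * (norm (x - y))\<^sup>2" .
qed

text \<open>At two points at distance exactly R both parts of (b) apply, and the Cauchy-Schwarz
  inequality compares them.\<close>

lemma driver_K_le_L:
  fixes B :: "'a::euclidean_space \<Rightarrow> 'u::euclidean_space \<Rightarrow> 'a"
  assumes D: "driver L K R \<sigma> B b \<mu>" and R: "0 < R"
  shows "K \<le> L"
proof -
  obtain i :: 'a where "i \<in> Basis" using nonempty_Basis by blast
  then have n: "norm (R *\<^sub>R i - 0) = R" using R by simp
  have "K * R\<^sup>2 \<le> - ((R *\<^sub>R i - 0) \<bullet> (b (R *\<^sub>R i) - b 0))"
    using driver_drift_contractive[OF D, of "R *\<^sub>R i" 0] n by simp
  also have "\<dots> \<le> norm (R *\<^sub>R i - 0) * norm (b (R *\<^sub>R i) - b 0)"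
    using Cauchy_Schwarz_ineq2[of "R *\<^sub>R i - 0" "b (R *\<^sub>R i) - b 0"] by linarith
  also have "\<dots> \<le> R * (L * R)"
    unfolding n using driver_drift_Lipschitz[OF D, of "R *\<^sub>R i" 0] n R by (intro mult_left_mono) auto
  finally show ?thesis using R by (simp add: power2_eq_square)
qed

text \<open>For \<open>norm x < R\<close> only the Lipschitz bounds from the origin and from the point
  \<open>(R / norm x) x\<close> are available; averaging them gives the claim.\<close>
lemma driver_drift_dissipative:
  fixes B :: "'a::euclidean_space \<Rightarrow> 'u::euclidean_space \<Rightarrow> 'a"
  assumes D: "driver L K R \<sigma> B b \<mu>" and pos: "0 < L" "0 < K" "0 < R"
  shows "x \<bullet> b x \<le> M2 L K R b - M1 K * (norm x)\<^sup>2"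
proof -
  let ?s = "norm x" and ?\<rho> = "rho K R b" and ?b = "norm (b 0)"
  have KL: "K \<le> L" by (rule driver_K_le_L[OF D pos(3)])
  have \<rho>: "R \<le> ?\<rho>" "2 * ?b \<le> K * ?\<rho>" using pos by (auto simp: rho_def max_def field_simps)
  have x0: "x \<bullet> b x = x \<bullet> (b x - b 0) + x \<bullet> b 0" by (simp add: inner_diff_right)
  have xb: "x \<bullet> b 0 \<le> ?s * ?b" by (rule norm_cauchy_schwarz)
  have b\<rho>: "0 \<le> ?b * ?\<rho>" "0 \<le> L * ?\<rho>\<^sup>2" "0 \<le> ?\<rho>" using \<rho> pos by auto
  show ?thesis
  proof (cases "R \<le> ?s")
    case True
    have "x \<bullet> (b x - b 0) \<le> - K * ?s\<^sup>2"
      using driver_drift_contractive[OF D, of x 0] True by simp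
    \<comment> \<open>Half of the dissipation absorbs norm x times norm (b 0) once norm x is at
      least 2 norm (b 0) / K; this is where the second entry of \<open>rho\<close> comes
      from.\<close>
    moreover have "?s * ?b - K / 2 * ?s\<^sup>2 \<le> ?b * ?\<rho>"
    proof (cases "?\<rho> \<le> ?s")
      case True
      then have "K * ?\<rho> \<le> K * ?s" using pos by simp
      with \<rho> have "?s * (2 * ?b) \<le> ?s * (K * ?s)" by (intro mult_left_mono) auto
      then have "?s * ?b - K / 2 * ?s\<^sup>2 \<le> 0" by (simp add: power2_eq_square mult_ac)
      with b\<rho> show ?thesis by linarith
    next
      case False
      then have "?s * ?b \<le> ?\<rho> * ?b" by (intro mult_right_mono) auto
      moreover have "0 \<le> K / 2 * ?s\<^sup>2" using pos by simp
      ultimately show ?thesis by (simp add: mult.commute)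
    qed
    ultimately show ?thesis
      using xb b\<rho> unfolding x0 by (simp add: M1_def M2_def field_simps)
  next
    case False
    have "x \<bullet> (b x - b 0) \<le> ?s * (L - K) * R / 2"
    proof (cases "x = 0")
      case False
      then have s0: "0 < ?s" by simp
      let ?y = "(R / ?s) *\<^sub>R x"
      have ny: "norm (?y - 0) = R" using s0 pos by simp
      have yx: "norm (?y - x) = R - ?s"
      proof -
        have "?y - x = ((R - ?s) / ?s) *\<^sub>R x" using s0 by (simp add: diff_divide_distrib scaleR_diff_left)
        then show ?thesis using s0 \<open>\<not> R \<le> ?s\<close> by simp
      qed
      have "x \<bullet> (b x - b 0) \<le> ?s * norm (b x - b 0)" by (rule norm_cauchy_schwarz)
      also have "\<dots> \<le> ?s * (L * ?s)"
        using driver_drift_Lipschitz[OF D, of x 0] by (intro mult_left_mono) auto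
      finally have 1: "x \<bullet> (b x - b 0) \<le> ?s * (L * ?s)" .
      have "(R / ?s) * (x \<bullet> (b ?y - b 0)) \<le> - K * R\<^sup>2"
        using driver_drift_contractive[OF D, of ?y 0] ny by simp
      then have "R * (x \<bullet> (b ?y - b 0)) \<le> R * (- K * R * ?s)"
        using s0 by (simp add: field_simps power2_eq_square)
      then have 2: "x \<bullet> (b ?y - b 0) \<le> - K * R * ?s"
        using pos by (simp only: mult_le_cancel_left_pos)
      have "x \<bullet> (b x - b ?y) \<le> ?s * norm (b x - b ?y)" by (rule norm_cauchy_schwarz)
      also have "\<dots> \<le> ?s * (L * (R - ?s))"
        using driver_drift_Lipschitz[OF D, of x ?y] yx by (intro mult_left_mono) (auto simp: norm_minus_commute)
      finally have "x \<bullet> (b x - b 0) \<le> - K * R * ?s + ?s * (L * (R - ?s))"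
        using 2 by (simp add: inner_diff_right)
      with 1 show ?thesis by (simp add: field_simps)
    qed simp
    also have "\<dots> \<le> R * (L - K) * R / 2"
      using False KL pos by (intro divide_right_mono mult_right_mono) auto
    finally have 1: "x \<bullet> (b x - b 0) \<le> (L - K) * R\<^sup>2 / 2" by (simp add: power2_eq_square mult_ac)
    have "?s\<^sup>2 \<le> R\<^sup>2" using False by (intro power_mono) auto
    then have "K / 2 * ?s\<^sup>2 \<le> K / 2 * R\<^sup>2" using pos by simp
    with 1 have "x \<bullet> (b x - b 0) + K / 2 * ?s\<^sup>2 \<le> L * R\<^sup>2 / 2" by (simp add: field_simps)
    also have "\<dots> \<le> L * ?\<rho>\<^sup>2"
    proof -
      have "L * R\<^sup>2 \<le> L * ?\<rho>\<^sup>2" using pos \<rho> by (intro mult_left_mono power_mono) auto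
      then show ?thesis using b\<rho> by linarith
    qed
    finally have "x \<bullet> (b x - b 0) + K / 2 * ?s\<^sup>2 \<le> L * ?\<rho>\<^sup>2" .
    moreover have "?s * ?b \<le> ?\<rho> * ?b" using False \<rho> by (intro mult_right_mono) auto
    ultimately show ?thesis
      using xb unfolding x0 by (simp add: M1_def M2_def mult.commute)
  qed
qed

lemma driver_drift_square:
  assumes D: "driver L K R \<sigma> B b \<mu>" and L: "0 < L"
  shows "(norm (b x))\<^sup>2 \<le> 2 * L\<^sup>2 * (norm x)\<^sup>2 + 2 * (norm (b 0))\<^sup>2"
proof -
  have "norm (b x) \<le> L * norm x + norm (b 0)"
    using driver_drift_Lipschitz[OF D, of x 0] norm_triangle_ineq[of "b x - b 0" "b 0"] by simp
  then have "(norm (b x))\<^sup>2 \<le> (L * norm x + norm (b 0))\<^sup>2" by (intro power_mono) auto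
  also have "\<dots> \<le> 2 * (L * norm x)\<^sup>2 + 2 * (norm (b 0))\<^sup>2"
    using sum_squares_bound[of "L * norm x" "norm (b 0)"] by (simp add: power2_sum)
  finally show ?thesis by (simp add: power_mult_distrib)
qed

lemma driver_variance:
  assumes D: "driver L K R \<sigma> B b \<mu>"
  shows "(\<integral>\<^sup>+u. ennreal ((norm (p + \<tau> *\<^sub>R B x u))\<^sup>2) \<partial>\<mu>)
    \<le> ennreal ((norm (p + \<tau> *\<^sub>R b x))\<^sup>2 + \<tau>\<^sup>2 * (\<sigma>\<^sup>2 * (1 + (norm x)\<^sup>2)))"
proof -
  interpret prob_space \<mu> by (rule driverD(1)[OF D])
  note i = driverD(3)[OF D, of x] and e = driverD(4)[OF D, of x] and v = driverD(5)[OF D, of x]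
  let ?\<xi> = "\<lambda>u. \<tau> *\<^sub>R (B x u - b x)"
  have [measurable]: "B x \<in> borel_measurable \<mu>" using i by simp
  have v': "(\<integral>\<^sup>+u. ennreal ((norm (?\<xi> u))\<^sup>2) \<partial>\<mu>) \<le> ennreal (\<tau>\<^sup>2 * (\<sigma>\<^sup>2 * (1 + (norm x)\<^sup>2)))"
  proof -
    have "(\<integral>\<^sup>+u. ennreal ((norm (?\<xi> u))\<^sup>2) \<partial>\<mu>) = ennreal (\<tau>\<^sup>2) * (\<integral>\<^sup>+u. ennreal ((norm (B x u - b x))\<^sup>2) \<partial>\<mu>)"
      by (subst nn_integral_cmult[symmetric]) (auto simp: power_mult_distrib ennreal_mult)
    also have "\<dots> \<le> ennreal (\<tau>\<^sup>2) * ennreal (\<sigma>\<^sup>2 * (1 + (norm x)\<^sup>2))" by (intro mult_left_mono v) auto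
    finally show ?thesis by (simp add: ennreal_mult)
  qed
  have "(\<integral>\<^sup>+u. ennreal ((norm (p + \<tau> *\<^sub>R b x + ?\<xi> u))\<^sup>2) \<partial>\<mu>)
     = ennreal ((norm (p + \<tau> *\<^sub>R b x))\<^sup>2) + (\<integral>\<^sup>+u. ennreal ((norm (?\<xi> u))\<^sup>2) \<partial>\<mu>)"
    using i e v' by (intro nn_integral_bias_variance prob_space_axioms) (auto simp: prob_space top_unique)
  also have "\<dots> \<le> ennreal ((norm (p + \<tau> *\<^sub>R b x))\<^sup>2) + ennreal (\<tau>\<^sup>2 * (\<sigma>\<^sup>2 * (1 + (norm x)\<^sup>2)))"
    by (intro add_left_mono v')
  finally show ?thesis by (simp add: scaleR_diff_right flip: ennreal_plus)
qed

lemma driver_mean_square: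
  assumes D: "driver L K R \<sigma> B b \<mu>" and L: "0 < L"
  shows "(\<integral>\<^sup>+u. ennreal ((norm (B x u))\<^sup>2) \<partial>\<mu>)
    \<le> ennreal ((\<sigma>\<^sup>2 + 2 * L\<^sup>2) * (norm x)\<^sup>2 + (\<sigma>\<^sup>2 + 2 * (norm (b 0))\<^sup>2))"
proof -
  have "(\<integral>\<^sup>+u. ennreal ((norm (B x u))\<^sup>2) \<partial>\<mu>) \<le> ennreal ((norm (b x))\<^sup>2 + \<sigma>\<^sup>2 * (1 + (norm x)\<^sup>2))"
    using driver_variance[OF D, of 0 1 x] by (simp del: ennreal_plus)
  also have "\<dots> \<le> ennreal ((\<sigma>\<^sup>2 + 2 * L\<^sup>2) * (norm x)\<^sup>2 + (\<sigma>\<^sup>2 + 2 * (norm (b 0))\<^sup>2))"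
    by (rule ennreal_leI) (use driver_drift_square[OF D L, of x] in \<open>simp add: algebra_simps\<close>)
  finally show ?thesis .
qed

text \<open>The noise enters only through its mean 0 and its second moment \<open>N\<close>, so the
  Gaussian increments of the fine chain and the scaled sums of the coarse chain are covered
  together.\<close>

lemma driver_step_mean_square:
  fixes B :: "'a::euclidean_space \<Rightarrow> 'u::euclidean_space \<Rightarrow> 'a"
  assumes D: "driver L K R \<sigma> B b \<mu>" and pos: "0 < L" "0 < K" "0 < R" "0 \<le> \<tau>"
    and \<nu>: "prob_space \<nu>" "integrable \<nu> W" "(\<integral>w. W w \<partial>\<nu>) = (0::'a)"
      "(\<integral>\<^sup>+w. ennreal ((norm (W w))\<^sup>2) \<partial>\<nu>) = ennreal N" and N: "0 \<le> N"
  shows "(\<integral>\<^sup>+u. \<integral>\<^sup>+w. ennreal ((norm (x + \<tau> *\<^sub>R B x u + W w))\<^sup>2) \<partial>\<nu> \<partial>\<mu>)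
    \<le> ennreal ((1 - \<tau> * (2 * M1 K - \<tau> * (2 * L\<^sup>2 + \<sigma>\<^sup>2))) * (norm x)\<^sup>2
        + (\<tau> * (2 * M2 L K R b + \<tau> * (2 * (norm (b 0))\<^sup>2 + \<sigma>\<^sup>2)) + N))"
proof -
  interpret prob_space \<mu> by (rule driverD(1)[OF D])
  have [measurable]: "B x \<in> borel_measurable \<mu>" using driverD(3)[OF D] by simp
  have "(\<integral>\<^sup>+u. \<integral>\<^sup>+w. ennreal ((norm (x + \<tau> *\<^sub>R B x u + W w))\<^sup>2) \<partial>\<nu> \<partial>\<mu>)
    = (\<integral>\<^sup>+u. ennreal ((norm (x + \<tau> *\<^sub>R B x u))\<^sup>2) + ennreal N \<partial>\<mu>)"
    using \<nu> by (intro nn_integral_cong) (simp add: nn_integral_bias_variance)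
  also have "\<dots> = (\<integral>\<^sup>+u. ennreal ((norm (x + \<tau> *\<^sub>R B x u))\<^sup>2) \<partial>\<mu>) + ennreal N"
    by (subst nn_integral_add) (auto simp: emeasure_space_1)
  also have "\<dots> \<le> ennreal ((norm (x + \<tau> *\<^sub>R b x))\<^sup>2 + \<tau>\<^sup>2 * (\<sigma>\<^sup>2 * (1 + (norm x)\<^sup>2))) + ennreal N"
    by (intro add_right_mono driver_variance[OF D])
  also have "\<dots> = ennreal ((norm (x + \<tau> *\<^sub>R b x))\<^sup>2 + \<tau>\<^sup>2 * (\<sigma>\<^sup>2 * (1 + (norm x)\<^sup>2)) + N)"
    using N by (simp flip: ennreal_plus)
  also have "\<dots> \<le> ennreal ((1 - \<tau> * (2 * M1 K - \<tau> * (2 * L\<^sup>2 + \<sigma>\<^sup>2))) * (norm x)\<^sup>2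
        + (\<tau> * (2 * M2 L K R b + \<tau> * (2 * (norm (b 0))\<^sup>2 + \<sigma>\<^sup>2)) + N))"
  proof (rule ennreal_leI)
    have "(norm (x + \<tau> *\<^sub>R b x))\<^sup>2 = (norm x)\<^sup>2 + 2 * \<tau> * (x \<bullet> b x) + \<tau>\<^sup>2 * (norm (b x))\<^sup>2"
      unfolding power2_norm_eq_inner
      by (simp add: inner_add_left inner_add_right inner_commute power2_eq_square)
    moreover have "2 * \<tau> * (x \<bullet> b x) \<le> 2 * \<tau> * (M2 L K R b - M1 K * (norm x)\<^sup>2)"
      using pos driver_drift_dissipative[OF D pos(1-3)] by (intro mult_left_mono) auto
    moreover have "\<tau>\<^sup>2 * (norm (b x))\<^sup>2 \<le> \<tau>\<^sup>2 * (2 * L\<^sup>2 * (norm x)\<^sup>2 + 2 * (norm (b 0))\<^sup>2)"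
      by (intro mult_left_mono driver_drift_square[OF D pos(1)]) auto
    ultimately show "(norm (x + \<tau> *\<^sub>R b x))\<^sup>2 + \<tau>\<^sup>2 * (\<sigma>\<^sup>2 * (1 + (norm x)\<^sup>2)) + N
      \<le> (1 - \<tau> * (2 * M1 K - \<tau> * (2 * L\<^sup>2 + \<sigma>\<^sup>2))) * (norm x)\<^sup>2
        + (\<tau> * (2 * M2 L K R b + \<tau> * (2 * (norm (b 0))\<^sup>2 + \<sigma>\<^sup>2)) + N)"
      by (simp add: algebra_simps power2_eq_square)
  qed
  finally show ?thesis .
qed

context prob_space
begin

subsection \<open>Independence and chains\<close>

text \<open>Independence as a product law: integrals then factor by Fubini, and the two variables
  may have different types.\<close>

definition indep_law :: "'b measure \<Rightarrow> ('a \<Rightarrow> 'b) \<Rightarrow> 'c measure \<Rightarrow> ('a \<Rightarrow> 'c) \<Rightarrow> bool" where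
  "indep_law S X T Y \<longleftrightarrow> X \<in> measurable M S \<and> Y \<in> measurable M T \<and>
     distr M (S \<Otimes>\<^sub>M T) (\<lambda>\<omega>. (X \<omega>, Y \<omega>)) = distr M S X \<Otimes>\<^sub>M distr M T Y"

lemma indep_lawI:
  assumes [measurable]: "X \<in> measurable M S" "Y \<in> measurable M T"
    and ev: "\<And>A B. A \<in> sets S \<Longrightarrow> B \<in> sets T \<Longrightarrow>
      emeasure M {\<omega>\<in>space M. X \<omega> \<in> A \<and> Y \<omega> \<in> B} = emeasure M {\<omega>\<in>space M. X \<omega> \<in> A} * emeasure M {\<omega>\<in>space M. Y \<omega> \<in> B}"
  shows "indep_law S X T Y"
proof -
  interpret X: prob_space "distr M S X" by (rule prob_space_distr) simp
  interpret Y: prob_space "distr M T Y" by (rule prob_space_distr) simp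
  have "distr M S X \<Otimes>\<^sub>M distr M T Y = distr M (S \<Otimes>\<^sub>M T) (\<lambda>\<omega>. (X \<omega>, Y \<omega>))"
  proof (rule pair_measure_eqI)
    show "sigma_finite_measure (distr M S X)" "sigma_finite_measure (distr M T Y)"
      by unfold_locales
    fix A B assume "A \<in> sets (distr M S X)" "B \<in> sets (distr M T Y)"
    then have A[measurable]: "A \<in> sets S" and B[measurable]: "B \<in> sets T" by auto
    have s: "X -` A \<inter> space M = {\<omega>\<in>space M. X \<omega> \<in> A}" "Y -` B \<inter> space M = {\<omega>\<in>space M. Y \<omega> \<in> B}"
      "(\<lambda>\<omega>. (X \<omega>, Y \<omega>)) -` (A \<times> B) \<inter> space M = {\<omega>\<in>space M. X \<omega> \<in> A \<and> Y \<omega> \<in> B}" by auto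
    show "emeasure (distr M S X) A * emeasure (distr M T Y) B
       = emeasure (distr M (S \<Otimes>\<^sub>M T) (\<lambda>\<omega>. (X \<omega>, Y \<omega>))) (A \<times> B)"
      by (simp add: emeasure_distr s ev[OF A B])
  qed simp
  then show ?thesis by (simp add: indep_law_def)
qed

lemma indep_law_event:
  assumes I: "indep_law S X T Y" and [measurable]: "A \<in> sets S" "B \<in> sets T"
  shows "emeasure M {\<omega>\<in>space M. X \<omega> \<in> A \<and> Y \<omega> \<in> B} = emeasure M {\<omega>\<in>space M. X \<omega> \<in> A} * emeasure M {\<omega>\<in>space M. Y \<omega> \<in> B}"
proof -
  have [measurable]: "X \<in> measurable M S" "Y \<in> measurable M T" using I by (auto simp: indep_law_def)
  interpret Y: prob_space "distr M T Y" by (rule prob_space_distr) simp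
  have "emeasure (distr M (S \<Otimes>\<^sub>M T) (\<lambda>\<omega>. (X \<omega>, Y \<omega>))) (A \<times> B) = emeasure (distr M S X) A * emeasure (distr M T Y) B"
    using I by (simp add: indep_law_def Y.emeasure_pair_measure_Times)
  moreover have s: "X -` A \<inter> space M = {\<omega>\<in>space M. X \<omega> \<in> A}" "Y -` B \<inter> space M = {\<omega>\<in>space M. Y \<omega> \<in> B}"
      "(\<lambda>\<omega>. (X \<omega>, Y \<omega>)) -` (A \<times> B) \<inter> space M = {\<omega>\<in>space M. X \<omega> \<in> A \<and> Y \<omega> \<in> B}" by auto
  ultimately show ?thesis by (simp add: emeasure_distr)
qed

lemma indep_law_independent:
  assumes "independent M S X T Y"
  shows "indep_law S X T Y"
proof (rule indep_lawI)
  show "X \<in> measurable M S" "Y \<in> measurable M T" using assms by (auto simp: independent_def)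
  fix A B assume "A \<in> sets S" "B \<in> sets T"
  moreover have "indep_set {X -` A \<inter> space M | A. A \<in> sets S} {Y -` B \<inter> space M | B. B \<in> sets T}"
    using assms by (simp add: independent_def)
  ultimately have "prob ((X -` A \<inter> space M) \<inter> (Y -` B \<inter> space M)) = prob (X -` A \<inter> space M) * prob (Y -` B \<inter> space M)"
    by (intro indep_setD) auto
  moreover have "X -` A \<inter> space M = {\<omega>\<in>space M. X \<omega> \<in> A}" "Y -` B \<inter> space M = {\<omega>\<in>space M. Y \<omega> \<in> B}"
      "(X -` A \<inter> space M) \<inter> (Y -` B \<inter> space M) = {\<omega>\<in>space M. X \<omega> \<in> A \<and> Y \<omega> \<in> B}" by auto
  ultimately show "emeasure M {\<omega>\<in>space M. X \<omega> \<in> A \<and> Y \<omega> \<in> B} = emeasure M {\<omega>\<in>space M. X \<omega> \<in> A} * emeasure M {\<omega>\<in>space M. Y \<omega> \<in> B}"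
    by (simp add: emeasure_eq_measure ennreal_mult)
qed

lemma indep_law_compose:
  assumes I: "indep_law S X T Y" and [measurable]: "g \<in> measurable S S'" "k \<in> measurable T T'"
    and eq: "\<And>\<omega>. \<omega> \<in> space M \<Longrightarrow> X' \<omega> = g (X \<omega>)" "\<And>\<omega>. \<omega> \<in> space M \<Longrightarrow> Y' \<omega> = k (Y \<omega>)"
  shows "indep_law S' X' T' Y'"
proof -
  have [measurable]: "X \<in> measurable M S" "Y \<in> measurable M T" using I by (auto simp: indep_law_def)
  have m: "X' \<in> measurable M S'" "Y' \<in> measurable M T'"
    using eq by (simp_all cong: measurable_cong)
  show ?thesis
  proof (rule indep_lawI[OF m])
    fix A B assume [measurable]: "A \<in> sets S'" "B \<in> sets T'"
    have sp: "X \<omega> \<in> space S" "Y \<omega> \<in> space T" if "\<omega> \<in> space M" for \<omega>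
      using measurable_space[OF \<open>X \<in> measurable M S\<close> that] measurable_space[OF \<open>Y \<in> measurable M T\<close> that] by auto
    have "{\<omega>\<in>space M. X' \<omega> \<in> A \<and> Y' \<omega> \<in> B} = {\<omega>\<in>space M. X \<omega> \<in> g -` A \<inter> space S \<and> Y \<omega> \<in> k -` B \<inter> space T}"
      "{\<omega>\<in>space M. X' \<omega> \<in> A} = {\<omega>\<in>space M. X \<omega> \<in> g -` A \<inter> space S}"
      "{\<omega>\<in>space M. Y' \<omega> \<in> B} = {\<omega>\<in>space M. Y \<omega> \<in> k -` B \<inter> space T}"
      using eq sp by auto
    then show "emeasure M {\<omega>\<in>space M. X' \<omega> \<in> A \<and> Y' \<omega> \<in> B} = emeasure M {\<omega>\<in>space M. X' \<omega> \<in> A} * emeasure M {\<omega>\<in>space M. Y' \<omega> \<in> B}"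
      by (simp only: indep_law_event[OF I] measurable_sets[OF \<open>g \<in> measurable S S'\<close> \<open>A \<in> sets S'\<close>] measurable_sets[OF \<open>k \<in> measurable T T'\<close> \<open>B \<in> sets T'\<close>])
  qed
qed

lemma indep_law_sym: "indep_law S X T Y \<Longrightarrow> indep_law T Y S X"
proof (rule indep_lawI)
  assume I: "indep_law S X T Y"
  then show "Y \<in> measurable M T" "X \<in> measurable M S" by (auto simp: indep_law_def)
  fix A B assume "A \<in> sets T" "B \<in> sets S"
  from indep_law_event[OF I this(2,1)]
  show "emeasure M {\<omega>\<in>space M. Y \<omega> \<in> A \<and> X \<omega> \<in> B} = emeasure M {\<omega>\<in>space M. Y \<omega> \<in> A} * emeasure M {\<omega>\<in>space M. X \<omega> \<in> B}"
    by (simp add: conj_commute mult.commute)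
qed

text \<open>The law of the triple is a threefold product, and products can be regrouped. Repeated
  use yields the joint independence of longer families from pairwise statements about
  groups.\<close>

lemma indep_law_assoc:
  assumes XYW: "indep_law S X (T \<Otimes>\<^sub>M V) (\<lambda>\<omega>. (Y \<omega>, W \<omega>))" and YW: "indep_law T Y V W"
  shows "indep_law (S \<Otimes>\<^sub>M T) (\<lambda>\<omega>. (X \<omega>, Y \<omega>)) V W"
proof -
  have [measurable]: "X \<in> measurable M S" "Y \<in> measurable M T" "W \<in> measurable M V"
    using XYW YW by (auto simp: indep_law_def)
  interpret X: prob_space "distr M S X" by (rule prob_space_distr) simp
  interpret Y: prob_space "distr M T Y" by (rule prob_space_distr) simp
  interpret W: prob_space "distr M V W" by (rule prob_space_distr) simp
  interpret P: prob_space "distr M T Y \<Otimes>\<^sub>M distr M V W"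
    by (rule prob_space_pair) unfold_locales
  have law: "distr M (S \<Otimes>\<^sub>M (T \<Otimes>\<^sub>M V)) (\<lambda>\<omega>. (X \<omega>, Y \<omega>, W \<omega>))
      = distr M S X \<Otimes>\<^sub>M (distr M T Y \<Otimes>\<^sub>M distr M V W)"
    using XYW YW by (simp add: indep_law_def)
  have XY: "indep_law S X T Y"
    by (rule indep_law_compose[OF XYW, where g="\<lambda>x. x" and k=fst]) auto
  show ?thesis
  proof (rule indep_lawI)
    fix A B assume [measurable]: "A \<in> sets (S \<Otimes>\<^sub>M T)" "B \<in> sets V"
    let ?A = "indicator A :: _ \<Rightarrow> ennreal" and ?B = "indicator B :: _ \<Rightarrow> ennreal"
    have "emeasure M {\<omega>\<in>space M. (X \<omega>, Y \<omega>) \<in> A \<and> W \<omega> \<in> B} = (\<integral>\<^sup>+\<omega>. ?A (X \<omega>, Y \<omega>) * ?B (W \<omega>) \<partial>M)"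
    proof -
      have "emeasure M {\<omega>\<in>space M. (X \<omega>, Y \<omega>) \<in> A \<and> W \<omega> \<in> B}
         = (\<integral>\<^sup>+\<omega>. indicator {\<omega>\<in>space M. (X \<omega>, Y \<omega>) \<in> A \<and> W \<omega> \<in> B} \<omega> \<partial>M)"
        by (rule nn_integral_indicator[symmetric]) measurable
      also have "\<dots> = (\<integral>\<^sup>+\<omega>. ?A (X \<omega>, Y \<omega>) * ?B (W \<omega>) \<partial>M)"
        by (rule nn_integral_cong) (auto simp: indicator_def)
      finally show ?thesis .
    qed
    also have "\<dots> = (\<integral>\<^sup>+p. ?A (fst p, fst (snd p)) * ?B (snd (snd p)) \<partial>distr M (S \<Otimes>\<^sub>M (T \<Otimes>\<^sub>M V)) (\<lambda>\<omega>. (X \<omega>, Y \<omega>, W \<omega>)))"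
      by (subst nn_integral_distr) auto
    also have "\<dots> = (\<integral>\<^sup>+x. \<integral>\<^sup>+y. \<integral>\<^sup>+w. ?A (x, y) * ?B w \<partial>distr M V W \<partial>distr M T Y \<partial>distr M S X)"
    proof -
      have "(\<integral>\<^sup>+p. ?A (fst p, fst (snd p)) * ?B (snd (snd p)) \<partial>(distr M S X \<Otimes>\<^sub>M (distr M T Y \<Otimes>\<^sub>M distr M V W)))
        = (\<integral>\<^sup>+x. \<integral>\<^sup>+r. ?A (x, fst r) * ?B (snd r) \<partial>(distr M T Y \<Otimes>\<^sub>M distr M V W) \<partial>distr M S X)"
        by (subst P.nn_integral_fst[symmetric]) simp_all
      also have "\<dots> = (\<integral>\<^sup>+x. \<integral>\<^sup>+y. \<integral>\<^sup>+w. ?A (x, y) * ?B w \<partial>distr M V W \<partial>distr M T Y \<partial>distr M S X)"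
      proof (rule nn_integral_cong)
        fix x assume "x \<in> space (distr M S X)"
        then have [measurable]: "x \<in> space S" by simp
        show "(\<integral>\<^sup>+r. ?A (x, fst r) * ?B (snd r) \<partial>(distr M T Y \<Otimes>\<^sub>M distr M V W))
          = (\<integral>\<^sup>+y. \<integral>\<^sup>+w. ?A (x, y) * ?B w \<partial>distr M V W \<partial>distr M T Y)"
          by (subst W.nn_integral_fst[symmetric]) simp_all
      qed
      finally show ?thesis unfolding law .
    qed
    also have "\<dots> = (\<integral>\<^sup>+x. \<integral>\<^sup>+y. ?A (x, y) \<partial>distr M T Y \<partial>distr M S X) * emeasure M {\<omega>\<in>space M. W \<omega> \<in> B}"
    proof -
      have "W -` B \<inter> space M = {\<omega>\<in>space M. W \<omega> \<in> B}" by auto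
      then have "(\<integral>\<^sup>+w. a * ?B w \<partial>distr M V W) = a * emeasure M {\<omega>\<in>space M. W \<omega> \<in> B}" for a
        by (simp add: nn_integral_cmult emeasure_distr)
      then have "(\<integral>\<^sup>+x. \<integral>\<^sup>+y. \<integral>\<^sup>+w. ?A (x, y) * ?B w \<partial>distr M V W \<partial>distr M T Y \<partial>distr M S X)
        = (\<integral>\<^sup>+x. \<integral>\<^sup>+y. ?A (x, y) * emeasure M {\<omega>\<in>space M. W \<omega> \<in> B} \<partial>distr M T Y \<partial>distr M S X)"
        by simp
      also have "\<dots> = (\<integral>\<^sup>+x. (\<integral>\<^sup>+y. ?A (x, y) \<partial>distr M T Y) * emeasure M {\<omega>\<in>space M. W \<omega> \<in> B} \<partial>distr M S X)"
      proof (rule nn_integral_cong)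
        fix x assume "x \<in> space (distr M S X)"
        then have [measurable]: "x \<in> space S" by simp
        show "(\<integral>\<^sup>+y. ?A (x, y) * emeasure M {\<omega>\<in>space M. W \<omega> \<in> B} \<partial>distr M T Y)
          = (\<integral>\<^sup>+y. ?A (x, y) \<partial>distr M T Y) * emeasure M {\<omega>\<in>space M. W \<omega> \<in> B}"
          by (rule nn_integral_multc) measurable
      qed
      also have "\<dots> = (\<integral>\<^sup>+x. \<integral>\<^sup>+y. ?A (x, y) \<partial>distr M T Y \<partial>distr M S X) * emeasure M {\<omega>\<in>space M. W \<omega> \<in> B}"
        by (rule nn_integral_multc) measurable
      finally show ?thesis .
    qed
    also have "(\<integral>\<^sup>+x. \<integral>\<^sup>+y. ?A (x, y) \<partial>distr M T Y \<partial>distr M S X) = (\<integral>\<^sup>+p. ?A p \<partial>(distr M S X \<Otimes>\<^sub>M distr M T Y))"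
      by (subst Y.nn_integral_fst) auto
    also have "\<dots> = (\<integral>\<^sup>+p. ?A p \<partial>distr M (S \<Otimes>\<^sub>M T) (\<lambda>\<omega>. (X \<omega>, Y \<omega>)))"
      using XY by (simp add: indep_law_def)
    also have "\<dots> = emeasure M {\<omega>\<in>space M. (X \<omega>, Y \<omega>) \<in> A}"
      by (simp add: nn_integral_indicator emeasure_distr) (rule arg_cong2[where f=emeasure], auto)
    finally show "emeasure M {\<omega>\<in>space M. (X \<omega>, Y \<omega>) \<in> A \<and> W \<omega> \<in> B}
      = emeasure M {\<omega>\<in>space M. (X \<omega>, Y \<omega>) \<in> A} * emeasure M {\<omega>\<in>space M. W \<omega> \<in> B}" .
  qed measurable
qed

text \<open>\<open>U1\<close>, \<open>Z1\<close> stand for past and \<open>U2\<close>,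
  \<open>Z2\<close> for present noise, read off from two sequences \<open>U\<close> and
  \<open>Z\<close>. Independence of the sequences from each other, together with independence of
  past and present within each of them, separates all the past from all the present.\<close>

lemma indep_law_past_future:
  assumes X: "indep_law S X (PU \<Otimes>\<^sub>M PZ) (\<lambda>\<omega>. (U \<omega>, Z \<omega>))" and UZ: "indep_law PU U PZ Z"
    and U12: "indep_law S1 U1 S2 U2" and Z12: "indep_law T1 Z1 T2 Z2"
    and meas: "g1 \<in> measurable PU S1" "g2 \<in> measurable PU S2" "k1 \<in> measurable PZ T1" "k2 \<in> measurable PZ T2"
    and eq: "\<And>\<omega>. \<omega> \<in> space M \<Longrightarrow> U1 \<omega> = g1 (U \<omega>)" "\<And>\<omega>. \<omega> \<in> space M \<Longrightarrow> U2 \<omega> = g2 (U \<omega>)"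
      "\<And>\<omega>. \<omega> \<in> space M \<Longrightarrow> Z1 \<omega> = k1 (Z \<omega>)" "\<And>\<omega>. \<omega> \<in> space M \<Longrightarrow> Z2 \<omega> = k2 (Z \<omega>)"
  shows "indep_law (S \<Otimes>\<^sub>M (T1 \<Otimes>\<^sub>M S1)) (\<lambda>\<omega>. (X \<omega>, Z1 \<omega>, U1 \<omega>)) (S2 \<Otimes>\<^sub>M T2) (\<lambda>\<omega>. (U2 \<omega>, Z2 \<omega>))"
    and "indep_law S2 U2 T2 Z2"
proof -
  note [measurable] = meas
  have UZ': "indep_law (S1 \<Otimes>\<^sub>M S2) (\<lambda>\<omega>. (U1 \<omega>, U2 \<omega>)) (T1 \<Otimes>\<^sub>M T2) (\<lambda>\<omega>. (Z1 \<omega>, Z2 \<omega>))"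
    by (rule indep_law_compose[OF UZ, where g="\<lambda>u. (g1 u, g2 u)" and k="\<lambda>z. (k1 z, k2 z)"]) (auto simp: eq)
  have 1: "indep_law ((S1 \<Otimes>\<^sub>M S2) \<Otimes>\<^sub>M T1) (\<lambda>\<omega>. ((U1 \<omega>, U2 \<omega>), Z1 \<omega>)) T2 Z2"
    by (rule indep_law_assoc[OF UZ' Z12])
  have "indep_law T1 Z1 (S1 \<Otimes>\<^sub>M S2) (\<lambda>\<omega>. (U1 \<omega>, U2 \<omega>))"
    by (rule indep_law_compose[OF indep_law_sym[OF UZ'], where g=fst and k="\<lambda>x. x"]) auto
  then have 2: "indep_law (T1 \<Otimes>\<^sub>M S1) (\<lambda>\<omega>. (Z1 \<omega>, U1 \<omega>)) S2 U2"
    by (rule indep_law_assoc[OF _ U12])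
  have "indep_law T2 Z2 (S2 \<Otimes>\<^sub>M (T1 \<Otimes>\<^sub>M S1)) (\<lambda>\<omega>. (U2 \<omega>, Z1 \<omega>, U1 \<omega>))"
    by (rule indep_law_compose[OF indep_law_sym[OF 1], where g="\<lambda>x. x" and k="\<lambda>p. (snd (fst p), snd p, fst (fst p))"]) auto
  then have 4: "indep_law (T2 \<Otimes>\<^sub>M S2) (\<lambda>\<omega>. (Z2 \<omega>, U2 \<omega>)) (T1 \<Otimes>\<^sub>M S1) (\<lambda>\<omega>. (Z1 \<omega>, U1 \<omega>))"
    by (rule indep_law_assoc[OF _ indep_law_sym[OF 2]])
  have 3: "indep_law (T1 \<Otimes>\<^sub>M S1) (\<lambda>\<omega>. (Z1 \<omega>, U1 \<omega>)) (S2 \<Otimes>\<^sub>M T2) (\<lambda>\<omega>. (U2 \<omega>, Z2 \<omega>))"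
    by (rule indep_law_compose[OF indep_law_sym[OF 4], where g="\<lambda>x. x" and k="\<lambda>p. (snd p, fst p)"]) auto
  have "indep_law S X ((T1 \<Otimes>\<^sub>M S1) \<Otimes>\<^sub>M (S2 \<Otimes>\<^sub>M T2)) (\<lambda>\<omega>. ((Z1 \<omega>, U1 \<omega>), (U2 \<omega>, Z2 \<omega>)))"
    by (rule indep_law_compose[OF X, where g="\<lambda>x. x" and k="\<lambda>p. ((k1 (snd p), g1 (fst p)), (g2 (fst p), k2 (snd p)))"]) (auto simp: eq)
  from indep_law_assoc[OF this 3]
  show "indep_law (S \<Otimes>\<^sub>M (T1 \<Otimes>\<^sub>M S1)) (\<lambda>\<omega>. (X \<omega>, Z1 \<omega>, U1 \<omega>)) (S2 \<Otimes>\<^sub>M T2) (\<lambda>\<omega>. (U2 \<omega>, Z2 \<omega>))" .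
  show "indep_law S2 U2 T2 Z2"
    by (rule indep_law_compose[OF UZ', where g=snd and k=snd]) auto
qed

lemma indep_law_restrict:
  assumes "indep_vars (\<lambda>_. borel) V I" "A \<inter> B = {}" "A \<subseteq> I" "B \<subseteq> I"
  shows "indep_law (PiM A (\<lambda>_. borel)) (\<lambda>\<omega>. \<lambda>i\<in>A. V i \<omega>) (PiM B (\<lambda>_. borel)) (\<lambda>\<omega>. \<lambda>i\<in>B. V i \<omega>)"
  using indep_var_restrict[OF assms] indep_var_distribution_eq by (auto simp: indep_law_def)

lemma nn_integral_indep_law:
  assumes I: "indep_law S X T Y" and [measurable]: "F \<in> borel_measurable (S \<Otimes>\<^sub>M T)"
  shows "(\<integral>\<^sup>+\<omega>. F (X \<omega>, Y \<omega>) \<partial>M) = (\<integral>\<^sup>+x. \<integral>\<^sup>+y. F (x, y) \<partial>distr M T Y \<partial>distr M S X)"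
proof -
  have [measurable]: "X \<in> measurable M S" "Y \<in> measurable M T" using I by (auto simp: indep_law_def)
  interpret Y: prob_space "distr M T Y" by (rule prob_space_distr) simp
  have "(\<integral>\<^sup>+\<omega>. F (X \<omega>, Y \<omega>) \<partial>M) = (\<integral>\<^sup>+p. F p \<partial>distr M (S \<Otimes>\<^sub>M T) (\<lambda>\<omega>. (X \<omega>, Y \<omega>)))"
    by (subst nn_integral_distr) auto
  also have "\<dots> = (\<integral>\<^sup>+p. F p \<partial>(distr M S X \<Otimes>\<^sub>M distr M T Y))"
    using I by (simp add: indep_law_def)
  also have "\<dots> = (\<integral>\<^sup>+x. \<integral>\<^sup>+y. F (x, y) \<partial>distr M T Y \<partial>distr M S X)"
    by (subst Y.nn_integral_fst[symmetric]) auto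
  finally show ?thesis .
qed

end

section \<open>Chains driven by independent noise\<close>

primrec chain_path ::
  "('s \<Rightarrow> 'u \<Rightarrow> 's \<Rightarrow> 's) \<Rightarrow> ('s \<Rightarrow> 's \<Rightarrow> 's) \<Rightarrow> (nat \<Rightarrow> nat) \<Rightarrow> (nat \<Rightarrow> nat) \<Rightarrow> (nat \<Rightarrow> nat)
    \<Rightarrow> 's \<Rightarrow> (nat \<Rightarrow> 's) \<Rightarrow> (nat \<Rightarrow> 'u) \<Rightarrow> nat \<Rightarrow> 's"
where
  "chain_path \<Phi> g \<iota> \<alpha> \<beta> x z u 0 = x"
| "chain_path \<Phi> g \<iota> \<alpha> \<beta> x z u (Suc n) = \<Phi> (chain_path \<Phi> g \<iota> \<alpha> \<beta> x z u n) (u (\<iota> n)) (g (z (\<alpha> n)) (z (\<beta> n)))"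

text \<open>Adaptedness: it allows \<open>chain_law\<close> to replace the noise sequences by their
  restrictions to the indices of the past.\<close>

lemma chain_path_cong:
  assumes "\<And>m. m < n \<Longrightarrow> u (\<iota> m) = u' (\<iota> m) \<and> z (\<alpha> m) = z' (\<alpha> m) \<and> z (\<beta> m) = z' (\<beta> m)"
  shows "chain_path \<Phi> g \<iota> \<alpha> \<beta> x z u n = chain_path \<Phi> g \<iota> \<alpha> \<beta> x z' u' n"
  using assms by (induction n) auto

lemma measurable_chain_path:
  fixes \<Phi> :: "'s::euclidean_space \<Rightarrow> 'u::euclidean_space \<Rightarrow> 's \<Rightarrow> 's"
  assumes \<Phi>[measurable]: "(\<lambda>(x, u, w). \<Phi> x u w) \<in> borel_measurable (borel \<Otimes>\<^sub>M (borel \<Otimes>\<^sub>M borel))"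
    and g[measurable]: "(\<lambda>(z, z'). g z z') \<in> borel_measurable (borel \<Otimes>\<^sub>M borel)"
    and sub: "\<And>m. m < n \<Longrightarrow> \<alpha> m \<in> A \<and> \<beta> m \<in> A \<and> \<iota> m \<in> B"
  shows "(\<lambda>p. chain_path \<Phi> g \<iota> \<alpha> \<beta> (fst p) (fst (snd p)) (snd (snd p)) n)
    \<in> borel_measurable (borel \<Otimes>\<^sub>M (PiM A (\<lambda>_. borel) \<Otimes>\<^sub>M PiM B (\<lambda>_. borel)))"
  using sub
proof (induction n)
  case (Suc n)
  let ?N = "borel \<Otimes>\<^sub>M (PiM A (\<lambda>_. borel) \<Otimes>\<^sub>M PiM B (\<lambda>_. borel)) :: ('s \<times> (nat \<Rightarrow> 's) \<times> (nat \<Rightarrow> 'u)) measure"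
  have in_sets: "\<alpha> n \<in> A" "\<beta> n \<in> A" "\<iota> n \<in> B" using Suc.prems by auto
  have IH[measurable]: "(\<lambda>p. chain_path \<Phi> g \<iota> \<alpha> \<beta> (fst p) (fst (snd p)) (snd (snd p)) n) \<in> borel_measurable ?N"
    using Suc by auto
  have [measurable]: "(\<lambda>p. snd (snd p) (\<iota> n)) \<in> borel_measurable ?N"
    "(\<lambda>p. fst (snd p) (\<alpha> n)) \<in> borel_measurable ?N" "(\<lambda>p. fst (snd p) (\<beta> n)) \<in> borel_measurable ?N"
    using in_sets by (auto intro!: measurable_compose[OF _ measurable_component_singleton])
  have gm: "(\<lambda>p. g (fst (snd p) (\<alpha> n)) (fst (snd p) (\<beta> n))) \<in> borel_measurable ?N"
    using measurable_compose[OF _ g, of "\<lambda>p. (fst (snd p) (\<alpha> n), fst (snd p) (\<beta> n))" ?N] by simp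
  note [measurable] = gm
  show ?case
    using measurable_compose[OF _ \<Phi>, of "\<lambda>p. (chain_path \<Phi> g \<iota> \<alpha> \<beta> (fst p) (fst (snd p)) (snd (snd p)) n, snd (snd p) (\<iota> n), g (fst (snd p) (\<alpha> n)) (fst (snd p) (\<beta> n)))" ?N]
    by simp
qed simp

context prob_space
begin

text \<open>The state after \<open>n\<close> steps is a function of the initial value and of noise
  with indices in \<open>A\<close> and \<open>B\<close>, disjoint from those of step
  \<open>n\<close>. \<open>W\<close> will be the sequence of pairs of fine and coarse
  \<open>U\<close>s and \<open>p\<close> a projection, so that independence in time is asked only of
  the projected sequence. Two indices \<open>\<alpha>\<close> and \<open>\<beta>\<close> let a step
  use two Gaussians, as the coarse chain does.\<close>

lemma chain_law:
  fixes \<Phi> :: "'s::euclidean_space \<Rightarrow> 'u::euclidean_space \<Rightarrow> 's \<Rightarrow> 's" and g :: "'s \<Rightarrow> 's \<Rightarrow> 's" and \<alpha> \<beta> :: "nat \<Rightarrow> nat" and W :: "nat \<Rightarrow> 'a \<Rightarrow> 'v::topological_space"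
  assumes \<Phi>: "(\<lambda>(x, u, w). \<Phi> x u w) \<in> borel_measurable (borel \<Otimes>\<^sub>M (borel \<Otimes>\<^sub>M borel))"
    and g[measurable]: "(\<lambda>(z, z'). g z z') \<in> borel_measurable (borel \<Otimes>\<^sub>M borel)"
    and X: "indep_law borel X (PiM UNIV (\<lambda>_. borel) \<Otimes>\<^sub>M PiM {1..} (\<lambda>_. borel)) (\<lambda>\<omega>. (\<lambda>k. W k \<omega>, \<lambda>k\<in>{1..}. Z k \<omega>))"
    and UZ: "indep_law (PiM UNIV (\<lambda>_. borel)) (\<lambda>\<omega> k. W k \<omega>) (PiM {1..} (\<lambda>_. borel)) (\<lambda>\<omega>. \<lambda>k\<in>{1..}. Z k \<omega>)"
    and p[measurable]: "p \<in> borel_measurable borel" and V: "indep_vars (\<lambda>_. borel) (\<lambda>k \<omega>. p (W k \<omega>)) UNIV"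
    and Z: "indep_vars (\<lambda>_. borel) Z {1..}"
    and \<iota>: "\<And>m n. m < n \<Longrightarrow> \<iota> m \<noteq> \<iota> n"
    and \<alpha>\<beta>: "\<And>n. 1 \<le> \<alpha> n" "\<And>n. 1 \<le> \<beta> n" "\<And>m n. m < n \<Longrightarrow> {\<alpha> m, \<beta> m} \<inter> {\<alpha> n, \<beta> n} = {}"
    and Y: "\<And>\<omega>. \<omega> \<in> space M \<Longrightarrow> Y 0 \<omega> = X \<omega>"
      "\<And>n \<omega>. \<omega> \<in> space M \<Longrightarrow> Y (Suc n) \<omega> = \<Phi> (Y n \<omega>) (p (W (\<iota> n) \<omega>)) (g (Z (\<alpha> n) \<omega>) (Z (\<beta> n) \<omega>))"
  shows "indep_law borel (Y n) (borel \<Otimes>\<^sub>M borel) (\<lambda>\<omega>. (p (W (\<iota> n) \<omega>), g (Z (\<alpha> n) \<omega>) (Z (\<beta> n) \<omega>)))"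
    and "indep_law borel (\<lambda>\<omega>. p (W (\<iota> n) \<omega>)) borel (\<lambda>\<omega>. g (Z (\<alpha> n) \<omega>) (Z (\<beta> n) \<omega>))"
proof -
  define A where "A = (\<Union>m<n. {\<alpha> m, \<beta> m})"
  define B where "B = \<iota> ` {..<n}"
  have A: "A \<inter> {\<alpha> n, \<beta> n} = {}" "A \<subseteq> {1..}" "{\<alpha> n, \<beta> n} \<subseteq> {1..}" using \<alpha>\<beta> by (auto simp: A_def)
  have B: "B \<inter> {\<iota> n} = {}" using \<iota> by (auto simp: B_def) metis
  have sub: "\<alpha> m \<in> A \<and> \<beta> m \<in> A \<and> \<iota> m \<in> B" if "m < n" for m using that by (auto simp: A_def B_def)
  have path: "Y k \<omega> = chain_path \<Phi> g \<iota> \<alpha> \<beta> (X \<omega>) (\<lambda>k. Z k \<omega>) (\<lambda>k. p (W k \<omega>)) k" if "\<omega> \<in> space M" for k \<omega>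
    using that Y by (induction k) auto
  have Yn: "Y n \<omega> = chain_path \<Phi> g \<iota> \<alpha> \<beta> (X \<omega>) (\<lambda>k\<in>A. Z k \<omega>) (\<lambda>k\<in>B. p (W k \<omega>)) n" if "\<omega> \<in> space M" for \<omega>
    unfolding path[OF that] using sub by (intro chain_path_cong) auto
  have [measurable]: "(\<lambda>z. g (z (\<alpha> n)) (z (\<beta> n))) \<in> borel_measurable (PiM {\<alpha> n, \<beta> n} (\<lambda>_. borel))"
    using measurable_compose[OF _ g, of "\<lambda>z. (z (\<alpha> n), z (\<beta> n))" "PiM {\<alpha> n, \<beta> n} (\<lambda>_. borel)"] by simp
  have gZ: "(\<lambda>z. g (z (\<alpha> n)) (z (\<beta> n))) \<in> borel_measurable (PiM {1..} (\<lambda>_. borel))"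
    using measurable_compose[OF _ g, of "\<lambda>z. (z (\<alpha> n), z (\<beta> n))" "PiM {1..} (\<lambda>_. borel)"] \<alpha>\<beta>(1,2)
    by (simp add: measurable_component_singleton)
  have Z12: "indep_law (PiM A (\<lambda>_. borel)) (\<lambda>\<omega>. \<lambda>k\<in>A. Z k \<omega>) borel (\<lambda>\<omega>. g (Z (\<alpha> n) \<omega>) (Z (\<beta> n) \<omega>))"
    by (rule indep_law_compose[OF indep_law_restrict[OF Z A], where g="\<lambda>x. x" and k="\<lambda>z. g (z (\<alpha> n)) (z (\<beta> n))"]) auto
  have U12: "indep_law (PiM B (\<lambda>_. borel)) (\<lambda>\<omega>. \<lambda>k\<in>B. p (W k \<omega>)) borel (\<lambda>\<omega>. p (W (\<iota> n) \<omega>))"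
    by (rule indep_law_compose[OF indep_law_restrict[OF V B], where g="\<lambda>x. x" and k="\<lambda>u. u (\<iota> n)"]) auto
  have mA: "(\<lambda>z. \<lambda>k\<in>A. z k) \<in> measurable (PiM {1..} (\<lambda>_. borel :: 's measure)) (PiM A (\<lambda>_. borel))"
    using A(2) by (intro measurable_restrict measurable_component_singleton) auto
  have mB: "(\<lambda>u. \<lambda>k\<in>B. p (u k)) \<in> measurable (PiM UNIV (\<lambda>_. borel)) (PiM B (\<lambda>_. borel))"
    by (intro measurable_restrict measurable_compose[OF _ p] measurable_component_singleton) auto
  have mp: "(\<lambda>u. p (u (\<iota> n))) \<in> borel_measurable (PiM UNIV (\<lambda>_. borel))"
    by (intro measurable_compose[OF _ p] measurable_component_singleton) auto
  have eqA: "(\<lambda>k\<in>A. Z k \<omega>) = (\<lambda>k\<in>A. (\<lambda>k\<in>{1..}. Z k \<omega>) k)" for \<omega>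
    using A(2) by (intro restrict_ext) auto
  have eqn: "g (Z (\<alpha> n) \<omega>) (Z (\<beta> n) \<omega>) = g ((\<lambda>k\<in>{1..}. Z k \<omega>) (\<alpha> n)) ((\<lambda>k\<in>{1..}. Z k \<omega>) (\<beta> n))" for \<omega>
    using \<alpha>\<beta>(1)[of n] \<alpha>\<beta>(2)[of n] by simp
  have pf: "indep_law (borel \<Otimes>\<^sub>M (PiM A (\<lambda>_. borel) \<Otimes>\<^sub>M PiM B (\<lambda>_. borel))) (\<lambda>\<omega>. (X \<omega>, \<lambda>k\<in>A. Z k \<omega>, \<lambda>k\<in>B. p (W k \<omega>)))
       (borel \<Otimes>\<^sub>M borel) (\<lambda>\<omega>. (p (W (\<iota> n) \<omega>), g (Z (\<alpha> n) \<omega>) (Z (\<beta> n) \<omega>)))"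
    by (rule indep_law_past_future(1)[OF X UZ U12 Z12 mB mp mA gZ]) (simp, simp, rule eqA, rule eqn)
  have 2: "indep_law borel (\<lambda>\<omega>. p (W (\<iota> n) \<omega>)) borel (\<lambda>\<omega>. g (Z (\<alpha> n) \<omega>) (Z (\<beta> n) \<omega>))"
    by (rule indep_law_past_future(2)[OF X UZ U12 Z12 mB mp mA gZ]) (simp, simp, rule eqA, rule eqn)
  show "indep_law borel (\<lambda>\<omega>. p (W (\<iota> n) \<omega>)) borel (\<lambda>\<omega>. g (Z (\<alpha> n) \<omega>) (Z (\<beta> n) \<omega>))" by fact
  show "indep_law borel (Y n) (borel \<Otimes>\<^sub>M borel) (\<lambda>\<omega>. (p (W (\<iota> n) \<omega>), g (Z (\<alpha> n) \<omega>) (Z (\<beta> n) \<omega>)))"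
    by (rule indep_law_compose[OF pf measurable_chain_path[OF \<Phi> g sub], where k="\<lambda>x. x"]) (auto simp: Yn)
qed

lemma chain_step_integral:
  fixes \<Phi> :: "'s::euclidean_space \<Rightarrow> 'u::euclidean_space \<Rightarrow> 's \<Rightarrow> 's"
  assumes \<Phi>: "(\<lambda>(x, u, w). \<Phi> x u w) \<in> borel_measurable (borel \<Otimes>\<^sub>M (borel \<Otimes>\<^sub>M borel))"
    and 1: "indep_law borel Y (borel \<Otimes>\<^sub>M borel) (\<lambda>\<omega>. (V \<omega>, \<zeta> \<omega>))" and 2: "indep_law borel V borel \<zeta>"
    and Y': "\<And>\<omega>. \<omega> \<in> space M \<Longrightarrow> Y' \<omega> = \<Phi> (Y \<omega>) (V \<omega>) (\<zeta> \<omega>)"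
    and F[measurable]: "F \<in> borel_measurable borel"
  shows "(\<integral>\<^sup>+\<omega>. F (Y' \<omega>) \<partial>M)
    = (\<integral>\<^sup>+x. \<integral>\<^sup>+u. \<integral>\<^sup>+w. F (\<Phi> x u w) \<partial>distr M borel \<zeta> \<partial>distr M borel V \<partial>distr M borel Y)"
proof -
  have [measurable]: "V \<in> borel_measurable M" "\<zeta> \<in> borel_measurable M" "Y \<in> borel_measurable M"
    using 1 2 by (auto simp: indep_law_def)
  interpret V: prob_space "distr M borel V" by (rule prob_space_distr) simp
  interpret \<zeta>: prob_space "distr M borel \<zeta>" by (rule prob_space_distr) simp
  have "(\<integral>\<^sup>+\<omega>. F (Y' \<omega>) \<partial>M) = (\<integral>\<^sup>+\<omega>. F (\<Phi> (Y \<omega>) (V \<omega>) (\<zeta> \<omega>)) \<partial>M)"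
    by (intro nn_integral_cong) (simp add: Y')
  also have "\<dots> = (\<integral>\<^sup>+x. \<integral>\<^sup>+y. F (\<Phi> x (fst y) (snd y)) \<partial>distr M (borel \<Otimes>\<^sub>M borel) (\<lambda>\<omega>. (V \<omega>, \<zeta> \<omega>)) \<partial>distr M borel Y)"
  proof -
    have "(\<lambda>p. F (\<Phi> (fst p) (fst (snd p)) (snd (snd p)))) \<in> borel_measurable (borel \<Otimes>\<^sub>M (borel \<Otimes>\<^sub>M borel))"
      using measurable_compose[OF \<Phi> F] by (simp only: case_prod_beta)
    from nn_integral_indep_law[OF 1 this] show ?thesis by (simp only: fst_conv snd_conv)
  qed
  also have "\<dots> = (\<integral>\<^sup>+x. \<integral>\<^sup>+u. \<integral>\<^sup>+w. F (\<Phi> x u w) \<partial>distr M borel \<zeta> \<partial>distr M borel V \<partial>distr M borel Y)"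
  proof (rule nn_integral_cong)
    fix x
    have [measurable]: "(\<lambda>p. F (\<Phi> x (fst p) (snd p))) \<in> borel_measurable (borel \<Otimes>\<^sub>M borel)"
      using measurable_compose[OF measurable_compose[OF _ \<Phi>] F, of "\<lambda>p. (x, fst p, snd p)" "borel \<Otimes>\<^sub>M borel"]
      by (simp add: case_prod_beta)
    have "distr M (borel \<Otimes>\<^sub>M borel) (\<lambda>\<omega>. (V \<omega>, \<zeta> \<omega>)) = distr M borel V \<Otimes>\<^sub>M distr M borel \<zeta>"
      using 2 by (simp add: indep_law_def)
    then show "(\<integral>\<^sup>+y. F (\<Phi> x (fst y) (snd y)) \<partial>distr M (borel \<Otimes>\<^sub>M borel) (\<lambda>\<omega>. (V \<omega>, \<zeta> \<omega>)))
      = (\<integral>\<^sup>+u. \<integral>\<^sup>+w. F (\<Phi> x u w) \<partial>distr M borel \<zeta> \<partial>distr M borel V)"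
      by (simp only:) (subst \<zeta>.nn_integral_fst[symmetric], simp_all)
  qed
  finally show ?thesis .
qed

end

text \<open>\<open>C\<close> dominates the fixed point of the affine map, so the bound
  \<open>m_0 + C\<close> is invariant: \<open>m_0\<close> is not increased by the factor
  \<open>\<theta>\<close>, and \<open>C\<close> pays for the increment.\<close>

lemma affine_recursion_bound:
  assumes \<theta>: "0 \<le> \<theta>" "\<theta> \<le> 1" and \<kappa>: "0 \<le> \<kappa>" "\<kappa> \<le> (1 - \<theta>) * C" and C: "0 \<le> C"
    and m0: "m 0 \<le> ennreal m_0" "0 \<le> m_0"
    and step: "\<And>n. m (Suc n) \<le> ennreal \<theta> * m n + ennreal \<kappa>"
  shows "m n \<le> ennreal (m_0 + C)"
proof (induction n)
  case 0
  show ?case using m0 C by (auto intro: order_trans ennreal_leI)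
next
  case (Suc n)
  have "m (Suc n) \<le> ennreal \<theta> * ennreal (m_0 + C) + ennreal \<kappa>"
    using step[of n] Suc by (meson add_right_mono mult_left_mono order_trans zero_le)
  also have "\<dots> = ennreal (\<theta> * (m_0 + C) + \<kappa>)"
    using \<theta> \<kappa> m0 C by (simp add: ennreal_mult ennreal_plus)
  also have "\<dots> \<le> ennreal (m_0 + C)"
  proof (rule ennreal_leI)
    have "\<theta> * m_0 \<le> m_0" using \<theta> m0 by (simp add: mult_left_le_one_le)
    with \<kappa> show "\<theta> * (m_0 + C) + \<kappa> \<le> m_0 + C" by (simp add: algebra_simps)
  qed
  finally show ?case .
qed

lemma nn_integral_le_mean_square:
  fixes \<pi> :: "'a::euclidean_space measure"
  assumes [simp]: "sets \<pi> = sets borel" and "prob_space \<pi>" and "0 \<le> A" "0 \<le> B"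
    and bd: "\<And>x. G x \<le> ennreal (A * (norm x)\<^sup>2 + B)"
    and m: "(\<integral>\<^sup>+x. ennreal ((norm x)\<^sup>2) \<partial>\<pi>) \<le> m"
  shows "(\<integral>\<^sup>+x. G x \<partial>\<pi>) \<le> ennreal A * m + ennreal B"
proof -
  interpret prob_space \<pi> by fact
  note [measurable_cong] = assms(1)
  have "(\<integral>\<^sup>+x. G x \<partial>\<pi>) \<le> (\<integral>\<^sup>+x. ennreal A * ennreal ((norm x)\<^sup>2) + ennreal B \<partial>\<pi>)"
    using assms by (intro nn_integral_mono order_trans[OF bd]) (simp add: ennreal_mult ennreal_plus)
  also have "\<dots> = ennreal A * (\<integral>\<^sup>+x. ennreal ((norm x)\<^sup>2) \<partial>\<pi>) + ennreal B"
    by (subst nn_integral_add) (auto simp: nn_integral_cmult emeasure_space_1)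
  also have "\<dots> \<le> ennreal A * m + ennreal B"
    by (intro add_right_mono mult_left_mono m) simp
  finally show ?thesis .
qed

context prob_space
begin

subsection \<open>Two fine steps against one coarse step\<close>

text \<open>(b) holds almost surely for each fixed pair of points, with an exceptional set that
  depends on the pair. Independence allows random points to be inserted.\<close>

lemma indep_law_AE:
  assumes I: "indep_law S X T Y" and [measurable]: "Measurable.pred (S \<Otimes>\<^sub>M T) (\<lambda>p. Q (fst p) (snd p))"
    and Q: "\<And>x. x \<in> space S \<Longrightarrow> AE y in distr M T Y. Q x y"
  shows "AE \<omega> in M. Q (X \<omega>) (Y \<omega>)"
proof -
  have [measurable]: "X \<in> measurable M S" "Y \<in> measurable M T" using I by (auto simp: indep_law_def)
  interpret X: prob_space "distr M S X" by (rule prob_space_distr) simp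
  interpret Y: prob_space "distr M T Y" by (rule prob_space_distr) simp
  interpret pair_sigma_finite "distr M S X" "distr M T Y" ..
  have m: "{p \<in> space (S \<Otimes>\<^sub>M T). Q (fst p) (snd p)} \<in> sets (S \<Otimes>\<^sub>M T)" by measurable
  have "AE p in distr M S X \<Otimes>\<^sub>M distr M T Y. Q (fst p) (snd p)"
    using Q by (intro AE_pair_measure) (auto simp: space_pair_measure)
  then have "AE p in distr M (S \<Otimes>\<^sub>M T) (\<lambda>\<omega>. (X \<omega>, Y \<omega>)). Q (fst p) (snd p)"
    using I unfolding indep_law_def by metis
  then show ?thesis by (subst (asm) AE_distr_iff[OF _ m]) auto
qed

text \<open>A bound on the L2 norm instead of the norm itself: all integrals stay in the extended
  reals, and finiteness is part of the statement.\<close>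

definition L2_le :: "('a \<Rightarrow> real) \<Rightarrow> real \<Rightarrow> bool" where
  "L2_le F s \<longleftrightarrow> F \<in> borel_measurable M \<and> 0 \<le> s \<and> (\<integral>\<^sup>+\<omega>. ennreal ((F \<omega>)\<^sup>2) \<partial>M) \<le> ennreal (s\<^sup>2)"

lemma L2_le_mult:
  assumes F: "L2_le F s" and G: "L2_le G t"
  shows "(\<integral>\<^sup>+\<omega>. ennreal \<bar>F \<omega> * G \<omega>\<bar> \<partial>M) \<le> ennreal (s * t)"
proof -
  have [measurable]: "F \<in> borel_measurable M" "G \<in> borel_measurable M" and st: "0 \<le> s" "0 \<le> t"
    using F G by (auto simp: L2_le_def)
  let ?I = "\<integral>\<^sup>+\<omega>. ennreal \<bar>F \<omega> * G \<omega>\<bar> \<partial>M"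
  have "?I\<^sup>2 = (\<integral>\<^sup>+\<omega>. ennreal \<bar>F \<omega>\<bar> * ennreal \<bar>G \<omega>\<bar> \<partial>M)\<^sup>2"
    by (simp add: abs_mult ennreal_mult)
  also have "\<dots> \<le> (\<integral>\<^sup>+\<omega>. (ennreal \<bar>F \<omega>\<bar>)\<^sup>2 \<partial>M) * (\<integral>\<^sup>+\<omega>. (ennreal \<bar>G \<omega>\<bar>)\<^sup>2 \<partial>M)"
    by (rule Cauchy_Schwarz_nn_integral) measurable
  also have "\<dots> \<le> ennreal (s\<^sup>2) * ennreal (t\<^sup>2)"
    using F G by (intro mult_mono) (auto simp: L2_le_def ennreal_power)
  finally have *: "?I\<^sup>2 \<le> ennreal ((s * t)\<^sup>2)" by (simp add: ennreal_mult power_mult_distrib)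
  show ?thesis
  proof (cases ?I)
    case (real r)
    with * have "r\<^sup>2 \<le> (s * t)\<^sup>2" by (simp add: ennreal_power)
    then have "r \<le> s * t" by (rule power2_le_imp_le) (use st in simp)
    with real show ?thesis by (simp add: ennreal_leI)
  next
    case top
    with * show ?thesis by (simp add: top_unique)
  qed
qed

lemma L2_le_const: "0 \<le> s \<Longrightarrow> L2_le (\<lambda>_. s) s"
  by (simp add: L2_le_def emeasure_space_1)

lemma L2_le_L1:
  assumes F: "L2_le F s"
  shows "(\<integral>\<^sup>+\<omega>. ennreal \<bar>F \<omega>\<bar> \<partial>M) \<le> ennreal s"
  using L2_le_mult[OF F L2_le_const[of 1]] by simp

lemma L2_le_add:
  assumes F: "L2_le F s" and G: "L2_le G t"
  shows "L2_le (\<lambda>\<omega>. F \<omega> + G \<omega>) (s + t)"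
proof -
  have [measurable]: "F \<in> borel_measurable M" "G \<in> borel_measurable M" and st: "0 \<le> s" "0 \<le> t"
    using F G by (auto simp: L2_le_def)
  have "(\<integral>\<^sup>+\<omega>. ennreal ((F \<omega> + G \<omega>)\<^sup>2) \<partial>M) \<le> (\<integral>\<^sup>+\<omega>. ennreal ((F \<omega>)\<^sup>2) + ennreal ((G \<omega>)\<^sup>2) + 2 * ennreal \<bar>F \<omega> * G \<omega>\<bar> \<partial>M)"
  proof (rule nn_integral_mono)
    fix \<omega>
    have "(F \<omega> + G \<omega>)\<^sup>2 \<le> (F \<omega>)\<^sup>2 + (G \<omega>)\<^sup>2 + 2 * \<bar>F \<omega> * G \<omega>\<bar>"
      by (simp add: power2_sum)
    then have "ennreal ((F \<omega> + G \<omega>)\<^sup>2) \<le> ennreal ((F \<omega>)\<^sup>2 + (G \<omega>)\<^sup>2 + 2 * \<bar>F \<omega> * G \<omega>\<bar>)"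
      by (rule ennreal_leI)
    then show "ennreal ((F \<omega> + G \<omega>)\<^sup>2) \<le> ennreal ((F \<omega>)\<^sup>2) + ennreal ((G \<omega>)\<^sup>2) + 2 * ennreal \<bar>F \<omega> * G \<omega>\<bar>"
      by (simp add: ennreal_plus ennreal_mult')
  qed
  also have "\<dots> = (\<integral>\<^sup>+\<omega>. ennreal ((F \<omega>)\<^sup>2) \<partial>M) + (\<integral>\<^sup>+\<omega>. ennreal ((G \<omega>)\<^sup>2) \<partial>M) + 2 * (\<integral>\<^sup>+\<omega>. ennreal \<bar>F \<omega> * G \<omega>\<bar> \<partial>M)"
    by (simp add: nn_integral_add nn_integral_cmult)
  also have "\<dots> \<le> ennreal (s\<^sup>2) + ennreal (t\<^sup>2) + 2 * ennreal (s * t)"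
    using F G by (intro add_mono mult_left_mono L2_le_mult) (auto simp: L2_le_def)
  also have "\<dots> = ennreal ((s + t)\<^sup>2)"
    using st by (simp add: power2_sum ennreal_plus ennreal_mult' mult_ac)
  finally show ?thesis using st by (simp add: L2_le_def)
qed

lemma L2_le_cmult:
  assumes F: "L2_le F s" and k: "0 \<le> k"
  shows "L2_le (\<lambda>\<omega>. k * F \<omega>) (k * s)"
proof -
  have [measurable]: "F \<in> borel_measurable M" using F by (auto simp: L2_le_def)
  have "(\<integral>\<^sup>+\<omega>. ennreal ((k * F \<omega>)\<^sup>2) \<partial>M) = ennreal (k\<^sup>2) * (\<integral>\<^sup>+\<omega>. ennreal ((F \<omega>)\<^sup>2) \<partial>M)"
    by (subst nn_integral_cmult[symmetric]) (auto simp: power_mult_distrib ennreal_mult)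
  also have "\<dots> \<le> ennreal (k\<^sup>2) * ennreal (s\<^sup>2)" using F by (intro mult_left_mono) (auto simp: L2_le_def)
  finally show ?thesis using F k by (simp add: L2_le_def power_mult_distrib ennreal_mult)
qed

lemma L2_le_mono:
  assumes G: "L2_le G s" and [measurable]: "F \<in> borel_measurable M" and le: "AE \<omega> in M. \<bar>F \<omega>\<bar> \<le> \<bar>G \<omega>\<bar>"
  shows "L2_le F s"
proof -
  have "(\<integral>\<^sup>+\<omega>. ennreal ((F \<omega>)\<^sup>2) \<partial>M) \<le> (\<integral>\<^sup>+\<omega>. ennreal ((G \<omega>)\<^sup>2) \<partial>M)"
    using le by (intro nn_integral_mono_AE) (auto elim!: eventually_mono simp: abs_le_square_iff ennreal_leI)
  then show ?thesis using G by (auto simp: L2_le_def)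
qed

lemma L2_le_weaken: "L2_le F s \<Longrightarrow> s \<le> s' \<Longrightarrow> L2_le F s'"
  unfolding L2_le_def by (meson ennreal_leI order_trans power_mono)

end

section \<open>One Euler step from each of two random points\<close>

locale coupled_step = contraction_parameters L K R h + prob_space M
  for L K R h :: real and M :: "'w measure" +
  fixes B :: "'a::euclidean_space \<Rightarrow> 'u::euclidean_space \<Rightarrow> 'a" and b :: "'a \<Rightarrow> 'a" and \<sigma> :: real
  assumes B: "(\<lambda>(x, u). B x u) \<in> borel_measurable (borel \<Otimes>\<^sub>M borel)"
begin

lemma measurable_B [measurable (raw)]:
  assumes [measurable]: "p \<in> borel_measurable N" "v \<in> borel_measurable N"
  shows "(\<lambda>\<omega>. B (p \<omega>) (v \<omega>)) \<in> borel_measurable N"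
  using measurable_compose[OF _ B, of "\<lambda>\<omega>. (p \<omega>, v \<omega>)" N] by simp

definition euler :: "'a \<Rightarrow> 'u \<Rightarrow> 'a \<Rightarrow> 'a" where
  "euler x u z = x + h *\<^sub>R B x u + sqrt h *\<^sub>R z"

text \<open>The noise of the step from \<open>x\<close> is built from that of the step from
  \<open>y\<close>, and not conversely, because the Gaussians of the latter are shared with the
  coarse step.\<close>

definition euler_coupled :: "'a \<Rightarrow> 'a \<Rightarrow> 'u \<Rightarrow> 'a \<Rightarrow> real \<Rightarrow> 'a" where
  "euler_coupled x y u z t = euler x u (coupled_noise (y + h *\<^sub>R B y u - (x + h *\<^sub>R B x u)) z t)"

lemma measurable_euler [measurable (raw)]:
  assumes [measurable]: "x \<in> borel_measurable N" "u \<in> borel_measurable N" "z \<in> borel_measurable N"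
  shows "(\<lambda>\<omega>. euler (x \<omega>) (u \<omega>) (z \<omega>)) \<in> borel_measurable N"
  unfolding euler_def by measurable

lemma measurable_euler_coupled [measurable (raw)]:
  assumes [measurable]: "x \<in> borel_measurable N" "y \<in> borel_measurable N" "u \<in> borel_measurable N"
    "z \<in> borel_measurable N" "t \<in> borel_measurable N"
  shows "(\<lambda>\<omega>. euler_coupled (x \<omega>) (y \<omega>) (u \<omega>) (z \<omega>) (t \<omega>)) \<in> borel_measurable N"
  unfolding euler_coupled_def by measurable

lemma euler_dist:
  "norm (euler_coupled x y u z t - euler y u z)
    = norm ((y + h *\<^sub>R B y u - (x + h *\<^sub>R B x u)) + sqrt h *\<^sub>R z
        - sqrt h *\<^sub>R coupled_noise (y + h *\<^sub>R B y u - (x + h *\<^sub>R B x u)) z t)"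
  unfolding euler_coupled_def euler_def by (subst norm_minus_commute) (simp add: algebra_simps)

lemma drift_diff_le:
  assumes "norm (B x u - B y u) \<le> L * norm (x - y)"
  shows "norm (y + h *\<^sub>R B y u - (x + h *\<^sub>R B x u)) \<le> (1 + h * L) * norm (x - y)"
proof -
  have "y + h *\<^sub>R B y u - (x + h *\<^sub>R B x u) = - ((x - y) + h *\<^sub>R (B x u - B y u))"
    by (simp add: algebra_simps)
  then have "norm (y + h *\<^sub>R B y u - (x + h *\<^sub>R B x u)) \<le> norm (x - y) + norm (h *\<^sub>R (B x u - B y u))"
    by (metis norm_minus_cancel norm_triangle_ineq)
  also have "norm (h *\<^sub>R (B x u - B y u)) \<le> h * (L * norm (x - y))"
    using assms h by simp
  finally show ?thesis by (simp add: algebra_simps)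
qed

text \<open>Expanding the square gives 1 - 2 h K + h^2 L^2. Half of the dissipation pays for the
  quadratic term, since h L^2 \<le> K by the first entry of \<open>h0\<close>.\<close>

lemma drift_diff_contract:
  assumes Lip: "norm (B x u - B y u) \<le> L * norm (x - y)"
    and con: "(x - y) \<bullet> (B x u - B y u) \<le> - K * (norm (x - y))\<^sup>2"
  shows "(norm (y + h *\<^sub>R B y u - (x + h *\<^sub>R B x u)))\<^sup>2 \<le> (1 - h * K) * (norm (x - y))\<^sup>2"
proof -
  let ?r = "norm (x - y)"
  have "y + h *\<^sub>R B y u - (x + h *\<^sub>R B x u) = - ((x - y) + h *\<^sub>R (B x u - B y u))"
    by (simp add: algebra_simps)
  then have "(norm (y + h *\<^sub>R B y u - (x + h *\<^sub>R B x u)))\<^sup>2 = (norm ((x - y) + h *\<^sub>R (B x u - B y u)))\<^sup>2"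
    by (simp only: norm_minus_cancel)
  also have "\<dots> = ?r\<^sup>2 + 2 * h * ((x - y) \<bullet> (B x u - B y u)) + h\<^sup>2 * (norm (B x u - B y u))\<^sup>2"
    unfolding power2_norm_eq_inner by (simp add: inner_add_left inner_add_right inner_commute power2_eq_square)
  also have "\<dots> \<le> ?r\<^sup>2 + 2 * h * (- K * ?r\<^sup>2) + h\<^sup>2 * (L * ?r)\<^sup>2"
    using Lip con h by (intro add_mono mult_left_mono power_mono) auto
  also have "\<dots> = (1 - 2 * h * K + h * (h * L\<^sup>2)) * ?r\<^sup>2"
    by (simp add: algebra_simps power2_eq_square)
  also have "\<dots> \<le> (1 - 2 * h * K + h * K) * ?r\<^sup>2"
    using hLL h by (intro mult_right_mono add_left_mono mult_left_mono) auto
  finally show ?thesis by (simp add: algebra_simps)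
qed

lemma prob_space_noise: "prob_space (gaussian \<Otimes>\<^sub>M unif :: ('a \<times> real) measure)"
  by (intro prob_space_pair prob_space_gaussian prob_space_unif)

context
  fixes x y z :: "'w \<Rightarrow> 'a" and u :: "'w \<Rightarrow> 'u" and t :: "'w \<Rightarrow> real" and \<mu> :: "'u measure"
  assumes ind: "indep_law (borel \<Otimes>\<^sub>M borel) (\<lambda>\<omega>. (x \<omega>, y \<omega>)) (borel \<Otimes>\<^sub>M (borel \<Otimes>\<^sub>M borel)) (\<lambda>\<omega>. (u \<omega>, z \<omega>, t \<omega>))"
    and ind': "indep_law borel u (borel \<Otimes>\<^sub>M borel) (\<lambda>\<omega>. (z \<omega>, t \<omega>))"
    and u: "distr M borel u = \<mu>" and driver: "driver L K R \<sigma> B b \<mu>"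
    and zt: "distr M (borel \<Otimes>\<^sub>M borel) (\<lambda>\<omega>. (z \<omega>, t \<omega>)) = gaussian \<Otimes>\<^sub>M unif"
begin

lemma step_random_variables [measurable]:
  "x \<in> borel_measurable M" "y \<in> borel_measurable M" "u \<in> borel_measurable M" "z \<in> borel_measurable M" "t \<in> borel_measurable M"
proof -
  have xy: "(\<lambda>\<omega>. (x \<omega>, y \<omega>)) \<in> measurable M (borel \<Otimes>\<^sub>M borel)" and zt: "(\<lambda>\<omega>. (z \<omega>, t \<omega>)) \<in> measurable M (borel \<Otimes>\<^sub>M borel)"
    and "u \<in> borel_measurable M"
    using ind ind' by (auto simp: indep_law_def)
  then show "u \<in> borel_measurable M" by simp
  show "x \<in> borel_measurable M" "y \<in> borel_measurable M" "z \<in> borel_measurable M" "t \<in> borel_measurable M"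
    using measurable_compose[OF xy measurable_fst] measurable_compose[OF xy measurable_snd]
      measurable_compose[OF zt measurable_fst] measurable_compose[OF zt measurable_snd] by simp_all
qed

lemma step_integral:
  assumes G[measurable]: "G \<in> borel_measurable ((borel \<Otimes>\<^sub>M borel) \<Otimes>\<^sub>M (borel \<Otimes>\<^sub>M (borel \<Otimes>\<^sub>M borel)))"
  shows "(\<integral>\<^sup>+\<omega>. G ((x \<omega>, y \<omega>), (u \<omega>, z \<omega>, t \<omega>)) \<partial>M)
    = (\<integral>\<^sup>+\<omega>. (\<integral>\<^sup>+v. \<integral>\<^sup>+w. \<integral>\<^sup>+s. G ((x \<omega>, y \<omega>), (v, w, s)) \<partial>unif \<partial>gaussian \<partial>\<mu>) \<partial>M)"
proof -
  interpret \<mu>: prob_space \<mu> by (rule driverD(1)[OF driver])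
  interpret un: prob_space unif by (rule prob_space_unif)
  interpret ga: prob_space "gaussian :: 'a measure" by (rule prob_space_gaussian)
  interpret gu: prob_space "gaussian \<Otimes>\<^sub>M unif :: ('a \<times> real) measure" by (rule prob_space_noise)
  have s\<mu>[measurable_cong]: "sets \<mu> = sets borel" by (rule driverD(2)[OF driver])
  have law: "distr M (borel \<Otimes>\<^sub>M (borel \<Otimes>\<^sub>M borel)) (\<lambda>\<omega>. (u \<omega>, z \<omega>, t \<omega>)) = \<mu> \<Otimes>\<^sub>M (gaussian \<Otimes>\<^sub>M unif)"
    using ind' by (simp add: indep_law_def u zt)
  have "(\<integral>\<^sup>+\<omega>. G ((x \<omega>, y \<omega>), (u \<omega>, z \<omega>, t \<omega>)) \<partial>M) = (\<integral>\<^sup>+p. \<integral>\<^sup>+r. G (p, r) \<partial>(\<mu> \<Otimes>\<^sub>M (gaussian \<Otimes>\<^sub>M unif)) \<partial>distr M (borel \<Otimes>\<^sub>M borel) (\<lambda>\<omega>. (x \<omega>, y \<omega>)))"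
    by (subst nn_integral_indep_law[OF ind G]) (simp only: law)
  also have "\<dots> = (\<integral>\<^sup>+p. (\<integral>\<^sup>+v. \<integral>\<^sup>+w. \<integral>\<^sup>+s. G (p, (v, w, s)) \<partial>unif \<partial>gaussian \<partial>\<mu>) \<partial>distr M (borel \<Otimes>\<^sub>M borel) (\<lambda>\<omega>. (x \<omega>, y \<omega>)))"
  proof (rule nn_integral_cong)
    fix p :: "'a \<times> 'a"
    have [measurable]: "p \<in> space (borel \<Otimes>\<^sub>M borel)" by (simp add: space_pair_measure)
    have "(\<integral>\<^sup>+r. G (p, r) \<partial>(\<mu> \<Otimes>\<^sub>M (gaussian \<Otimes>\<^sub>M unif))) = (\<integral>\<^sup>+v. \<integral>\<^sup>+r. G (p, v, r) \<partial>(gaussian \<Otimes>\<^sub>M unif) \<partial>\<mu>)"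
      by (rule gu.nn_integral_fst[symmetric]) measurable
    also have "\<dots> = (\<integral>\<^sup>+v. \<integral>\<^sup>+w. \<integral>\<^sup>+s. G (p, (v, w, s)) \<partial>unif \<partial>gaussian \<partial>\<mu>)"
      by (intro nn_integral_cong un.nn_integral_fst[symmetric]) measurable
    finally show "(\<integral>\<^sup>+r. G (p, r) \<partial>(\<mu> \<Otimes>\<^sub>M (gaussian \<Otimes>\<^sub>M unif))) = (\<integral>\<^sup>+v. \<integral>\<^sup>+w. \<integral>\<^sup>+s. G (p, (v, w, s)) \<partial>unif \<partial>gaussian \<partial>\<mu>)" .
  qed
  also have "\<dots> = (\<integral>\<^sup>+\<omega>. (\<integral>\<^sup>+v. \<integral>\<^sup>+w. \<integral>\<^sup>+s. G ((x \<omega>, y \<omega>), (v, w, s)) \<partial>unif \<partial>gaussian \<partial>\<mu>) \<partial>M)"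
    by (rule nn_integral_distr) measurable
  finally show ?thesis .
qed

text \<open>With the points fixed, the bounds of (b) hold for almost every value of
  \<open>u\<close>, and for such a value the noise contracts on average. The random points are
  averaged last.\<close>

lemma step_contracts:
  "(\<integral>\<^sup>+\<omega>. ennreal (f (norm (euler_coupled (x \<omega>) (y \<omega>) (u \<omega>) (z \<omega>) (t \<omega>) - euler (y \<omega>) (u \<omega>) (z \<omega>)))) \<partial>M)
   \<le> ennreal (1 - c * h) * (\<integral>\<^sup>+\<omega>. ennreal (f (norm (x \<omega> - y \<omega>))) \<partial>M)"
proof -
  interpret \<mu>: prob_space \<mu> by (rule driverD(1)[OF driver])
  have "(\<integral>\<^sup>+\<omega>. ennreal (f (norm (euler_coupled (x \<omega>) (y \<omega>) (u \<omega>) (z \<omega>) (t \<omega>) - euler (y \<omega>) (u \<omega>) (z \<omega>)))) \<partial>M)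
    = (\<integral>\<^sup>+\<omega>. (\<integral>\<^sup>+v. \<integral>\<^sup>+w. \<integral>\<^sup>+s. ennreal (f (norm (euler_coupled (x \<omega>) (y \<omega>) v w s - euler (y \<omega>) v w))) \<partial>unif \<partial>gaussian \<partial>\<mu>) \<partial>M)"
    using step_integral[of "\<lambda>p. ennreal (f (norm (euler_coupled (fst (fst p)) (snd (fst p)) (fst (snd p)) (fst (snd (snd p))) (snd (snd (snd p))) - euler (snd (fst p)) (fst (snd p)) (fst (snd (snd p))))))"] by simp
  also have "\<dots> \<le> (\<integral>\<^sup>+\<omega>. ennreal (1 - c * h) * ennreal (f (norm (x \<omega> - y \<omega>))) \<partial>M)"
  proof (rule nn_integral_mono)
    fix \<omega>
    let ?x = "x \<omega>" and ?y = "y \<omega>"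
    have "AE v in \<mu>. (\<integral>\<^sup>+w. \<integral>\<^sup>+s. ennreal (f (norm (euler_coupled ?x ?y v w s - euler ?y v w))) \<partial>unif \<partial>gaussian)
      \<le> ennreal ((1 - c * h) * f (norm (?x - ?y)))"
    proof (cases "R \<le> norm (?x - ?y)")
      case True
      show ?thesis
        using driverD(6)[OF driver, of ?x ?y] driverD(7)[OF driver True]
      proof eventually_elim
        case (elim v)
        show ?case
          unfolding euler_dist
          by (rule coupling_contracts) (use elim in \<open>auto intro!: drift_diff_le drift_diff_contract\<close>)
      qed
    next
      case False
      show ?thesis
        using driverD(6)[OF driver, of ?x ?y]
      proof eventually_elim
        case (elim v)
        show ?case
          unfolding euler_dist
          by (rule coupling_contracts) (use elim False in \<open>auto intro!: drift_diff_le\<close>)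
      qed
    qed
    then have "(\<integral>\<^sup>+v. \<integral>\<^sup>+w. \<integral>\<^sup>+s. ennreal (f (norm (euler_coupled ?x ?y v w s - euler ?y v w))) \<partial>unif \<partial>gaussian \<partial>\<mu>)
       \<le> (\<integral>\<^sup>+v. ennreal ((1 - c * h) * f (norm (?x - ?y))) \<partial>\<mu>)"
      by (rule nn_integral_mono_AE)
    then show "(\<integral>\<^sup>+v. \<integral>\<^sup>+w. \<integral>\<^sup>+s. ennreal (f (norm (euler_coupled ?x ?y v w s - euler ?y v w))) \<partial>unif \<partial>gaussian \<partial>\<mu>)
       \<le> ennreal (1 - c * h) * ennreal (f (norm (?x - ?y)))"
      using ch_bounds by (simp add: \<mu>.emeasure_space_1 ennreal_mult f_nonneg)
  qed
  also have "\<dots> = ennreal (1 - c * h) * (\<integral>\<^sup>+\<omega>. ennreal (f (norm (x \<omega> - y \<omega>))) \<partial>M)"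
    by (rule nn_integral_cmult) measurable
  finally show ?thesis .
qed

text \<open>The coupled noise is Gaussian once its inputs are averaged, whatever the drifted
  difference is, so every trace of \<open>y\<close> disappears. This keeps the fine marginal
  correct.\<close>

lemma step_law:
  assumes [measurable]: "F \<in> borel_measurable borel"
  shows "(\<integral>\<^sup>+\<omega>. F (euler_coupled (x \<omega>) (y \<omega>) (u \<omega>) (z \<omega>) (t \<omega>)) \<partial>M)
    = (\<integral>\<^sup>+\<omega>. \<integral>\<^sup>+v. \<integral>\<^sup>+w. F (euler (x \<omega>) v w) \<partial>gaussian \<partial>\<mu> \<partial>M)"
proof -
  have "(\<integral>\<^sup>+\<omega>. F (euler_coupled (x \<omega>) (y \<omega>) (u \<omega>) (z \<omega>) (t \<omega>)) \<partial>M)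
    = (\<integral>\<^sup>+\<omega>. (\<integral>\<^sup>+v. \<integral>\<^sup>+w. \<integral>\<^sup>+s. F (euler_coupled (x \<omega>) (y \<omega>) v w s) \<partial>unif \<partial>gaussian \<partial>\<mu>) \<partial>M)"
    using step_integral[of "\<lambda>p. F (euler_coupled (fst (fst p)) (snd (fst p)) (fst (snd p)) (fst (snd (snd p))) (snd (snd (snd p))))"] by simp
  also have "\<dots> = (\<integral>\<^sup>+\<omega>. \<integral>\<^sup>+v. \<integral>\<^sup>+w. F (euler (x \<omega>) v w) \<partial>gaussian \<partial>\<mu> \<partial>M)"
  proof (rule nn_integral_cong, rule nn_integral_cong)
    fix \<omega> v
    show "(\<integral>\<^sup>+w. \<integral>\<^sup>+s. F (euler_coupled (x \<omega>) (y \<omega>) v w s) \<partial>unif \<partial>gaussian) = (\<integral>\<^sup>+w. F (euler (x \<omega>) v w) \<partial>gaussian)"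
      unfolding euler_coupled_def by (rule nn_integral_coupled_noise) measurable
  qed
  finally show ?thesis .
qed

text \<open>A bound on the distance itself, not on the mean of \<open>f\<close>: it supplies the
  second moment for the Cauchy-Schwarz estimate of the cross term.\<close>

lemma step_dist_le:
  "AE \<omega> in M. norm (euler_coupled (x \<omega>) (y \<omega>) (u \<omega>) (z \<omega>) (t \<omega>) - euler (y \<omega>) (u \<omega>) (z \<omega>))
     \<le> (1 + h * L) * norm (x \<omega> - y \<omega>) + sqrt H"
proof -
  have xyu: "indep_law (borel \<Otimes>\<^sub>M borel) (\<lambda>\<omega>. (x \<omega>, y \<omega>)) borel u"
    by (rule indep_law_compose[OF ind, where g="\<lambda>p. p" and k=fst]) auto
  have "AE \<omega> in M. norm (B (fst (x \<omega>, y \<omega>)) (u \<omega>) - B (snd (x \<omega>, y \<omega>)) (u \<omega>)) \<le> L * norm (fst (x \<omega>, y \<omega>) - snd (x \<omega>, y \<omega>))"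
    by (rule indep_law_AE[OF xyu, where Q="\<lambda>p v. norm (B (fst p) v - B (snd p) v) \<le> L * norm (fst p - snd p)"])
       (measurable, unfold u, rule driverD(6)[OF driver])
  then show ?thesis
  proof eventually_elim
    case (elim \<omega>)
    then show ?case
      unfolding euler_dist using norm_coupled_noise_le drift_diff_le by (smt (verit) fst_conv snd_conv)
  qed
qed

text \<open>For \<open>C\<close> equal to \<open>C_IEul2h\<close> the expression multiplied by h^2
  is \<open>C_ISM\<close>. Given \<open>y\<close> and \<open>u\<close>, the centred Gaussian
  contributes h d separately.\<close>

lemma increment_mean_square:
  assumes C: "(\<integral>\<^sup>+\<omega>. ennreal ((norm (y \<omega>))\<^sup>2) \<partial>M) \<le> ennreal C" "0 \<le> C"
  shows "(\<integral>\<^sup>+\<omega>. ennreal ((norm (euler (y \<omega>) (u \<omega>) (z \<omega>) - y \<omega>))\<^sup>2) \<partial>M)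
    \<le> ennreal (h\<^sup>2 * (C * (\<sigma>\<^sup>2 + 2 * L\<^sup>2) + \<sigma>\<^sup>2 + 2 * (norm (b 0))\<^sup>2) + h * real DIM('a))"
proof -
  interpret \<mu>: prob_space \<mu> by (rule driverD(1)[OF driver])
  interpret un: prob_space unif by (rule prob_space_unif)
  have s\<mu>[measurable_cong]: "sets \<mu> = sets borel" by (rule driverD(2)[OF driver])
  let ?d = "real DIM('a)"
  let ?P = "\<lambda>x. (\<sigma>\<^sup>2 + 2 * L\<^sup>2) * (norm x)\<^sup>2 + (\<sigma>\<^sup>2 + 2 * (norm (b 0))\<^sup>2)"
  have "(\<integral>\<^sup>+w. ennreal ((norm (euler x v w - x))\<^sup>2) \<partial>gaussian) = ennreal (h\<^sup>2) * ennreal ((norm (B x v))\<^sup>2) + ennreal (h * ?d)" for x v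
  proof -
    have sq: "ennreal ((norm (sqrt h *\<^sub>R w))\<^sup>2) = ennreal h * ennreal ((norm w)\<^sup>2)" for w :: 'a
      using h by (simp add: power_mult_distrib ennreal_mult)
    have g2: "(\<integral>\<^sup>+w. ennreal ((norm (sqrt h *\<^sub>R (w::'a)))\<^sup>2) \<partial>gaussian) = ennreal (h * ?d)"
      unfolding sq using h by (subst nn_integral_cmult) (auto simp: nn_integral_gaussian_norm_square ennreal_mult)
    have "(\<integral>\<^sup>+w. ennreal ((norm (euler x v w - x))\<^sup>2) \<partial>gaussian) = (\<integral>\<^sup>+w. ennreal ((norm (h *\<^sub>R B x v + sqrt h *\<^sub>R w))\<^sup>2) \<partial>gaussian)"
      by (simp add: euler_def)
    also have "\<dots> = ennreal ((norm (h *\<^sub>R B x v))\<^sup>2) + ennreal (h * ?d)"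
      using g2 by (subst nn_integral_bias_variance[OF prob_space_gaussian]) (auto simp: integrable_gaussian_id integral_gaussian_id)
    finally show ?thesis using h by (simp add: power_mult_distrib ennreal_mult)
  qed
  note inner = this
  have "(\<integral>\<^sup>+\<omega>. ennreal ((norm (euler (y \<omega>) (u \<omega>) (z \<omega>) - y \<omega>))\<^sup>2) \<partial>M)
    = (\<integral>\<^sup>+\<omega>. (\<integral>\<^sup>+v. \<integral>\<^sup>+w. \<integral>\<^sup>+s. ennreal ((norm (euler (y \<omega>) v w - y \<omega>))\<^sup>2) \<partial>unif \<partial>gaussian \<partial>\<mu>) \<partial>M)"
    using step_integral[of "\<lambda>p. ennreal ((norm (euler (snd (fst p)) (fst (snd p)) (fst (snd (snd p))) - snd (fst p)))\<^sup>2)"] by simp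
  also have "\<dots> = (\<integral>\<^sup>+\<omega>. (\<integral>\<^sup>+v. ennreal (h\<^sup>2) * ennreal ((norm (B (y \<omega>) v))\<^sup>2) + ennreal (h * ?d) \<partial>\<mu>) \<partial>M)"
    by (simp add: un.emeasure_space_1[simplified] inner)
  also have "\<dots> \<le> (\<integral>\<^sup>+\<omega>. ennreal (h\<^sup>2 * (\<sigma>\<^sup>2 + 2 * L\<^sup>2)) * ennreal ((norm (y \<omega>))\<^sup>2) + ennreal (h\<^sup>2 * (\<sigma>\<^sup>2 + 2 * (norm (b 0))\<^sup>2) + h * ?d) \<partial>M)"
  proof (rule nn_integral_mono)
    fix \<omega>
    have "(\<integral>\<^sup>+v. ennreal (h\<^sup>2) * ennreal ((norm (B (y \<omega>) v))\<^sup>2) + ennreal (h * ?d) \<partial>\<mu>)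
      = ennreal (h\<^sup>2) * (\<integral>\<^sup>+v. ennreal ((norm (B (y \<omega>) v))\<^sup>2) \<partial>\<mu>) + ennreal (h * ?d)"
      by (subst nn_integral_add) (auto simp: nn_integral_cmult \<mu>.emeasure_space_1)
    also have "\<dots> \<le> ennreal (h\<^sup>2) * ennreal (?P (y \<omega>)) + ennreal (h * ?d)"
      by (intro add_right_mono mult_left_mono driver_mean_square[OF driver]) (use pos in auto)
    also have "\<dots> = ennreal (h\<^sup>2 * ?P (y \<omega>) + h * ?d)"
      using h by (simp add: ennreal_mult ennreal_plus)
    also have "h\<^sup>2 * ?P (y \<omega>) + h * ?d = h\<^sup>2 * (\<sigma>\<^sup>2 + 2 * L\<^sup>2) * (norm (y \<omega>))\<^sup>2 + (h\<^sup>2 * (\<sigma>\<^sup>2 + 2 * (norm (b 0))\<^sup>2) + h * ?d)"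
      by (simp add: algebra_simps)
    also have "ennreal \<dots> = ennreal (h\<^sup>2 * (\<sigma>\<^sup>2 + 2 * L\<^sup>2)) * ennreal ((norm (y \<omega>))\<^sup>2) + ennreal (h\<^sup>2 * (\<sigma>\<^sup>2 + 2 * (norm (b 0))\<^sup>2) + h * ?d)"
      using h by (subst ennreal_plus) (auto simp: ennreal_mult'')
    finally show "(\<integral>\<^sup>+v. ennreal (h\<^sup>2) * ennreal ((norm (B (y \<omega>) v))\<^sup>2) + ennreal (h * ?d) \<partial>\<mu>)
       \<le> ennreal (h\<^sup>2 * (\<sigma>\<^sup>2 + 2 * L\<^sup>2)) * ennreal ((norm (y \<omega>))\<^sup>2) + ennreal (h\<^sup>2 * (\<sigma>\<^sup>2 + 2 * (norm (b 0))\<^sup>2) + h * ?d)" .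
  qed
  also have "\<dots> = ennreal (h\<^sup>2 * (\<sigma>\<^sup>2 + 2 * L\<^sup>2)) * (\<integral>\<^sup>+\<omega>. ennreal ((norm (y \<omega>))\<^sup>2) \<partial>M) + ennreal (h\<^sup>2 * (\<sigma>\<^sup>2 + 2 * (norm (b 0))\<^sup>2) + h * ?d)"
    by (subst nn_integral_add) (auto simp: nn_integral_cmult emeasure_space_1)
  also have "\<dots> \<le> ennreal (h\<^sup>2 * (\<sigma>\<^sup>2 + 2 * L\<^sup>2)) * ennreal C + ennreal (h\<^sup>2 * (\<sigma>\<^sup>2 + 2 * (norm (b 0))\<^sup>2) + h * ?d)"
    by (intro add_right_mono mult_left_mono C) auto
  also have "\<dots> = ennreal (h\<^sup>2 * (\<sigma>\<^sup>2 + 2 * L\<^sup>2) * C + (h\<^sup>2 * (\<sigma>\<^sup>2 + 2 * (norm (b 0))\<^sup>2) + h * ?d))"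
    using h C by (subst ennreal_plus) (auto simp: ennreal_mult'')
  finally show ?thesis by (simp add: algebra_simps)
qed

end

declare step_random_variables [measurable del]

end

lemma (in prob_space) distr_indep_pair:
  assumes "indep_law borel z1 borel z2" "distr M borel z1 = \<nu>" "distr M borel z2 = \<nu>"
    and g[measurable]: "(\<lambda>p. g (fst p) (snd p)) \<in> borel_measurable (borel \<Otimes>\<^sub>M borel)"
  shows "distr M borel (\<lambda>\<omega>. g (z1 \<omega>) (z2 \<omega>)) = distr (\<nu> \<Otimes>\<^sub>M \<nu>) borel (\<lambda>p. g (fst p) (snd p))"
proof -
  have [measurable]: "z1 \<in> borel_measurable M" "z2 \<in> borel_measurable M" using assms by (auto simp: indep_law_def)
  have "distr (\<nu> \<Otimes>\<^sub>M \<nu>) borel (\<lambda>p. g (fst p) (snd p))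
     = distr (distr M (borel \<Otimes>\<^sub>M borel) (\<lambda>\<omega>. (z1 \<omega>, z2 \<omega>))) borel (\<lambda>p. g (fst p) (snd p))"
    using assms by (simp add: indep_law_def)
  also have "\<dots> = distr M borel (\<lambda>\<omega>. g (z1 \<omega>) (z2 \<omega>))"
    by (subst distr_distr) (auto simp: comp_def)
  finally show ?thesis by simp
qed

text \<open>The two variables live on different probability spaces. Their laws agree because the
  starting laws and the transition kernels do.\<close>

lemma (in coupled_step) euler_kernel_law:
  assumes [measurable]: "X \<in> borel_measurable M" "X' \<in> borel_measurable M"
    and N: "prob_space N" and [measurable]: "Y \<in> borel_measurable N" "Y' \<in> borel_measurable N"
    and XY: "distr M borel X = distr N borel Y" and \<mu>: "prob_space \<mu>" and s\<mu>[measurable_cong]: "sets \<mu> = sets borel"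
    and X': "\<And>F. F \<in> borel_measurable borel \<Longrightarrow>
      (\<integral>\<^sup>+\<omega>. F (X' \<omega>) \<partial>M) = (\<integral>\<^sup>+\<omega>. \<integral>\<^sup>+v. \<integral>\<^sup>+w. F (euler (X \<omega>) v w) \<partial>gaussian \<partial>\<mu> \<partial>M)"
    and Y': "\<And>F. F \<in> borel_measurable borel \<Longrightarrow>
      (\<integral>\<^sup>+\<omega>. F (Y' \<omega>) \<partial>N) = (\<integral>\<^sup>+a. \<integral>\<^sup>+v. \<integral>\<^sup>+w. F (euler a v w) \<partial>gaussian \<partial>\<mu> \<partial>distr N borel Y)"
  shows "distr M borel X' = distr N borel Y'"
proof (rule measure_eqI)
  interpret \<mu>: prob_space \<mu> by fact
  interpret ga: prob_space "gaussian :: 'a measure" by (rule prob_space_gaussian)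
  fix A assume "A \<in> sets (distr M borel X')"
  then have [measurable]: "A \<in> sets borel" by simp
  have e: "emeasure (distr Q borel V) A = (\<integral>\<^sup>+\<omega>. indicator A (V \<omega>) \<partial>Q)"
    if [measurable]: "V \<in> borel_measurable Q" for Q :: "'c measure" and V
    by (subst nn_integral_indicator[symmetric], simp, subst nn_integral_distr) auto
  have e': "emeasure (distr N borel Y') A = (\<integral>\<^sup>+\<omega>. indicator A (Y' \<omega>) \<partial>N)"
    by (subst nn_integral_indicator[symmetric], simp, subst nn_integral_distr) auto
  have "emeasure (distr M borel X') A = (\<integral>\<^sup>+\<omega>. \<integral>\<^sup>+v. \<integral>\<^sup>+w. indicator A (euler (X \<omega>) v w) \<partial>gaussian \<partial>\<mu> \<partial>M)"
    by (subst nn_integral_indicator[symmetric], simp, subst nn_integral_distr) (auto simp: X')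
  also have "\<dots> = (\<integral>\<^sup>+a. \<integral>\<^sup>+v. \<integral>\<^sup>+w. indicator A (euler a v w) \<partial>gaussian \<partial>\<mu> \<partial>distr M borel X)"
    by (rule nn_integral_distr[symmetric]) measurable
  also have "\<dots> = emeasure (distr N borel Y') A"
    unfolding XY e' by (rule Y'[symmetric]) measurable
  finally show "emeasure (distr M borel X') A = emeasure (distr N borel Y') A" .
qed simp

context coupled_step
begin

context
  fixes x y z1 z2 :: "'w \<Rightarrow> 'a" and u1 u2 u3 :: "'w \<Rightarrow> 'u" and t1 t2 :: "'w \<Rightarrow> real" and \<mu>1 \<mu>2 :: "'u measure"
    and Lu ac C Cf \<delta> sy :: real
  assumes p_vw: "indep_law (borel \<Otimes>\<^sub>M borel) (\<lambda>\<omega>. (x \<omega>, y \<omega>))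
      ((borel \<Otimes>\<^sub>M (borel \<Otimes>\<^sub>M borel)) \<Otimes>\<^sub>M ((borel \<Otimes>\<^sub>M borel) \<Otimes>\<^sub>M (borel \<Otimes>\<^sub>M borel)))
      (\<lambda>\<omega>. ((u1 \<omega>, u2 \<omega>, u3 \<omega>), ((z1 \<omega>, t1 \<omega>), (z2 \<omega>, t2 \<omega>))))"
    and v_w: "indep_law (borel \<Otimes>\<^sub>M (borel \<Otimes>\<^sub>M borel)) (\<lambda>\<omega>. (u1 \<omega>, u2 \<omega>, u3 \<omega>))
      ((borel \<Otimes>\<^sub>M borel) \<Otimes>\<^sub>M (borel \<Otimes>\<^sub>M borel)) (\<lambda>\<omega>. ((z1 \<omega>, t1 \<omega>), (z2 \<omega>, t2 \<omega>)))"
    and w12: "indep_law (borel \<Otimes>\<^sub>M borel) (\<lambda>\<omega>. (z1 \<omega>, t1 \<omega>)) (borel \<Otimes>\<^sub>M borel) (\<lambda>\<omega>. (z2 \<omega>, t2 \<omega>))"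
    and u12: "indep_law borel u1 borel u2"
    and \<mu>: "distr M borel u1 = \<mu>1" "distr M borel u2 = \<mu>2" and D: "driver L K R \<sigma> B b \<mu>1" "driver L K R \<sigma> B b \<mu>2"
    and zt: "distr M (borel \<Otimes>\<^sub>M borel) (\<lambda>\<omega>. (z1 \<omega>, t1 \<omega>)) = gaussian \<Otimes>\<^sub>M unif"
      "distr M (borel \<Otimes>\<^sub>M borel) (\<lambda>\<omega>. (z2 \<omega>, t2 \<omega>)) = gaussian \<Otimes>\<^sub>M unif"
begin

text \<open>\<open>u1\<close>, \<open>u2\<close> drive the two fine steps and \<open>u3\<close>,
  which may depend on both, the coarse one. \<open>X1\<close>, \<open>X2\<close> continue the fine
  side of the coupling, \<open>Y1\<close>, \<open>Y2\<close> are auxiliary fine steps from the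
  coarse point \<open>y\<close>, and \<open>Yc\<close> is the coarse step with the same Gaussians.
  \<open>X2\<close> and \<open>Y2\<close> contract towards each other, while \<open>Y2 - Yc\<close>
  is a discretisation defect.\<close>

definition "X1 \<omega> = euler_coupled (x \<omega>) (y \<omega>) (u1 \<omega>) (z1 \<omega>) (t1 \<omega>)"
definition "Y1 \<omega> = euler (y \<omega>) (u1 \<omega>) (z1 \<omega>)"
definition "X2 \<omega> = euler_coupled (X1 \<omega>) (Y1 \<omega>) (u2 \<omega>) (z2 \<omega>) (t2 \<omega>)"
definition "Y2 \<omega> = euler (Y1 \<omega>) (u2 \<omega>) (z2 \<omega>)"
definition "Yc \<omega> = y \<omega> + (2 * h) *\<^sub>R B (y \<omega>) (u3 \<omega>) + sqrt (2 * h) *\<^sub>R ((1 / sqrt 2) *\<^sub>R (z1 \<omega> + z2 \<omega>))"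

lemma ind1: "indep_law (borel \<Otimes>\<^sub>M borel) (\<lambda>\<omega>. (x \<omega>, y \<omega>)) (borel \<Otimes>\<^sub>M (borel \<Otimes>\<^sub>M borel)) (\<lambda>\<omega>. (u1 \<omega>, z1 \<omega>, t1 \<omega>))"
  by (rule indep_law_compose[OF p_vw, where g="\<lambda>p. p" and k="\<lambda>p. (fst (fst p), fst (snd p))"]) auto

lemma ind1': "indep_law borel u1 (borel \<Otimes>\<^sub>M borel) (\<lambda>\<omega>. (z1 \<omega>, t1 \<omega>))"
  by (rule indep_law_compose[OF v_w, where g=fst and k=fst]) auto

lemmas step1 = ind1 ind1' \<mu>(1) D(1) zt(1)
lemmas step1_rvs [measurable] = step_random_variables[OF step1]

lemma u3_measurable [measurable]: "u3 \<in> borel_measurable M"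
proof -
  have "(\<lambda>\<omega>. (u1 \<omega>, u2 \<omega>, u3 \<omega>)) \<in> measurable M (borel \<Otimes>\<^sub>M (borel \<Otimes>\<^sub>M borel))"
    using v_w unfolding indep_law_def by blast
  from measurable_compose[OF this measurable_compose[OF measurable_snd measurable_snd]]
  show ?thesis by (simp only: snd_conv)
qed

text \<open>The past of the second step consists of the points and of the noise of the first step.
  \<open>u3\<close> stays outside, since it may depend on \<open>u2\<close>.\<close>

lemma past_indep:
  "indep_law ((borel \<Otimes>\<^sub>M borel) \<Otimes>\<^sub>M ((borel \<Otimes>\<^sub>M borel) \<Otimes>\<^sub>M borel)) (\<lambda>\<omega>. ((x \<omega>, y \<omega>), (z1 \<omega>, t1 \<omega>), u1 \<omega>))
     (borel \<Otimes>\<^sub>M (borel \<Otimes>\<^sub>M borel)) (\<lambda>\<omega>. (u2 \<omega>, z2 \<omega>, t2 \<omega>))"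
  and ind2': "indep_law borel u2 (borel \<Otimes>\<^sub>M borel) (\<lambda>\<omega>. (z2 \<omega>, t2 \<omega>))"
  by (rule indep_law_past_future[OF p_vw v_w u12 w12, where ?g1.0=fst and ?g2.0="\<lambda>v. fst (snd v)" and ?k1.0=fst and ?k2.0=snd]; simp)+

lemma ind2: "indep_law (borel \<Otimes>\<^sub>M borel) (\<lambda>\<omega>. (X1 \<omega>, Y1 \<omega>)) (borel \<Otimes>\<^sub>M (borel \<Otimes>\<^sub>M borel)) (\<lambda>\<omega>. (u2 \<omega>, z2 \<omega>, t2 \<omega>))"
  by (rule indep_law_compose[OF past_indep, where k="\<lambda>p. p" and
      g="\<lambda>p. (euler_coupled (fst (fst p)) (snd (fst p)) (snd (snd p)) (fst (fst (snd p))) (snd (fst (snd p))),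
          euler (snd (fst p)) (snd (snd p)) (fst (fst (snd p))))"]) (auto simp: X1_def Y1_def)

lemmas step2 = ind2 ind2' \<mu>(2) D(2) zt(2)
lemmas step2_rvs [measurable] = step_random_variables[OF step2]

lemma second_measurable [measurable]: "X2 \<in> borel_measurable M" "Y2 \<in> borel_measurable M" "Yc \<in> borel_measurable M"
  unfolding X2_def[abs_def] Y2_def[abs_def] Yc_def[abs_def] by measurable

lemma law_X1:
  "F \<in> borel_measurable borel \<Longrightarrow>
     (\<integral>\<^sup>+\<omega>. F (X1 \<omega>) \<partial>M) = (\<integral>\<^sup>+\<omega>. \<integral>\<^sup>+v. \<integral>\<^sup>+w. F (euler (x \<omega>) v w) \<partial>gaussian \<partial>\<mu>1 \<partial>M)"
  unfolding X1_def by (rule step_law[OF step1])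

lemma law_X2:
  "F \<in> borel_measurable borel \<Longrightarrow>
     (\<integral>\<^sup>+\<omega>. F (X2 \<omega>) \<partial>M) = (\<integral>\<^sup>+\<omega>. \<integral>\<^sup>+v. \<integral>\<^sup>+w. F (euler (X1 \<omega>) v w) \<partial>gaussian \<partial>\<mu>2 \<partial>M)"
  unfolding X2_def by (rule step_law[OF step2])

lemma distr_z: "distr M borel z1 = gaussian" "distr M borel z2 = gaussian"
proof -
  interpret un: prob_space unif by (rule prob_space_unif)
  have fst_gauss: "distr (gaussian \<Otimes>\<^sub>M unif) borel fst = (gaussian :: 'a measure)"
    by (rule measure_eqI)
       (auto simp: emeasure_distr space_pair_measure vimage_fst un.emeasure_pair_measure_Times un.emeasure_space_1[simplified])
  have d: "distr M borel (\<lambda>\<omega>. fst (p \<omega>)) = distr (distr M (borel \<Otimes>\<^sub>M borel) p) borel fst"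
    if [measurable]: "p \<in> measurable M (borel \<Otimes>\<^sub>M borel)" for p :: "'w \<Rightarrow> 'a \<times> real"
    by (subst distr_distr) (auto simp: comp_def)
  show "distr M borel z1 = gaussian" "distr M borel z2 = gaussian"
    using d[of "\<lambda>\<omega>. (z1 \<omega>, t1 \<omega>)"] d[of "\<lambda>\<omega>. (z2 \<omega>, t2 \<omega>)"] by (simp_all add: zt fst_gauss)
qed

lemma coarse_indep:
  "indep_law borel y (borel \<Otimes>\<^sub>M borel) (\<lambda>\<omega>. (u3 \<omega>, (1 / sqrt 2) *\<^sub>R (z1 \<omega> + z2 \<omega>)))"
  "indep_law borel u3 borel (\<lambda>\<omega>. (1 / sqrt 2) *\<^sub>R (z1 \<omega> + z2 \<omega>))"
  "distr M borel (\<lambda>\<omega>. (1 / sqrt 2) *\<^sub>R (z1 \<omega> + z2 \<omega>))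
     = distr (gaussian \<Otimes>\<^sub>M gaussian) borel (\<lambda>p. (1 / sqrt 2) *\<^sub>R (fst p + snd p))"
proof -
  show "indep_law borel y (borel \<Otimes>\<^sub>M borel) (\<lambda>\<omega>. (u3 \<omega>, (1 / sqrt 2) *\<^sub>R (z1 \<omega> + z2 \<omega>)))"
    by (rule indep_law_compose[OF p_vw, where g=snd and
      k="\<lambda>p. (snd (snd (fst p)), (1 / sqrt 2) *\<^sub>R (fst (fst (snd p)) + fst (snd (snd p))))"]) auto
  show "indep_law borel u3 borel (\<lambda>\<omega>. (1 / sqrt 2) *\<^sub>R (z1 \<omega> + z2 \<omega>))"
    by (rule indep_law_compose[OF v_w, where g="\<lambda>v. snd (snd v)" and
      k="\<lambda>p. (1 / sqrt 2) *\<^sub>R (fst (fst p) + fst (snd p))"]) auto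
  have "indep_law borel z1 borel z2"
    by (rule indep_law_compose[OF w12, where g=fst and k=fst]) auto
  then show "distr M borel (\<lambda>\<omega>. (1 / sqrt 2) *\<^sub>R (z1 \<omega> + z2 \<omega>))
     = distr (gaussian \<Otimes>\<^sub>M gaussian) borel (\<lambda>p. (1 / sqrt 2) *\<^sub>R (fst p + snd p))"
    by (rule distr_indep_pair) (auto simp: distr_z)
qed

context
  assumes bd: "\<And>a. (\<integral>\<^sup>+\<omega>. ennreal ((norm (B a (u1 \<omega>) + B a (u2 \<omega>) - 2 *\<^sub>R B a (u3 \<omega>)))\<^sup>2) \<partial>M)
        \<le> ennreal (Lu * (1 + (norm a)\<^sup>2) * h powr ac)"
    and my: "(\<integral>\<^sup>+\<omega>. ennreal ((norm (y \<omega>))\<^sup>2) \<partial>M) \<le> ennreal C" "0 \<le> C"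
    and mX1: "(\<integral>\<^sup>+\<omega>. ennreal ((norm (X1 \<omega>))\<^sup>2) \<partial>M) \<le> ennreal Cf" "0 \<le> Cf"
    and Lu: "0 \<le> Lu" and \<delta>: "0 \<le> \<delta>"
      "2 * h\<^sup>2 * (Lu * (1 + C) * h powr ac + L\<^sup>2 * (h\<^sup>2 * (C * (\<sigma>\<^sup>2 + 2 * L\<^sup>2) + \<sigma>\<^sup>2 + 2 * (norm (b 0))\<^sup>2) + h * real DIM('a))) \<le> \<delta>\<^sup>2"
    and sy: "sqrt C + sqrt (h\<^sup>2 * (C * (\<sigma>\<^sup>2 + 2 * L\<^sup>2) + \<sigma>\<^sup>2 + 2 * (norm (b 0))\<^sup>2) + h * real DIM('a)) \<le> sy"
begin

lemma increment: "(\<integral>\<^sup>+\<omega>. ennreal ((norm (Y1 \<omega> - y \<omega>))\<^sup>2) \<partial>M)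
    \<le> ennreal (h\<^sup>2 * (C * (\<sigma>\<^sup>2 + 2 * L\<^sup>2) + \<sigma>\<^sup>2 + 2 * (norm (b 0))\<^sup>2) + h * real DIM('a))"
  unfolding Y1_def by (rule increment_mean_square[OF step1 my])

text \<open>The difference is h times the sum of the defect in (c) at \<open>y\<close> and the
  change of the second drift between \<open>y\<close> and \<open>Y1\<close>. The first is of size
  h^(alpha_c / 2), the second, by the Lipschitz condition, of the size sqrt h of one Euler
  increment.\<close>

lemma defect: "L2_le (\<lambda>\<omega>. norm (Y2 \<omega> - Yc \<omega>)) \<delta>"
proof -
  let ?J = "h\<^sup>2 * (C * (\<sigma>\<^sup>2 + 2 * L\<^sup>2) + \<sigma>\<^sup>2 + 2 * (norm (b 0))\<^sup>2) + h * real DIM('a)"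
  let ?V = "\<lambda>\<omega>. B (y \<omega>) (u1 \<omega>) + B (y \<omega>) (u2 \<omega>) - 2 *\<^sub>R B (y \<omega>) (u3 \<omega>)"
  have J: "0 \<le> ?J" using h my by (intro add_nonneg_nonneg mult_nonneg_nonneg) auto
  \<comment> \<open>The Gaussian increments of the two fine steps add up exactly to the coarse one,
    so only drift terms remain.\<close>
  have "sqrt (2 * h) * (1 / sqrt 2) = sqrt h" by (simp add: real_sqrt_mult)
  then have noise: "sqrt (2 * h) *\<^sub>R ((1 / sqrt 2) *\<^sub>R w) = sqrt h *\<^sub>R w" for w :: 'a by (simp only: scaleR_scaleR)
  have diff: "Y2 \<omega> - Yc \<omega> = h *\<^sub>R (?V \<omega> + (B (Y1 \<omega>) (u2 \<omega>) - B (y \<omega>) (u2 \<omega>)))" for \<omega>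
    unfolding Y2_def Y1_def Yc_def euler_def noise by (simp add: algebra_simps)
  have Yy: "indep_law (borel \<Otimes>\<^sub>M borel) (\<lambda>\<omega>. (Y1 \<omega>, y \<omega>)) borel u2"
    by (rule indep_law_compose[OF past_indep, where k=fst and
        g="\<lambda>p. (euler (snd (fst p)) (snd (snd p)) (fst (fst (snd p))), snd (fst p))"]) (auto simp: Y1_def)
  have "AE \<omega> in M. norm (B (fst (Y1 \<omega>, y \<omega>)) (u2 \<omega>) - B (snd (Y1 \<omega>, y \<omega>)) (u2 \<omega>)) \<le> L * norm (fst (Y1 \<omega>, y \<omega>) - snd (Y1 \<omega>, y \<omega>))"
    by (rule indep_law_AE[OF Yy, where Q="\<lambda>p v. norm (B (fst p) v - B (snd p) v) \<le> L * norm (fst p - snd p)"])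
       (measurable, unfold \<mu>, rule driverD(6)[OF D(2)])
  then have AE: "AE \<omega> in M. norm (B (Y1 \<omega>) (u2 \<omega>) - B (y \<omega>) (u2 \<omega>)) \<le> L * norm (Y1 \<omega> - y \<omega>)" by simp
  \<comment> \<open>(c) bounds the expectation at each fixed point; \<open>y\<close> is independent
    of the triple of \<open>U\<close>s and can be inserted.\<close>
  have V: "(\<integral>\<^sup>+\<omega>. ennreal ((norm (?V \<omega>))\<^sup>2) \<partial>M) \<le> ennreal (Lu * (1 + C) * h powr ac)"
  proof -
    have yv: "indep_law borel y (borel \<Otimes>\<^sub>M (borel \<Otimes>\<^sub>M borel)) (\<lambda>\<omega>. (u1 \<omega>, u2 \<omega>, u3 \<omega>))"
      by (rule indep_law_compose[OF p_vw, where g=snd and k=fst]) auto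
    let ?F = "\<lambda>p. ennreal ((norm (B (fst p) (fst (snd p)) + B (fst p) (fst (snd (snd p))) - 2 *\<^sub>R B (fst p) (snd (snd (snd p)))))\<^sup>2)"
    have "(\<integral>\<^sup>+\<omega>. ?F (y \<omega>, (u1 \<omega>, u2 \<omega>, u3 \<omega>)) \<partial>M)
      = (\<integral>\<^sup>+a. \<integral>\<^sup>+v. ?F (a, v) \<partial>distr M (borel \<Otimes>\<^sub>M (borel \<Otimes>\<^sub>M borel)) (\<lambda>\<omega>. (u1 \<omega>, u2 \<omega>, u3 \<omega>)) \<partial>distr M borel y)"
      by (rule nn_integral_indep_law[OF yv]) measurable
    also have "\<dots> = (\<integral>\<^sup>+a. (\<integral>\<^sup>+\<omega>. ?F (a, (u1 \<omega>, u2 \<omega>, u3 \<omega>)) \<partial>M) \<partial>distr M borel y)"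
      by (rule nn_integral_cong, subst nn_integral_distr) simp_all
    also have "\<dots> \<le> ennreal (Lu * h powr ac) * ennreal C + ennreal (Lu * h powr ac)"
    proof (rule nn_integral_le_mean_square)
      show "(\<integral>\<^sup>+\<omega>. ?F (a, (u1 \<omega>, u2 \<omega>, u3 \<omega>)) \<partial>M) \<le> ennreal (Lu * h powr ac * (norm a)\<^sup>2 + Lu * h powr ac)" for a
        using bd[of a] by (simp add: algebra_simps)
      show "(\<integral>\<^sup>+a. ennreal ((norm a)\<^sup>2) \<partial>distr M borel y) \<le> ennreal C"
        using my by (simp add: nn_integral_distr)
    qed (use Lu in \<open>auto intro!: prob_space_distr\<close>)
    also have "\<dots> = ennreal (Lu * (1 + C) * h powr ac)"
      using Lu my by (simp add: algebra_simps flip: ennreal_mult ennreal_plus)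
    finally show ?thesis by simp
  qed
  have "(\<integral>\<^sup>+\<omega>. ennreal ((norm (Y2 \<omega> - Yc \<omega>))\<^sup>2) \<partial>M)
    \<le> (\<integral>\<^sup>+\<omega>. ennreal (2 * h\<^sup>2) * ennreal ((norm (?V \<omega>))\<^sup>2) + ennreal (2 * h\<^sup>2 * L\<^sup>2) * ennreal ((norm (Y1 \<omega> - y \<omega>))\<^sup>2) \<partial>M)"
    using AE
  proof (intro nn_integral_mono_AE, eventually_elim)
    case (elim \<omega>)
    let ?a = "norm (?V \<omega>)" and ?b = "norm (B (Y1 \<omega>) (u2 \<omega>) - B (y \<omega>) (u2 \<omega>))"
    have "norm (Y2 \<omega> - Yc \<omega>) \<le> h * (?a + ?b)"
    proof -
      have "norm (Y2 \<omega> - Yc \<omega>) = h * norm (?V \<omega> + (B (Y1 \<omega>) (u2 \<omega>) - B (y \<omega>) (u2 \<omega>)))"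
        unfolding diff norm_scaleR using h by (simp only: abs_of_pos)
      also have "\<dots> \<le> h * (?a + ?b)"
        using h by (intro mult_left_mono norm_triangle_ineq) auto
      finally show ?thesis .
    qed
    then have "(norm (Y2 \<omega> - Yc \<omega>))\<^sup>2 \<le> (h * (?a + ?b))\<^sup>2" by (intro power_mono) auto
    also have "\<dots> \<le> h\<^sup>2 * (2 * ?a\<^sup>2 + 2 * ?b\<^sup>2)"
      using sum_squares_bound[of ?a ?b] unfolding power_mult_distrib by (intro mult_left_mono) (auto simp: power2_sum)
    also have "\<dots> \<le> h\<^sup>2 * (2 * ?a\<^sup>2 + 2 * (L * norm (Y1 \<omega> - y \<omega>))\<^sup>2)"
      using elim by (intro mult_left_mono add_left_mono power_mono) auto
    also have "\<dots> = 2 * h\<^sup>2 * ?a\<^sup>2 + 2 * h\<^sup>2 * L\<^sup>2 * (norm (Y1 \<omega> - y \<omega>))\<^sup>2"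
      by (simp add: power_mult_distrib algebra_simps)
    finally have "ennreal ((norm (Y2 \<omega> - Yc \<omega>))\<^sup>2) \<le> ennreal (2 * h\<^sup>2 * ?a\<^sup>2 + 2 * h\<^sup>2 * L\<^sup>2 * (norm (Y1 \<omega> - y \<omega>))\<^sup>2)"
      by (rule ennreal_leI)
    also have "\<dots> = ennreal (2 * h\<^sup>2) * ennreal (?a\<^sup>2) + ennreal (2 * h\<^sup>2 * L\<^sup>2) * ennreal ((norm (Y1 \<omega> - y \<omega>))\<^sup>2)"
      by (subst ennreal_plus) (auto simp: ennreal_mult'')
    finally show ?case .
  qed
  also have "\<dots> = ennreal (2 * h\<^sup>2) * (\<integral>\<^sup>+\<omega>. ennreal ((norm (?V \<omega>))\<^sup>2) \<partial>M)
      + ennreal (2 * h\<^sup>2 * L\<^sup>2) * (\<integral>\<^sup>+\<omega>. ennreal ((norm (Y1 \<omega> - y \<omega>))\<^sup>2) \<partial>M)"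
    by (simp add: nn_integral_add nn_integral_cmult)
  also have "\<dots> \<le> ennreal (2 * h\<^sup>2) * ennreal (Lu * (1 + C) * h powr ac) + ennreal (2 * h\<^sup>2 * L\<^sup>2) * ennreal ?J"
    by (intro add_mono mult_left_mono V increment) auto
  also have "\<dots> = ennreal (2 * h\<^sup>2 * (Lu * (1 + C) * h powr ac) + 2 * h\<^sup>2 * L\<^sup>2 * ?J)"
    using J Lu my by (subst ennreal_plus) (auto simp: ennreal_mult'')
  also have "\<dots> \<le> ennreal (\<delta>\<^sup>2)"
    by (rule ennreal_leI) (use \<delta>(2) in \<open>simp add: algebra_simps\<close>)
  finally show ?thesis using \<delta>(1) by (simp add: L2_le_def)
qed

text \<open>The crude bound of one step is applied to norm X1 + norm Y1. \<open>X1\<close> has the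
  law of the fine chain, whose moment is bounded by \<open>C_IEul\<close>. \<open>Y1\<close> belongs
  to no given chain, so its moment comes from \<open>y\<close> and one increment; this is the origin
  of \<open>C_IASP\<close>.\<close>

lemma intermediate_dist: "L2_le (\<lambda>\<omega>. norm (X2 \<omega> - Y2 \<omega>)) ((1 + H * L) * (sqrt Cf + sy) + sqrt H)"
proof -
  let ?J = "h\<^sup>2 * (C * (\<sigma>\<^sup>2 + 2 * L\<^sup>2) + \<sigma>\<^sup>2 + 2 * (norm (b 0))\<^sup>2) + h * real DIM('a)"
  have J: "0 \<le> ?J" using h my by (intro add_nonneg_nonneg mult_nonneg_nonneg) auto
  have X1: "L2_le (\<lambda>\<omega>. norm (X1 \<omega>)) (sqrt Cf)" using mX1 by (simp add: L2_le_def)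
  have "L2_le (\<lambda>\<omega>. norm (y \<omega>)) (sqrt C)" "L2_le (\<lambda>\<omega>. norm (Y1 \<omega> - y \<omega>)) (sqrt ?J)"
    using my increment J by (simp_all add: L2_le_def)
  from L2_le_add[OF this] have "L2_le (\<lambda>\<omega>. norm (y \<omega>) + norm (Y1 \<omega> - y \<omega>)) sy"
    by (rule L2_le_weaken) (rule sy)
  then have "L2_le (\<lambda>\<omega>. norm (Y1 \<omega>)) sy"
  proof (rule L2_le_mono)
    show "AE \<omega> in M. \<bar>norm (Y1 \<omega>)\<bar> \<le> \<bar>norm (y \<omega>) + norm (Y1 \<omega> - y \<omega>)\<bar>"
    proof (rule AE_I2)
      fix \<omega> show "\<bar>norm (Y1 \<omega>)\<bar> \<le> \<bar>norm (y \<omega>) + norm (Y1 \<omega> - y \<omega>)\<bar>"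
        using norm_triangle_ineq[of "y \<omega>" "Y1 \<omega> - y \<omega>"] by simp
    qed
  qed measurable
  from L2_le_add[OF L2_le_cmult[OF L2_le_add[OF X1 this], of "1 + H * L"] L2_le_const[of "sqrt H"]]
  have "L2_le (\<lambda>\<omega>. (1 + H * L) * (norm (X1 \<omega>) + norm (Y1 \<omega>)) + sqrt H) ((1 + H * L) * (sqrt Cf + sy) + sqrt H)"
    using H_pos pos by simp
  then show ?thesis
  proof (rule L2_le_mono)
    show "AE \<omega> in M. \<bar>norm (X2 \<omega> - Y2 \<omega>)\<bar> \<le> \<bar>(1 + H * L) * (norm (X1 \<omega>) + norm (Y1 \<omega>)) + sqrt H\<bar>"
      using step_dist_le[OF step2]
    proof eventually_elim
      case (elim \<omega>)
      have "(1 + h * L) * norm (X1 \<omega> - Y1 \<omega>) \<le> (1 + H * L) * (norm (X1 \<omega>) + norm (Y1 \<omega>))"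
        using h pos hL norm_triangle_ineq4[of "X1 \<omega>" "Y1 \<omega>"] by (intro mult_mono) auto
      with elim show ?case unfolding X2_def Y2_def by (smt (verit) norm_ge_zero)
    qed
  qed measurable
qed

text \<open>From \<open>X2\<close> to \<open>Y2\<close> the one-step contraction applies twice;
  passing from \<open>Y2\<close> to \<open>Yc\<close> costs what \<open>f_diff_le\<close> gives, and
  the Cauchy-Schwarz inequality separates the defect from the distance in the cross term.\<close>

lemma two_step_contraction:
  "(\<integral>\<^sup>+\<omega>. ennreal (f (norm (X2 \<omega> - Yc \<omega>))) \<partial>M)
   \<le> ennreal ((1 - c * h)\<^sup>2) * (\<integral>\<^sup>+\<omega>. ennreal (f (norm (x \<omega> - y \<omega>))) \<partial>M)
     + ennreal (\<delta> + q * (\<delta> * ((1 + H * L) * (sqrt Cf + sy) + sqrt H)) + q * \<delta>\<^sup>2)"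
proof -
  let ?S = "(1 + H * L) * (sqrt Cf + sy) + sqrt H"
  let ?r = "\<lambda>\<omega>. norm (X2 \<omega> - Y2 \<omega>)" and ?d = "\<lambda>\<omega>. norm (Y2 \<omega> - Yc \<omega>)"
  have S: "0 \<le> ?S" using intermediate_dist by (simp add: L2_le_def)
  have "(\<integral>\<^sup>+\<omega>. ennreal (f (norm (X2 \<omega> - Yc \<omega>))) \<partial>M)
    \<le> (\<integral>\<^sup>+\<omega>. ennreal (f (?r \<omega>)) + (ennreal (?d \<omega>) + (ennreal q * ennreal \<bar>?d \<omega> * ?r \<omega>\<bar> + ennreal q * ennreal ((?d \<omega>)\<^sup>2))) \<partial>M)"
  proof (rule nn_integral_mono)
    fix \<omega>
    have "f (norm (X2 \<omega> - Yc \<omega>)) \<le> f (?r \<omega> + ?d \<omega>)"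
      using norm_triangle_ineq[of "X2 \<omega> - Y2 \<omega>" "Y2 \<omega> - Yc \<omega>"] by (intro f_mono) auto
    also have "\<dots> \<le> f (?r \<omega>) + ?d \<omega> * (1 + q * (?r \<omega> + ?d \<omega>))"
      using f_diff_le[of "?r \<omega>" "?r \<omega> + ?d \<omega>"] by simp
    also have "\<dots> = f (?r \<omega>) + (?d \<omega> + (q * \<bar>?d \<omega> * ?r \<omega>\<bar> + q * (?d \<omega>)\<^sup>2))"
      by (simp add: algebra_simps power2_eq_square)
    finally have "ennreal (f (norm (X2 \<omega> - Yc \<omega>))) \<le> ennreal (f (?r \<omega>) + (?d \<omega> + (q * \<bar>?d \<omega> * ?r \<omega>\<bar> + q * (?d \<omega>)\<^sup>2)))"
      by (rule ennreal_leI)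
    then show "ennreal (f (norm (X2 \<omega> - Yc \<omega>))) \<le> ennreal (f (?r \<omega>)) + (ennreal (?d \<omega>) + (ennreal q * ennreal \<bar>?d \<omega> * ?r \<omega>\<bar> + ennreal q * ennreal ((?d \<omega>)\<^sup>2)))"
      using q_pos by (simp add: ennreal_plus ennreal_mult f_nonneg)
  qed
  also have "\<dots> = (\<integral>\<^sup>+\<omega>. ennreal (f (?r \<omega>)) \<partial>M) + ((\<integral>\<^sup>+\<omega>. ennreal (?d \<omega>) \<partial>M)
      + (ennreal q * (\<integral>\<^sup>+\<omega>. ennreal \<bar>?d \<omega> * ?r \<omega>\<bar> \<partial>M) + ennreal q * (\<integral>\<^sup>+\<omega>. ennreal ((?d \<omega>)\<^sup>2) \<partial>M)))"
    by (simp add: nn_integral_add nn_integral_cmult)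
  also have "\<dots> \<le> ennreal ((1 - c * h)\<^sup>2) * (\<integral>\<^sup>+\<omega>. ennreal (f (norm (x \<omega> - y \<omega>))) \<partial>M)
      + (ennreal \<delta> + (ennreal q * ennreal (\<delta> * ?S) + ennreal q * ennreal (\<delta>\<^sup>2)))"
  proof (intro add_mono mult_left_mono)
    have "(\<integral>\<^sup>+\<omega>. ennreal (f (?r \<omega>)) \<partial>M) \<le> ennreal (1 - c * h) * (\<integral>\<^sup>+\<omega>. ennreal (f (norm (X1 \<omega> - Y1 \<omega>))) \<partial>M)"
      unfolding X2_def Y2_def by (rule step_contracts[OF step2])
    also have "\<dots> \<le> ennreal (1 - c * h) * (ennreal (1 - c * h) * (\<integral>\<^sup>+\<omega>. ennreal (f (norm (x \<omega> - y \<omega>))) \<partial>M))"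
      unfolding X1_def Y1_def by (intro mult_left_mono step_contracts[OF step1]) simp
    also have "\<dots> = ennreal ((1 - c * h)\<^sup>2) * (\<integral>\<^sup>+\<omega>. ennreal (f (norm (x \<omega> - y \<omega>))) \<partial>M)"
      using ch_bounds by (simp add: power2_eq_square ennreal_mult mult.assoc)
    finally show "(\<integral>\<^sup>+\<omega>. ennreal (f (?r \<omega>)) \<partial>M) \<le> ennreal ((1 - c * h)\<^sup>2) * (\<integral>\<^sup>+\<omega>. ennreal (f (norm (x \<omega> - y \<omega>))) \<partial>M)" .
    show "(\<integral>\<^sup>+\<omega>. ennreal (?d \<omega>) \<partial>M) \<le> ennreal \<delta>" using L2_le_L1[OF defect] by simp
    show "(\<integral>\<^sup>+\<omega>. ennreal \<bar>?d \<omega> * ?r \<omega>\<bar> \<partial>M) \<le> ennreal (\<delta> * ?S)" by (rule L2_le_mult[OF defect intermediate_dist])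
    show "(\<integral>\<^sup>+\<omega>. ennreal ((?d \<omega>)\<^sup>2) \<partial>M) \<le> ennreal (\<delta>\<^sup>2)" using defect by (simp add: L2_le_def)
  qed simp_all
  also have "ennreal \<delta> + (ennreal q * ennreal (\<delta> * ?S) + ennreal q * ennreal (\<delta>\<^sup>2)) = ennreal (\<delta> + q * (\<delta> * ?S) + q * \<delta>\<^sup>2)"
    using \<delta>(1) q_pos S by (simp add: add.assoc flip: ennreal_mult ennreal_plus)
  finally show ?thesis .
qed

end

text \<open>The second moment of \<open>X1\<close> remains a premise of the last clause: it becomes
  available only after the law of \<open>X1\<close>, described in an earlier clause, has been
  identified with that of the fine chain.\<close>

lemma two_step_coupling:
  assumes "\<And>a. (\<integral>\<^sup>+\<omega>. ennreal ((norm (B a (u1 \<omega>) + B a (u2 \<omega>) - 2 *\<^sub>R B a (u3 \<omega>)))\<^sup>2) \<partial>M)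
        \<le> ennreal (Lu * (1 + (norm a)\<^sup>2) * h powr ac)"
    and "(\<integral>\<^sup>+\<omega>. ennreal ((norm (y \<omega>))\<^sup>2) \<partial>M) \<le> ennreal C" "0 \<le> C" "0 \<le> Cf"
    and "0 \<le> Lu" "0 \<le> \<delta>"
      "2 * h\<^sup>2 * (Lu * (1 + C) * h powr ac + L\<^sup>2 * (h\<^sup>2 * (C * (\<sigma>\<^sup>2 + 2 * L\<^sup>2) + \<sigma>\<^sup>2 + 2 * (norm (b 0))\<^sup>2) + h * real DIM('a))) \<le> \<delta>\<^sup>2"
    and "sqrt C + sqrt (h\<^sup>2 * (C * (\<sigma>\<^sup>2 + 2 * L\<^sup>2) + \<sigma>\<^sup>2 + 2 * (norm (b 0))\<^sup>2) + h * real DIM('a)) \<le> sy"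
  shows "\<exists>X1 X2 Yc. X1 \<in> borel_measurable M \<and> X2 \<in> borel_measurable M \<and> Yc \<in> borel_measurable M \<and>
    (\<forall>F\<in>borel_measurable borel. (\<integral>\<^sup>+\<omega>. F (X1 \<omega>) \<partial>M) = (\<integral>\<^sup>+\<omega>. \<integral>\<^sup>+v. \<integral>\<^sup>+w. F (euler (x \<omega>) v w) \<partial>gaussian \<partial>\<mu>1 \<partial>M)) \<and>
    (\<forall>F\<in>borel_measurable borel. (\<integral>\<^sup>+\<omega>. F (X2 \<omega>) \<partial>M) = (\<integral>\<^sup>+\<omega>. \<integral>\<^sup>+v. \<integral>\<^sup>+w. F (euler (X1 \<omega>) v w) \<partial>gaussian \<partial>\<mu>2 \<partial>M)) \<and>
    (\<forall>\<omega>. Yc \<omega> = y \<omega> + (2 * h) *\<^sub>R B (y \<omega>) (u3 \<omega>) + sqrt (2 * h) *\<^sub>R ((1 / sqrt 2) *\<^sub>R (z1 \<omega> + z2 \<omega>))) \<and>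
    ((\<integral>\<^sup>+\<omega>. ennreal ((norm (X1 \<omega>))\<^sup>2) \<partial>M) \<le> ennreal Cf \<longrightarrow>
      (\<integral>\<^sup>+\<omega>. ennreal (f (norm (X2 \<omega> - Yc \<omega>))) \<partial>M)
       \<le> ennreal ((1 - c * h)\<^sup>2) * (\<integral>\<^sup>+\<omega>. ennreal (f (norm (x \<omega> - y \<omega>))) \<partial>M)
         + ennreal (\<delta> + q * (\<delta> * ((1 + H * L) * (sqrt Cf + sy) + sqrt H)) + q * \<delta>\<^sup>2))"
proof (rule exI[of _ X1], rule exI[of _ X2], rule exI[of _ Yc], intro conjI ballI allI impI)
  show "X1 \<in> borel_measurable M" "X2 \<in> borel_measurable M" "Yc \<in> borel_measurable M"
    by (rule step2_rvs(1) second_measurable)+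
qed (rule law_X1 law_X2 Yc_def two_step_contraction assms | assumption)+

end

declare step1_rvs [measurable del] step2_rvs [measurable del] u3_measurable [measurable del] second_measurable [measurable del]

end

subsection \<open>Conditional sampling\<close>

text \<open>The integrals are tested on the set where the inequality fails; finiteness of the
  integral of \<open>g\<close> makes the subtraction legitimate.\<close>

lemma AE_le_of_set_nn_integral_le:
  fixes f g :: "'s \<Rightarrow> ennreal"
  assumes [measurable]: "f \<in> borel_measurable N" "g \<in> borel_measurable N"
    and fin: "(\<integral>\<^sup>+x. g x \<partial>N) \<noteq> \<infinity>"
    and le: "\<And>A. A \<in> sets N \<Longrightarrow> (\<integral>\<^sup>+x. f x * indicator A x \<partial>N) \<le> (\<integral>\<^sup>+x. g x * indicator A x \<partial>N)"
  shows "AE x in N. f x \<le> g x"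
proof -
  let ?A = "{x\<in>space N. g x < f x}"
  let ?g = "\<lambda>x. g x * indicator ?A x" and ?f = "\<lambda>x. f x * indicator ?A x"
  have A: "?A \<in> sets N" by measurable
  have "(\<integral>\<^sup>+x. ?g x \<partial>N) \<le> (\<integral>\<^sup>+x. g x \<partial>N)" by (intro nn_integral_mono) (auto simp: indicator_def)
  then have finA: "(\<integral>\<^sup>+x. ?g x \<partial>N) \<noteq> \<infinity>" using fin by (auto simp: top_unique)
  have "(\<integral>\<^sup>+x. ?f x - ?g x \<partial>N) = (\<integral>\<^sup>+x. ?f x \<partial>N) - (\<integral>\<^sup>+x. ?g x \<partial>N)"
    by (rule nn_integral_diff) (use finA A in \<open>auto simp: indicator_def less_imp_le\<close>)
  also have "\<dots> = 0"
    using le[OF A] finA by (intro diff_eq_0_ennreal) (auto simp: less_top intro: order_le_less_trans)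
  finally have "AE x in N. ?f x - ?g x = 0"
    by (subst (asm) nn_integral_0_iff_AE) (use A in auto)
  then show ?thesis
  proof (rule AE_mp, intro AE_I2 impI)
    fix x assume "x \<in> space N" and 0: "?f x - ?g x = 0"
    show "f x \<le> g x"
    proof (rule ccontr)
      assume "\<not> f x \<le> g x"
      with 0 \<open>x \<in> space N\<close> have "f x - g x = 0" "g x < f x" by auto
      then show False by (metis diff_gt_0_iff_gt_ennreal less_irrefl)
    qed
  qed
qed

text \<open>The quantile transform applied to a version \<open>D q x\<close> of the conditional probability of
  \<open>Y > q\<close> given \<open>X = x\<close>, made monotone in the rational \<open>q\<close>.\<close>
lemma conditional_sampling_bounded:
  fixes Q :: "('s \<times> real) measure"
  assumes Q: "prob_space Q" and sQ: "sets Q = sets (S \<Otimes>\<^sub>M borel)"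
    and bounded: "AE p in Q. \<bar>snd p\<bar> \<le> 1"
  shows "\<exists>g \<in> borel_measurable (S \<Otimes>\<^sub>M borel).
    distr (distr Q S fst \<Otimes>\<^sub>M unif) (S \<Otimes>\<^sub>M borel) (\<lambda>p. (fst p, g p)) = Q"
proof -
  interpret Q: prob_space Q by fact
  interpret U: prob_space unif by (rule prob_space_unif)
  note [measurable_cong] = sQ
  define \<nu> where "\<nu> = distr Q S fst"
  have [measurable]: "fst \<in> measurable Q S" by (simp cong: measurable_cong_sets add: sQ)
  interpret \<nu>: prob_space \<nu> unfolding \<nu>_def by (rule Q.prob_space_distr) measurable
  have s\<nu>[measurable_cong]: "sets \<nu> = sets S" by (simp add: \<nu>_def)
  have sp\<nu>: "space \<nu> = space S" by (simp add: \<nu>_def)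
  have spQ: "space Q = space S \<times> UNIV" using sets_eq_imp_space_eq[OF sQ] by (simp add: space_pair_measure)
  have rect[measurable]: "A \<times> T \<in> sets Q" if "A \<in> sets S" "T \<in> sets borel" for A and T :: "real set"
    using that by (simp add: sQ)
  have \<nu>A: "emeasure \<nu> A = emeasure Q (A \<times> UNIV)" if "A \<in> sets S" for A
    using that sets.sets_into_space[OF that] unfolding \<nu>_def
    by (subst emeasure_distr) (auto simp: spQ intro!: arg_cong2[where f=emeasure])
  \<comment> \<open>The Radon-Nikodym derivative of the first marginal, restricted to second
    components above \<open>t\<close>: a version of a conditional probability.\<close>
  have "\<exists>d. d \<in> borel_measurable S \<and> (\<forall>A\<in>sets S. (\<integral>\<^sup>+x. d x * indicator A x \<partial>\<nu>) = emeasure Q (A \<times> {t<..}))" for t :: real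
  proof -
    let ?N = "distr (density Q (indicator (space S \<times> {t<..}))) S fst"
    have N: "emeasure ?N A = emeasure Q (A \<times> {t<..})" if A: "A \<in> sets S" for A
    proof -
      have [measurable]: "space S \<times> {t<..} \<in> sets Q" "A \<times> UNIV \<in> sets Q" using A by auto
      have "emeasure ?N A = emeasure (density Q (indicator (space S \<times> {t<..}))) (A \<times> UNIV)"
        using A sets.sets_into_space[OF A] by (subst emeasure_distr) (auto simp: spQ intro!: arg_cong2[where f=emeasure])
      also have "\<dots> = (\<integral>\<^sup>+p. indicator (A \<times> {t<..}) p \<partial>Q)"
        using sets.sets_into_space[OF A] by (subst emeasure_density) (auto simp: indicator_def intro!: nn_integral_cong)
      also have "\<dots> = emeasure Q (A \<times> {t<..})" using A by (intro nn_integral_indicator) auto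
      finally show ?thesis .
    qed
    have "absolutely_continuous \<nu> ?N"
      unfolding absolutely_continuous_def
    proof (safe intro!: null_setsI)
      fix A assume A: "A \<in> null_sets \<nu>"
      then have AS: "A \<in> sets S" by (auto simp: s\<nu>)
      then have "emeasure ?N A \<le> emeasure \<nu> A" unfolding N[OF AS] \<nu>A[OF AS] by (intro emeasure_mono) auto
      with A show "emeasure ?N A = 0" by auto
      show "A \<in> sets ?N" using AS by simp
    qed
    from \<nu>.Radon_Nikodym[OF this] obtain d where d: "d \<in> borel_measurable \<nu>" "density \<nu> d = ?N"
      by (auto simp: s\<nu>)
    have "(\<integral>\<^sup>+x. d x * indicator A x \<partial>\<nu>) = emeasure Q (A \<times> {t<..})" if A: "A \<in> sets S" for A
      using emeasure_density[of d \<nu> A] d A by (simp add: N s\<nu>)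
    with d show ?thesis by (intro exI[of _ d]) (auto cong: measurable_cong_sets simp: s\<nu>)
  qed
  then obtain d0 where d0: "\<And>t. d0 t \<in> borel_measurable S"
      "\<And>t A. A \<in> sets S \<Longrightarrow> (\<integral>\<^sup>+x. d0 t x * indicator A x \<partial>\<nu>) = emeasure Q (A \<times> {t<..})" by metis
  \<comment> \<open>Rational levels suffice and are countable, so their almost sure inequalities
    hold simultaneously.\<close>
  define d where "d q = d0 (of_rat q)" for q :: rat
  have d[measurable]: "d q \<in> borel_measurable S" for q by (simp add: d_def d0)
  have dA: "(\<integral>\<^sup>+x. d q x * indicator A x \<partial>\<nu>) = emeasure Q (A \<times> {of_rat q<..})" if "A \<in> sets S" for q A
    using that by (simp add: d_def d0)
  have dfin: "(\<integral>\<^sup>+x. d q x \<partial>\<nu>) \<noteq> \<infinity>" for q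
  proof -
    have "(\<integral>\<^sup>+x. d q x \<partial>\<nu>) = (\<integral>\<^sup>+x. d q x * indicator (space S) x \<partial>\<nu>)"
      by (intro nn_integral_cong) (simp add: sp\<nu>)
    then show ?thesis by (simp add: dA)
  qed
  have AE_mono: "AE x in \<nu>. d p x \<le> d q x" if "q \<le> p" for p q
  proof (rule AE_le_of_set_nn_integral_le)
    fix A assume "A \<in> sets \<nu>"
    then have A: "A \<in> sets S" by (simp add: s\<nu>)
    show "(\<integral>\<^sup>+x. d p x * indicator A x \<partial>\<nu>) \<le> (\<integral>\<^sup>+x. d q x * indicator A x \<partial>\<nu>)"
      unfolding dA[OF A] using that A by (intro emeasure_mono) (auto simp: less_le_trans le_less_trans of_rat_less_eq intro: le_less_trans[of "of_rat q :: real" "of_rat p"])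
  qed (use dfin[of q] in auto)
  have AE_1: "AE x in \<nu>. d q x \<le> 1" for q
  proof (rule AE_le_of_set_nn_integral_le)
    fix A assume "A \<in> sets \<nu>"
    then have A: "A \<in> sets S" by (simp add: s\<nu>)
    have "(\<integral>\<^sup>+x. 1 * indicator A x \<partial>\<nu>) = emeasure Q (A \<times> UNIV)"
      using A by (simp add: \<nu>A[symmetric] s\<nu>)
    then show "(\<integral>\<^sup>+x. d q x * indicator A x \<partial>\<nu>) \<le> (\<integral>\<^sup>+x. 1 * indicator A x \<partial>\<nu>)"
      unfolding dA[OF A] using A by (auto intro!: emeasure_mono)
  qed (auto simp: \<nu>.emeasure_space_1)
  \<comment> \<open>The supremum over higher levels is decreasing in \<open>q\<close> at every
    point, and it differs from \<open>d\<close> only on a null set.\<close>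
  define D where "D q x = min 1 (SUP p\<in>{q..}. d p x)" for q x
  have D[measurable]: "D q \<in> borel_measurable S" for q
    unfolding D_def[abs_def] by measurable
  have D1: "D q x \<le> 1" for q x by (simp add: D_def)
  have D_mono: "D p x \<le> D q x" if "q \<le> p" for p q x
    unfolding D_def using that by (intro min.mono SUP_subset_mono) auto
  have "AE x in \<nu>. \<forall>q p. q \<le> p \<longrightarrow> d p x \<le> d q x"
    using AE_mono by (simp add: AE_all_countable)
  moreover have "AE x in \<nu>. \<forall>q. d q x \<le> 1" using AE_1 by (simp add: AE_all_countable)
  ultimately have Dd: "AE x in \<nu>. \<forall>q. D q x = d q x"
  proof eventually_elim
    case (elim x)
    have "(SUP p\<in>{q..}. d p x) = d q x" for q
      using elim(1) by (intro antisym SUP_least SUP_upper) auto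
    with elim(2) show ?case by (simp add: D_def min_def antisym)
  qed
  have DA: "(\<integral>\<^sup>+x. D q x * indicator A x \<partial>\<nu>) = emeasure Q (A \<times> {of_rat q<..})" if "A \<in> sets S" for q A
    unfolding dA[OF that, symmetric] by (rule nn_integral_cong_AE) (use Dd in eventually_elim, simp)
  define E where "E q x = enn2real (D q x)" for q x
  have [measurable]: "E q \<in> borel_measurable S" for q unfolding E_def[abs_def] by measurable
  have E0: "0 \<le> E q x" for q x by (simp add: E_def)
  have ED: "ennreal (min 1 (E q x)) = D q x" for q x
  proof -
    have "D q x < \<top>" using D1[of q x] by (metis ennreal_one_less_top order_le_less_trans)
    then have *: "ennreal (E q x) = D q x" by (simp add: E_def)
    with D1[of q x] have "E q x \<le> 1" by (metis ennreal_1 ennreal_le_iff zero_le_one)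
    with * show ?thesis by (simp add: min_def)
  qed
  have E_mono: "E p x \<le> E q x" if "q \<le> p" for p q x
    unfolding E_def using D_mono[OF that, of x] D1[of q x]
    by (intro enn2real_mono) (auto intro: order_le_less_trans)
  \<comment> \<open>The generalised inverse of the tail function: the supremum of the levels whose
    tail probability is at least the uniform value. Clipping to [-1, 1], which the bound on the
    second component permits, makes the supremum exist everywhere.\<close>
  define g where "g p = (SUP q::rat. if snd p \<le> E q (fst p) \<and> of_rat q \<le> (1::real) then max (of_rat q) (- 1 :: real) else - 1)" for p :: "'s \<times> real"
  have bdd: "bdd_above (range (\<lambda>q::rat. if snd p \<le> E q (fst p) \<and> of_rat q \<le> (1::real) then max (of_rat q) (- 1 :: real) else - 1))" for p :: "'s \<times> real"
    by (rule bdd_aboveI[of _ 1]) (auto split: if_splits)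
  have gm[measurable]: "g \<in> borel_measurable (S \<Otimes>\<^sub>M borel)"
    unfolding g_def[abs_def] by (rule borel_measurable_cSUP) (use bdd in \<open>auto\<close>)
  have g_gt: "t < g p \<longleftrightarrow> t < - 1 \<or> (\<exists>q::rat. snd p \<le> E q (fst p) \<and> of_rat q \<le> (1::real) \<and> t < of_rat q)" for t p
    unfolding g_def by (subst less_cSUP_iff[OF _ bdd]) (auto split: if_splits simp: less_max_iff_disj)
  let ?P = "\<nu> \<Otimes>\<^sub>M unif"
  let ?T = "\<lambda>p. (fst p, g p)"
  have Tm[measurable]: "?T \<in> measurable ?P (S \<Otimes>\<^sub>M borel)" by measurable
  have P_le: "emeasure ?P {p \<in> space ?P. fst p \<in> A \<and> snd p \<le> E q (fst p)} = emeasure Q (A \<times> {of_rat q<..})"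
    if A[measurable]: "A \<in> sets S" for A q
  proof -
    have "emeasure ?P {p \<in> space ?P. fst p \<in> A \<and> snd p \<le> E q (fst p)}
      = (\<integral>\<^sup>+x. emeasure unif (Pair x -` {p \<in> space ?P. fst p \<in> A \<and> snd p \<le> E q (fst p)}) \<partial>\<nu>)"
      by (rule U.emeasure_pair_measure_alt) measurable
    also have "\<dots> = (\<integral>\<^sup>+x. D q x * indicator A x \<partial>\<nu>)"
    proof (rule nn_integral_cong)
      fix x assume x: "x \<in> space \<nu>"
      show "emeasure unif (Pair x -` {p \<in> space ?P. fst p \<in> A \<and> snd p \<le> E q (fst p)}) = D q x * indicator A x"
      proof (cases "x \<in> A")
        case True
        then have "Pair x -` {p \<in> space ?P. fst p \<in> A \<and> snd p \<le> E q (fst p)} = {v. v \<le> E q x}"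
          using x by (auto simp: space_pair_measure)
        then show ?thesis using True by (simp add: emeasure_unif_le[OF E0] ED)
      qed (auto simp: space_pair_measure)
    qed
    finally show ?thesis by (simp add: DA[OF A])
  qed
  have total: "emeasure ?P {p \<in> space ?P. fst p \<in> A} = emeasure Q (A \<times> UNIV)" if A[measurable]: "A \<in> sets S" for A
  proof -
    have "{p \<in> space ?P. fst p \<in> A} = A \<times> UNIV"
      using sets.sets_into_space[OF A] by (auto simp: space_pair_measure sp\<nu>)
    then show ?thesis using A by (simp add: U.emeasure_pair_measure_Times U.emeasure_space_1[simplified] s\<nu> \<nu>A)
  qed
  have gt: "emeasure ?P {p \<in> space ?P. fst p \<in> A \<and> t < g p} = emeasure Q (A \<times> {t<..})" if A[measurable]: "A \<in> sets S" for A t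
  proof -
    consider "t < - 1" | "- 1 \<le> t" "t < 1" | "1 \<le> t" by linarith
    then show ?thesis
    proof cases
      case 1
      have "emeasure Q (A \<times> UNIV) = emeasure Q (A \<times> {t<..})"
      proof (rule emeasure_eq_AE)
        show "AE p in Q. (p \<in> A \<times> UNIV) = (p \<in> A \<times> {t<..})"
          using bounded by eventually_elim (use 1 in \<open>auto simp: abs_le_iff\<close>)
      qed (use A in auto)
      with 1 show ?thesis using total[OF A] by (simp add: g_gt)
    next
      case 2
      \<comment> \<open>Rational levels above \<open>t\<close> that tend to \<open>t\<close>;
        staying below 1 they pass the test in \<open>g\<close>.\<close>
      have "\<exists>s::rat. t < of_rat s \<and> of_rat s < min 1 (t + 1 / real (Suc n))" for n
        using 2 of_rat_dense[of t "min 1 (t + 1 / real (Suc n))"] by auto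
      then obtain s :: "nat \<Rightarrow> rat" where s: "\<And>n. t < of_rat (s n)" "\<And>n. of_rat (s n) < min 1 (t + 1 / real (Suc n))"
        by metis
      \<comment> \<open>Running minima make the levels decreasing, so that the corresponding events
        increase.\<close>
      define r where "r n = Min (s ` {..n})" for n
      have r_in: "r n \<in> s ` {..n}" for n unfolding r_def by (rule Min_in) auto
      have r_le: "r n \<le> s n" for n unfolding r_def by (rule Min_le) auto
      have r_anti: "r n \<le> r m" if "m \<le> n" for m n unfolding r_def using that by (intro Min_antimono) auto
      have r_gt: "t < of_rat (r n)" and r1: "of_rat (r n) \<le> (1::real)" for n
        using r_in[of n] s by (auto intro: less_imp_le)
      have r_lim: "\<exists>n. of_rat (r n) < x" if "t < x" for x
      proof -
        obtain n where "1 / real (Suc n) < x - t" using \<open>t < x\<close> nat_approx_posE[of "x - t"] by auto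
        moreover have "of_rat (r n) \<le> (of_rat (s n) :: real)" using r_le by (simp add: of_rat_less_eq)
        ultimately have "of_rat (r n) < x" using s(2)[of n] by linarith
        then show ?thesis ..
      qed
      let ?B = "\<lambda>n. {p \<in> space ?P. fst p \<in> A \<and> snd p \<le> E (r n) (fst p)}"
      have UB: "{p \<in> space ?P. fst p \<in> A \<and> t < g p} = (\<Union>n. ?B n)"
      proof safe
        fix p assume p: "p \<in> space ?P" "fst p \<in> A" "t < g p"
        then obtain q :: rat where q: "snd p \<le> E q (fst p)" "t < of_rat q" using 2 by (auto simp: g_gt)
        obtain n where n: "of_rat (r n) < (of_rat q :: real)" using r_lim[OF q(2)] by blast
        then have "E q (fst p) \<le> E (r n) (fst p)" by (intro E_mono) (simp add: of_rat_less)
        with p q show "p \<in> (\<Union>n. ?B n)" by (auto intro!: exI[of _ n])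
      next
        fix p n assume "p \<in> space ?P" "fst p \<in> A" "snd p \<le> E (r n) (fst p)"
        then show "t < g p" using r_gt[of n] r1[of n] by (auto simp: g_gt)
      qed
      have UC: "A \<times> {t<..} = (\<Union>n. A \<times> {of_rat (r n)<..})"
        using r_gt r_lim by (auto intro: less_trans)
      have "emeasure ?P {p \<in> space ?P. fst p \<in> A \<and> t < g p} = (SUP n. emeasure ?P (?B n))"
        unfolding UB
      proof (rule SUP_emeasure_incseq[symmetric])
        show "range ?B \<subseteq> sets ?P"
        proof (intro image_subsetI)
          fix n show "?B n \<in> sets ?P" by measurable
        qed
        show "incseq ?B"
          unfolding incseq_def using E_mono[OF r_anti] by (auto intro: order_trans)
      qed
      also have "\<dots> = (SUP n. emeasure Q (A \<times> {of_rat (r n)<..}))" by (simp only: P_le[OF A])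
      also have "\<dots> = emeasure Q (A \<times> {t<..})"
        unfolding UC
      proof (rule SUP_emeasure_incseq)
        have "A \<times> {of_rat (r m)<..} \<subseteq> A \<times> {(of_rat (r n) :: real)<..}" if "m \<le> n" for m n
        proof -
          have "of_rat (r n) \<le> (of_rat (r m) :: real)" using r_anti[OF that] by (simp add: of_rat_less_eq)
          then show ?thesis by auto
        qed
        then show "incseq (\<lambda>n. A \<times> {(of_rat (r n) :: real)<..})" by (simp add: incseq_def)
      qed (use A in auto)
      finally show ?thesis .
    next
      case 3
      have "\<not> t < g p" for p
      proof
        assume "t < g p"
        then consider "t < - 1" | q :: rat where "of_rat q \<le> (1::real)" "t < of_rat q" unfolding g_gt by blast
        then show False using 3 by cases linarith+
      qed
      then have "{p \<in> space ?P. fst p \<in> A \<and> t < g p} = {}" by simp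
      moreover have "emeasure Q (A \<times> {t<..}) = emeasure Q {}"
      proof (rule emeasure_eq_AE)
        show "AE p in Q. (p \<in> A \<times> {t<..}) = (p \<in> {})"
          using bounded by eventually_elim (use 3 in \<open>auto simp: abs_le_iff\<close>)
      qed (use A in auto)
      ultimately show ?thesis by (simp only: emeasure_empty)
    qed
  qed
  have rectangle: "emeasure (distr ?P (S \<Otimes>\<^sub>M borel) ?T) (A \<times> T) = emeasure Q (A \<times> T)"
    if A[measurable]: "A \<in> sets S" and T[measurable]: "T \<in> sets borel" for A T
  proof -
    \<comment> \<open>For fixed \<open>A\<close> both sides are finite measures in \<open>T\<close>,
      determined by their values on half-lines.\<close>
    let ?M1 = "distr (density ?P (\<lambda>p. indicator A (fst p))) borel g"
    let ?M2 = "distr (density Q (\<lambda>p. indicator A (fst p))) borel snd"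
    have [measurable]: "snd \<in> borel_measurable Q" by (simp cong: measurable_cong_sets add: sQ)
    have M1: "emeasure ?M1 T = emeasure ?P {p \<in> space ?P. fst p \<in> A \<and> g p \<in> T}" if [measurable]: "T \<in> sets borel" for T
    proof -
      have gP: "g \<in> borel_measurable ?P" by measurable
      have "emeasure ?M1 T = emeasure (density ?P (\<lambda>p. indicator A (fst p))) (g -` T \<inter> space ?P)"
        using gP that by (subst emeasure_distr) auto
      also have "\<dots> = (\<integral>\<^sup>+p. indicator A (fst p) * indicator (g -` T \<inter> space ?P) p \<partial>?P)"
        by (rule emeasure_density[OF _ measurable_sets[OF gP that]]) measurable
      also have "\<dots> = (\<integral>\<^sup>+p. indicator {p \<in> space ?P. fst p \<in> A \<and> g p \<in> T} p \<partial>?P)"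
        by (intro nn_integral_cong) (auto simp: indicator_def)
      also have "\<dots> = emeasure ?P {p \<in> space ?P. fst p \<in> A \<and> g p \<in> T}"
        by (rule nn_integral_indicator) measurable
      finally show ?thesis .
    qed
    have M2: "emeasure ?M2 T = emeasure Q (A \<times> T)" if [measurable]: "T \<in> sets borel" for T
    proof -
      have sndQ: "snd \<in> borel_measurable Q" by measurable
      have "emeasure ?M2 T = emeasure (density Q (\<lambda>p. indicator A (fst p))) (snd -` T \<inter> space Q)"
        using sndQ that by (subst emeasure_distr) auto
      also have "\<dots> = (\<integral>\<^sup>+p. indicator A (fst p) * indicator (snd -` T \<inter> space Q) p \<partial>Q)"
        by (rule emeasure_density[OF _ measurable_sets[OF sndQ that]]) measurable
      also have "\<dots> = (\<integral>\<^sup>+p. indicator (A \<times> T) p \<partial>Q)"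
        by (intro nn_integral_cong) (auto simp: indicator_def)
      also have "\<dots> = emeasure Q (A \<times> T)" using A that by (intro nn_integral_indicator) auto
      finally show ?thesis .
    qed
    have "?M1 = ?M2"
    proof (rule measure_eqI_lessThan)
      fix t :: real
      show "emeasure ?M1 {t<..} = emeasure ?M2 {t<..}" by (simp add: M1 M2 gt)
      show "emeasure ?M1 {t<..} < \<infinity>" by (simp add: M1 gt less_top[symmetric])
    qed simp_all
    then have "emeasure ?P {p \<in> space ?P. fst p \<in> A \<and> g p \<in> T} = emeasure Q (A \<times> T)"
      using M1[OF T] M2[OF T] by simp
    moreover have "?T -` (A \<times> T) \<inter> space ?P = {p \<in> space ?P. fst p \<in> A \<and> g p \<in> T}" by auto
    ultimately show ?thesis using A T by (subst emeasure_distr) auto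
  qed
  have "distr ?P (S \<Otimes>\<^sub>M borel) ?T = Q"
  proof (rule measure_eqI_generator_eq[OF Int_stable_pair_measure_generator[of S borel], where \<Omega>="space S \<times> UNIV" and A="\<lambda>_. space S \<times> UNIV"])
    show "{a \<times> b |a b. a \<in> sets S \<and> b \<in> sets borel} \<subseteq> Pow (space S \<times> (UNIV :: real set))"
      using sets.sets_into_space[of _ S] by blast
    show "sets (distr ?P (S \<Otimes>\<^sub>M borel) ?T) = sigma_sets (space S \<times> UNIV) {a \<times> b |a b. a \<in> sets S \<and> b \<in> sets borel}"
      by (simp add: sets_pair_measure)
    show "sets Q = sigma_sets (space S \<times> UNIV) {a \<times> b |a b. a \<in> sets S \<and> b \<in> sets borel}"
      by (simp add: sQ sets_pair_measure)
    show "range (\<lambda>_::nat. space S \<times> (UNIV::real set)) \<subseteq> {a \<times> b |a b. a \<in> sets S \<and> b \<in> sets borel}"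
      using sets.top[of S] by (auto intro!: exI[of _ "space S"])
    show "emeasure (distr ?P (S \<Otimes>\<^sub>M borel) ?T) (space S \<times> UNIV) \<noteq> \<infinity>"
      by (simp add: rectangle)
  qed (auto simp: rectangle)
  then show ?thesis using gm by (auto simp: \<nu>_def)
qed

text \<open>The map y / (1 + |y|) sends the line into [-1, 1] and has a measurable inverse, which
  reduces the claim to the bounded case.\<close>

lemma conditional_sampling_real:
  fixes Q :: "('s \<times> real) measure"
  assumes Q: "prob_space Q" and sQ: "sets Q = sets (S \<Otimes>\<^sub>M borel)"
  shows "\<exists>g \<in> borel_measurable (S \<Otimes>\<^sub>M borel).
    distr (distr Q S fst \<Otimes>\<^sub>M unif) (S \<Otimes>\<^sub>M borel) (\<lambda>p. (fst p, g p)) = Q"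
proof -
  interpret Q: prob_space Q by fact
  define s :: "real \<Rightarrow> real" where "s y = y / (1 + \<bar>y\<bar>)" for y
  define s' :: "real \<Rightarrow> real" where "s' z = z / (1 - \<bar>z\<bar>)" for z
  have [measurable]: "s \<in> borel_measurable borel" "s' \<in> borel_measurable borel"
    unfolding s_def[abs_def] s'_def[abs_def] by measurable
  have s1: "\<bar>s y\<bar> \<le> 1" for y by (simp add: s_def abs_divide)
  have s's: "s' (s y) = y" for y
  proof -
    have "1 - \<bar>s y\<bar> = 1 / (1 + \<bar>y\<bar>)" by (simp add: s_def abs_divide field_simps)
    then show ?thesis by (simp add: s'_def s_def)
  qed
  have [measurable]: "fst \<in> measurable Q S" "snd \<in> borel_measurable Q"
    by (simp_all cong: measurable_cong_sets add: sQ)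
  define Q' where "Q' = distr Q (S \<Otimes>\<^sub>M borel) (\<lambda>p. (fst p, s (snd p)))"
  have f: "distr Q' S fst = distr Q S fst"
    unfolding Q'_def by (subst distr_distr) (auto simp: comp_def)
  have "prob_space Q'" unfolding Q'_def by (rule Q.prob_space_distr) measurable
  moreover have "AE p in Q'. \<bar>snd p\<bar> \<le> 1"
    unfolding Q'_def by (subst AE_distr_iff) (auto simp: s1)
  ultimately obtain g where g[measurable]: "g \<in> borel_measurable (S \<Otimes>\<^sub>M borel)"
    and eq: "distr (distr Q S fst \<Otimes>\<^sub>M unif) (S \<Otimes>\<^sub>M borel) (\<lambda>p. (fst p, g p)) = Q'"
    using conditional_sampling_bounded[of Q' S] unfolding f by (auto simp: Q'_def)
  have "distr (distr Q S fst \<Otimes>\<^sub>M unif) (S \<Otimes>\<^sub>M borel) (\<lambda>p. (fst p, s' (g p)))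
     = distr Q' (S \<Otimes>\<^sub>M borel) (\<lambda>p. (fst p, s' (snd p)))"
    unfolding eq[symmetric] by (subst distr_distr) (auto simp: comp_def)
  also have "\<dots> = distr Q (S \<Otimes>\<^sub>M borel) (\<lambda>p. p)"
    unfolding Q'_def by (subst distr_distr) (auto simp: comp_def s's)
  also have "\<dots> = Q" by (rule distr_id2) (simp add: sQ)
  finally show ?thesis by (intro bexI[of _ "\<lambda>p. s' (g p)"]) auto
qed

lemma measure_eqI_indicator:
  assumes "sets M = sets N"
    and "\<And>A. A \<in> sets N \<Longrightarrow> (\<integral>\<^sup>+x. indicator A x \<partial>M) = (\<integral>\<^sup>+x. indicator A x \<partial>N)"
  shows "M = N"
  using assms by (intro measure_eqI) auto

lemma distr_eqI_nn_integral:
  assumes T[measurable]: "T \<in> measurable M N" and s: "sets Q = sets N"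
    and eq: "\<And>F :: _ \<Rightarrow> ennreal. F \<in> borel_measurable N \<Longrightarrow> (\<integral>\<^sup>+x. F (T x) \<partial>M) = (\<integral>\<^sup>+x. F x \<partial>Q)"
  shows "distr M N T = Q"
proof (rule measure_eqI_indicator)
  fix A assume "A \<in> sets Q"
  then have [measurable]: "A \<in> sets N" by (simp add: s)
  have "(\<integral>\<^sup>+x. indicator A x \<partial>distr M N T) = (\<integral>\<^sup>+x. indicator A (T x) \<partial>M)"
    by (rule nn_integral_distr) auto
  then show "(\<integral>\<^sup>+x. indicator A x \<partial>distr M N T) = (\<integral>\<^sup>+x. indicator A x \<partial>Q)"
    by (simp only: eq[OF borel_measurable_indicator[OF \<open>A \<in> sets N\<close>]])
qed (simp add: s)

text \<open>The coordinates are sampled one after the other, each with its own uniform variable and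
  conditionally on the first component and the coordinates already present. For this
  \<open>conditional_sampling_real\<close> is stated over an arbitrary conditioning space.\<close>

lemma conditional_sampling_PiM:
  fixes Q :: "('s \<times> ('i \<Rightarrow> real)) measure"
  assumes "finite I" and Q: "prob_space Q" and sQ: "sets Q = sets (S \<Otimes>\<^sub>M PiM I (\<lambda>_. borel))"
  shows "\<exists>g \<in> measurable (S \<Otimes>\<^sub>M PiM I (\<lambda>_. borel)) (PiM I (\<lambda>_. borel)).
    distr (distr Q S fst \<Otimes>\<^sub>M PiM I (\<lambda>_. unif)) (S \<Otimes>\<^sub>M PiM I (\<lambda>_. borel)) (\<lambda>p. (fst p, g p)) = Q"
  using assms
proof (induction I arbitrary: Q rule: finite_induct)
  case empty
  note sQ = empty.prems(2)
  interpret Q: prob_space Q by (rule empty.prems(1))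
  interpret U: prob_space "PiM {} (\<lambda>_. unif) :: ('i \<Rightarrow> real) measure" by (rule prob_space_PiM) (rule prob_space_unif)
  have spQ: "snd p = (\<lambda>_. undefined)" if "p \<in> space Q" for p
  proof -
    have "p \<in> space (S \<Otimes>\<^sub>M PiM {} (\<lambda>_. borel))"
      using that unfolding sets_eq_imp_space_eq[OF sQ] .
    then have "snd p \<in> space (PiM {} (\<lambda>_. borel) :: ('i \<Rightarrow> real) measure)"
      unfolding space_pair_measure mem_Times_iff by (rule conjunct2)
    then show ?thesis unfolding space_PiM by (simp only: PiE_empty_domain singleton_iff)
  qed
  have [measurable]: "fst \<in> measurable Q S"
    unfolding measurable_cong_sets[OF sQ refl] by (rule measurable_fst)
  have sU[measurable_cong]: "sets (PiM {} (\<lambda>_. unif) :: ('i \<Rightarrow> real) measure) = sets (PiM {} (\<lambda>_. borel))"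
    by (rule sets_PiM_cong) auto
  have [measurable]: "(\<lambda>_. (\<lambda>_. undefined)) \<in> measurable N (PiM {} (\<lambda>_. borel) :: ('i \<Rightarrow> real) measure)" for N :: "'x measure"
    by (rule measurable_const) (simp add: space_PiM)
  let ?U0 = "PiM {} (\<lambda>_. unif) :: ('i \<Rightarrow> real) measure"
  have "distr (distr Q S fst \<Otimes>\<^sub>M ?U0) (S \<Otimes>\<^sub>M PiM {} (\<lambda>_. borel)) (\<lambda>p. (fst p, \<lambda>_. undefined)) = Q"
  proof (rule distr_eqI_nn_integral)
    fix F :: "'s \<times> ('i \<Rightarrow> real) \<Rightarrow> ennreal" assume [measurable]: "F \<in> borel_measurable (S \<Otimes>\<^sub>M PiM {} (\<lambda>_. borel))"
    have "(\<integral>\<^sup>+p. F (fst p, \<lambda>_. undefined) \<partial>(distr Q S fst \<Otimes>\<^sub>M ?U0))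
      = (\<integral>\<^sup>+x. F (x, \<lambda>_. undefined) \<partial>distr Q S fst)"
      by (subst U.nn_integral_fst[symmetric]) (auto simp: U.emeasure_space_1)
    also have "\<dots> = (\<integral>\<^sup>+p. F (fst p, \<lambda>_. undefined) \<partial>Q)" by (rule nn_integral_distr) measurable
    also have "\<dots> = (\<integral>\<^sup>+p. F p \<partial>Q)"
    proof (rule nn_integral_cong)
      fix p assume "p \<in> space Q"
      from spQ[OF this] have "(fst p, \<lambda>_. undefined) = p" by (simp add: prod_eq_iff)
      then show "F (fst p, \<lambda>_. undefined) = F p" by simp
    qed
    finally show "(\<integral>\<^sup>+p. F (fst p, \<lambda>_. undefined) \<partial>(distr Q S fst \<Otimes>\<^sub>M ?U0)) = (\<integral>\<^sup>+p. F p \<partial>Q)" .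
  qed (auto simp: sQ)
  then show ?case by (intro bexI[of _ "\<lambda>_ _. undefined"]) auto
next
  case (insert i I)
  note sQ = insert.prems(2)
  interpret Q: prob_space Q by (rule insert.prems(1))
  interpret un: prob_space unif by (rule prob_space_unif)
  let ?Pi = "\<lambda>J. PiM J (\<lambda>_. borel) :: ('i \<Rightarrow> real) measure"
  let ?U = "\<lambda>J. PiM J (\<lambda>_. unif) :: ('i \<Rightarrow> real) measure"
  interpret UI: prob_space "?U I" by (rule prob_space_PiM) (rule prob_space_unif)
  interpret UiI: prob_space "?U (insert i I)" by (rule prob_space_PiM) (rule prob_space_unif)
  have sU[measurable_cong]: "sets (?U J) = sets (?Pi J)" for J by (rule sets_PiM_cong) auto
  note [measurable_cong] = sQ
  have [measurable]: "fst \<in> measurable Q S" "snd \<in> measurable Q (?Pi (insert i I))"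
    unfolding measurable_cong_sets[OF sQ refl] by (rule measurable_fst measurable_snd)+
  have res[measurable]: "(\<lambda>y. restrict y I) \<in> measurable (?Pi (insert i I)) (?Pi I)"
    by (rule measurable_restrict_subset) auto
  have upd: "(\<lambda>p. (fst p)(i := snd p)) \<in> measurable (?Pi I \<Otimes>\<^sub>M borel) (?Pi (insert i I))"
    using measurable_add_dim[of i I "\<lambda>_. borel :: real measure"] by (simp add: case_prod_beta)
  have upd'[measurable (raw)]: "(\<lambda>x. (a x)(i := r x)) \<in> measurable N (?Pi (insert i I))"
    if [measurable]: "a \<in> measurable N (?Pi I)" "r \<in> borel_measurable N" for a r and N :: "'x measure"
    using measurable_compose[OF _ upd, of "\<lambda>x. (a x, r x)" N] by simp
  have comp[measurable]: "(\<lambda>y. y i) \<in> borel_measurable (?Pi (insert i I))"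
    by (rule measurable_component_singleton) simp
  define \<nu> where "\<nu> = distr Q S fst"
  have s\<nu>[measurable_cong]: "sets \<nu> = sets S" by (simp add: \<nu>_def)
  interpret \<nu>: prob_space \<nu> unfolding \<nu>_def by (rule Q.prob_space_distr) measurable
  \<comment> \<open>\<open>Q1\<close> forgets coordinate \<open>i\<close>; \<open>Q2\<close>
    regroups \<open>Q\<close> so that coordinate \<open>i\<close> can be sampled given all the
    rest.\<close>
  define Q1 where "Q1 = distr Q (S \<Otimes>\<^sub>M ?Pi I) (\<lambda>p. (fst p, restrict (snd p) I))"
  define Q2 where "Q2 = distr Q ((S \<Otimes>\<^sub>M ?Pi I) \<Otimes>\<^sub>M borel) (\<lambda>p. ((fst p, restrict (snd p) I), snd p i))"
  have sQ1[measurable_cong]: "sets Q1 = sets (S \<Otimes>\<^sub>M ?Pi I)" and sQ2: "sets Q2 = sets ((S \<Otimes>\<^sub>M ?Pi I) \<Otimes>\<^sub>M borel)"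
    by (simp_all add: Q1_def Q2_def)
  interpret Q1: prob_space Q1 unfolding Q1_def by (rule Q.prob_space_distr) measurable
  have pQ2: "prob_space Q2" unfolding Q2_def by (rule Q.prob_space_distr) measurable
  have \<nu>1: "distr Q1 S fst = \<nu>" unfolding Q1_def \<nu>_def by (subst distr_distr) (auto simp: comp_def)
  from insert.IH[OF Q1.prob_space_axioms sQ1, unfolded \<nu>1] obtain g1 where
    g1[measurable]: "g1 \<in> measurable (S \<Otimes>\<^sub>M ?Pi I) (?Pi I)"
    and eq1: "distr (\<nu> \<Otimes>\<^sub>M ?U I) (S \<Otimes>\<^sub>M ?Pi I) (\<lambda>p. (fst p, g1 p)) = Q1" by (elim bexE)
  have Q21: "distr Q2 (S \<Otimes>\<^sub>M ?Pi I) fst = Q1" unfolding Q1_def Q2_def by (subst distr_distr) (auto simp: comp_def)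
  from conditional_sampling_real[OF pQ2 sQ2, unfolded Q21] obtain g2 where
    g2[measurable]: "g2 \<in> borel_measurable ((S \<Otimes>\<^sub>M ?Pi I) \<Otimes>\<^sub>M borel)"
    and eq2: "distr (Q1 \<Otimes>\<^sub>M unif) ((S \<Otimes>\<^sub>M ?Pi I) \<Otimes>\<^sub>M borel) (\<lambda>p. (fst p, g2 p)) = Q2" by (elim bexE)
  define g where "g p = (g1 (fst p, restrict (snd p) I))(i := g2 ((fst p, g1 (fst p, restrict (snd p) I)), snd p i))" for p
  have g[measurable]: "g \<in> measurable (S \<Otimes>\<^sub>M ?Pi (insert i I)) (?Pi (insert i I))"
    unfolding g_def[abs_def] by measurable
  have "distr (\<nu> \<Otimes>\<^sub>M ?U (insert i I)) (S \<Otimes>\<^sub>M ?Pi (insert i I)) (\<lambda>p. (fst p, g p)) = Q"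
  proof (rule distr_eqI_nn_integral)
    fix F :: "'s \<times> ('i \<Rightarrow> real) \<Rightarrow> ennreal"
    assume F[measurable]: "F \<in> borel_measurable (S \<Otimes>\<^sub>M ?Pi (insert i I))"
    let ?G = "\<lambda>s w. F (fst s, (snd s)(i := g2 (s, w)))"
    have U: "distr (unif \<Otimes>\<^sub>M ?U I) (?U (insert i I)) (\<lambda>(x, X). X(i := x)) = ?U (insert i I)"
      by (rule distr_pair_PiM_eq_PiM) (use insert.hyps in \<open>auto intro: prob_space_unif\<close>)
    have "(\<integral>\<^sup>+p. F (fst p, g p) \<partial>(\<nu> \<Otimes>\<^sub>M ?U (insert i I))) = (\<integral>\<^sup>+x. \<integral>\<^sup>+v. F (x, g (x, v)) \<partial>?U (insert i I) \<partial>\<nu>)"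
      by (subst UiI.nn_integral_fst[symmetric]) auto
    also have "\<dots> = (\<integral>\<^sup>+x. \<integral>\<^sup>+v. \<integral>\<^sup>+w. ?G (x, g1 (x, v)) w \<partial>unif \<partial>?U I \<partial>\<nu>)"
    proof (rule nn_integral_cong)
      fix x assume "x \<in> space \<nu>"
      then have [measurable]: "x \<in> space S" by (simp add: \<nu>_def)
      interpret P: pair_sigma_finite unif "?U I" ..
      have "(\<integral>\<^sup>+v. F (x, g (x, v)) \<partial>?U (insert i I)) = (\<integral>\<^sup>+p. F (x, g (x, (snd p)(i := fst p))) \<partial>(unif \<Otimes>\<^sub>M ?U I))"
        by (subst U[symmetric], subst nn_integral_distr) (auto simp: case_prod_beta)
      also have "\<dots> = (\<integral>\<^sup>+p. ?G (x, g1 (x, snd p)) (fst p) \<partial>(unif \<Otimes>\<^sub>M ?U I))"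
      proof (rule nn_integral_cong)
        fix p assume "p \<in> space (unif \<Otimes>\<^sub>M ?U I)"
        then have "restrict ((snd p)(i := fst p)) I = snd p"
          using insert.hyps(2) by (auto simp: space_pair_measure space_PiM PiE_def extensional_def fun_eq_iff restrict_def)
        then show "F (x, g (x, (snd p)(i := fst p))) = ?G (x, g1 (x, snd p)) (fst p)" by (simp add: g_def)
      qed
      also have "\<dots> = (\<integral>\<^sup>+v. \<integral>\<^sup>+w. ?G (x, g1 (x, v)) w \<partial>unif \<partial>?U I)"
        by (subst P.nn_integral_snd[symmetric]) (auto simp: case_prod_beta)
      finally show "(\<integral>\<^sup>+v. F (x, g (x, v)) \<partial>?U (insert i I)) = (\<integral>\<^sup>+v. \<integral>\<^sup>+w. ?G (x, g1 (x, v)) w \<partial>unif \<partial>?U I)" .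
    qed
    also have "\<dots> = (\<integral>\<^sup>+p. \<integral>\<^sup>+w. ?G (fst p, g1 p) w \<partial>unif \<partial>(\<nu> \<Otimes>\<^sub>M ?U I))"
      by (subst UI.nn_integral_fst[symmetric]) auto
    also have "\<dots> = (\<integral>\<^sup>+s. \<integral>\<^sup>+w. ?G s w \<partial>unif \<partial>Q1)"
      unfolding eq1[symmetric] by (rule nn_integral_distr[symmetric]) measurable
    also have "\<dots> = (\<integral>\<^sup>+p. ?G (fst p) (snd p) \<partial>(Q1 \<Otimes>\<^sub>M unif))"
      by (subst un.nn_integral_fst[symmetric]) auto
    also have "\<dots> = (\<integral>\<^sup>+p. F (fst (fst p), (snd (fst p))(i := snd p)) \<partial>Q2)"
      unfolding eq2[symmetric] by (subst nn_integral_distr) auto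
    also have "\<dots> = (\<integral>\<^sup>+p. F (fst p, (restrict (snd p) I)(i := snd p i)) \<partial>Q)"
      unfolding Q2_def by (subst nn_integral_distr) auto
    also have "\<dots> = (\<integral>\<^sup>+p. F p \<partial>Q)"
    proof (rule nn_integral_cong)
      fix p assume "p \<in> space Q"
      then have "p \<in> space (S \<Otimes>\<^sub>M ?Pi (insert i I))"
        unfolding sets_eq_imp_space_eq[OF sQ] .
      then have "snd p \<in> space (?Pi (insert i I))"
        unfolding space_pair_measure mem_Times_iff by (rule conjunct2)
      then have "snd p \<in> extensional (insert i I)"
        unfolding space_PiM PiE_def by (rule IntD2)
      then have "(restrict (snd p) I)(i := snd p i) = snd p"
        by (auto simp: fun_eq_iff extensional_def restrict_def)
      then show "F (fst p, (restrict (snd p) I)(i := snd p i)) = F p" by simp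
    qed
    finally show "(\<integral>\<^sup>+p. F (fst p, g p) \<partial>(\<nu> \<Otimes>\<^sub>M ?U (insert i I))) = (\<integral>\<^sup>+p. F p \<partial>Q)" .
  qed (use sQ in auto)
  with g show ?case unfolding \<nu>_def by (intro bexI[of _ g])
qed

text \<open>The randomness is a sequence of uniform variables in every dimension: an injection of
  the basis into the natural numbers selects the coordinates to be used. This gives the extra factor
  of the final probability space a type that does not depend on the dimension.\<close>

lemma conditional_sampling_euclidean:
  fixes Q :: "('s \<times> 'a::euclidean_space) measure"
  assumes Q: "prob_space Q" and sQ: "sets Q = sets (S \<Otimes>\<^sub>M borel)"
  shows "\<exists>g \<in> borel_measurable (S \<Otimes>\<^sub>M PiM UNIV (\<lambda>_::nat. borel)).
    distr (distr Q S fst \<Otimes>\<^sub>M PiM UNIV (\<lambda>_::nat. unif)) (S \<Otimes>\<^sub>M borel) (\<lambda>p. (fst p, g p)) = Q"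
proof -
  interpret Q: prob_space Q by fact
  let ?B = "PiM Basis (\<lambda>_. borel) :: ('a \<Rightarrow> real) measure"
  let ?U = "PiM UNIV (\<lambda>_. unif) :: (nat \<Rightarrow> real) measure"
  let ?UB = "PiM Basis (\<lambda>_. unif) :: ('a \<Rightarrow> real) measure"
  interpret U: prob_space ?U by (rule prob_space_PiM) (rule prob_space_unif)
  interpret UB: prob_space ?UB by (rule prob_space_PiM) (rule prob_space_unif)
  have [measurable_cong]: "sets ?U = sets (PiM UNIV (\<lambda>_. borel))" "sets ?UB = sets ?B" by (rule sets_PiM_cong; simp)+
  have [measurable]: "fst \<in> measurable Q S" "snd \<in> borel_measurable Q" by (simp_all cong: measurable_cong_sets add: sQ)
  define enc where "enc y = (\<lambda>b\<in>Basis. y \<bullet> b)" for y :: 'a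
  define dec where "dec z = (\<Sum>b\<in>Basis. z b *\<^sub>R b)" for z :: "'a \<Rightarrow> real"
  have [measurable]: "enc \<in> measurable borel ?B" unfolding enc_def[abs_def] by measurable
  have [measurable]: "dec \<in> borel_measurable ?B"
    unfolding dec_def[abs_def] by (intro borel_measurable_sum borel_measurable_scaleR measurable_component_singleton) auto
  have de: "dec (enc y) = y" for y by (simp add: dec_def enc_def euclidean_representation)
  define \<nu> where "\<nu> = distr Q S fst"
  have s\<nu>[measurable_cong]: "sets \<nu> = sets S" by (simp add: \<nu>_def)
  define Q' where "Q' = distr Q (S \<Otimes>\<^sub>M ?B) (\<lambda>p. (fst p, enc (snd p)))"
  have \<nu>': "distr Q' S fst = \<nu>" unfolding Q'_def \<nu>_def by (subst distr_distr) (auto simp: comp_def)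
  have pQ': "prob_space Q'" unfolding Q'_def by (rule Q.prob_space_distr) measurable
  have sQ': "sets Q' = sets (S \<Otimes>\<^sub>M ?B)" by (simp add: Q'_def)
  from conditional_sampling_PiM[OF finite_Basis pQ' sQ', unfolded \<nu>'] obtain g' where g'[measurable]: "g' \<in> measurable (S \<Otimes>\<^sub>M ?B) ?B"
    and eq: "distr (\<nu> \<Otimes>\<^sub>M ?UB) (S \<Otimes>\<^sub>M ?B) (\<lambda>p. (fst p, g' p)) = Q'"
    by (elim bexE)
  obtain e :: "'a \<Rightarrow> nat" where e: "inj_on e Basis"
    using finite_imp_inj_to_nat_seg[OF finite_Basis] by blast
  define \<rho> where "\<rho> v = (\<lambda>b\<in>Basis. v (e b))" for v :: "nat \<Rightarrow> real"
  have [measurable]: "\<rho> \<in> measurable (PiM UNIV (\<lambda>_. borel)) ?B"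
    unfolding \<rho>_def[abs_def] by (intro measurable_restrict measurable_component_singleton) auto
  have \<rho>: "distr ?U ?UB \<rho> = ?UB"
    unfolding \<rho>_def[abs_def] by (rule distr_PiM_reindex) (auto intro: e prob_space_unif)
  define g where "g p = dec (g' (fst p, \<rho> (snd p)))" for p
  have g[measurable]: "g \<in> borel_measurable (S \<Otimes>\<^sub>M PiM UNIV (\<lambda>_::nat. borel))"
    unfolding g_def[abs_def] by measurable
  have "distr (\<nu> \<Otimes>\<^sub>M ?U) (S \<Otimes>\<^sub>M borel) (\<lambda>p. (fst p, g p)) = Q"
  proof (rule distr_eqI_nn_integral)
    fix F :: "'s \<times> 'a \<Rightarrow> ennreal"
    assume F[measurable]: "F \<in> borel_measurable (S \<Otimes>\<^sub>M borel)"
    have "(\<integral>\<^sup>+p. F (fst p, g p) \<partial>(\<nu> \<Otimes>\<^sub>M ?U)) = (\<integral>\<^sup>+x. \<integral>\<^sup>+v. F (x, dec (g' (x, \<rho> v))) \<partial>?U \<partial>\<nu>)"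
      by (subst U.nn_integral_fst[symmetric]) (auto simp: g_def)
    also have "\<dots> = (\<integral>\<^sup>+x. \<integral>\<^sup>+v. F (x, dec (g' (x, v))) \<partial>?UB \<partial>\<nu>)"
    proof (rule nn_integral_cong)
      fix x assume "x \<in> space \<nu>"
      then have [measurable]: "x \<in> space S" by (simp add: \<nu>_def)
      show "(\<integral>\<^sup>+v. F (x, dec (g' (x, \<rho> v))) \<partial>?U) = (\<integral>\<^sup>+v. F (x, dec (g' (x, v))) \<partial>?UB)"
        by (subst \<rho>[symmetric], subst nn_integral_distr) auto
    qed
    also have "\<dots> = (\<integral>\<^sup>+p. F (fst p, dec (g' p)) \<partial>(\<nu> \<Otimes>\<^sub>M ?UB))"
      by (subst UB.nn_integral_fst[symmetric]) auto
    also have "\<dots> = (\<integral>\<^sup>+p. F (fst p, dec (snd p)) \<partial>Q')"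
      unfolding eq[symmetric] by (subst nn_integral_distr) auto
    also have "\<dots> = (\<integral>\<^sup>+p. F p \<partial>Q)"
      unfolding Q'_def by (subst nn_integral_distr) (auto simp: de)
    finally show "(\<integral>\<^sup>+p. F (fst p, g p) \<partial>(\<nu> \<Otimes>\<^sub>M ?U)) = (\<integral>\<^sup>+p. F p \<partial>Q)" .
  qed (use sQ in auto)
  with g show ?thesis unfolding \<nu>_def by (intro bexI[of _ g])
qed

section \<open>Realising a coupling next to a given random variable\<close>

lemma (in prob_space) indep_law_transfer:
  assumes [measurable]: "\<psi> \<in> measurable M N" and "prob_space.indep_law (distr M N \<psi>) S X T Y"
  shows "indep_law S (\<lambda>\<omega>. X (\<psi> \<omega>)) T (\<lambda>\<omega>. Y (\<psi> \<omega>))"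
proof -
  interpret D: prob_space "distr M N \<psi>" by (rule prob_space_distr) measurable
  have [measurable]: "X \<in> measurable N S" "Y \<in> measurable N T"
    using assms(2) by (auto simp: D.indep_law_def)
  have "distr M S (\<lambda>\<omega>. X (\<psi> \<omega>)) = distr (distr M N \<psi>) S X" "distr M T (\<lambda>\<omega>. Y (\<psi> \<omega>)) = distr (distr M N \<psi>) T Y"
    "distr M (S \<Otimes>\<^sub>M T) (\<lambda>\<omega>. (X (\<psi> \<omega>), Y (\<psi> \<omega>))) = distr (distr M N \<psi>) (S \<Otimes>\<^sub>M T) (\<lambda>\<omega>. (X \<omega>, Y \<omega>))"
    by (subst distr_distr; simp add: comp_def)+
  then show ?thesis
    using assms(2) unfolding indep_law_def D.indep_law_def by simp
qed

lemma
  assumes "prob_space A" "prob_space B"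
  shows distr_fst_pair: "distr (A \<Otimes>\<^sub>M B) A fst = A"
    and distr_snd_pair: "distr (A \<Otimes>\<^sub>M B) B snd = B"
proof -
  interpret A: prob_space A by fact
  interpret B: prob_space B by fact
  interpret pair_sigma_finite A B ..
  show "distr (A \<Otimes>\<^sub>M B) A fst = A"
  proof (rule distr_eqI_nn_integral)
    fix F :: "'a \<Rightarrow> ennreal" assume [measurable]: "F \<in> borel_measurable A"
    show "(\<integral>\<^sup>+x. F (fst x) \<partial>(A \<Otimes>\<^sub>M B)) = (\<integral>\<^sup>+x. F x \<partial>A)"
      by (subst B.nn_integral_fst[symmetric]) (auto simp: B.emeasure_space_1)
  qed auto
  show "distr (A \<Otimes>\<^sub>M B) B snd = B"
  proof (rule distr_eqI_nn_integral)
    fix F :: "'b \<Rightarrow> ennreal" assume [measurable]: "F \<in> borel_measurable B"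
    show "(\<integral>\<^sup>+x. F (snd x) \<partial>(A \<Otimes>\<^sub>M B)) = (\<integral>\<^sup>+x. F x \<partial>B)"
      by (subst B.nn_integral_fst[symmetric]) (auto simp: A.emeasure_space_1)
  qed auto
qed

lemma indep_law_pair:
  assumes "prob_space A" "prob_space B" "sets A = sets S" "sets B = sets T"
  shows "prob_space.indep_law (A \<Otimes>\<^sub>M B) S fst T snd"
proof -
  interpret P: prob_space "A \<Otimes>\<^sub>M B" by (rule prob_space_pair) fact+
  have m: "fst \<in> measurable (A \<Otimes>\<^sub>M B) S" "snd \<in> measurable (A \<Otimes>\<^sub>M B) T"
    using assms measurable_fst[of A B] measurable_snd[of A B] by (auto cong: measurable_cong_sets)
  have f: "distr (A \<Otimes>\<^sub>M B) S fst = A" "distr (A \<Otimes>\<^sub>M B) T snd = B"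
    using distr_fst_pair[OF assms(1,2)] distr_snd_pair[OF assms(1,2)] assms(3,4)
    by (metis distr_cong)+
  have "distr (A \<Otimes>\<^sub>M B) (S \<Otimes>\<^sub>M T) (\<lambda>\<omega>. (fst \<omega>, snd \<omega>)) = A \<Otimes>\<^sub>M B"
    using assms by (simp add: distr_id2 cong: sets_pair_measure_cong)
  then show ?thesis using m f by (simp add: P.indep_law_def)
qed

text \<open>\<open>V\<close> already exists on \<open>M\<close>, so it is the conditioning variable,
  and the first component of \<open>\<pi>\<close> is sampled from it. For this the components of
  \<open>\<pi>\<close> are swapped in the proof.\<close>

lemma (in prob_space) glue_law:
  fixes V :: "'a \<Rightarrow> 's::euclidean_space" and \<pi> :: "('s \<times> 's) measure"
  assumes [measurable]: "V \<in> borel_measurable M" and \<pi>: "prob_space \<pi>" "sets \<pi> = sets (borel \<Otimes>\<^sub>M borel)"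
    and V: "distr \<pi> borel snd = distr M borel V"
  defines "N \<equiv> M \<Otimes>\<^sub>M PiM UNIV (\<lambda>_::nat. unif)"
  shows "\<exists>G \<in> borel_measurable N. distr N (borel \<Otimes>\<^sub>M borel) (\<lambda>\<omega>. (G \<omega>, V (fst \<omega>))) = \<pi>"
proof -
  let ?U = "PiM UNIV (\<lambda>_. unif) :: (nat \<Rightarrow> real) measure"
  interpret \<pi>: prob_space \<pi> by fact
  interpret U: prob_space ?U by (rule prob_space_PiM) (rule prob_space_unif)
  have sU[measurable_cong]: "sets ?U = sets (PiM UNIV (\<lambda>_. borel))" by (rule sets_PiM_cong) auto
  have [measurable]: "fst \<in> borel_measurable \<pi>" "snd \<in> borel_measurable \<pi>"
    unfolding measurable_cong_sets[OF \<pi>(2) refl] by (rule measurable_fst measurable_snd)+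
  let ?Q = "distr \<pi> (borel \<Otimes>\<^sub>M borel) (\<lambda>p. (snd p, fst p))"
  have "prob_space ?Q" by (rule \<pi>.prob_space_distr) measurable
  from conditional_sampling_euclidean[OF this, of borel]
  obtain g where g[measurable]: "g \<in> borel_measurable (borel \<Otimes>\<^sub>M PiM UNIV (\<lambda>_::nat. borel))"
    and eq: "distr (distr ?Q borel fst \<Otimes>\<^sub>M ?U) (borel \<Otimes>\<^sub>M borel) (\<lambda>p. (fst p, g p)) = ?Q"
    by auto
  have Q1: "distr ?Q borel fst = distr M borel V"
    unfolding V[symmetric] by (subst distr_distr) (auto simp: comp_def)
  define G where "G \<omega> = g (V (fst \<omega>), snd \<omega>)" for \<omega>
  have G[measurable]: "G \<in> borel_measurable N" unfolding G_def[abs_def] N_def by measurable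
  have "distr N (borel \<Otimes>\<^sub>M borel) (\<lambda>\<omega>. (G \<omega>, V (fst \<omega>))) = \<pi>"
  proof (rule distr_eqI_nn_integral)
    show "(\<lambda>\<omega>. (G \<omega>, V (fst \<omega>))) \<in> measurable N (borel \<Otimes>\<^sub>M borel)"
      unfolding N_def G_def by measurable
    fix F :: "'s \<times> 's \<Rightarrow> ennreal" assume F[measurable]: "F \<in> borel_measurable (borel \<Otimes>\<^sub>M borel)"
    have "(\<integral>\<^sup>+\<omega>. F (G \<omega>, V (fst \<omega>)) \<partial>N) = (\<integral>\<^sup>+\<omega>. \<integral>\<^sup>+v. F (g (V \<omega>, v), V \<omega>) \<partial>?U \<partial>M)"
      unfolding N_def G_def by (subst U.nn_integral_fst[symmetric]) auto
    also have "\<dots> = (\<integral>\<^sup>+a. \<integral>\<^sup>+v. F (g (a, v), a) \<partial>?U \<partial>distr ?Q borel fst)"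
      unfolding Q1 by (rule nn_integral_distr[symmetric]) measurable
    also have "\<dots> = (\<integral>\<^sup>+p. F (g p, fst p) \<partial>(distr ?Q borel fst \<Otimes>\<^sub>M ?U))"
      by (subst U.nn_integral_fst[symmetric]) auto
    also have "\<dots> = (\<integral>\<^sup>+p. F (snd p, fst p) \<partial>?Q)"
      by (subst (2) eq[symmetric], subst nn_integral_distr) auto
    also have "\<dots> = (\<integral>\<^sup>+p. F (fst p, snd p) \<partial>\<pi>)"
      by (subst nn_integral_distr) auto
    finally show "(\<integral>\<^sup>+\<omega>. F (G \<omega>, V (fst \<omega>)) \<partial>N) = (\<integral>\<^sup>+p. F p \<partial>\<pi>)" by simp
  qed (simp add: \<pi>)
  with G show ?thesis by blast
qed

subsection \<open>The theorem\<close>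

lemma (in prob_space) scaled_sum_of_gaussians:
  fixes z1 z2 :: "'a \<Rightarrow> 's::euclidean_space"
  assumes I: "indep_law borel z1 borel z2" and z: "distr M borel z1 = gaussian" "distr M borel z2 = gaussian"
  shows "integrable M (\<lambda>\<omega>. (1 / sqrt 2) *\<^sub>R (z1 \<omega> + z2 \<omega>))"
    and "(\<integral>\<omega>. (1 / sqrt 2) *\<^sub>R (z1 \<omega> + z2 \<omega>) \<partial>M) = 0"
    and "(\<integral>\<^sup>+\<omega>. ennreal ((norm ((1 / sqrt 2) *\<^sub>R (z1 \<omega> + z2 \<omega>)))\<^sup>2) \<partial>M) = ennreal (real DIM('s))"
proof -
  let ?g = "gaussian :: 's measure" and ?d = "real DIM('s)"
  interpret g: prob_space ?g by (rule prob_space_gaussian)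
  have [measurable]: "z1 \<in> borel_measurable M" "z2 \<in> borel_measurable M" using I by (auto simp: indep_law_def)
  have int: "integrable M z" if "z \<in> borel_measurable M" "distr M borel z = gaussian" for z :: "'a \<Rightarrow> 's"
  proof -
    have "integrable (distr M borel z) (\<lambda>w. w)" unfolding that(2) by (rule integrable_gaussian_id)
    from integrable_distr[OF that(1) this] show ?thesis .
  qed
  have i: "integrable M z1" "integrable M z2" using z by (auto intro!: int)
  have "(\<integral>\<omega>. z1 \<omega> \<partial>M) = (\<integral>w. w \<partial>distr M borel z1)" "(\<integral>\<omega>. z2 \<omega> \<partial>M) = (\<integral>w. w \<partial>distr M borel z2)"
    by (simp_all add: integral_distr)
  then have e: "(\<integral>\<omega>. z1 \<omega> \<partial>M) = 0" "(\<integral>\<omega>. z2 \<omega> \<partial>M) = 0"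
    by (simp_all add: z integral_gaussian_id)
  show "integrable M (\<lambda>\<omega>. (1 / sqrt 2) *\<^sub>R (z1 \<omega> + z2 \<omega>))" using i by simp
  show "(\<integral>\<omega>. (1 / sqrt 2) *\<^sub>R (z1 \<omega> + z2 \<omega>) \<partial>M) = 0" using i e by simp
  have sq: "ennreal ((norm ((1 / sqrt 2) *\<^sub>R w))\<^sup>2) = ennreal (1/2) * ennreal ((norm w)\<^sup>2)" for w :: 's
  proof -
    have "(norm ((1 / sqrt 2) *\<^sub>R w))\<^sup>2 = 1/2 * (norm w)\<^sup>2" by (simp add: power_divide)
    then show ?thesis by (simp only:) (rule ennreal_mult, auto)
  qed
  have "(\<integral>\<^sup>+\<omega>. ennreal ((norm ((1 / sqrt 2) *\<^sub>R (z1 \<omega> + z2 \<omega>)))\<^sup>2) \<partial>M)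
     = ennreal (1/2) * (\<integral>\<^sup>+\<omega>. ennreal ((norm (z1 \<omega> + z2 \<omega>))\<^sup>2) \<partial>M)"
    unfolding sq by (rule nn_integral_cmult) measurable
  also have "(\<integral>\<^sup>+\<omega>. ennreal ((norm (z1 \<omega> + z2 \<omega>))\<^sup>2) \<partial>M) = (\<integral>\<^sup>+a. \<integral>\<^sup>+w. ennreal ((norm (a + w))\<^sup>2) \<partial>?g \<partial>?g)"
    using nn_integral_indep_law[OF I, of "\<lambda>p. ennreal ((norm (fst p + snd p))\<^sup>2)"] by (simp add: z)
  also have "\<dots> = (\<integral>\<^sup>+a. ennreal ((norm a)\<^sup>2) + ennreal ?d \<partial>?g)"
    by (intro nn_integral_cong, subst nn_integral_bias_variance)
       (auto intro: prob_space_gaussian integrable_gaussian_id integral_gaussian_id simp: nn_integral_gaussian_norm_square)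
  also have "\<dots> = ennreal ?d + ennreal ?d"
    by (subst nn_integral_add) (auto simp: nn_integral_gaussian_norm_square g.emeasure_space_1[simplified])
  also have "ennreal (1/2) * (ennreal ?d + ennreal ?d) = ennreal (1/2 * (?d + ?d))"
    by (subst ennreal_mult, simp, simp, subst ennreal_plus) simp_all
  finally show "(\<integral>\<^sup>+\<omega>. ennreal ((norm ((1 / sqrt 2) *\<^sub>R (z1 \<omega> + z2 \<omega>)))\<^sup>2) \<partial>M) = ennreal ?d" by simp
qed

text \<open>\<open>\<tau>\<close> is the step size and \<open>\<tau>'\<close> an upper bound for it,
  h0 or 2 h0 in the applications, so that the result is uniform in h and has the shape of
  \<open>C_IEul\<close> and \<open>C_IEul2h\<close>. The bound on \<open>\<tau> * K\<close> keeps
  the factor 1 - \<beta> of the recursion nonnegative.\<close>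

lemma (in prob_space) chain_mean_square:
  fixes B :: "'s::euclidean_space \<Rightarrow> 'u::euclidean_space \<Rightarrow> 's" and Y :: "nat \<Rightarrow> 'a \<Rightarrow> 's"
  assumes B: "(\<lambda>(x, u). B x u) \<in> borel_measurable (borel \<Otimes>\<^sub>M borel)" and pos: "0 < L" "0 < K" "0 < R"
    and \<tau>: "0 < \<tau>" "\<tau> \<le> \<tau>'" "\<tau> * K \<le> 1"
    and den: "0 < M1 K - \<tau>' * (2 * L\<^sup>2 + \<sigma>\<^sup>2)"
    and ind: "\<And>n. indep_law borel (Y n) (borel \<Otimes>\<^sub>M borel) (\<lambda>\<omega>. (V n \<omega>, \<zeta> n \<omega>))" "\<And>n. indep_law borel (V n) borel (\<zeta> n)"
    and Y: "\<And>n \<omega>. \<omega> \<in> space M \<Longrightarrow> Y (Suc n) \<omega> = Y n \<omega> + \<tau> *\<^sub>R B (Y n \<omega>) (V n \<omega>) + sqrt \<tau> *\<^sub>R \<zeta> n \<omega>"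
    and D: "\<And>n. driver L K R \<sigma> B b (distr M borel (V n))"
    and \<zeta>: "\<And>n. integrable M (\<zeta> n)" "\<And>n. (\<integral>\<omega>. \<zeta> n \<omega> \<partial>M) = 0"
      "\<And>n. (\<integral>\<^sup>+\<omega>. ennreal ((norm (\<zeta> n \<omega>))\<^sup>2) \<partial>M) = ennreal (real DIM('s))"
    and m0: "(\<integral>\<^sup>+\<omega>. ennreal ((norm (Y 0 \<omega>))\<^sup>2) \<partial>M) \<le> ennreal m0" "0 \<le> m0"
  shows "(\<integral>\<^sup>+\<omega>. ennreal ((norm (Y n \<omega>))\<^sup>2) \<partial>M)
    \<le> ennreal (m0 + (\<tau>' * (2 * (norm (b 0))\<^sup>2 + \<sigma>\<^sup>2) + real DIM('s) + M2 L K R b) / (M1 K - \<tau>' * (2 * L\<^sup>2 + \<sigma>\<^sup>2)))"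
proof -
  let ?d = "real DIM('s)" and ?s = "2 * L\<^sup>2 + \<sigma>\<^sup>2" and ?b = "2 * (norm (b 0))\<^sup>2 + \<sigma>\<^sup>2"
  let ?Den = "M1 K - \<tau>' * ?s" and ?Num = "\<tau>' * ?b + ?d + M2 L K R b"
  define \<beta> where "\<beta> = \<tau> * (2 * M1 K - \<tau> * ?s)"
  define \<kappa> where "\<kappa> = \<tau> * (2 * M2 L K R b + \<tau> * ?b) + \<tau> * ?d"
  have M2: "0 \<le> M2 L K R b"
    using pos by (auto simp: M2_def rho_def intro!: add_nonneg_nonneg mult_nonneg_nonneg intro: max.coboundedI1)
  have Num: "0 \<le> ?Num" using M2 \<tau> by (intro add_nonneg_nonneg mult_nonneg_nonneg) auto
  have ts: "\<tau> * ?s \<le> \<tau>' * ?s" and tb: "\<tau> * ?b \<le> \<tau>' * ?b" "0 \<le> \<tau> * ?b"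
    using \<tau> by (auto intro!: mult_right_mono mult_nonneg_nonneg)
  have l2: "2 * ?Den \<le> 2 * M1 K - \<tau> * ?s"
  proof -
    have "0 \<le> \<tau>' * ?s" using \<tau> by (intro mult_nonneg_nonneg) auto
    then show ?thesis using ts by (simp add: algebra_simps)
  qed
  have \<beta>1: "\<beta> \<le> 1"
  proof -
    have "\<beta> \<le> \<tau> * (2 * M1 K)" unfolding \<beta>_def using \<tau> by (intro mult_left_mono) auto
    then show ?thesis using \<tau> by (simp add: M1_def)
  qed
  have \<beta>den: "\<tau> * (2 * ?Den) \<le> \<beta>" unfolding \<beta>_def using l2 \<tau> by (intro mult_left_mono) auto
  have \<beta>0: "0 \<le> \<beta>"
  proof -
    have "0 \<le> \<tau> * (2 * ?Den)" using den \<tau> by (intro mult_nonneg_nonneg) auto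
    with \<beta>den show ?thesis by linarith
  qed
  have \<kappa>0: "0 \<le> \<kappa>" unfolding \<kappa>_def using M2 \<tau> tb by (intro add_nonneg_nonneg mult_nonneg_nonneg) auto
  \<comment> \<open>The decay is at least 2 \<tau> times the denominator and the increment at most 2
    \<tau> times the numerator, so the step size cancels.\<close>
  have \<kappa>C: "\<kappa> \<le> \<beta> * (?Num / ?Den)"
  proof -
    have "\<kappa> = \<tau> * (2 * M2 L K R b + \<tau> * ?b + ?d)" by (simp add: \<kappa>_def algebra_simps)
    also have "\<dots> \<le> \<tau> * (2 * ?Num)"
    proof (rule mult_left_mono)
      have sum_le: "2 * m + u + d \<le> 2 * (v + d + m)" if "u \<le> v" "0 \<le> v" "0 \<le> d" for m u v d :: real
        using that by simp
      show "2 * M2 L K R b + \<tau> * ?b + ?d \<le> 2 * ?Num"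
        by (rule sum_le[OF tb(1) order_trans[OF tb(2) tb(1)]]) simp
    qed (use \<tau> in simp)
    also have "\<dots> = \<tau> * (2 * ?Den) * (?Num / ?Den)"
    proof -
      have "\<tau> * (2 * n) = \<tau> * (2 * e) * (n / e)" if "0 < e" for n e :: real using that by simp
      then show ?thesis using den by blast
    qed
    also have "\<dots> \<le> \<beta> * (?Num / ?Den)" using \<beta>den Num den by (intro mult_right_mono) auto
    finally show ?thesis .
  qed
  let ?m = "\<lambda>n. \<integral>\<^sup>+\<omega>. ennreal ((norm (Y n \<omega>))\<^sup>2) \<partial>M"
  show ?thesis
  proof (rule affine_recursion_bound[where m="?m" and \<theta>="1 - \<beta>" and \<kappa>=\<kappa>])
    fix n
    have [measurable]: "Y n \<in> borel_measurable M" "V n \<in> borel_measurable M" "\<zeta> n \<in> borel_measurable M"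
      using ind[of n] by (auto simp: indep_law_def)
    have B'[measurable]: "(\<lambda>p. B (fst p) (snd p)) \<in> borel_measurable (borel \<Otimes>\<^sub>M borel)" using B by (simp add: case_prod_beta)
    have \<Phi>: "(\<lambda>(x, u, w). x + \<tau> *\<^sub>R B x u + sqrt \<tau> *\<^sub>R w) \<in> borel_measurable (borel \<Otimes>\<^sub>M (borel \<Otimes>\<^sub>M borel))"
    proof -
      have [measurable]: "(\<lambda>p. B (fst p) (fst (snd p))) \<in> borel_measurable (borel \<Otimes>\<^sub>M (borel \<Otimes>\<^sub>M borel :: ('u \<times> 's) measure))"
        using measurable_compose[OF _ B', of "\<lambda>p. (fst p, fst (snd p))" "borel \<Otimes>\<^sub>M (borel \<Otimes>\<^sub>M borel :: ('u \<times> 's) measure)"] by simp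
      show ?thesis unfolding case_prod_beta by measurable
    qed
    have "?m (Suc n) = (\<integral>\<^sup>+x. \<integral>\<^sup>+u. \<integral>\<^sup>+w. ennreal ((norm (x + \<tau> *\<^sub>R B x u + sqrt \<tau> *\<^sub>R w))\<^sup>2)
        \<partial>distr M borel (\<zeta> n) \<partial>distr M borel (V n) \<partial>distr M borel (Y n))"
      by (rule chain_step_integral[OF \<Phi> ind(1)[of n] ind(2)[of n]]) (auto simp: Y)
    also have "\<dots> \<le> ennreal (1 - \<beta>) * ?m n + ennreal \<kappa>"
    proof (rule nn_integral_le_mean_square)
      show "prob_space (distr M borel (Y n))" by (rule prob_space_distr) simp
      show "0 \<le> 1 - \<beta>" "0 \<le> \<kappa>" using \<beta>1 \<kappa>0 by auto
      show "(\<integral>\<^sup>+x. ennreal ((norm x)\<^sup>2) \<partial>distr M borel (Y n)) \<le> ?m n" by (simp add: nn_integral_distr)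
      fix x
      have "(\<integral>\<^sup>+w. ennreal ((norm (sqrt \<tau> *\<^sub>R w))\<^sup>2) \<partial>distr M borel (\<zeta> n)) = (\<integral>\<^sup>+w. ennreal \<tau> * ennreal ((norm w)\<^sup>2) \<partial>distr M borel (\<zeta> n))"
        using \<tau> by (intro nn_integral_cong) (simp add: power_mult_distrib ennreal_mult)
      also have "\<dots> = ennreal \<tau> * ennreal ?d"
        using \<zeta>(3)[of n] by (subst nn_integral_cmult) (auto simp: nn_integral_distr)
      also have "\<dots> = ennreal (\<tau> * ?d)" using \<tau> by (simp add: ennreal_mult)
      finally have sq: "(\<integral>\<^sup>+w. ennreal ((norm (sqrt \<tau> *\<^sub>R w))\<^sup>2) \<partial>distr M borel (\<zeta> n)) = ennreal (\<tau> * ?d)" .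
      have "(\<integral>\<^sup>+u. \<integral>\<^sup>+w. ennreal ((norm (x + \<tau> *\<^sub>R B x u + sqrt \<tau> *\<^sub>R w))\<^sup>2) \<partial>distr M borel (\<zeta> n) \<partial>distr M borel (V n))
        \<le> ennreal ((1 - \<tau> * (2 * M1 K - \<tau> * ?s)) * (norm x)\<^sup>2 + (\<tau> * (2 * M2 L K R b + \<tau> * ?b) + \<tau> * ?d))"
      proof (rule driver_step_mean_square[OF D pos])
        show "prob_space (distr M borel (\<zeta> n))" by (rule prob_space_distr) simp
        show "integrable (distr M borel (\<zeta> n)) ((*\<^sub>R) (sqrt \<tau>))"
          by (subst integrable_distr_eq) (use \<zeta>(1)[of n] in auto)
        show "(\<integral>w. sqrt \<tau> *\<^sub>R w \<partial>distr M borel (\<zeta> n)) = 0"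
          by (subst integral_distr) (use \<zeta>(1,2)[of n] in auto)
      qed (use \<tau> sq in auto)
      then show "(\<integral>\<^sup>+u. \<integral>\<^sup>+w. ennreal ((norm (x + \<tau> *\<^sub>R B x u + sqrt \<tau> *\<^sub>R w))\<^sup>2) \<partial>distr M borel (\<zeta> n) \<partial>distr M borel (V n))
        \<le> ennreal ((1 - \<beta>) * (norm x)\<^sup>2 + \<kappa>)"
        by (simp only: \<beta>_def \<kappa>_def)
    qed simp
    finally show "?m (Suc n) \<le> ennreal (1 - \<beta>) * ?m n + ennreal \<kappa>" .
  qed (use \<beta>0 \<beta>1 \<kappa>0 \<kappa>C m0 Num den in auto)
qed

section \<open>Extending a coupling by one coarse step\<close>

lemma (in prob_space) indep_law_distr:
  assumes [measurable]: "\<psi> \<in> measurable M N" "X \<in> measurable N S" "Y \<in> measurable N T"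
    and "indep_law S (\<lambda>\<omega>. X (\<psi> \<omega>)) T (\<lambda>\<omega>. Y (\<psi> \<omega>))"
  shows "prob_space.indep_law (distr M N \<psi>) S X T Y"
proof -
  interpret D: prob_space "distr M N \<psi>" by (rule prob_space_distr) measurable
  have "distr M S (\<lambda>\<omega>. X (\<psi> \<omega>)) = distr (distr M N \<psi>) S X" "distr M T (\<lambda>\<omega>. Y (\<psi> \<omega>)) = distr (distr M N \<psi>) T Y"
    "distr M (S \<Otimes>\<^sub>M T) (\<lambda>\<omega>. (X (\<psi> \<omega>), Y (\<psi> \<omega>))) = distr (distr M N \<psi>) (S \<Otimes>\<^sub>M T) (\<lambda>\<omega>. (X \<omega>, Y \<omega>))"
    by (subst distr_distr; simp add: comp_def)+
  then show ?thesis
    using assms(4) unfolding indep_law_def D.indep_law_def by simp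
qed

text \<open>On the product of the old coupling, one triple of \<open>U\<close>s and two pairs of a
  Gaussian and a uniform variable, the independence required by \<open>two_step_coupling\<close>
  holds by construction. \<open>F0\<close>, \<open>F1\<close>, \<open>F2\<close> and
  \<open>C0\<close>, \<open>C1\<close> are consecutive states of the given chains; they enter
  through their laws and one-step kernels, so their dependence on each other does not
  matter.\<close>

lemma (in contraction_parameters) coupling_step_exists:
  fixes B :: "'a::euclidean_space \<Rightarrow> 'u::euclidean_space \<Rightarrow> 'a" and b :: "'a \<Rightarrow> 'a"
    and \<pi> :: "('a \<times> 'a) measure" and \<beta> :: "('u \<times> 'u \<times> 'u) measure"
    and N :: "'n measure" and F0 F1 F2 C0 C1 :: "'n \<Rightarrow> 'a"
  assumes B: "(\<lambda>(x, u). B x u) \<in> borel_measurable (borel \<Otimes>\<^sub>M borel)"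
    and \<beta>: "prob_space \<beta>" "sets \<beta> = sets (borel \<Otimes>\<^sub>M (borel \<Otimes>\<^sub>M borel))"
    and \<beta>12: "prob_space.indep_law \<beta> borel fst borel (\<lambda>v. fst (snd v))"
    and \<mu>: "distr \<beta> borel fst = \<mu>1" "distr \<beta> borel (\<lambda>v. fst (snd v)) = \<mu>2" "distr \<beta> borel (\<lambda>v. snd (snd v)) = \<mu>3"
    and D: "driver L K R \<sigma> B b \<mu>1" "driver L K R \<sigma> B b \<mu>2"
    and bd: "\<And>a. (\<integral>\<^sup>+v. ennreal ((norm (B a (fst v) + B a (fst (snd v)) - 2 *\<^sub>R B a (snd (snd v))))\<^sup>2) \<partial>\<beta>)
        \<le> ennreal (Lu * (1 + (norm a)\<^sup>2) * h powr ac)"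
    and \<pi>: "prob_space \<pi>" "sets \<pi> = sets (borel \<Otimes>\<^sub>M borel)"
    and C: "0 \<le> C" "0 \<le> Cf" and Lu: "0 \<le> Lu" and \<delta>: "0 \<le> \<delta>"
      "2 * h\<^sup>2 * (Lu * (1 + C) * h powr ac + L\<^sup>2 * (h\<^sup>2 * (C * (\<sigma>\<^sup>2 + 2 * L\<^sup>2) + \<sigma>\<^sup>2 + 2 * (norm (b 0))\<^sup>2) + h * real DIM('a))) \<le> \<delta>\<^sup>2"
    and sy: "sqrt C + sqrt (h\<^sup>2 * (C * (\<sigma>\<^sup>2 + 2 * L\<^sup>2) + \<sigma>\<^sup>2 + 2 * (norm (b 0))\<^sup>2) + h * real DIM('a)) \<le> sy"
    and N: "prob_space N" and rv[measurable]: "F0 \<in> borel_measurable N" "F1 \<in> borel_measurable N" "F2 \<in> borel_measurable N"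
      "C0 \<in> borel_measurable N" "C1 \<in> borel_measurable N"
    and marg: "distr \<pi> borel fst = distr N borel F0" "distr \<pi> borel snd = distr N borel C0"
    and F1: "\<And>F. F \<in> borel_measurable borel \<Longrightarrow> (\<integral>\<^sup>+\<omega>. F (F1 \<omega>) \<partial>N)
      = (\<integral>\<^sup>+a. \<integral>\<^sup>+v. \<integral>\<^sup>+w. F (a + h *\<^sub>R B a v + sqrt h *\<^sub>R w) \<partial>gaussian \<partial>\<mu>1 \<partial>distr N borel F0)"
    and F2: "\<And>F. F \<in> borel_measurable borel \<Longrightarrow> (\<integral>\<^sup>+\<omega>. F (F2 \<omega>) \<partial>N)
      = (\<integral>\<^sup>+a. \<integral>\<^sup>+v. \<integral>\<^sup>+w. F (a + h *\<^sub>R B a v + sqrt h *\<^sub>R w) \<partial>gaussian \<partial>\<mu>2 \<partial>distr N borel F1)"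
    and C1: "\<And>F. F \<in> borel_measurable borel \<Longrightarrow> (\<integral>\<^sup>+\<omega>. F (C1 \<omega>) \<partial>N)
      = (\<integral>\<^sup>+a. \<integral>\<^sup>+v. \<integral>\<^sup>+w. F (a + (2 * h) *\<^sub>R B a v + sqrt (2 * h) *\<^sub>R w)
          \<partial>distr (gaussian \<Otimes>\<^sub>M gaussian) borel (\<lambda>p. (1 / sqrt 2) *\<^sub>R (fst p + snd p)) \<partial>\<mu>3 \<partial>distr N borel C0)"
    and m: "(\<integral>\<^sup>+\<omega>. ennreal ((norm (F1 \<omega>))\<^sup>2) \<partial>N) \<le> ennreal Cf" "(\<integral>\<^sup>+\<omega>. ennreal ((norm (C0 \<omega>))\<^sup>2) \<partial>N) \<le> ennreal C"
  shows "\<exists>\<pi>'. prob_space \<pi>' \<and> sets \<pi>' = sets (borel \<Otimes>\<^sub>M borel) \<and>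
    distr \<pi>' borel fst = distr N borel F2 \<and> distr \<pi>' borel snd = distr N borel C1 \<and>
    (\<integral>\<^sup>+p. ennreal (f (norm (fst p - snd p))) \<partial>\<pi>')
      \<le> ennreal ((1 - c * h)\<^sup>2) * (\<integral>\<^sup>+p. ennreal (f (norm (fst p - snd p))) \<partial>\<pi>)
        + ennreal (\<delta> + q * (\<delta> * ((1 + H * L) * (sqrt Cf + sy) + sqrt H)) + q * \<delta>\<^sup>2)"
proof -
  let ?W = "gaussian \<Otimes>\<^sub>M unif :: ('a \<times> real) measure"
  let ?WW = "?W \<Otimes>\<^sub>M ?W"
  let ?R = "\<beta> \<Otimes>\<^sub>M ?WW"
  let ?P = "\<pi> \<Otimes>\<^sub>M ?R"
  let ?bW = "borel \<Otimes>\<^sub>M borel :: ('a \<times> real) measure"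
  let ?bV = "borel \<Otimes>\<^sub>M (borel \<Otimes>\<^sub>M borel) :: ('u \<times> 'u \<times> 'u) measure"
  have W: "prob_space ?W" by (intro prob_space_pair prob_space_gaussian prob_space_unif)
  have WW: "prob_space ?WW" by (intro prob_space_pair W)
  have R: "prob_space ?R" by (intro prob_space_pair \<beta> WW)
  interpret P: prob_space ?P by (intro prob_space_pair \<pi> R)
  interpret P: coupled_step L K R h ?P B b \<sigma> by unfold_locales (rule B)
  have sW: "sets ?W = sets ?bW" by (intro sets_pair_measure_cong) simp_all
  have sWW: "sets ?WW = sets (?bW \<Otimes>\<^sub>M ?bW)" by (intro sets_pair_measure_cong sW)
  have sR: "sets ?R = sets (?bV \<Otimes>\<^sub>M (?bW \<Otimes>\<^sub>M ?bW))" by (intro sets_pair_measure_cong \<beta> sWW)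
  have sP: "sets ?P = sets ((borel \<Otimes>\<^sub>M borel) \<Otimes>\<^sub>M (?bV \<Otimes>\<^sub>M (?bW \<Otimes>\<^sub>M ?bW)))" by (intro sets_pair_measure_cong \<pi> sR)
  have mP: "measurable ?P = measurable ((borel \<Otimes>\<^sub>M borel) \<Otimes>\<^sub>M (?bV \<Otimes>\<^sub>M (?bW \<Otimes>\<^sub>M ?bW)))"
    by (intro ext measurable_cong_sets sP refl)
  let ?x = "\<lambda>\<omega>. fst (fst \<omega>)" and ?y = "\<lambda>\<omega>. snd (fst \<omega>)"
  let ?u1 = "\<lambda>\<omega>. fst (fst (snd \<omega>))" and ?u2 = "\<lambda>\<omega>. fst (snd (fst (snd \<omega>)))" and ?u3 = "\<lambda>\<omega>. snd (snd (fst (snd \<omega>)))"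
  let ?z1 = "\<lambda>\<omega>. fst (fst (snd (snd \<omega>)))" and ?t1 = "\<lambda>\<omega>. snd (fst (snd (snd \<omega>)))"
  let ?z2 = "\<lambda>\<omega>. fst (snd (snd (snd \<omega>)))" and ?t2 = "\<lambda>\<omega>. snd (snd (snd (snd \<omega>)))"
  have d\<pi>: "distr ?P \<pi> fst = \<pi>" by (rule distr_fst_pair[OF \<pi>(1) R])
  have dR: "distr ?P ?R snd = ?R" by (rule distr_snd_pair[OF \<pi>(1) R])
  have d\<beta>: "distr ?P \<beta> (\<lambda>\<omega>. fst (snd \<omega>)) = \<beta>"
    using distr_distr[of fst ?R \<beta> snd ?P] by (simp add: dR comp_def distr_fst_pair[OF \<beta>(1) WW])
  have dWW: "distr ?P ?WW (\<lambda>\<omega>. snd (snd \<omega>)) = ?WW"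
    using distr_distr[of snd ?R ?WW snd ?P] by (simp add: dR comp_def distr_snd_pair[OF \<beta>(1) WW])
  have dW1: "distr ?P ?W (\<lambda>\<omega>. fst (snd (snd \<omega>))) = ?W"
    using distr_distr[of fst ?WW ?W "\<lambda>\<omega>. snd (snd \<omega>)" ?P] by (simp add: dWW comp_def distr_fst_pair[OF W W])
  have dW2: "distr ?P ?W (\<lambda>\<omega>. snd (snd (snd \<omega>))) = ?W"
    using distr_distr[of snd ?WW ?W "\<lambda>\<omega>. snd (snd \<omega>)" ?P] by (simp add: dWW comp_def distr_snd_pair[OF W W])
  have p_vw: "P.indep_law (borel \<Otimes>\<^sub>M borel) (\<lambda>\<omega>. (?x \<omega>, ?y \<omega>)) (?bV \<Otimes>\<^sub>M (?bW \<Otimes>\<^sub>M ?bW))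
      (\<lambda>\<omega>. ((?u1 \<omega>, ?u2 \<omega>, ?u3 \<omega>), ((?z1 \<omega>, ?t1 \<omega>), (?z2 \<omega>, ?t2 \<omega>))))"
    using indep_law_pair[OF \<pi>(1) R \<pi>(2) sR] by simp
  have v_w: "P.indep_law ?bV (\<lambda>\<omega>. (?u1 \<omega>, ?u2 \<omega>, ?u3 \<omega>)) (?bW \<Otimes>\<^sub>M ?bW) (\<lambda>\<omega>. ((?z1 \<omega>, ?t1 \<omega>), (?z2 \<omega>, ?t2 \<omega>)))"
    using P.indep_law_transfer[OF measurable_snd, unfolded dR, OF indep_law_pair[OF \<beta>(1) WW \<beta>(2) sWW]] by simp
  have w12: "P.indep_law ?bW (\<lambda>\<omega>. (?z1 \<omega>, ?t1 \<omega>)) ?bW (\<lambda>\<omega>. (?z2 \<omega>, ?t2 \<omega>))"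
    using P.indep_law_transfer[OF measurable_compose[OF measurable_snd measurable_snd], unfolded dWW, OF indep_law_pair[OF W W sW sW]] by simp
  have m\<beta>: "(\<lambda>\<omega>. fst (snd \<omega>)) \<in> measurable ?P \<beta>"
    by (rule measurable_compose[OF measurable_snd measurable_fst])
  have u12: "P.indep_law borel ?u1 borel ?u2"
    using P.indep_law_transfer[OF m\<beta>, unfolded d\<beta>, OF \<beta>12] .
  have du: "distr ?P borel (\<lambda>\<omega>. k (fst (snd \<omega>))) = distr \<beta> borel k" if "k \<in> borel_measurable ?bV" for k :: "_ \<Rightarrow> 'u"
  proof -
    have "k \<in> borel_measurable \<beta>" using that unfolding measurable_cong_sets[OF \<beta>(2) refl] .
    from distr_distr[OF this m\<beta>] show ?thesis by (simp add: d\<beta> comp_def)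
  qed
  have u\<mu>: "distr ?P borel ?u1 = \<mu>1" "distr ?P borel ?u2 = \<mu>2" "distr ?P borel ?u3 = \<mu>3"
    using du[of fst] du[of "\<lambda>v. fst (snd v)"] du[of "\<lambda>v. snd (snd v)"] by (simp_all add: \<mu>)
  have zt: "distr ?P ?bW (\<lambda>\<omega>. (?z1 \<omega>, ?t1 \<omega>)) = ?W" "distr ?P ?bW (\<lambda>\<omega>. (?z2 \<omega>, ?t2 \<omega>)) = ?W"
    using dW1 dW2 distr_cong[OF refl sW[symmetric], of ?P] by simp_all
  note hyps = p_vw v_w w12 u12 u\<mu>(1,2) D zt
  have px[measurable]: "?x \<in> borel_measurable ?P" "?y \<in> borel_measurable ?P" "?u3 \<in> borel_measurable ?P"
    unfolding mP by measurable
  have dxy: "distr ?P borel ?x = distr \<pi> borel fst" "distr ?P borel ?y = distr \<pi> borel snd"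
  proof -
    have "fst \<in> borel_measurable \<pi>" "snd \<in> borel_measurable \<pi>"
      unfolding measurable_cong_sets[OF \<pi>(2) refl] by (rule measurable_fst measurable_snd)+
    from distr_distr[OF this(1), of fst ?P] distr_distr[OF this(2), of fst ?P]
    show "distr ?P borel ?x = distr \<pi> borel fst" "distr ?P borel ?y = distr \<pi> borel snd"
      by (simp_all add: d\<pi> comp_def)
  qed
  have my: "(\<integral>\<^sup>+\<omega>. ennreal ((norm (?y \<omega>))\<^sup>2) \<partial>?P) \<le> ennreal C"
  proof -
    have "(\<integral>\<^sup>+\<omega>. ennreal ((norm (?y \<omega>))\<^sup>2) \<partial>?P) = (\<integral>\<^sup>+a. ennreal ((norm a)\<^sup>2) \<partial>distr ?P borel ?y)"
      using px by (subst nn_integral_distr) auto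
    also have "\<dots> = (\<integral>\<^sup>+\<omega>. ennreal ((norm (C0 \<omega>))\<^sup>2) \<partial>N)"
      unfolding dxy marg by (subst nn_integral_distr) auto
    finally show ?thesis using m by simp
  qed
  have bdP: "(\<integral>\<^sup>+\<omega>. ennreal ((norm (B a (?u1 \<omega>) + B a (?u2 \<omega>) - 2 *\<^sub>R B a (?u3 \<omega>)))\<^sup>2) \<partial>?P)
        \<le> ennreal (Lu * (1 + (norm a)\<^sup>2) * h powr ac)" for a
  proof -
    let ?k = "\<lambda>v. ennreal ((norm (B a (fst v) + B a (fst (snd v)) - 2 *\<^sub>R B a (snd (snd v))))\<^sup>2)"
    have "?k \<in> borel_measurable \<beta>" unfolding measurable_cong_sets[OF \<beta>(2) refl] by measurable
    then have "(\<integral>\<^sup>+v. ?k v \<partial>distr ?P \<beta> (\<lambda>\<omega>. fst (snd \<omega>))) = (\<integral>\<^sup>+\<omega>. ?k (fst (snd \<omega>)) \<partial>?P)"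
      by (intro nn_integral_distr[OF m\<beta>]) simp
    with bd[of a] show ?thesis unfolding d\<beta> by simp
  qed
  from P.two_step_coupling[OF hyps bdP my C Lu \<delta> sy]
  obtain X1 X2 Yc where X[measurable]: "X1 \<in> borel_measurable ?P" "X2 \<in> borel_measurable ?P" "Yc \<in> borel_measurable ?P"
    and X1: "\<And>F. F \<in> borel_measurable borel \<Longrightarrow> (\<integral>\<^sup>+\<omega>. F (X1 \<omega>) \<partial>?P) = (\<integral>\<^sup>+\<omega>. \<integral>\<^sup>+v. \<integral>\<^sup>+w. F (P.euler (?x \<omega>) v w) \<partial>gaussian \<partial>\<mu>1 \<partial>?P)"
    and X2: "\<And>F. F \<in> borel_measurable borel \<Longrightarrow> (\<integral>\<^sup>+\<omega>. F (X2 \<omega>) \<partial>?P) = (\<integral>\<^sup>+\<omega>. \<integral>\<^sup>+v. \<integral>\<^sup>+w. F (P.euler (X1 \<omega>) v w) \<partial>gaussian \<partial>\<mu>2 \<partial>?P)"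
    and Yc: "\<And>\<omega>. Yc \<omega> = ?y \<omega> + (2 * h) *\<^sub>R B (?y \<omega>) (?u3 \<omega>) + sqrt (2 * h) *\<^sub>R ((1 / sqrt 2) *\<^sub>R (?z1 \<omega> + ?z2 \<omega>))"
    and contr: "(\<integral>\<^sup>+\<omega>. ennreal ((norm (X1 \<omega>))\<^sup>2) \<partial>?P) \<le> ennreal Cf \<Longrightarrow>
      (\<integral>\<^sup>+\<omega>. ennreal (f (norm (X2 \<omega> - Yc \<omega>))) \<partial>?P)
       \<le> ennreal ((1 - c * h)\<^sup>2) * (\<integral>\<^sup>+\<omega>. ennreal (f (norm (?x \<omega> - ?y \<omega>))) \<partial>?P)
         + ennreal (\<delta> + q * (\<delta> * ((1 + H * L) * (sqrt Cf + sy) + sqrt H)) + q * \<delta>\<^sup>2)"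
    by blast
  \<comment> \<open>With the law of the given fine chain, \<open>X1\<close> inherits its second
    moment, the premise left open in \<open>two_step_coupling\<close>.\<close>
  have lX1: "distr ?P borel X1 = distr N borel F1"
    by (rule P.euler_kernel_law[OF px(1) X(1) N rv(1,2) _ driverD(1,2)[OF D(1)] X1])
       (simp_all add: dxy marg F1 P.euler_def)
  have lX2: "distr ?P borel X2 = distr N borel F2"
    by (rule P.euler_kernel_law[OF X(1,2) N rv(2,3) lX1 driverD(1,2)[OF D(2)] X2])
       (simp_all add: F2 P.euler_def)
  have lYc: "distr ?P borel Yc = distr N borel C1"
  proof (rule distr_eqI_nn_integral)
    fix F :: "'a \<Rightarrow> ennreal" assume F[measurable]: "F \<in> borel_measurable borel"
    have \<Phi>: "(\<lambda>(x, u, w). x + (2 * h) *\<^sub>R B x u + sqrt (2 * h) *\<^sub>R w) \<in> borel_measurable (borel \<Otimes>\<^sub>M (borel \<Otimes>\<^sub>M borel))"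
      unfolding case_prod_beta by measurable
    have "(\<integral>\<^sup>+\<omega>. F (Yc \<omega>) \<partial>?P) = (\<integral>\<^sup>+a. \<integral>\<^sup>+v. \<integral>\<^sup>+w. F (a + (2 * h) *\<^sub>R B a v + sqrt (2 * h) *\<^sub>R w)
        \<partial>distr ?P borel (\<lambda>\<omega>. (1 / sqrt 2) *\<^sub>R (?z1 \<omega> + ?z2 \<omega>)) \<partial>distr ?P borel ?u3 \<partial>distr ?P borel ?y)"
      by (rule P.chain_step_integral[OF \<Phi> P.coarse_indep(1)[OF hyps] P.coarse_indep(2)[OF hyps] Yc F])
    also have "\<dots> = (\<integral>\<^sup>+\<omega>. F (C1 \<omega>) \<partial>N)"
      unfolding P.coarse_indep(3)[OF hyps] u\<mu> dxy marg by (rule C1[OF F, symmetric])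
    also have "\<dots> = (\<integral>\<^sup>+a. F a \<partial>distr N borel C1)" by (rule nn_integral_distr[symmetric]) auto
    finally show "(\<integral>\<^sup>+\<omega>. F (Yc \<omega>) \<partial>?P) = (\<integral>\<^sup>+a. F a \<partial>distr N borel C1)" .
  qed (use X in auto)
  have mX1: "(\<integral>\<^sup>+\<omega>. ennreal ((norm (X1 \<omega>))\<^sup>2) \<partial>?P) \<le> ennreal Cf"
  proof -
    have "(\<integral>\<^sup>+\<omega>. ennreal ((norm (X1 \<omega>))\<^sup>2) \<partial>?P) = (\<integral>\<^sup>+a. ennreal ((norm a)\<^sup>2) \<partial>distr ?P borel X1)"
      using X(1) by (subst nn_integral_distr) auto
    also have "\<dots> = (\<integral>\<^sup>+\<omega>. ennreal ((norm (F1 \<omega>))\<^sup>2) \<partial>N)"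
      unfolding lX1 by (subst nn_integral_distr) auto
    finally show ?thesis using m by simp
  qed
  let ?\<pi>' = "distr ?P (borel \<Otimes>\<^sub>M borel) (\<lambda>\<omega>. (X2 \<omega>, Yc \<omega>))"
  have XY: "(\<lambda>\<omega>. (X2 \<omega>, Yc \<omega>)) \<in> measurable ?P (borel \<Otimes>\<^sub>M borel)" using X by (intro measurable_Pair)
  have fm: "(\<lambda>p. ennreal (f (norm (fst p - snd p)))) \<in> borel_measurable (borel \<Otimes>\<^sub>M borel :: ('a \<times> 'a) measure)" by measurable
  show ?thesis
  proof (intro exI[of _ ?\<pi>'] conjI)
    show "prob_space ?\<pi>'" by (rule P.prob_space_distr[OF XY])
    show "distr ?\<pi>' borel fst = distr N borel F2" "distr ?\<pi>' borel snd = distr N borel C1"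
      unfolding lX2[symmetric] lYc[symmetric] using XY by (subst distr_distr; simp add: comp_def)+
    have "(\<integral>\<^sup>+p. ennreal (f (norm (fst p - snd p))) \<partial>?\<pi>') = (\<integral>\<^sup>+\<omega>. ennreal (f (norm (X2 \<omega> - Yc \<omega>))) \<partial>?P)"
      by (subst nn_integral_distr[OF XY]) (use fm in auto)
    moreover have "(\<integral>\<^sup>+\<omega>. ennreal (f (norm (?x \<omega> - ?y \<omega>))) \<partial>?P) = (\<integral>\<^sup>+p. ennreal (f (norm (fst p - snd p))) \<partial>\<pi>)"
    proof -
      have "(\<lambda>p. ennreal (f (norm (fst p - snd p)))) \<in> borel_measurable \<pi>"
        unfolding measurable_cong_sets[OF \<pi>(2) refl] by (rule fm)
      then have "(\<integral>\<^sup>+p. ennreal (f (norm (fst p - snd p))) \<partial>distr ?P \<pi> fst) = (\<integral>\<^sup>+\<omega>. ennreal (f (norm (?x \<omega> - ?y \<omega>))) \<partial>?P)"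
        by (intro nn_integral_distr[OF measurable_fst]) simp
      then show ?thesis unfolding d\<pi> by simp
    qed
    ultimately show "(\<integral>\<^sup>+p. ennreal (f (norm (fst p - snd p))) \<partial>?\<pi>')
      \<le> ennreal ((1 - c * h)\<^sup>2) * (\<integral>\<^sup>+p. ennreal (f (norm (fst p - snd p))) \<partial>\<pi>)
        + ennreal (\<delta> + q * (\<delta> * ((1 + H * L) * (sqrt Cf + sy) + sqrt H)) + q * \<delta>\<^sup>2)"
      using contr[OF mX1] by (simp only:)
  qed simp
qed

section \<open>The constants and the size of the error of one double step\<close>

lemma (in contraction_parameters) C_IEul2h_nonneg:
  fixes b :: "'a::euclidean_space \<Rightarrow> 'a"
  assumes "0 < M1 K - 4 * H * L\<^sup>2 - 2 * H * \<sigma>\<^sup>2" "0 \<le> mc"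
  shows "0 \<le> C_IEul2h L K R \<sigma> b mc"
proof -
  have "0 \<le> M2 L K R b"
    using pos by (auto simp: M2_def rho_def intro!: add_nonneg_nonneg mult_nonneg_nonneg intro: max.coboundedI1)
  then have "0 \<le> 4 * H * (norm (b 0))\<^sup>2 + real DIM('a) + M2 L K R b + 2 * H * \<sigma>\<^sup>2"
    using H_pos by (intro add_nonneg_nonneg mult_nonneg_nonneg) auto
  then have "0 \<le> (4 * H * (norm (b 0))\<^sup>2 + real DIM('a) + M2 L K R b + 2 * H * \<sigma>\<^sup>2) / (M1 K - 4 * H * L\<^sup>2 - 2 * H * \<sigma>\<^sup>2)"
    using assms(1) by (rule divide_nonneg_pos)
  with assms(2) show ?thesis
    unfolding C_IEul2h_def Let_def by (rule add_nonneg_nonneg)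
qed

lemma (in contraction_parameters) C_IEul_nonneg:
  fixes b :: "'a::euclidean_space \<Rightarrow> 'a"
  assumes "0 < M1 K - 2 * H * L\<^sup>2 - H * \<sigma>\<^sup>2" "0 \<le> mf"
  shows "0 \<le> C_IEul L K R \<sigma> b mf"
proof -
  have "0 \<le> M2 L K R b"
    using pos by (auto simp: M2_def rho_def intro!: add_nonneg_nonneg mult_nonneg_nonneg intro: max.coboundedI1)
  then have "0 \<le> 2 * H * (norm (b 0))\<^sup>2 + real DIM('a) + M2 L K R b + H * \<sigma>\<^sup>2"
    using H_pos by (intro add_nonneg_nonneg mult_nonneg_nonneg) auto
  then have "0 \<le> (2 * H * (norm (b 0))\<^sup>2 + real DIM('a) + M2 L K R b + H * \<sigma>\<^sup>2) / (M1 K - 2 * H * L\<^sup>2 - H * \<sigma>\<^sup>2)"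
    using assms(1) by (rule divide_nonneg_pos)
  with assms(2) show ?thesis
    unfolding C_IEul_def Let_def by (rule add_nonneg_nonneg)
qed

text \<open>\<open>\<delta>\<close> is the L2 bound for the defect. The left side of the fourth
  claim is the error in \<open>two_step_contraction\<close>; extracting one factor h^(1 + m / 2)
  from it and replacing the remaining h by h0 produces \<open>C_IMLult\<close>.\<close>

lemma (in contraction_parameters) step_error_bounds:
  fixes b :: "'a::euclidean_space \<Rightarrow> 'a" and \<sigma> Lu ac mf mc :: real
  assumes h1: "h < 1" and Lu: "0 < Lu" and ac: "0 < ac"
  defines "C \<equiv> C_IEul2h L K R \<sigma> b mc" and "Cf \<equiv> C_IEul L K R \<sigma> b mf" and "m \<equiv> min ac 1"
    and "D \<equiv> C_IMLdif L K R \<sigma> Lu ac b mc" and "sy \<equiv> sqrt (C_IASP L K R \<sigma> b mc)"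
  defines "\<delta> \<equiv> sqrt D * h powr (1 + m / 2)"
  assumes C: "0 \<le> C" "0 \<le> Cf"
  shows "0 \<le> \<delta>"
    and "2 * h\<^sup>2 * (Lu * (1 + C) * h powr ac + L\<^sup>2 * (h\<^sup>2 * (C * (\<sigma>\<^sup>2 + 2 * L\<^sup>2) + \<sigma>\<^sup>2 + 2 * (norm (b 0))\<^sup>2) + h * real DIM('a))) \<le> \<delta>\<^sup>2"
    and "sqrt C + sqrt (h\<^sup>2 * (C * (\<sigma>\<^sup>2 + 2 * L\<^sup>2) + \<sigma>\<^sup>2 + 2 * (norm (b 0))\<^sup>2) + h * real DIM('a)) \<le> sy"
    and "\<delta> + q * (\<delta> * ((1 + H * L) * (sqrt Cf + sy) + sqrt H)) + q * \<delta>\<^sup>2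
      \<le> C_IMLult L K R \<sigma> Lu ac b mf mc * h powr (1 + m / 2)"
    and "0 \<le> C_IMLult L K R \<sigma> Lu ac b mf mc"
proof -
  let ?d = "real DIM('a)"
  define S where "S = C_ISM L K R \<sigma> b mc"
  have S: "S = C * (\<sigma>\<^sup>2 + 2 * L\<^sup>2) + \<sigma>\<^sup>2 + 2 * (norm (b 0))\<^sup>2" by (simp add: S_def C_ISM_def C_def)
  have S0: "0 \<le> S" unfolding S using C by (intro add_nonneg_nonneg mult_nonneg_nonneg) auto
  have hH: "h \<le> H" "0 \<le> h" "0 < H" using h H_pos by auto
  \<comment> \<open>The exponent of h0 in \<open>C_IMLdif\<close>, complementary to
    \<open>m\<close>. A single power of h is written as h^m h^p and bounded by h^m H^p, see
    \<open>hp\<close>.\<close>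
  define p where "p = max (1 - ac) 0"
  have pm: "p = 1 - m" by (auto simp: p_def m_def)
  have m: "0 < m" "m \<le> ac" "m \<le> 1" using ac by (auto simp: m_def)
  have D: "D = (4 * H * L\<^sup>2 * S + 4 * L\<^sup>2 * ?d) * H powr p + 2 * Lu * (1 + C)"
    by (simp add: D_def C_IMLdif_def S_def p_def C_def)
  have D0: "0 \<le> D" unfolding D using S0 C Lu hH by (intro add_nonneg_nonneg mult_nonneg_nonneg) auto
  show \<delta>0: "0 \<le> \<delta>" using D0 by (simp add: \<delta>_def)
  have e2: "(h powr (1 + m / 2))\<^sup>2 = h\<^sup>2 * h powr m"
  proof -
    have "(h powr (1 + m / 2))\<^sup>2 = h powr (2 + m)"
      by (simp add: power2_eq_square flip: powr_add) 
    also have "\<dots> = h powr 2 * h powr m" by (rule powr_add)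
    also have "h powr 2 = h\<^sup>2" using h by simp
    finally show ?thesis .
  qed
  have \<delta>2: "\<delta>\<^sup>2 = D * (h\<^sup>2 * h powr m)"
    using D0 by (simp add: \<delta>_def power_mult_distrib e2)
  \<comment> \<open>Cutting the exponent \<open>ac\<close> at 1 enlarges the power because h <
    1.\<close>
  have hac: "h powr ac \<le> h powr m" using h h1 m by (intro powr_mono') auto
  have hp: "h \<le> h powr m * H powr p"
  proof -
    have "h = h powr (m + p)" using h by (simp add: pm)
    also have "\<dots> = h powr m * h powr p" by (rule powr_add)
    also have "\<dots> \<le> h powr m * H powr p"
      using hH by (intro mult_left_mono powr_mono2) (auto simp: p_def)
    finally show ?thesis .
  qed
  have "Lu * (1 + C) * h powr ac \<le> Lu * (1 + C) * h powr m" using Lu C hac by (intro mult_left_mono) auto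
  moreover have "L\<^sup>2 * (h\<^sup>2 * S + h * ?d) \<le> (2 * H * L\<^sup>2 * S + 2 * L\<^sup>2 * ?d) * H powr p * h powr m"
  proof -
    have "h\<^sup>2 * S + h * ?d = h * (h * S + ?d)" by (simp add: algebra_simps power2_eq_square)
    also have "\<dots> \<le> (h powr m * H powr p) * (2 * (H * S + ?d))"
    proof (rule mult_mono)
      have "u + d \<le> 2 * (v + d)" if "u \<le> v" "0 \<le> v" "0 \<le> d" for u v d :: real using that by simp
      moreover have "h * S \<le> H * S" "0 \<le> H * S" using hH S0 by (auto intro: mult_right_mono)
      ultimately show "h * S + ?d \<le> 2 * (H * S + ?d)" by simp
    qed (use hp hH S0 in auto)
    finally have "L\<^sup>2 * (h\<^sup>2 * S + h * ?d) \<le> L\<^sup>2 * ((h powr m * H powr p) * (2 * (H * S + ?d)))"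
      by (intro mult_left_mono) auto
    then show ?thesis by (simp add: algebra_simps)
  qed
  ultimately have "Lu * (1 + C) * h powr ac + L\<^sup>2 * (h\<^sup>2 * S + h * ?d)
     \<le> Lu * (1 + C) * h powr m + (2 * H * L\<^sup>2 * S + 2 * L\<^sup>2 * ?d) * H powr p * h powr m" by (rule add_mono)
  also have "\<dots> = D / 2 * h powr m" by (simp add: D algebra_simps)
  finally have "2 * h\<^sup>2 * (Lu * (1 + C) * h powr ac + L\<^sup>2 * (h\<^sup>2 * S + h * ?d)) \<le> 2 * h\<^sup>2 * (D / 2 * h powr m)"
    by (intro mult_left_mono) auto
  also have "\<dots> = \<delta>\<^sup>2" by (simp add: \<delta>2)
  finally show "2 * h\<^sup>2 * (Lu * (1 + C) * h powr ac + L\<^sup>2 * (h\<^sup>2 * (C * (\<sigma>\<^sup>2 + 2 * L\<^sup>2) + \<sigma>\<^sup>2 + 2 * (norm (b 0))\<^sup>2) + h * ?d)) \<le> \<delta>\<^sup>2"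
    by (simp only: S)
  have sy: "sy = sqrt C + H * sqrt S + sqrt (H * ?d)"
    using C S0 hH by (simp add: sy_def C_IASP_def Let_def S_def[symmetric] C_def[symmetric])
  have "sqrt (h\<^sup>2 * S + h * ?d) \<le> sqrt (h\<^sup>2 * S) + sqrt (h * ?d)"
    using S0 hH by (intro sqrt_add_le_add_sqrt) auto
  also have "\<dots> \<le> H * sqrt S + sqrt (H * ?d)"
    using hH S0 by (intro add_mono) (auto simp: real_sqrt_mult intro!: mult_right_mono)
  finally show "sqrt C + sqrt (h\<^sup>2 * (C * (\<sigma>\<^sup>2 + 2 * L\<^sup>2) + \<sigma>\<^sup>2 + 2 * (norm (b 0))\<^sup>2) + h * ?d) \<le> sy"
    unfolding S[symmetric] sy by simp
  have sy0: "0 \<le> sy" unfolding sy using C S0 hH by (intro add_nonneg_nonneg mult_nonneg_nonneg) auto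
  have ult: "C_IMLult L K R \<sigma> Lu ac b mf mc
      = q * D * H powr (1 + m / 2) + (1 + q * sqrt H) * sqrt D + q * (1 + H * L) * (sqrt Cf + sy) * sqrt D"
    by (simp add: C_IMLult_def Let_def q_def D_def m_def Cf_def sy_def)
  show "0 \<le> C_IMLult L K R \<sigma> Lu ac b mf mc"
    unfolding ult using q_pos D0 hH C sy0 pos by (intro add_nonneg_nonneg mult_nonneg_nonneg) auto
  \<comment> \<open>Of the two equal powers of h in \<delta>^2 one is kept and the other is replaced
    by its value at H.\<close>
  have "q * \<delta>\<^sup>2 = q * D * h powr (1 + m / 2) * h powr (1 + m / 2)"
    using D0 by (simp add: \<delta>_def power_mult_distrib power2_eq_square[of "h powr _"])
  also have "\<dots> \<le> q * D * H powr (1 + m / 2) * h powr (1 + m / 2)"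
    using q_pos D0 hH m by (intro mult_right_mono mult_left_mono powr_mono2) auto
  finally have "q * \<delta>\<^sup>2 \<le> q * D * H powr (1 + m / 2) * h powr (1 + m / 2)" .
  then show "\<delta> + q * (\<delta> * ((1 + H * L) * (sqrt Cf + sy) + sqrt H)) + q * \<delta>\<^sup>2
      \<le> C_IMLult L K R \<sigma> Lu ac b mf mc * h powr (1 + m / 2)"
    unfolding ult \<delta>_def by (simp add: algebra_simps)
qed

text \<open>This makes \<open>f\<close> of the initial distance integrable when the initial values
  have second moments.\<close>

lemma (in contraction_parameters) f_le_quadratic:
  assumes "0 \<le> r"
  shows "f r \<le> 1 + (1 + q) * r\<^sup>2"
proof -
  have "f r \<le> r * (1 + q * r)" using f_diff_le[of 0 r] assms by simp
  moreover have "0 \<le> (r - 1)\<^sup>2" by simp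
  then have "2 * r \<le> 1 + r\<^sup>2" by (simp add: power2_diff)
  then have "r \<le> 1 + r\<^sup>2" using assms by linarith
  ultimately show ?thesis by (simp add: algebra_simps power2_eq_square)
qed

theorem theorem2p20:
  fixes M :: "'w measure"
    and b :: "'a::euclidean_space \<Rightarrow> 'a"
    and bbar :: "real \<Rightarrow> 'a \<Rightarrow> 'u::euclidean_space \<Rightarrow> 'a"
    and L K R \<sigma> \<alpha> Lu \<alpha>c h :: real
    and Z :: "nat \<Rightarrow> 'w \<Rightarrow> 'a"
    and Uf Uc :: "nat \<Rightarrow> 'w \<Rightarrow> 'u"
    and Xf Xc :: "nat \<Rightarrow> 'w \<Rightarrow> 'a"
  assumes prob: "prob_space M"
    and pos: "L > 0" "K > 0" "R > 0" "\<sigma> > 0" "\<alpha> > 0" "Lu > 0" "\<alpha>c > 0"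
    and bbar_measurable: "\<And>s. s > 0 \<Longrightarrow> (\<lambda>(x, u). bbar s x u) \<in> borel_measurable borel"
    and a: "\<And>s x \<mu>. s > 0 \<Longrightarrow> prob_space \<mu> \<Longrightarrow> sets \<mu> = sets borel \<Longrightarrow>
              unbiased_at (bbar s) b \<mu> x \<Longrightarrow>
              mean_square \<mu> (\<lambda>u. bbar s x u - b x)
                \<le> ennreal (\<sigma>\<^sup>2 * (1 + (norm x)\<^sup>2) * s powr \<alpha>)"
    and b_Lipschitz: "\<And>s x y \<mu>. s > 0 \<Longrightarrow> prob_space \<mu> \<Longrightarrow> sets \<mu> = sets borel \<Longrightarrow>
              unbiased_at (bbar s) b \<mu> x \<Longrightarrow> unbiased_at (bbar s) b \<mu> y \<Longrightarrow>
              AE u in \<mu>. norm (bbar s x u - bbar s y u) \<le> L * norm (x - y)"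
    and b_contractive: "\<And>s x y \<mu>. s > 0 \<Longrightarrow> prob_space \<mu> \<Longrightarrow> sets \<mu> = sets borel \<Longrightarrow>
              unbiased_at (bbar s) b \<mu> x \<Longrightarrow> unbiased_at (bbar s) b \<mu> y \<Longrightarrow>
              norm (x - y) \<ge> R \<Longrightarrow>
              AE u in \<mu>. (x - y) \<bullet> (bbar s x u - bbar s y u) \<le> - K * (norm (x - y))\<^sup>2"
    and h: "0 < h" "h < h0 L K R" "h < K / (4 * L\<^sup>2 + 2 * \<sigma>\<^sup>2)" "h < 1"
    and C_IEul2h_denominator: "M1 K - 4 * h0 L K R * L\<^sup>2 - 2 * h0 L K R * \<sigma>\<^sup>2 > 0"
    and Z_normal: "\<And>k. k \<ge> 1 \<Longrightarrow> distributed M lborel (Z k) (\<lambda>z. ennreal (std_gaussian_density z))"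
    and Z_indep: "prob_space.indep_vars M (\<lambda>_. borel) Z {1..}"
    and Uf_indep: "prob_space.indep_vars M (\<lambda>_. borel) Uf UNIV"
    and Uc_indep: "prob_space.indep_vars M (\<lambda>_. borel) Uc UNIV"
    and Uf_unbiased: "\<And>k x. unbiased_at (bbar h) b (distr M borel (Uf k)) x"
    and Uc_unbiased: "\<And>k x. unbiased_at (bbar h) b (distr M borel (Uc k)) x"
    and U_Z_indep: "independent M
          (Pi\<^sub>M UNIV (\<lambda>_. borel)) (\<lambda>\<omega> k. (Uf k \<omega>, Uc k \<omega>))
          (Pi\<^sub>M {1..} (\<lambda>_. borel)) (\<lambda>\<omega>. \<lambda>k\<in>{1..}. Z k \<omega>)"
    and c_law: "\<And>k. distr M borel (Uf k) = distr M borel (Uc k)"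
    and c_bound: "\<And>x k. mean_square M
          (\<lambda>\<omega>. bbar h x (Uf k \<omega>) + bbar h x (Uf (k + 1) \<omega>) - 2 *\<^sub>R bbar h x (Uc k \<omega>))
            \<le> ennreal (Lu * (1 + (norm x)\<^sup>2) * h powr \<alpha>c)"
    and init_indep: "independent M
          borel (\<lambda>\<omega>. (Xf 0 \<omega>, Xc 0 \<omega>))
          (Pi\<^sub>M UNIV (\<lambda>_. borel) \<Otimes>\<^sub>M Pi\<^sub>M {1..} (\<lambda>_. borel))
          (\<lambda>\<omega>. (\<lambda>k. (Uf k \<omega>, Uc k \<omega>), \<lambda>k\<in>{1..}. Z k \<omega>))"
    and init_moments: "integrable M (\<lambda>\<omega>. (norm (Xf 0 \<omega>))\<^sup>2)" "integrable M (\<lambda>\<omega>. (norm (Xc 0 \<omega>))\<^sup>2)"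
    and fine_chain: "\<And>k \<omega>. \<omega> \<in> space M \<Longrightarrow>
          Xf (k + 1) \<omega> = Xf k \<omega> + h *\<^sub>R bbar h (Xf k \<omega>) (Uf k \<omega>) + sqrt h *\<^sub>R Z (k + 1) \<omega>"
    and coarse_chain: "\<And>k \<omega>. even k \<Longrightarrow> \<omega> \<in> space M \<Longrightarrow>
          Xc (k + 2) \<omega> = Xc k \<omega> + (2 * h) *\<^sub>R bbar h (Xc k \<omega>) (Uc k \<omega>)
            + sqrt (2 * h) *\<^sub>R ((1 / sqrt 2) *\<^sub>R (Z (k + 1) \<omega> + Z (k + 2) \<omega>))"
  shows "\<exists>(N :: ('w \<times> (nat \<Rightarrow> real)) measure) (G :: nat \<Rightarrow> 'w \<times> (nat \<Rightarrow> real) \<Rightarrow> 'a).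
    enlargement N fst M \<and>
    (\<forall>k. G k \<in> borel_measurable N) \<and>
    (\<forall>\<omega>\<in>space N. G 0 \<omega> = Xf 0 (fst \<omega>)) \<and>
    (\<forall>k\<ge>1. distr N borel (G k) = distr M borel (Xf k)) \<and>
    (\<forall>k. even k \<longrightarrow>
      mean_square N (\<lambda>\<omega>. G k \<omega> - Xc k (fst \<omega>))
        \<le> ennreal (A_const L K R * (1 - c_rate L K R * h) ^ k
                     * (\<integral>\<omega>. f_dist L K R (norm (G 0 \<omega> - Xc 0 (fst \<omega>))) \<partial>N)
                   + A_const L K R * C_IMLult L K R \<sigma> Lu \<alpha>c b
                       (\<integral>\<omega>. (norm (Xf 0 \<omega>))\<^sup>2 \<partial>M) (\<integral>\<omega>. (norm (Xc 0 \<omega>))\<^sup>2 \<partial>M)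
                     / c_rate L K R
                     * h powr (min \<alpha>c 1 / 2)))"
proof -
  interpret prob_space M by (rule prob)
  have B: "(\<lambda>(x, u). bbar h x u) \<in> borel_measurable (borel \<Otimes>\<^sub>M borel)"
    using bbar_measurable[OF h(1)] by (simp add: borel_prod)
  have Bfs[measurable]: "(\<lambda>p. bbar h (fst p) (snd p)) \<in> borel_measurable (borel \<Otimes>\<^sub>M borel)"
    using B by (simp add: case_prod_beta)
  have Uf_rv[measurable]: "Uf k \<in> borel_measurable M" and Uc_rv[measurable]: "Uc k \<in> borel_measurable M" for k
    using Uf_indep Uc_indep by (auto simp: indep_vars_def)
  have Z_rv: "Z k \<in> borel_measurable M" if "1 \<le> k" for k
    using Z_normal[OF that] by (auto simp: distributed_def)
  have Z_law: "distr M borel (Z k) = gaussian" if "1 \<le> k" for k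
    using distributed_distr_eq_density[OF Z_normal[OF that]] by (simp add: gaussian_def cong: distr_cong)
  \<comment> \<open>As h < 1, the power of h in (a) is at most 1. The same property of
    \<open>Uc\<close> follows later from the equality of laws in (c).\<close>
  have driver: "driver L K R \<sigma> (bbar h) b (distr M borel (Uf k))" for k
  proof -
    let ?\<mu> = "distr M borel (Uf k)"
    have \<mu>: "prob_space ?\<mu>" "sets ?\<mu> = sets borel" by (auto intro: prob_space_distr)
    have "mean_square ?\<mu> (\<lambda>u. bbar h x u - b x) \<le> ennreal (\<sigma>\<^sup>2 * (1 + (norm x)\<^sup>2))" for x
    proof (rule order_trans[OF a[OF h(1) \<mu> Uf_unbiased]], rule ennreal_leI)
      have "h powr \<alpha> \<le> 1 powr \<alpha>" using h pos by (intro powr_mono2) auto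
      then have "\<sigma>\<^sup>2 * (1 + (norm x)\<^sup>2) * h powr \<alpha> \<le> \<sigma>\<^sup>2 * (1 + (norm x)\<^sup>2) * 1" by (intro mult_left_mono) auto
      then show "\<sigma>\<^sup>2 * (1 + (norm x)\<^sup>2) * h powr \<alpha> \<le> \<sigma>\<^sup>2 * (1 + (norm x)\<^sup>2)" by simp
    qed
    with \<mu> show ?thesis
      unfolding driver_def
      using Uf_unbiased b_Lipschitz[OF h(1) \<mu> Uf_unbiased Uf_unbiased] b_contractive[OF h(1) \<mu> Uf_unbiased Uf_unbiased]
      by blast
  qed
  note Lu_pos = pos(6) and \<alpha>c_pos = pos(7) and h_le_1 = h(4)
  interpret contraction_parameters L K R h
    by unfold_locales (use pos h driver_K_le_L[OF driver] in auto)

  define mf mc where "mf = (\<integral>\<omega>. (norm (Xf 0 \<omega>))\<^sup>2 \<partial>M)" and "mc = (\<integral>\<omega>. (norm (Xc 0 \<omega>))\<^sup>2 \<partial>M)"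
  have mfc0: "0 \<le> mf" "0 \<le> mc" by (simp_all add: mf_def mc_def)
  define C where "C = C_IEul2h L K R \<sigma> b mc"
  define Cf where "Cf = C_IEul L K R \<sigma> b mf"
  \<comment> \<open>The denominator for step size 2 h0 is the smallest one, so its positivity
    carries over to step size h0.\<close>
  have den: "0 < M1 K - (2 * H) * (2 * L\<^sup>2 + \<sigma>\<^sup>2)" "0 < M1 K - H * (2 * L\<^sup>2 + \<sigma>\<^sup>2)" "0 < M1 K - 2 * H * L\<^sup>2 - H * \<sigma>\<^sup>2"
  proof -
    have "0 \<le> H * L\<^sup>2" "0 \<le> H * \<sigma>\<^sup>2" using H_pos by auto
    with C_IEul2h_denominator show "0 < M1 K - (2 * H) * (2 * L\<^sup>2 + \<sigma>\<^sup>2)" "0 < M1 K - H * (2 * L\<^sup>2 + \<sigma>\<^sup>2)"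
      "0 < M1 K - 2 * H * L\<^sup>2 - H * \<sigma>\<^sup>2"
      by (simp_all add: algebra_simps)
  qed
  have C0: "0 \<le> C" "0 \<le> Cf"
    unfolding C_def Cf_def
    using C_IEul2h_nonneg[OF C_IEul2h_denominator mfc0(2)] C_IEul_nonneg[OF den(3) mfc0(1)] by auto

  let ?PU = "PiM UNIV (\<lambda>_. borel) :: (nat \<Rightarrow> 'u \<times> 'u) measure"
  let ?PZ = "PiM {1..} (\<lambda>_. borel) :: (nat \<Rightarrow> 'a) measure"
  have UZ: "indep_law ?PU (\<lambda>\<omega> k. (Uf k \<omega>, Uc k \<omega>)) ?PZ (\<lambda>\<omega>. \<lambda>k\<in>{1..}. Z k \<omega>)"
    by (rule indep_law_independent[OF U_Z_indep])
  note X0 = indep_law_independent[OF init_indep]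
  have fs: "fst \<in> borel_measurable (borel :: ('x::euclidean_space \<times> 'x) measure)"
    "snd \<in> borel_measurable (borel :: ('x \<times> 'x) measure)"
    by (simp_all flip: borel_prod)
  have Xf0: "indep_law borel (Xf 0) (?PU \<Otimes>\<^sub>M ?PZ) (\<lambda>\<omega>. (\<lambda>k. (Uf k \<omega>, Uc k \<omega>), \<lambda>k\<in>{1..}. Z k \<omega>))"
    by (rule indep_law_compose[OF X0 fs(1), where k="\<lambda>x. x"]) auto
  have Xc0: "indep_law borel (Xc 0) (?PU \<Otimes>\<^sub>M ?PZ) (\<lambda>\<omega>. (\<lambda>k. (Uf k \<omega>, Uc k \<omega>), \<lambda>k\<in>{1..}. Z k \<omega>))"
    by (rule indep_law_compose[OF X0 fs(2), where k="\<lambda>x. x"]) auto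
  have \<Phi>: "(\<lambda>(x, u, w). x + s *\<^sub>R bbar h x u + r *\<^sub>R w) \<in> borel_measurable (borel \<Otimes>\<^sub>M (borel \<Otimes>\<^sub>M borel))" for s r
  proof -
    have [measurable]: "(\<lambda>p. bbar h (fst p) (fst (snd p))) \<in> borel_measurable (borel \<Otimes>\<^sub>M (borel \<Otimes>\<^sub>M borel :: ('u \<times> 'a) measure))"
      using measurable_compose[OF _ Bfs, of "\<lambda>p. (fst p, fst (snd p))" "borel \<Otimes>\<^sub>M (borel \<Otimes>\<^sub>M borel :: ('u \<times> 'a) measure)"] by simp
    show ?thesis unfolding case_prod_beta by measurable
  qed
  \<comment> \<open>The fine chain takes the first components of the pairs, and one Gaussian per
    step, so both Gaussian indices are \<open>Suc\<close>.\<close>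
  have fine_law: "indep_law borel (Xf n) (borel \<Otimes>\<^sub>M borel) (\<lambda>\<omega>. (Uf n \<omega>, Z (Suc n) \<omega>))"
      "indep_law borel (Uf n) borel (Z (Suc n))" for n
    using chain_law[OF \<Phi>[of h "sqrt h"], where g="\<lambda>z z'. z" and p=fst and \<iota>="\<lambda>n. n" and \<alpha>=Suc and \<beta>=Suc and Y=Xf and n=n,
        OF _ Xf0 UZ fs(1) _ Z_indep] Uf_indep fine_chain
    by (simp_all add: case_prod_beta)
  \<comment> \<open>The coarse chain counted by its own steps: step \<open>n\<close> leads from time
    2 n to 2 n + 2.\<close>
  define Xc2 where "Xc2 n = Xc (2 * n)" for n
  define \<zeta> where "\<zeta> n \<omega> = (1 / sqrt 2) *\<^sub>R (Z (2 * n + 1) \<omega> + Z (2 * n + 2) \<omega>)" for n \<omega>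
  have coarse_step: "Xc2 (Suc n) \<omega> = Xc2 n \<omega> + (2 * h) *\<^sub>R bbar h (Xc2 n \<omega>) (Uc (2 * n) \<omega>) + sqrt (2 * h) *\<^sub>R \<zeta> n \<omega>"
    if "\<omega> \<in> space M" for n \<omega>
    using coarse_chain[of "2 * n" \<omega>] that by (simp add: Xc2_def \<zeta>_def)
  have coarse_law: "indep_law borel (Xc2 n) (borel \<Otimes>\<^sub>M borel) (\<lambda>\<omega>. (Uc (2 * n) \<omega>, \<zeta> n \<omega>))"
      "indep_law borel (Uc (2 * n)) borel (\<zeta> n)" for n
  proof -
    have V: "indep_vars (\<lambda>_. borel) (\<lambda>k \<omega>. snd (Uf k \<omega>, Uc k \<omega>)) UNIV" using Uc_indep by simp
    have g: "(\<lambda>(z, z'). (1 / sqrt 2) *\<^sub>R (z + z') :: 'a) \<in> borel_measurable (borel \<Otimes>\<^sub>M borel)"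
      unfolding case_prod_beta by measurable
    have dis: "{2 * m + 1, 2 * m + 2} \<inter> {2 * n + 1, 2 * n + 2} = {}" if "m < n" for m n :: nat
      using that by auto
    have st: "Xc2 (Suc n) \<omega> = Xc2 n \<omega> + (2 * h) *\<^sub>R bbar h (Xc2 n \<omega>) (snd (Uf (2 * n) \<omega>, Uc (2 * n) \<omega>))
        + sqrt (2 * h) *\<^sub>R ((1 / sqrt 2) *\<^sub>R (Z (2 * n + 1) \<omega> + Z (2 * n + 2) \<omega>))" if "\<omega> \<in> space M" for n \<omega>
      using coarse_step[OF that] by (simp only: \<zeta>_def snd_conv)
    note cl = chain_law[OF \<Phi>[of "2 * h" "sqrt (2 * h)"] g Xc0 UZ fs(2) V Z_indep,
        where \<iota>="\<lambda>n. 2 * n" and \<alpha>="\<lambda>n. 2 * n + 1" and \<beta>="\<lambda>n. 2 * n + 2" and Y=Xc2 and n=n, OF _ _ _ dis _ st]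
    show "indep_law borel (Xc2 n) (borel \<Otimes>\<^sub>M borel) (\<lambda>\<omega>. (Uc (2 * n) \<omega>, \<zeta> n \<omega>))"
      using cl(1) by (simp add: Xc2_def \<zeta>_def[abs_def])
    show "indep_law borel (Uc (2 * n)) borel (\<zeta> n)"
      using cl(2) by (simp add: Xc2_def \<zeta>_def[abs_def])
  qed
  have Xf_rv[measurable]: "Xf n \<in> borel_measurable M" and Xc2_rv[measurable]: "Xc2 n \<in> borel_measurable M" for n
    using fine_law(1)[of n] coarse_law(1)[of n] by (simp_all add: indep_law_def)

  have Z12: "indep_law borel (Z (2 * n + 1)) borel (Z (2 * n + 2))" for n
    by (rule indep_law_compose[OF indep_law_restrict[OF Z_indep, of "{2 * n + 1}" "{2 * n + 2}"],
          where g="\<lambda>z. z (2 * n + 1)" and k="\<lambda>z. z (2 * n + 2)"]) auto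
  have U12: "indep_law borel (Uf (2 * n)) borel (Uf (Suc (2 * n)))" for n
    by (rule indep_law_compose[OF indep_law_restrict[OF Uf_indep, of "{2 * n}" "{Suc (2 * n)}"],
          where g="\<lambda>z. z (2 * n)" and k="\<lambda>z. z (Suc (2 * n))"]) auto
  have \<zeta>_law: "distr M borel (\<zeta> n) = distr (gaussian \<Otimes>\<^sub>M gaussian) borel (\<lambda>p. (1 / sqrt 2) *\<^sub>R (fst p + snd p))" for n
    unfolding \<zeta>_def[abs_def] by (rule distr_indep_pair[OF Z12]) (auto simp: Z_law)
  note \<zeta>_moments = scaled_sum_of_gaussians[OF Z12 Z_law Z_law, of n for n]

  have mean_square_fine: "(\<integral>\<^sup>+\<omega>. ennreal ((norm (Xf n \<omega>))\<^sup>2) \<partial>M) \<le> ennreal Cf" for n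
  proof -
    have zm: "integrable M (Z (Suc n))" "(\<integral>\<omega>. Z (Suc n) \<omega> \<partial>M) = 0"
      "(\<integral>\<^sup>+\<omega>. ennreal ((norm (Z (Suc n) \<omega>))\<^sup>2) \<partial>M) = ennreal (real DIM('a))" for n
    proof -
      have rv: "Z (Suc n) \<in> borel_measurable M" by (rule Z_rv) simp
      have law: "distr M borel (Z (Suc n)) = gaussian" by (rule Z_law) simp
      have "integrable (distr M borel (Z (Suc n))) (\<lambda>w. w)" unfolding law by (rule integrable_gaussian_id)
      from integrable_distr[OF rv this] show "integrable M (Z (Suc n))" .
      have "(\<integral>w. w \<partial>distr M borel (Z (Suc n))) = (\<integral>\<omega>. Z (Suc n) \<omega> \<partial>M)" using rv by (intro integral_distr) auto
      then show "(\<integral>\<omega>. Z (Suc n) \<omega> \<partial>M) = 0" by (simp add: law integral_gaussian_id)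
      have "(\<integral>\<^sup>+w. ennreal ((norm w)\<^sup>2) \<partial>distr M borel (Z (Suc n))) = (\<integral>\<^sup>+\<omega>. ennreal ((norm (Z (Suc n) \<omega>))\<^sup>2) \<partial>M)"
        using rv by (intro nn_integral_distr) auto
      then show "(\<integral>\<^sup>+\<omega>. ennreal ((norm (Z (Suc n) \<omega>))\<^sup>2) \<partial>M) = ennreal (real DIM('a))"
        by (simp add: law nn_integral_gaussian_norm_square)
    qed
    have "(\<integral>\<^sup>+\<omega>. ennreal ((norm (Xf n \<omega>))\<^sup>2) \<partial>M)
      \<le> ennreal (mf + (H * (2 * (norm (b 0))\<^sup>2 + \<sigma>\<^sup>2) + real DIM('a) + M2 L K R b) / (M1 K - H * (2 * L\<^sup>2 + \<sigma>\<^sup>2)))"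
    proof (rule chain_mean_square[where B="bbar h" and Y=Xf and V=Uf and \<zeta>="\<lambda>n. Z (Suc n)" and \<tau>=h,
          OF B pos(1-3) h(1) _ _ den(2) fine_law _ driver zm])
      show "Xf (Suc n) \<omega> = Xf n \<omega> + h *\<^sub>R bbar h (Xf n \<omega>) (Uf n \<omega>) + sqrt h *\<^sub>R Z (Suc n) \<omega>" if "\<omega> \<in> space M" for n \<omega>
        using fine_chain[OF that, of n] by simp
      show "(\<integral>\<^sup>+\<omega>. ennreal ((norm (Xf 0 \<omega>))\<^sup>2) \<partial>M) \<le> ennreal mf"
        using init_moments(1) by (simp add: nn_integral_eq_integral mf_def)
    qed (use h hK mfc0 in auto)
    also have "mf + (H * (2 * (norm (b 0))\<^sup>2 + \<sigma>\<^sup>2) + real DIM('a) + M2 L K R b) / (M1 K - H * (2 * L\<^sup>2 + \<sigma>\<^sup>2)) = Cf"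
      unfolding Cf_def C_IEul_def Let_def by (simp add: algebra_simps)
    finally show ?thesis .
  qed
  have mean_square_coarse: "(\<integral>\<^sup>+\<omega>. ennreal ((norm (Xc2 n \<omega>))\<^sup>2) \<partial>M) \<le> ennreal C" for n
  proof -
    have "(\<integral>\<^sup>+\<omega>. ennreal ((norm (Xc2 n \<omega>))\<^sup>2) \<partial>M)
      \<le> ennreal (mc + ((2 * H) * (2 * (norm (b 0))\<^sup>2 + \<sigma>\<^sup>2) + real DIM('a) + M2 L K R b) / (M1 K - (2 * H) * (2 * L\<^sup>2 + \<sigma>\<^sup>2)))"
    proof (rule chain_mean_square[where B="bbar h" and Y=Xc2 and V="\<lambda>n. Uc (2 * n)" and \<zeta>=\<zeta> and \<tau>="2 * h",
          OF B pos(1-3) _ _ _ den(1) coarse_law coarse_step])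
      show "driver L K R \<sigma> (bbar h) b (distr M borel (Uc (2 * n)))" for n
        unfolding c_law[symmetric] by (rule driver)
      show "integrable M (\<zeta> n)" "(\<integral>\<omega>. \<zeta> n \<omega> \<partial>M) = 0" "(\<integral>\<^sup>+\<omega>. ennreal ((norm (\<zeta> n \<omega>))\<^sup>2) \<partial>M) = ennreal (real DIM('a))" for n
        unfolding \<zeta>_def[abs_def] by (rule \<zeta>_moments; simp)+
      show "(\<integral>\<^sup>+\<omega>. ennreal ((norm (Xc2 0 \<omega>))\<^sup>2) \<partial>M) \<le> ennreal mc"
        using init_moments(2) by (simp add: nn_integral_eq_integral mc_def Xc2_def)
    qed (use h hK mfc0 in auto)
    also have "mc + ((2 * H) * (2 * (norm (b 0))\<^sup>2 + \<sigma>\<^sup>2) + real DIM('a) + M2 L K R b) / (M1 K - (2 * H) * (2 * L\<^sup>2 + \<sigma>\<^sup>2)) = C"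
      unfolding C_def C_IEul2h_def Let_def by (simp add: algebra_simps)
    finally show ?thesis .
  qed

  have fine_step_law: "(\<integral>\<^sup>+\<omega>. F (Xf (Suc n) \<omega>) \<partial>M)
      = (\<integral>\<^sup>+a. \<integral>\<^sup>+v. \<integral>\<^sup>+w. F (a + h *\<^sub>R bbar h a v + sqrt h *\<^sub>R w) \<partial>gaussian \<partial>distr M borel (Uf n) \<partial>distr M borel (Xf n))"
    if "F \<in> borel_measurable borel" for F :: "'a \<Rightarrow> ennreal" and n
  proof -
    have law: "distr M borel (Z (Suc n)) = gaussian" by (rule Z_law) simp
    show ?thesis
      by (rule chain_step_integral[OF \<Phi>[of h "sqrt h"] fine_law[of n] _ that, unfolded law]) (use fine_chain[of _ n] in simp)
  qed
  have coarse_step_law: "(\<integral>\<^sup>+\<omega>. F (Xc2 (Suc n) \<omega>) \<partial>M)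
      = (\<integral>\<^sup>+a. \<integral>\<^sup>+v. \<integral>\<^sup>+w. F (a + (2 * h) *\<^sub>R bbar h a v + sqrt (2 * h) *\<^sub>R w)
          \<partial>distr (gaussian \<Otimes>\<^sub>M gaussian) borel (\<lambda>p. (1 / sqrt 2) *\<^sub>R (fst p + snd p)) \<partial>distr M borel (Uc (2 * n)) \<partial>distr M borel (Xc2 n))"
    if "F \<in> borel_measurable borel" for F :: "'a \<Rightarrow> ennreal" and n
    by (rule chain_step_integral[OF \<Phi>[of "2 * h" "sqrt (2 * h)"] coarse_law coarse_step that, unfolded \<zeta>_law])

  let ?bb = "borel \<Otimes>\<^sub>M borel :: ('a \<times> 'a) measure"
  let ?I = "\<lambda>\<pi>. \<integral>\<^sup>+p. ennreal (f (norm (fst p - snd p))) \<partial>\<pi>"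
  define I0 where "I0 = (\<integral>\<omega>. f (norm (Xf 0 \<omega> - Xc 0 \<omega>)) \<partial>M)"
  define e where "e = min \<alpha>c 1 / 2"
  define Cu where "Cu = C_IMLult L K R \<sigma> Lu \<alpha>c b mf mc"
  \<comment> \<open>\<open>E\<close> is chosen so that c h E equals the error of one double step,
    which makes it invariant under the recursion.\<close>
  define E where "E = Cu / c * h powr e"
  have Xc0_rv[measurable]: "Xc 0 \<in> borel_measurable M" using Xc2_rv[of 0] by (simp add: Xc2_def)
  \<comment> \<open>The conclusion contains the initial term as a Bochner integral, so integrability
    is needed to identify it with the integral in the extended reals.\<close>
  have I0: "(\<integral>\<^sup>+\<omega>. ennreal (f (norm (Xf 0 \<omega> - Xc 0 \<omega>))) \<partial>M) = ennreal I0" and I0_nonneg: "0 \<le> I0"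
  proof -
    have "integrable M (\<lambda>\<omega>. f (norm (Xf 0 \<omega> - Xc 0 \<omega>)))"
    proof (rule Bochner_Integration.integrable_bound)
      show "integrable M (\<lambda>\<omega>. 1 + (1 + q) * (2 * (norm (Xf 0 \<omega>))\<^sup>2 + 2 * (norm (Xc 0 \<omega>))\<^sup>2))"
        using init_moments by auto
      show "AE \<omega> in M. norm (f (norm (Xf 0 \<omega> - Xc 0 \<omega>))) \<le> norm (1 + (1 + q) * (2 * (norm (Xf 0 \<omega>))\<^sup>2 + 2 * (norm (Xc 0 \<omega>))\<^sup>2))"
      proof (rule AE_I2)
        fix \<omega>
        let ?x = "norm (Xf 0 \<omega>)" and ?y = "norm (Xc 0 \<omega>)" and ?r = "norm (Xf 0 \<omega> - Xc 0 \<omega>)"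
        have "?r\<^sup>2 \<le> (?x + ?y)\<^sup>2" by (intro power_mono norm_triangle_ineq4) auto
        also have "\<dots> \<le> 2 * ?x\<^sup>2 + 2 * ?y\<^sup>2" using sum_squares_bound[of ?x ?y] by (simp add: power2_sum)
        finally have "(1 + q) * ?r\<^sup>2 \<le> (1 + q) * (2 * ?x\<^sup>2 + 2 * ?y\<^sup>2)" using q_pos by (intro mult_left_mono) auto
        with f_le_quadratic[of ?r] have "f ?r \<le> 1 + (1 + q) * (2 * ?x\<^sup>2 + 2 * ?y\<^sup>2)" by simp
        with f_nonneg[of ?r] show "norm (f ?r) \<le> norm (1 + (1 + q) * (2 * ?x\<^sup>2 + 2 * ?y\<^sup>2))" by simp
      qed
    qed measurable
    then show "(\<integral>\<^sup>+\<omega>. ennreal (f (norm (Xf 0 \<omega> - Xc 0 \<omega>))) \<partial>M) = ennreal I0"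
      unfolding I0_def by (rule nn_integral_eq_integral) (auto simp: f_nonneg)
    show "0 \<le> I0" unfolding I0_def by (rule Bochner_Integration.integral_nonneg) (simp add: f_nonneg)
  qed
  note bounds = step_error_bounds[OF h_le_1 Lu_pos \<alpha>c_pos, of \<sigma> b mc mf, folded C_def Cf_def Cu_def, OF C0]
  have E0: "0 \<le> E" using bounds(5) c_pos by (simp add: E_def)
  have ch1: "0 \<le> 1 - c * h" "(1 - c * h)\<^sup>2 \<le> 1 - c * h"
    using ch_bounds by (auto simp: power2_eq_square mult_left_le)
  \<comment> \<open>The recursion over double steps; the couplings are tied to the given chains only
    through their marginals.\<close>
  have couplings: "\<exists>\<pi>. prob_space \<pi> \<and> sets \<pi> = sets ?bb \<and> distr \<pi> borel fst = distr M borel (Xf (2 * n)) \<and>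
      distr \<pi> borel snd = distr M borel (Xc2 n) \<and> ?I \<pi> \<le> ennreal ((1 - c * h) ^ (2 * n) * I0 + E)" for n
  proof (induction n)
    case 0
    let ?\<pi> = "distr M ?bb (\<lambda>\<omega>. (Xf 0 \<omega>, Xc 0 \<omega>))"
    have "?I ?\<pi> = ennreal I0" unfolding I0[symmetric] by (subst nn_integral_distr) auto
    then have "?I ?\<pi> \<le> ennreal ((1 - c * h) ^ (2 * 0) * I0 + E)" using E0 by (simp add: ennreal_leI)
    moreover have "distr ?\<pi> borel fst = distr M borel (Xf (2 * 0))" "distr ?\<pi> borel snd = distr M borel (Xc2 0)"
      by (subst distr_distr; simp add: comp_def Xc2_def)+
    moreover have "prob_space ?\<pi>" by (rule prob_space_distr) measurable
    ultimately show ?case by (intro exI[of _ ?\<pi>]) auto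
  next
    case (Suc n)
    then obtain \<pi> where \<pi>: "prob_space \<pi>" "sets \<pi> = sets ?bb" "distr \<pi> borel fst = distr M borel (Xf (2 * n))"
      "distr \<pi> borel snd = distr M borel (Xc2 n)" "?I \<pi> \<le> ennreal ((1 - c * h) ^ (2 * n) * I0 + E)" by blast
    let ?bV = "borel \<Otimes>\<^sub>M (borel \<Otimes>\<^sub>M borel) :: ('u \<times> 'u \<times> 'u) measure"
    \<comment> \<open>The law of the triple is used as a fresh factor, independent of the coupling
      built so far, whatever the dependence on the original space.\<close>
    let ?\<beta> = "distr M ?bV (\<lambda>\<omega>. (Uf (2 * n) \<omega>, Uf (Suc (2 * n)) \<omega>, Uc (2 * n) \<omega>))"
    have \<beta>: "prob_space ?\<beta>" by (rule prob_space_distr) measurable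
    have \<beta>12: "prob_space.indep_law ?\<beta> borel fst borel (\<lambda>v. fst (snd v))"
      by (rule indep_law_distr) (use U12[of n] in simp_all)
    have \<mu>: "distr ?\<beta> borel fst = distr M borel (Uf (2 * n))" "distr ?\<beta> borel (\<lambda>v. fst (snd v)) = distr M borel (Uf (Suc (2 * n)))"
      "distr ?\<beta> borel (\<lambda>v. snd (snd v)) = distr M borel (Uc (2 * n))"
      by (subst distr_distr; simp add: comp_def)+
    have bd: "(\<integral>\<^sup>+v. ennreal ((norm (bbar h a (fst v) + bbar h a (fst (snd v)) - 2 *\<^sub>R bbar h a (snd (snd v))))\<^sup>2) \<partial>?\<beta>)
        \<le> ennreal (Lu * (1 + (norm a)\<^sup>2) * h powr \<alpha>c)" for a
    proof -
      have [measurable]: "(\<lambda>u. bbar h a u) \<in> borel_measurable borel"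
        using measurable_compose[OF _ Bfs, of "\<lambda>u. (a, u)" borel] by simp
      show ?thesis
        using c_bound[of a "2 * n"] by (subst nn_integral_distr) (auto simp: mean_square_def)
    qed
    note ex = coupling_step_exists[OF B \<beta> _ \<beta>12 \<mu> driver driver bd \<pi>(1,2) C0 less_imp_le[OF Lu_pos] bounds(1-3) prob
        Xf_rv[of "2 * n"] Xf_rv[of "Suc (2 * n)"] Xf_rv[of "Suc (Suc (2 * n))"] Xc2_rv[of n] Xc2_rv[of "Suc n"] \<pi>(3,4)
        _ _ _ mean_square_fine mean_square_coarse]
    note le = add_left_mono[OF ennreal_leI[OF bounds(4)]]
    obtain \<pi>' where \<pi>': "prob_space \<pi>'" "sets \<pi>' = sets ?bb" "distr \<pi>' borel fst = distr M borel (Xf (Suc (Suc (2 * n))))"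
      "distr \<pi>' borel snd = distr M borel (Xc2 (Suc n))"
      and I': "?I \<pi>' \<le> ennreal ((1 - c * h)\<^sup>2) * ?I \<pi> + ennreal (Cu * h powr (1 + min \<alpha>c 1 / 2))"
      by (rule exE[OF ex], simp, erule fine_step_law, erule fine_step_law, erule coarse_step_law, elim conjE,
          rule that, assumption, assumption, assumption, assumption, erule order_trans[OF _ le])
    have "?I \<pi>' \<le> ennreal ((1 - c * h)\<^sup>2) * ennreal ((1 - c * h) ^ (2 * n) * I0 + E) + ennreal (Cu * h powr (1 + min \<alpha>c 1 / 2))"
      by (rule order_trans[OF I']) (intro add_right_mono mult_left_mono \<pi>(5), simp)
    also have "\<dots> = ennreal ((1 - c * h)\<^sup>2 * ((1 - c * h) ^ (2 * n) * I0 + E) + Cu * h powr (1 + min \<alpha>c 1 / 2))"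
      using bounds(5) E0 I0_nonneg ch1 by (subst ennreal_plus) (auto simp: ennreal_mult)
    also have "\<dots> \<le> ennreal ((1 - c * h) ^ (2 * Suc n) * I0 + E)"
    proof (rule ennreal_leI)
      \<comment> \<open>On \<open>E\<close> the factor (1 - c h)^2 is weakened to 1 - c h; the
        missing c h E is exactly the new error.\<close>
      have "Cu * h powr (1 + min \<alpha>c 1 / 2) = c * h * E"
        using c_pos h by (simp add: E_def e_def powr_add)
      moreover have "(1 - c * h)\<^sup>2 * E \<le> (1 - c * h) * E" using ch1 E0 by (intro mult_right_mono) auto
      moreover have "(1 - c * h) ^ (2 * Suc n) * I0 = (1 - c * h)\<^sup>2 * ((1 - c * h) ^ (2 * n) * I0)"
        by (simp add: power2_eq_square)
      ultimately show "(1 - c * h)\<^sup>2 * ((1 - c * h) ^ (2 * n) * I0 + E) + Cu * h powr (1 + min \<alpha>c 1 / 2) \<le> (1 - c * h) ^ (2 * Suc n) * I0 + E"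
        by (simp add: distrib_left left_diff_distrib)
    qed
    finally show ?case using \<pi>' by (intro exI[of _ \<pi>']) simp
  qed
  obtain \<Xi> where \<Xi>: "\<And>n. prob_space (\<Xi> n)" "\<And>n. sets (\<Xi> n) = sets ?bb" "\<And>n. distr (\<Xi> n) borel fst = distr M borel (Xf (2 * n))"
      "\<And>n. distr (\<Xi> n) borel snd = distr M borel (Xc2 n)" "\<And>n. ?I (\<Xi> n) \<le> ennreal ((1 - c * h) ^ (2 * n) * I0 + E)"
    by (rule exE[OF choice[OF allI[OF couplings]]], rule that; drule spec, elim conjE, assumption)

  let ?U = "PiM UNIV (\<lambda>_. unif) :: (nat \<Rightarrow> real) measure"
  let ?N = "M \<Otimes>\<^sub>M ?U"
  interpret U: prob_space ?U by (rule prob_space_PiM) (rule prob_space_unif)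
  have pN: "prob_space ?N" by (rule prob_space_pair[OF prob U.prob_space_axioms])
  have dfst: "distr ?N M fst = M" by (rule distr_fst_pair[OF prob U.prob_space_axioms])
  \<comment> \<open>The same uniform sequence serves every \<open>n\<close>: each coupling concerns
    one time only.\<close>
  have liftings: "\<exists>G. G \<in> borel_measurable ?N \<and> distr ?N ?bb (\<lambda>\<omega>. (G \<omega>, Xc2 n (fst \<omega>))) = \<Xi> n" for n
    by (rule bexE[OF glue_law[OF Xc2_rv \<Xi>(1,2,4)]], rule exI, erule conjI, assumption)
  obtain g where g: "\<And>n. g n \<in> borel_measurable ?N" "\<And>n. distr ?N ?bb (\<lambda>\<omega>. (g n \<omega>, Xc2 n (fst \<omega>))) = \<Xi> n"
    by (rule exE[OF choice[OF allI[OF liftings]]], rule that; drule spec, elim conjE, assumption)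
  \<comment> \<open>At time 0 the value is prescribed. At odd times only the law is, so the fine
    chain itself can be taken; the couplings are needed at positive even times.\<close>
  define G where "G k = (if k = 0 \<or> odd k then (\<lambda>\<omega>. Xf k (fst \<omega>)) else g (k div 2))" for k
  have push: "distr ?N borel (\<lambda>\<omega>. V (fst \<omega>)) = distr M borel V" if "V \<in> borel_measurable M" for V :: "'w \<Rightarrow> 'a"
    using distr_distr[OF that measurable_fst[of M ?U]] by (simp add: dfst comp_def)
  have fm: "(\<lambda>\<omega>. V (fst \<omega>)) \<in> borel_measurable ?N" if "V \<in> borel_measurable M" for V :: "'w \<Rightarrow> 'a"
    by (rule measurable_compose[OF measurable_fst that])
  have G_rv: "G k \<in> borel_measurable ?N" for k
    using g(1) fm[OF Xf_rv] by (auto simp: G_def)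
  have G_law: "distr ?N borel (G k) = distr M borel (Xf k)" for k
  proof (cases "k = 0 \<or> odd k")
    case True
    then show ?thesis using push[OF Xf_rv] by (simp add: G_def)
  next
    case False
    then have k: "2 * (k div 2) = k" by simp
    have "distr ?N borel (g (k div 2)) = distr (\<Xi> (k div 2)) borel fst"
      unfolding g(2)[symmetric] using g(1) fm[OF Xc2_rv] by (subst distr_distr) (auto simp: comp_def)
    then show ?thesis using False by (simp add: G_def \<Xi>(3) k)
  qed
  have G_pair: "(\<integral>\<^sup>+\<omega>. ennreal (f (norm (G k \<omega> - Xc k (fst \<omega>)))) \<partial>?N) \<le> ennreal ((1 - c * h) ^ k * I0 + E)" if "even k" for k
  proof (cases "k = 0")
    case True
    have "(\<integral>\<^sup>+\<omega>. ennreal (f (norm (Xf 0 \<omega> - Xc 0 \<omega>))) \<partial>distr ?N M fst) = (\<integral>\<^sup>+\<omega>. ennreal (f (norm (Xf 0 (fst \<omega>) - Xc 0 (fst \<omega>)))) \<partial>?N)"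
      by (rule nn_integral_distr) (simp_all add: dfst)
    then have "(\<integral>\<^sup>+\<omega>. ennreal (f (norm (Xf 0 (fst \<omega>) - Xc 0 (fst \<omega>)))) \<partial>?N) = ennreal I0" by (simp only: dfst I0)
    then show ?thesis using True E0 by (simp add: G_def ennreal_leI)
  next
    case False
    with that have k: "2 * (k div 2) = k" "Xc k = Xc2 (k div 2)" "G k = g (k div 2)" by (auto simp: Xc2_def G_def)
    have "?I (\<Xi> (k div 2)) = (\<integral>\<^sup>+\<omega>. ennreal (f (norm (g (k div 2) \<omega> - Xc2 (k div 2) (fst \<omega>)))) \<partial>?N)"
      unfolding g(2)[symmetric] using g(1) fm[OF Xc2_rv] by (subst nn_integral_distr) auto
    with \<Xi>(5)[of "k div 2"] show ?thesis by (simp add: k)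
  qed
  have intf: "(\<integral>\<omega>. f (norm (G 0 \<omega> - Xc 0 (fst \<omega>))) \<partial>?N) = I0"
  proof -
    have "(\<integral>\<omega>. f (norm (Xf 0 \<omega> - Xc 0 \<omega>)) \<partial>distr ?N M fst) = (\<integral>\<omega>. f (norm (Xf 0 (fst \<omega>) - Xc 0 (fst \<omega>))) \<partial>?N)"
      by (rule integral_distr) simp_all
    then show ?thesis by (simp add: dfst I0_def G_def)
  qed
  let ?A = "A_const L K R"
  have final: "mean_square ?N (\<lambda>\<omega>. G k \<omega> - Xc k (fst \<omega>))
      \<le> ennreal (?A * (1 - c * h) ^ k * (\<integral>\<omega>. f (norm (G 0 \<omega> - Xc 0 (fst \<omega>))) \<partial>?N) + ?A * Cu / c * h powr (min \<alpha>c 1 / 2))"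
    if k: "even k" for k
  proof -
    have XcN: "(\<lambda>\<omega>. Xc k (fst \<omega>)) \<in> borel_measurable ?N"
      using fm[OF Xc2_rv[of "k div 2"]] k by (simp add: Xc2_def)
    have "mean_square ?N (\<lambda>\<omega>. G k \<omega> - Xc k (fst \<omega>)) \<le> (\<integral>\<^sup>+\<omega>. ennreal ?A * ennreal (f (norm (G k \<omega> - Xc k (fst \<omega>)))) \<partial>?N)"
      unfolding mean_square_def
    proof (rule nn_integral_mono)
      fix \<omega>
      show "ennreal ((norm (G k \<omega> - Xc k (fst \<omega>)))\<^sup>2) \<le> ennreal ?A * ennreal (f (norm (G k \<omega> - Xc k (fst \<omega>))))"
        using square_le_A_f[of "norm (G k \<omega> - Xc k (fst \<omega>))"] A_pos by (simp add: ennreal_leI f_nonneg flip: ennreal_mult)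
    qed
    also have "\<dots> = ennreal ?A * (\<integral>\<^sup>+\<omega>. ennreal (f (norm (G k \<omega> - Xc k (fst \<omega>)))) \<partial>?N)"
      by (intro nn_integral_cmult measurable_compose[OF _ measurable_ennreal] measurable_compose[OF _ borel_measurable_f]
          measurable_compose[OF _ borel_measurable_norm] borel_measurable_diff G_rv XcN)
    also have "\<dots> \<le> ennreal ?A * ennreal ((1 - c * h) ^ k * I0 + E)" by (intro mult_left_mono G_pair k) simp
    also have "\<dots> = ennreal (?A * ((1 - c * h) ^ k * I0 + E))"
      using A_pos by (simp add: ennreal_mult')
    also have "?A * ((1 - c * h) ^ k * I0 + E) = ?A * (1 - c * h) ^ k * I0 + ?A * Cu / c * h powr (min \<alpha>c 1 / 2)"
      by (simp add: E_def e_def algebra_simps)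
    finally show ?thesis by (simp only: intf)
  qed
  show ?thesis
  proof (rule exI[of _ ?N], rule exI[of _ G], intro conjI ballI allI impI)
    show "enlargement ?N fst M" by (simp add: enlargement_def pN dfst)
    show "G 0 \<omega> = Xf 0 (fst \<omega>)" for \<omega> by (simp add: G_def)
  qed (use G_rv G_law final in \<open>simp_all only: Cu_def mf_def mc_def\<close>)
qed

end
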